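(* Let $n\ge2$ and let $S$ be a nondegenerate $n$-simplex in an $n$-dimensional real vector space $\mathbb V$, with chosen inpoints. For $k\in\{n-1,n\}$ let $A^k(S)=K^k(S)+\mathfrak p_SK^{k+1}(S)$ as defined in the context, and consider on $A^k(S)$ the degrees of freedom consisting of: the values at the vertices of $S$, the values of the exterior derivative at the vertices of $S$, and the integrals on the $k$-dimensional faces of $S$. Then: (a) these degrees of freedom are unisolvent on $A^{n-1}(S)$ and on $A^n(S)$, and $\dim A^{n-1}(S)=(n+1)(n+2)$, $\dim A^n(S)=n+2$; (b) the associated interpolators commute with the divergence operator: if $I^{n-1}$ (defined on continuous $(n-1)$-forms on $S$ with continuous exterior derivative) and $I^n$ (defined on continuous $n$-forms on $S$) send a form to the unique element of $A^{n-1}(S)$, resp. $A^n(S)$, with the same degrees of freedom, then $\mathrm d I^{n-1}u=I^n\mathrm d u$; (c) this gives a minimal good element for continuous vector fields with continuous divergence, in the sense that for $k=n-1,n$ the dimension of $A^k(S)$ equals the lower bound $(n+1)\left(\dim \mathrm{Alt}^k(\mathbb V)+\dim\mathrm{Alt}^{k+1}(\mathbb V)\right)+\binom{n+1}{k+1}$.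
   Context: $\mathrm{Alt}^k(\mathbb V)$ is the space of alternating $k$-linear forms on $\mathbb V$. A simplex is identified with its vertex set, its faces with nonempty subsets, and $|T|$ is the convex hull of $T$. For each face $T$ of $S$ an inpoint $W_T$ in the relative interior of $|T|$ is chosen ($W_T=T$ if $T$ is a vertex). For $m\ge0$ and a face $T$, the $m$-refinement $\mathcal R_m(T)$ is the simplicial complex consisting of the simplices $[W_{T_k},\ldots,W_{T_0},V_0,\ldots,V_l]$ (and their faces), where $T'=[V_0,\ldots,V_l]$ is a face of $T$ of dimension $l\le m$, and $T'\subsetneq T_0\subsetneq\cdots\subsetneq T_k$ is a (possibly empty) chain of faces $T_i$ of $T$ of dimension at least $m+1$. Thus faces of dimension at most $m$ are not refined, and $\mathcal R_m(T)$ is the complex of faces of $T$ if $m\ge\dim T$. $\mathrm C^0\mathrm P^1\Lambda^k(\mathcal R)$ is the space of $k$-forms which are continuous (all components) and have affine coefficients on each simplex of $\mathcal R$. For $k\ge1$, $K^k(S)=\{u\in\mathrm C^0\mathrm P^1\Lambda^k(\mathcal R_{k-1}(S)):\mathrm d u=0\}$ (zero for $k>n$). $\mathfrak p_S$ is the Poincaré operator with base point $W_S$: for a $k$-form $u$, $k\ge1$, $(\mathfrak p_Su)_x(\xi_2,\ldots,\xi_k)=\int_0^1t^{k-1}u_{W_S+t(x-W_S)}(x-W_S,\xi_2,\ldots,\xi_k)\,\mathrm dt$. The value of a $k$-form $u$ at a vertex $V$ means the whole element $u(V)\in\mathrm{Alt}^k(\mathbb V)$, likewise for $\mathrm du(V)\in\mathrm{Alt}^{k+1}(\mathbb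 V)$; integrals are of pullbacks. Unisolvent means that an element is determined by its degrees of freedom and that these can be prescribed arbitrarily (number of scalar degrees of freedom equal to the dimension). Through vector proxies, $(n-1)$-forms correspond to vector fields and $\mathrm d$ on $(n-1)$-forms to the divergence. The lower bound in (c) reflects that a compatible system of $k$-forms (containing constants), with restrictions to faces keeping all components of both $u$ and $\mathrm du$, must have the full space $\mathrm{Alt}^k(\mathbb V)\oplus\mathrm{Alt}^{k+1}(\mathbb V)$ at each vertex and at least one additional dimension for each $k$-face. *)

theory Defs
  imports "HOL-Analysis.Analysis" "HOL-Library.Function_Algebras"
begin

text \<open>Pointwise vector space structure on functions, so that \<^term>\<open>dim\<close> applies to sets of forms.\<close>

instantiation "fun" :: (type, real_vector) real_vector
begin

definition scaleR_fun_def: "r *\<^sub>R f = (\<lambda>x. r *\<^sub>R f x)"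

instance
  by standard (auto simp: scaleR_fun_def fun_eq_iff algebra_simps)

end


section \<open>Alternating forms and differential forms\<close>

text \<open>A \<open>k\<close>-linear form takes the list of its \<open>k\<close> arguments. It is normalised to be zero on
  lists of any other length, so that equality of functions is equality of forms.\<close>

definition alt_forms :: "nat \<Rightarrow> ('a::real_vector list \<Rightarrow> real) set" where
  "alt_forms k = {f.
     (\<forall>\<xi>. length \<xi> \<noteq> k \<longrightarrow> f \<xi> = 0) \<and>
     (\<forall>\<xi> i. length \<xi> = k \<and> i < k \<longrightarrow> linear (\<lambda>v. f (\<xi>[i := v]))) \<and>
     (\<forall>\<xi>. length \<xi> = k \<and> \<not> distinct \<xi> \<longrightarrow> f \<xi> = 0)}"

type_synonym 'a form = "'a \<Rightarrow> 'a list \<Rightarrow> real"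

text \<open>Continuous \<open>k\<close>-forms on \<open>D\<close> (all components continuous). Forms on \<open>D\<close> are extended by
  zero outside \<open>D\<close>, again to have the right notion of equality.\<close>

definition C0_forms :: "nat \<Rightarrow> 'a::euclidean_space set \<Rightarrow> 'a form set" where
  "C0_forms k D = {u.
     (\<forall>x. u x \<in> alt_forms k) \<and> (\<forall>x. x \<notin> D \<longrightarrow> u x = 0) \<and>
     (\<forall>\<xi>. continuous_on D (\<lambda>x. u x \<xi>))}"

text \<open>Elements of the finite element spaces are only piecewise smooth, so the exterior derivative
  is the one in the sense of distributions on the interior of \<open>D\<close>. It is obtained from
  \<open>du(\<xi>\<^sub>0, \<dots>, \<xi>\<^sub>k) = \<Sum>\<^sub>i (-1)\<^sup>i \<partial>\<^bsub>\<xi>\<^sub>i\<^esub> (u(\<xi>\<^sub>0, \<dots>, \<xi>\<^sub>k with \<xi>\<^sub>i omitted))\<close>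
  for constant \<open>\<xi>\<^sub>i\<close>, by integration by parts against test functions. As \<open>u\<close> and \<open>w\<close> are
  continuous, it makes no difference whether the compactly supported test functions are
  taken to be \<open>C\<^sup>1\<close> or infinitely differentiable.\<close>

definition test_fun :: "'a::euclidean_space set \<Rightarrow> ('a \<Rightarrow> real) \<Rightarrow> ('a \<Rightarrow> 'a \<Rightarrow> real) \<Rightarrow> bool" where
  "test_fun U \<phi> \<phi>' \<longleftrightarrow>
     (\<forall>x. (\<phi> has_derivative \<phi>' x) (at x)) \<and> (\<forall>v. continuous_on UNIV (\<lambda>x. \<phi>' x v)) \<and>
     (\<exists>K. compact K \<and> K \<subseteq> U \<and> (\<forall>x. x \<notin> K \<longrightarrow> \<phi> x = 0))"

definition has_ext_deriv ::
  "nat \<Rightarrow> 'a::euclidean_space set \<Rightarrow> 'a form \<Rightarrow> 'a form \<Rightarrow> bool" where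
  "has_ext_deriv k D u w \<longleftrightarrow> w \<in> C0_forms (k + 1) D \<and>
     (\<forall>\<phi> \<phi>' \<xi>. test_fun (interior D) \<phi> \<phi>' \<and> length \<xi> = k + 1 \<longrightarrow>
        (LINT x:D|lborel. \<phi> x * w x \<xi>) =
        - (\<Sum>i<k + 1. (- 1) ^ i *
             (LINT x:D|lborel. \<phi>' x (\<xi> ! i) * u x (take i \<xi> @ drop (i + 1) \<xi>))))"

text \<open>The continuous representative is unique if \<open>D\<close> is the closure of its interior, as is the
  case for a nondegenerate simplex of full dimension.\<close>

definition ext_deriv :: "nat \<Rightarrow> 'a::euclidean_space set \<Rightarrow> 'a form \<Rightarrow> 'a form" where
  "ext_deriv k D u = (THE w. has_ext_deriv k D u w)"

definition C0d_forms :: "nat \<Rightarrow> 'a::euclidean_space set \<Rightarrow> 'a form set" where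
  "C0d_forms k D = {u \<in> C0_forms k D. \<exists>w. has_ext_deriv k D u w}"


section \<open>Simplices and refinements\<close>

text \<open>A simplex is its set of vertices; the dimension of a face \<open>T\<close> is \<open>card T - 1\<close>.\<close>

definition faces :: "'a set \<Rightarrow> 'a set set" where
  "faces S = {T. T \<subseteq> S \<and> T \<noteq> {}}"

definition kfaces :: "nat \<Rightarrow> 'a set \<Rightarrow> 'a set set" where
  "kfaces k S = {T \<in> faces S. card T = k + 1}"

definition inpoints :: "'a::euclidean_space set \<Rightarrow> ('a set \<Rightarrow> 'a) \<Rightarrow> bool" where
  "inpoints S W \<longleftrightarrow>
     (\<forall>T \<in> faces S. W T \<in> rel_interior (convex hull T)) \<and> (\<forall>V \<in> S. W {V} = V)"

definition refinement :: "nat \<Rightarrow> ('a set \<Rightarrow> 'a) \<Rightarrow> 'a set \<Rightarrow> 'a set set" where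
  "refinement m W T = (\<Union>{faces (W ` C \<union> T') | C T'.
     T' \<in> faces T \<and> card T' \<le> m + 1 \<and>
     C \<subseteq> faces T \<and> chain\<^sub>\<subseteq> C \<and> (\<forall>F \<in> C. T' \<subset> F \<and> card F \<ge> m + 2)})"

definition C0P1_forms :: "nat \<Rightarrow> 'a::euclidean_space set set \<Rightarrow> 'a form set" where
  "C0P1_forms k R = {u \<in> C0_forms k (\<Union>\<sigma>\<in>R. convex hull \<sigma>).
     \<forall>\<sigma>\<in>R. \<forall>\<xi>. \<exists>g c. linear g \<and> (\<forall>x \<in> convex hull \<sigma>. u x \<xi> = g x + c)}"


section \<open>The finite element spaces\<close>

text \<open>Only used for \<open>k \<ge> 1\<close>.\<close>

definition K_space :: "nat \<Rightarrow> ('a set \<Rightarrow> 'a) \<Rightarrow> 'a::euclidean_space set \<Rightarrow> 'a form set" where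
  "K_space k W S = {u \<in> C0P1_forms k (refinement (k - 1) W S).
     has_ext_deriv k (convex hull S) u 0}"

text \<open>The Poincare operator from \<open>k\<close>-forms to \<open>(k - 1)\<close>-forms on \<open>D\<close>, with base point \<open>w\<close>.\<close>

definition poincare :: "nat \<Rightarrow> 'a::euclidean_space set \<Rightarrow> 'a \<Rightarrow> 'a form \<Rightarrow> 'a form" where
  "poincare k D w u = (\<lambda>x \<xi>. if x \<in> D
     then integral {0..1} (\<lambda>t. t ^ (k - 1) * u (w + t *\<^sub>R (x - w)) ((x - w) # \<xi>))
     else 0)"

definition A_space :: "nat \<Rightarrow> ('a set \<Rightarrow> 'a) \<Rightarrow> 'a::euclidean_space set \<Rightarrow> 'a form set" where
  "A_space k W S =
     {v + poincare (k + 1) (convex hull S) (W S) b | v b.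
        v \<in> K_space k W S \<and> b \<in> K_space (k + 1) W S}"


section \<open>Degrees of freedom\<close>

text \<open>The integral of the pullback of a \<open>k\<close>-form to the simplex with the ordered vertices
  \<open>vs = [V\<^sub>0, \<dots>, V\<^sub>k]\<close>, computed in the chart
  \<open>t \<mapsto> V\<^sub>0 + t\<^sub>1 (V\<^sub>1 - V\<^sub>0) + \<dots> + t\<^sub>k (V\<^sub>k - V\<^sub>0)\<close> on the standard simplex; coordinates are numbered
  from zero in the code.\<close>

definition face_integral :: "nat \<Rightarrow> 'a::euclidean_space form \<Rightarrow> 'a list \<Rightarrow> real" where
  "face_integral k u vs =
     (LINT t:{t. (\<forall>i<k. 0 \<le> t i) \<and> (\<Sum>i<k. t i) \<le> 1}|PiM {..<k} (\<lambda>_. lborel).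
        u (vs ! 0 + (\<Sum>i<k. t i *\<^sub>R (vs ! (i + 1) - vs ! 0)))
          (map (\<lambda>i. vs ! (i + 1) - vs ! 0) [0..<k]))"

text \<open>An orientation of each face, given by an ordering of its vertices.\<close>

definition orientation :: "'a set \<Rightarrow> ('a set \<Rightarrow> 'a list) \<Rightarrow> bool" where
  "orientation S ori \<longleftrightarrow> (\<forall>T \<in> faces S. set (ori T) = T \<and> distinct (ori T))"

text \<open>The degrees of freedom of \<open>u\<close> have the values \<open>a\<close> (for \<open>u\<close> at vertices), \<open>b\<close> (for the
  exterior derivative of \<open>u\<close> at vertices) and \<open>c\<close> (for the integrals on \<open>k\<close>-faces).\<close>

definition has_dofs :: "nat \<Rightarrow> 'a::euclidean_space set \<Rightarrow> ('a set \<Rightarrow> 'a list) \<Rightarrow> 'a form \<Rightarrow>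
    ('a \<Rightarrow> 'a list \<Rightarrow> real) \<Rightarrow> ('a \<Rightarrow> 'a list \<Rightarrow> real) \<Rightarrow> ('a set \<Rightarrow> real) \<Rightarrow> bool" where
  "has_dofs k S ori u a b c \<longleftrightarrow>
     (\<forall>V \<in> S. u V = a V) \<and>
     (\<forall>V \<in> S. ext_deriv k (convex hull S) u V = b V) \<and>
     (\<forall>F \<in> kfaces k S. face_integral k u (ori F) = c F)"

text \<open>The inclusion in \<^term>\<open>C0d_forms k (convex hull S)\<close> says that the degrees of freedom make
  sense on \<open>A\<close>.\<close>

definition unisolvent ::
  "nat \<Rightarrow> 'a::euclidean_space set \<Rightarrow> ('a set \<Rightarrow> 'a list) \<Rightarrow> 'a form set \<Rightarrow> bool" where
  "unisolvent k S ori A \<longleftrightarrow> A \<subseteq> C0d_forms k (convex hull S) \<and>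
     (\<forall>a b c. (\<forall>V \<in> S. a V \<in> alt_forms k) \<and> (\<forall>V \<in> S. b V \<in> alt_forms (k + 1)) \<longrightarrow>
        (\<exists>!u. u \<in> A \<and> has_dofs k S ori u a b c))"

definition interpolator :: "nat \<Rightarrow> ('a set \<Rightarrow> 'a) \<Rightarrow> 'a::euclidean_space set \<Rightarrow>
    ('a set \<Rightarrow> 'a list) \<Rightarrow> 'a form \<Rightarrow> 'a form" where
  "interpolator k W S ori u = (THE v. v \<in> A_space k W S \<and>
     has_dofs k S ori v u (ext_deriv k (convex hull S) u) (\<lambda>F. face_integral k u (ori F)))"

end

theory Submission
  imports Defs
begin

text \<open>
  Let \<open>\<omega>\<close> be a nonzero alternating \<open>n\<close>-form. Every \<open>n\<close>-form is \<open>f \<omega>\<close> for a function \<open>f\<close>, every \<open>(n - 1)\<close>-form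
  is \<open>\<iota>\<^sub>v \<omega>\<close> for a vector field \<open>v\<close>, and since \<open>l \<and> \<iota>\<^sub>v \<omega> = l(v) \<omega>\<close> the exterior derivative of \<open>\<iota>\<^sub>v \<omega>\<close> in the sense of
  distributions is \<open>f \<omega>\<close>, where \<open>f\<close> is the weak divergence of \<open>v\<close> (\<open>has_ext_deriv_flux_iff\<close>). So the claim is about
  continuous piecewise affine functions and vector fields on two splits of the simplex: the coarse
  split from the inpoint \<open>W\<^sub>S\<close> into the \<open>n + 1\<close> cones over the facets, and the fine split, in which also the facets are
  split from their inpoints, into the cells \<open>(V, U)\<close> with the vertices \<open>W\<^sub>S\<close>, \<open>W\<^sub>F\<close> for \<open>F = S - {V}\<close>, and
  \<open>S - {V, U}\<close>.

  The hat functions of the new vertices of these splits are minima of affine functions. Therefore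
  piecewise affine fields on the fine split have the form
  \<open>\<Sum>\<^sub>Z lam Z a(Z) + \<Sum>\<^sub>V hatF V A(V) + hatS B\<close> (\<open>pl\<close>, \<open>pl_representation\<close>), with a constant divergence on each cell
  (\<open>sector_div\<close>). As these functions are locally Lipschitz and differentiable outside finitely many
  hyperplanes, their distributional derivatives are the piecewise ones (\<open>integration_by_parts\<close>), and
  \<open>K\<^bsup>n-1\<^esup>\<close> consists of the fields for which all these constants vanish. Since \<open>K\<^bsup>n+1\<^esup> = 0\<close>, the space \<open>A\<^sup>n = K\<^sup>n\<close>
  consists of the functions \<open>\<Sum>\<^sub>Z lam Z c(Z) + \<beta> hatS\<close>, and the Poincare operator maps such a function
  \<open>f\<close> to a radial field with divergence \<open>f\<close> (\<open>weak_div_radial_field\<close>).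

  The link between the degrees of freedom is Stokes' theorem for fields that are merely continuous
  with a continuous weak divergence (\<open>stokes\<close>): the integral of the divergence is a combination of the
  fluxes through the facets, with coefficients that depend only on the simplex. It is obtained by
  testing with cutoff functions whose gradients concentrate in boundary layers at the facets.

  In top degree, the vertex values determine \<open>c\<close> and the integral determines \<open>\<beta>\<close>. For a field in \<open>A\<^bsup>n-1\<^esup>\<close>, the vertex
  values of the divergence and, by Stokes' theorem, the fluxes determine the divergence, and the
  vertex values of the field determine \<open>a\<close>. What remains is the field \<open>\<Sum>\<^sub>V hatF V A(V) + hatS B\<close>. Its fluxes
  determine the normal components of the vectors \<open>A(V)\<close>, and the conditions on the cells \<open>(V, U)\<close>, weighted by
  the barycentric coordinates of the inpoint of the facet and summed over \<open>U\<close>, determine \<open>B\<close>, and then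
  the remaining components of \<open>A(V)\<close> (\<open>unique_field\<close>). Conversely, for each facet there is an explicit
  bubble field with divergence \<open>-1\<close> that vanishes at the vertices and on the other facets; a combination of
  these adjusts the fluxes at the cost of a constant divergence, which Stokes' theorem shows to be zero
  (\<open>exists_field\<close>). The dimensions follow by counting the degrees of freedom, and so do those of the spaces of alternating
  forms in the lower bound (\<open>dim_eq_card_functionals\<close>).

  The interpolators commute with the divergence because \<open>d I u\<close> and \<open>d u\<close> have the same vertex values by
  construction and the same integral by Stokes' theorem (\<open>interpolators_commute\<close>).
\<close>

section \<open>Alternating forms\<close>

lemma alt_len: "f \<in> alt_forms k \<Longrightarrow> length \<xi> \<noteq> k \<Longrightarrow> f \<xi> = 0"
  by (auto simp: alt_forms_def)

lemma alt_lin: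
  assumes "f \<in> alt_forms k" "length xs + length ys + 1 = k"
  shows "linear (\<lambda>v. f (xs @ v # ys))"
proof -
  have "length (xs @ 0 # ys) = k \<and> length xs < k"
    using assms(2) by simp
  then have "linear (\<lambda>v. f ((xs @ 0 # ys)[length xs := v]))"
    using assms(1) unfolding alt_forms_def by blast
  then show ?thesis by (simp add: list_update_append)
qed

lemma alt_nondistinct: "f \<in> alt_forms k \<Longrightarrow> \<not> distinct \<xi> \<Longrightarrow> f \<xi> = 0"
  by (cases "length \<xi> = k") (auto simp: alt_forms_def)

lemma alt_dup: "f \<in> alt_forms k \<Longrightarrow> f (xs @ x # ys @ x # zs) = 0"
  by (rule alt_nondistinct) auto

text \<open>The two conditions are stated for split argument lists \<open>xs @ v # ys\<close>, the shape in which
  forms are evaluated everywhere below.\<close>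

lemma alt_formsI:
  assumes "\<And>\<xi>. length \<xi> \<noteq> k \<Longrightarrow> f \<xi> = 0"
    and "\<And>xs ys. length xs + length ys + 1 = k \<Longrightarrow> linear (\<lambda>v. f (xs @ v # ys))"
    and "\<And>xs x ys zs. length xs + length ys + length zs + 2 = k \<Longrightarrow> f (xs @ x # ys @ x # zs) = 0"
  shows "f \<in> alt_forms k"
  unfolding alt_forms_def
proof (intro CollectI conjI allI impI)
  fix \<xi> :: "'a list" and i assume *: "length \<xi> = k \<and> i < k"
  have "linear (\<lambda>v. f (take i \<xi> @ v # drop (Suc i) \<xi>))"
    using * by (intro assms(2)) auto
  then show "linear (\<lambda>v. f (\<xi>[i := v]))" using * by (simp add: upd_conv_take_nth_drop)
next
  fix \<xi> :: "'a list" assume *: "length \<xi> = k \<and> \<not> distinct \<xi>"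
  then obtain xs ys zs y where "\<xi> = xs@[y]@ys@[y]@zs" using not_distinct_decomp by blast
  with * show "f \<xi> = 0" using assms(3)[of xs ys zs y] by auto
qed (use assms(1) in auto)

lemma subspace_alt_forms: "subspace (alt_forms k)"
  unfolding subspace_def
proof (intro conjI ballI allI)
  show "0 \<in> alt_forms k" by (auto simp: alt_forms_def linear_zero)
next
  fix f g :: "'a list \<Rightarrow> real" assume *: "f \<in> alt_forms k" "g \<in> alt_forms k"
  show "f + g \<in> alt_forms k"
  proof (rule alt_formsI)
    fix xs ys :: "'a list" assume len: "length xs + length ys + 1 = k"
    show "linear (\<lambda>v. (f + g) (xs @ v # ys))"
      using linear_compose_add[OF alt_lin[OF *(1) len] alt_lin[OF *(2) len]] by simp
  qed (use * in \<open>auto simp: alt_len alt_dup\<close>)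
next
  fix f :: "'a list \<Rightarrow> real" and c assume *: "f \<in> alt_forms k"
  show "c *\<^sub>R f \<in> alt_forms k"
  proof (rule alt_formsI)
    fix xs ys :: "'a list" assume len: "length xs + length ys + 1 = k"
    show "linear (\<lambda>v. (c *\<^sub>R f) (xs @ v # ys))"
      unfolding scaleR_fun_def by (rule linear_compose_scale_right[OF alt_lin[OF * len]])
  qed (use * in \<open>auto simp: scaleR_fun_def alt_len alt_dup\<close>)
qed

lemma alt_swap:
  assumes "f \<in> alt_forms k"
  shows "f (xs @ x # y # zs) = - f (xs @ y # x # zs)"
proof (cases "length xs + length zs + 2 = k")
  case True
  have l1: "linear (\<lambda>v. f (xs @ v # w # zs))" for w
    by (rule alt_lin[OF assms]) (use True in auto)
  have l2: "linear (\<lambda>v. f (xs @ w # v # zs))" for w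
    using alt_lin[OF assms, of "xs @ [w]" zs] True by auto
  have d: "f (xs @ w # w # zs) = 0" for w
    using alt_dup[OF assms, of xs w "[]" zs] by simp
  have "0 = f (xs @ (x + y) # (x + y) # zs)" using d by simp
  also have "\<dots> = f (xs @ x # y # zs) + f (xs @ y # x # zs)"
    unfolding linear_add[OF l1] linear_add[OF l2] by (simp add: d)
  finally show ?thesis by simp
qed (use assms in \<open>auto simp: alt_len\<close>)

lemma alt_move:
  assumes "f \<in> alt_forms k"
  shows "f (xs @ x # ys @ zs) = (- 1) ^ length ys * f (xs @ ys @ x # zs)"
proof (induction ys arbitrary: xs)
  case (Cons y ys)
  have "f (xs @ x # (y # ys) @ zs) = - f ((xs @ [y]) @ x # ys @ zs)"
    using alt_swap[OF assms, of xs x y "ys @ zs"] by simp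
  also have "\<dots> = - ((- 1) ^ length ys * f ((xs @ [y]) @ ys @ x # zs))"
    using Cons.IH[of "xs @ [y]"] by (simp only:)
  finally show ?case by simp
qed simp

text \<open>More vectors than the dimension are linearly dependent, so one argument is a combination of the others, and
  every term of the expansion has a repeated argument.\<close>

lemma alt_forms_above_dim:
  assumes "f \<in> alt_forms k" "k > DIM('a::euclidean_space)"
  shows "f = (0 :: 'a list \<Rightarrow> real)"
proof
  fix \<xi> :: "'a list"
  show "f \<xi> = 0 \<xi>"
  proof (cases "length \<xi> = k \<and> distinct \<xi>")
    case True
    then have "dependent (set \<xi>)"
      using assms(2) by (intro dependent_biggerset) (auto simp: distinct_card)
    then obtain x where x: "x \<in> set \<xi>" "x \<in> span (set \<xi> - {x})"
      unfolding dependent_def by blast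
    then obtain xs ys where \<xi>: "\<xi> = xs @ x # ys" by (meson split_list)
    have "f (xs @ y # ys) = 0" if "y \<in> set \<xi> - {x}" for y
    proof -
      have "y \<in> set xs \<union> set ys" using that \<xi> by auto
      then show ?thesis by (intro alt_nondistinct[OF assms(1)]) auto
    qed
    moreover have "linear (\<lambda>v. f (xs @ v # ys))"
      by (rule alt_lin[OF assms(1)]) (use True \<xi> in auto)
    ultimately have "f (xs @ x # ys) = 0"
      using linear_eq_0_on_span[of "\<lambda>v. f (xs @ v # ys)" "set \<xi> - {x}" x] x(2) by blast
    then show ?thesis using \<xi> by simp
  qed (use assms(1) in \<open>auto simp: alt_len alt_nondistinct\<close>)
qed

lemma alt_contract: "f \<in> alt_forms (Suc k) \<Longrightarrow> (\<lambda>\<xi>. f (v # \<xi>)) \<in> alt_forms k"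
  by (rule alt_formsI)
     (use alt_lin[of f "Suc k" "v # _"] alt_dup[of f "Suc k" "v # _"] in \<open>auto simp: alt_len\<close>)

text \<open>The wedge product of a linear form with a \<open>k\<close>-form. It is the symbol of the exterior derivative:
  the sum in the definition of \<open>has_ext_deriv\<close> is the integral of
  \<open>\<phi>' x \<and> u x\<close>.\<close>

definition wedge :: "nat \<Rightarrow> ('a::real_vector \<Rightarrow> real) \<Rightarrow> ('a list \<Rightarrow> real) \<Rightarrow> 'a list \<Rightarrow> real" where
  "wedge k l a \<xi> = (if length \<xi> = k + 1
     then \<Sum>i<k + 1. (- 1) ^ i * (l (\<xi> ! i) * a (take i \<xi> @ drop (i + 1) \<xi>)) else 0)"

text \<open>In the second part only the two terms that omit one of the equal arguments survive; moving one of these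
  arguments across the list between them shows that the two terms cancel.\<close>

lemma wedge_alt:
  assumes "linear l" "a \<in> alt_forms k"
  shows "wedge k l a \<in> alt_forms (k + 1)"
proof (rule alt_formsI)
  fix xs ys :: "'a list" assume len: "length xs + length ys + 1 = k + 1"
  have "linear (\<lambda>v. (- 1) ^ i * (l ((xs @ v # ys) ! i) *
      a (take i (xs @ v # ys) @ drop (i + 1) (xs @ v # ys))))" if "i < k + 1" for i
  proof -
    consider "i < length xs" | "i = length xs" | "i > length xs" by linarith
    then show ?thesis
    proof cases
      case 1
      have "linear (\<lambda>v. a ((take i xs @ drop (i + 1) xs) @ v # ys))"
        by (rule alt_lin[OF assms(2)]) (use 1 len in auto)
      then show ?thesis using 1
        by (auto simp: nth_append mult.assoc[symmetric]
            intro!: linear_compose_scale_right[where 'b=real, simplified real_scaleR_def])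
    next
      case 2
      then show ?thesis using assms(1)
        by (simp add: linear_iff algebra_simps)
    next
      case 3
      then obtain j where j: "i = length xs + 1 + j" using less_iff_Suc_add by auto
      have "linear (\<lambda>v. a (xs @ v # (take j ys @ drop (j + 1) ys)))"
        by (rule alt_lin[OF assms(2)]) (use j len that in auto)
      moreover have "(take i (xs @ v # ys) @ drop (i + 1) (xs @ v # ys)) =
           xs @ v # (take j ys @ drop (j + 1) ys)" for v
        using j by simp
      moreover have "(xs @ v # ys) ! i = ys ! j" for v
        using j by (simp add: nth_append)
      ultimately show ?thesis
        by (auto simp: mult.assoc[symmetric] simp del: append_assoc
            intro!: linear_compose_scale_right[where 'b=real, simplified real_scaleR_def])
    qed
  qed
  moreover have "wedge k l a (xs @ v # ys) = (\<Sum>i<k + 1. (- 1) ^ i * (l ((xs @ v # ys) ! i) *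
      a (take i (xs @ v # ys) @ drop (i + 1) (xs @ v # ys))))" for v
    using len unfolding wedge_def by auto
  ultimately show "linear (\<lambda>v. wedge k l a (xs @ v # ys))"
    by (simp add: linear_compose_sum del: sum.lessThan_Suc)
next
  fix xs ys zs :: "'a list" and x assume len: "length xs + length ys + length zs + 2 = k + 1"
  let ?\<xi> = "xs @ x # ys @ x # zs" and ?p = "length xs" and ?q = "length xs + length ys + 1"
  let ?t = "\<lambda>i. (- 1) ^ i * (l (?\<xi> ! i) * a (take i ?\<xi> @ drop (i + 1) ?\<xi>))"
  have zero: "?t i = 0" if i: "i \<notin> {?p, ?q}" for i
  proof -
    have "\<not> distinct (take i ?\<xi> @ drop (i + 1) ?\<xi>)"
    proof -
      \<comment> \<open>Omitting any other argument leaves both copies of x in the list.\<close>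
      consider "i < ?p" | "?p < i" "i < ?q" | "i > ?q" using i by fastforce
      then show ?thesis
      proof cases
        case 1 then show ?thesis by simp
      next
        case 2
        then obtain j where j: "i = length xs + 1 + j" "j < length ys" using less_iff_Suc_add by auto
        then show ?thesis by simp
      next
        case 3
        then obtain j where j: "i = length xs + length ys + 2 + j" using less_iff_Suc_add by auto
        then show ?thesis by simp
      qed
    qed
    then show ?thesis using alt_nondistinct[OF assms(2)] by simp
  qed
  have "wedge k l a ?\<xi> = (\<Sum>i<k + 1. ?t i)"
    using len by (simp add: wedge_def)
  also have "\<dots> = (\<Sum>i\<in>{?p, ?q}. ?t i)"
    by (rule sum.mono_neutral_right) (use zero len in auto)
  also have "\<dots> = ?t ?p + ?t ?q" by simp
  also have "?t ?p = (- 1) ^ ?p * (l x * a (xs @ ys @ x # zs))" by simp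
  also have "?t ?q = (- 1) ^ ?q * (l x * a (xs @ x # ys @ zs))"
    by (simp add: nth_append)
  also have "a (xs @ x # ys @ zs) = (- 1) ^ length ys * a (xs @ ys @ x # zs)"
    by (rule alt_move[OF assms(2)])
  finally show "wedge k l a ?\<xi> = 0"
    by (simp add: power_add algebra_simps flip: power_mult_distrib)
qed (auto simp: wedge_def)

lemma wedge_Cons:
  assumes "length \<xi> = Suc k"
  shows "wedge (Suc k) l a (x # \<xi>) = l x * a \<xi> - wedge k l (\<lambda>\<eta>. a (x # \<eta>)) \<xi>"
  using assms by (simp add: wedge_def sum.lessThan_Suc_shift del: sum.lessThan_Suc)
    (simp add: sum_negf)

lemma wedge_linear_right:
  "wedge k l (a - c *\<^sub>R b) = wedge k l a - c *\<^sub>R wedge k l b"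
  by (auto simp: fun_eq_iff wedge_def scaleR_fun_def sum_subtractf sum_distrib_left algebra_simps)

text \<open>The identity \<open>l \<wedge> \<iota>\<^sub>v a = l(v) a\<close> holds in top degree because \<open>l \<wedge> a = 0\<close> there.\<close>

lemma wedge_contract_top:
  fixes a :: "'a::euclidean_space list \<Rightarrow> real"
  assumes "linear l" "a \<in> alt_forms (Suc k)" "DIM('a) = Suc k"
  shows "wedge k l (\<lambda>\<eta>. a (v # \<eta>)) = l v *\<^sub>R a"
proof
  fix \<xi> :: "'a list"
  have "wedge (Suc k) l a (v # \<xi>) = 0"
    using alt_forms_above_dim[OF wedge_alt[OF assms(1,2)]] assms(3) by simp
  then show "wedge k l (\<lambda>\<eta>. a (v # \<eta>)) \<xi> = (l v *\<^sub>R a) \<xi>"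
    using wedge_Cons[of \<xi> k l a v] alt_len[OF assms(2), of \<xi>]
    by (cases "length \<xi> = Suc k") (auto simp: scaleR_fun_def wedge_def)
qed

text \<open>Contracting \<open>l \<wedge> a = 0\<close> with the
  vectors of the basis one at a time expresses \<open>a\<close> by its values on lists that begin with more and
  more of the basis.\<close>

lemma top_form_zero:
  fixes a :: "'a::euclidean_space list \<Rightarrow> real"
  assumes a: "a \<in> alt_forms k" and k: "DIM('a) = k"
    and e: "length e = k" "distinct e" "independent (set e)" and "a e = 0"
  shows "a = 0"
proof -
  \<comment> \<open>Downward induction on the number m of basis vectors at the front of the argument list;
    they are listed in the order of rev e, so that the next one can be put at the head.\<close>
  define r where "r = rev e"
  have r: "length r = k" "distinct r" "independent (set r)" using e by (auto simp: r_def)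
  have "\<forall>\<xi>. length \<xi> = k - m \<longrightarrow> a (rev (take m r) @ \<xi>) = 0" if "m \<le> k" for m
    using that
  proof (induction rule: inc_induct)
    case base
    show ?case using r \<open>a e = 0\<close> by (auto simp: r_def)
  next
    case (step m)
    show ?case
    proof (intro allI impI)
      fix \<xi> :: "'a list" assume len: "length \<xi> = k - m"
      let ?\<eta> = "rev (take m r) @ \<xi>"
      \<comment> \<open>The functional l that is dual to the next basis vector picks out, from the vanishing of
        \<open>l \<and> a\<close> on the extended list, the value of a on the list itself.\<close>
      obtain l where l: "linear l" "\<And>x. x \<in> set r \<Longrightarrow> l x = (if x = r ! m then 1 else 0 :: real)"
        using linear_independent_extend[OF r(3), of "\<lambda>x. if x = r ! m then 1 else 0 :: real"] by auto
      have mk: "m < length r" using step r by simp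
      have l1: "l (r ! m) = 1" using l(2)[of "r ! m"] mk by simp
      have l0: "l (?\<eta> ! i) = 0" if "i < m" for i
      proof -
        have "?\<eta> ! i = r ! (m - 1 - i)" using that mk by (simp add: nth_append rev_nth)
        moreover have "r ! (m - 1 - i) \<noteq> r ! m" using that mk r(2) by (simp add: nth_eq_iff_index_eq)
        ultimately show ?thesis using l(2)[of "r ! (m - 1 - i)"] mk by simp
      qed
      have z: "l (?\<eta> ! i) * a (r ! m # (take i ?\<eta> @ drop (i + 1) ?\<eta>)) = 0" if "i < k" for i
      proof (cases "i < m")
        case False
        then obtain j where j: "i = m + j" using le_Suc_ex by (metis not_less)
        have "r ! m # (take i ?\<eta> @ drop (i + 1) ?\<eta>) =
            rev (take (Suc m) r) @ (take j \<xi> @ drop (j + 1) \<xi>)"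
          using j mk by (simp add: take_Suc_conv_app_nth min_def)
        then show ?thesis using step.IH j len that by auto
      qed (simp add: l0)
      have "wedge k l a (r ! m # ?\<eta>) = 0"
        using alt_forms_above_dim[OF wedge_alt[OF l(1) a]] k by simp
      moreover have "wedge k l a (r ! m # ?\<eta>) =
          a ?\<eta> - (\<Sum>i<k. (- 1) ^ i * (l (?\<eta> ! i) * a (r ! m # (take i ?\<eta> @ drop (i + 1) ?\<eta>))))"
        using len mk r l1 by (simp add: wedge_def sum.lessThan_Suc_shift del: sum.lessThan_Suc)
          (simp add: sum_negf)
      moreover have "(\<Sum>i<k. (- 1) ^ i * (l (?\<eta> ! i) * a (r ! m # (take i ?\<eta> @ drop (i + 1) ?\<eta>)))) = 0"
        by (rule sum.neutral) (use z in simp)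
      ultimately show "a ?\<eta> = 0" by simp
    qed
  qed
  from this[of 0] have "a \<xi> = 0" if "length \<xi> = k" for \<xi> using that by simp
  then show ?thesis using alt_len[OF a] by (auto simp: fun_eq_iff)
qed

text \<open>The wedge product of all coordinate forms, built up one factor at a time; its value on the reversed list of
  basis vectors is \<open>1\<close>, because each new factor annihilates the earlier basis vectors.\<close>

lemma ex_top_form:
  "\<exists>\<omega> \<in> alt_forms DIM('a::euclidean_space). \<omega> \<noteq> (0 :: 'a list \<Rightarrow> real)"
proof -
  obtain e :: "'a list" where e: "set e = Basis" "distinct e"
    using finite_distinct_list[OF finite_Basis] by blast
  have "\<exists>a \<in> alt_forms m. a (rev (take m e)) = 1" if "m \<le> length e" for m
    using that
  proof (induction m)
    case 0
    have "(\<lambda>\<xi>. if \<xi> = [] then 1 else 0) \<in> alt_forms 0" by (rule alt_formsI) auto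
    then show ?case by (intro bexI) auto
  next
    case (Suc m)
    then obtain a where a: "a \<in> alt_forms m" "a (rev (take m e)) = 1" by auto
    have m: "m < length e" using Suc by simp
    then have em: "e ! m \<in> Basis" using e(1) nth_mem by blast
    let ?a = "wedge m ((\<bullet>) (e ! m)) a"
    have lin: "linear ((\<bullet>) (e ! m))" by (rule bounded_linear.linear) (rule bounded_linear_inner_right)
    have "e ! m \<bullet> x = 0" if "x \<in> set (take m e)" for x
    proof -
      have "x \<in> Basis" using that e(1) in_set_takeD by fastforce
      moreover have "x \<noteq> e ! m"
        using that m e(2) by (auto simp: in_set_conv_nth nth_eq_iff_index_eq)
      ultimately show ?thesis using em by (simp add: inner_Basis)
    qed
    then have "(\<Sum>i<m. (- 1) ^ Suc i * ((e ! m \<bullet> rev (take m e) ! i) *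
        a (e ! m # take i (rev (take m e)) @ drop (Suc i) (rev (take m e))))) = 0"
      using m by (intro sum.neutral ballI) (metis (no_types, lifting) length_rev length_take lessThan_iff
          min.absorb4 mult_eq_0_iff nth_mem set_rev)
    then have "?a (e ! m # rev (take m e)) = 1"
      using m a em by (simp add: wedge_def sum.lessThan_Suc_shift inner_Basis del: sum.lessThan_Suc)
    moreover have "rev (take (Suc m) e) = e ! m # rev (take m e)"
      using m by (simp add: take_Suc_conv_app_nth)
    ultimately show ?case using wedge_alt[OF lin a(1)] by (intro bexI[of _ ?a]) auto
  qed
  from this[of "length e"] obtain a where a: "a \<in> alt_forms (length e)" "a (rev e) = 1" by auto
  have "length e = DIM('a)" using e distinct_card by fastforce
  then show ?thesis using a by (intro bexI[of _ a]) auto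
qed

text \<open>Only the term that feeds \<open>x\<close> to \<open>l\<close> remains.\<close>

lemma wedge_annihilating_tail:
  assumes "length \<xi> = m" "\<And>i. i < m \<Longrightarrow> l (\<xi> ! i) = 0"
  shows "wedge m l d (x # \<xi>) = l x * d \<xi>"
  using assms by (simp add: wedge_def sum.lessThan_Suc_shift del: sum.lessThan_Suc)

lemma linear_basis_expand:
  fixes g :: "'a::euclidean_space \<Rightarrow> real"
  assumes "linear g" shows "g y = (\<Sum>b\<in>Basis. (y \<bullet> b) * g b)"
proof -
  have "g y = g (\<Sum>b\<in>Basis. (y \<bullet> b) *\<^sub>R b)" by (simp add: euclidean_representation)
  then show ?thesis by (simp add: linear_sum[OF assms] linear_scale[OF assms])
qed

section \<open>Vector and scalar proxies of forms\<close>

text \<open>A fixed nonzero \<open>n\<close>-form turns \<open>n\<close>-forms into functions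
  (\<open>f \<mapsto> f \<omega>\<close>) and \<open>(n - 1)\<close>-forms into vector fields
  (\<open>v \<mapsto> \<iota>\<^sub>v \<omega>\<close>).\<close>

locale volume_form =
  fixes \<omega> :: "'a::euclidean_space list \<Rightarrow> real"
  assumes \<omega>: "\<omega> \<in> alt_forms DIM('a)" and \<omega>_nz: "\<omega> \<noteq> 0"
begin

lemma Suc_codim: "Suc (DIM('a) - 1) = DIM('a)"
  using DIM_positive[where 'a='a] by simp

lemma volume_basis_nz:
  assumes "length e = DIM('a)" "distinct e" "independent (set e)"
  shows "\<omega> e \<noteq> 0"
  using top_form_zero[OF \<omega> refl assms] \<omega>_nz by blast

lemma ex_nz: "\<exists>\<xi>. \<omega> \<xi> \<noteq> 0 \<and> length \<xi> = DIM('a)"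
  using \<omega>_nz alt_len[OF \<omega>] by (metis ext zero_fun_def)

lemma top_form_multiple:
  assumes "a \<in> alt_forms DIM('a)"
  shows "\<exists>c. a = c *\<^sub>R \<omega>"
proof -
  obtain e :: "'a list" where e: "set e = Basis" "distinct e"
    using finite_distinct_list[OF finite_Basis] by blast
  have len: "length e = DIM('a)" using e distinct_card by fastforce
  have ind: "independent (set e)" using e independent_Basis by simp
  have nz: "\<omega> e \<noteq> 0" by (rule volume_basis_nz[OF len e(2) ind])
  have "a - (a e / \<omega> e) *\<^sub>R \<omega> \<in> alt_forms DIM('a)"
    by (intro subspace_diff subspace_scale subspace_alt_forms assms \<omega>)
  then have "a - (a e / \<omega> e) *\<^sub>R \<omega> = 0"
    by (rule top_form_zero[OF _ refl len e(2) ind]) (use nz in \<open>simp add: scaleR_fun_def\<close>)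
  then show ?thesis by (intro exI[of _ "a e / \<omega> e"]) simp
qed

text \<open>The identity behind all uses of proxies: it converts the exterior derivative of
  \<open>\<iota>\<^sub>v \<omega>\<close> into the divergence of \<open>v\<close>.\<close>

lemma wedge_flux:
  assumes "linear l"
  shows "wedge (DIM('a) - 1) l (\<lambda>\<xi>. \<omega> (v # \<xi>)) = l v *\<^sub>R \<omega>"
  using wedge_contract_top[OF assms, of \<omega> "DIM('a) - 1"] \<omega> Suc_codim by simp

text \<open>The components of the proxy are read off from the wedge products with the coordinate forms. To see that the
  difference \<open>d\<close> of both sides vanishes, note that \<open>l \<and> d = 0\<close> for all
  linear forms \<open>l\<close>, and that \<open>n - 1\<close> vectors are always annihilated by some
  nonzero \<open>l\<close>; evaluating on these vectors and one more gives \<open>d = 0\<close> on them.\<close>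

lemma flux_proxy:
  assumes a: "a \<in> alt_forms (DIM('a) - 1)"
    and c: "\<And>b. b \<in> Basis \<Longrightarrow> wedge (DIM('a) - 1) ((\<bullet>) b) a = c b *\<^sub>R \<omega>"
  shows "a = (\<lambda>\<xi>. \<omega> ((\<Sum>b\<in>Basis. c b *\<^sub>R b) # \<xi>))"
proof -
  let ?k = "DIM('a) - 1" and ?v = "\<Sum>b\<in>Basis. c b *\<^sub>R b"
  define d where "d = a - 1 *\<^sub>R (\<lambda>\<xi>. \<omega> (?v # \<xi>))"
  have lin: "linear ((\<bullet>) x)" for x :: 'a by (rule bounded_linear.linear) (rule bounded_linear_inner_right)
  have d_alt: "d \<in> alt_forms ?k"
    unfolding d_def using alt_contract[of \<omega> ?k ?v] \<omega> Suc_codim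
    by (intro subspace_diff subspace_scale subspace_alt_forms a) auto
  have basis0: "wedge ?k ((\<bullet>) b) d = 0" if "b \<in> Basis" for b
  proof -
    have "wedge ?k ((\<bullet>) b) d = c b *\<^sub>R \<omega> - (b \<bullet> ?v) *\<^sub>R \<omega>"
      unfolding d_def wedge_linear_right using c[OF that] wedge_flux[OF lin, of b ?v] by simp
    also have "b \<bullet> ?v = c b" using that by (simp add: inner_sum_right inner_Basis if_distrib cong: if_cong)
    finally show ?thesis by (simp add: zero_fun_def)
  qed
  have all0: "wedge ?k ((\<bullet>) x) d \<xi> = 0" for x \<xi>
  proof -
    have "(- 1) ^ i * ((x \<bullet> y) * r) = (\<Sum>b\<in>Basis. (x \<bullet> b) * ((- 1) ^ i * ((b \<bullet> y) * r)))"
      for i :: nat and y :: 'a and r :: real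
      unfolding euclidean_inner[of x y] sum_distrib_left sum_distrib_right
      by (intro sum.cong refl) (simp add: inner_commute)
    note expand = this
    have "wedge ?k ((\<bullet>) x) d \<xi> = (\<Sum>b\<in>Basis. (x \<bullet> b) * wedge ?k ((\<bullet>) b) d \<xi>)"
    proof (cases "length \<xi> = ?k + 1")
      case True
      then have "wedge ?k ((\<bullet>) x) d \<xi> = (\<Sum>i<?k + 1. \<Sum>b\<in>Basis. (x \<bullet> b) *
          ((- 1) ^ i * ((b \<bullet> \<xi> ! i) * d (take i \<xi> @ drop (i + 1) \<xi>))))"
        unfolding wedge_def expand by simp
      also have "\<dots> = (\<Sum>b\<in>Basis. \<Sum>i<?k + 1. (x \<bullet> b) *
          ((- 1) ^ i * ((b \<bullet> \<xi> ! i) * d (take i \<xi> @ drop (i + 1) \<xi>))))"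
        by (rule sum.swap)
      also have "\<dots> = (\<Sum>b\<in>Basis. (x \<bullet> b) * wedge ?k ((\<bullet>) b) d \<xi>)"
        using True unfolding wedge_def by (simp add: sum_distrib_left)
      finally show ?thesis .
    qed (simp add: wedge_def)
    then show ?thesis using basis0 by simp
  qed
  have "d \<xi> = 0" for \<xi>
  proof (cases "length \<xi> = ?k")
    case True
    have "dim (span (set \<xi>)) < DIM('a)"
      using dim_le_card'[OF finite_set, of \<xi>] card_length[of \<xi>] True DIM_positive[where 'a='a]
      unfolding dim_span by linarith
    then obtain x where x: "x \<noteq> 0" "\<And>y. y \<in> span (span (set \<xi>)) \<Longrightarrow> orthogonal x y"
      using orthogonal_to_subspace_exists[of "span (set \<xi>)"] by (auto simp: span_span)
    have xi: "x \<bullet> \<xi> ! i = 0" if "i < ?k" for i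
      using x(2)[of "\<xi> ! i"] that True by (simp add: orthogonal_def span_base)
    have "wedge ?k ((\<bullet>) x) d (x # \<xi>) = (x \<bullet> x) * d \<xi>"
      by (rule wedge_annihilating_tail) (use True xi in auto)
    then show ?thesis using all0 x(1) by simp
  qed (use d_alt alt_len in auto)
  then have "d = 0" by (simp add: fun_eq_iff)
  then show ?thesis by (simp add: d_def)
qed

lemma flux_inj:
  assumes "(\<lambda>\<xi>. \<omega> (v # \<xi>)) = (\<lambda>\<xi>. \<omega> (w # \<xi>))"
  shows "v = w"
proof (rule euclidean_eqI)
  fix b :: 'a
  have lin: "linear (\<lambda>x. x \<bullet> b)" by (rule bounded_linear.linear) (rule bounded_linear_inner_left)
  have "(v \<bullet> b) *\<^sub>R \<omega> = (w \<bullet> b) *\<^sub>R \<omega>"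
    using wedge_flux[OF lin, of v] wedge_flux[OF lin, of w] assms by simp
  then show "v \<bullet> b = w \<bullet> b" using \<omega>_nz by simp
qed

text \<open>Forms on \<open>D\<close> are zero outside \<open>D\<close>, hence the case distinction here and in
  \<open>dens\<close>.\<close>

definition flux :: "'a set \<Rightarrow> ('a \<Rightarrow> 'a) \<Rightarrow> 'a form" where
  "flux D v x = (if x \<in> D then (\<lambda>\<xi>. \<omega> (v x # \<xi>)) else 0)"

definition dens :: "'a set \<Rightarrow> ('a \<Rightarrow> real) \<Rightarrow> 'a form" where
  "dens D f x = (if x \<in> D then f x *\<^sub>R \<omega> else 0)"

lemma \<omega>_sum:
  assumes "length \<xi> = DIM('a) - 1"
  shows "\<omega> (v # \<xi>) = (\<Sum>b\<in>Basis. (v \<bullet> b) * \<omega> (b # \<xi>))"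
proof -
  have "linear (\<lambda>v. \<omega> (v # \<xi>))"
    using alt_lin[OF \<omega>, of "[]" \<xi>] assms Suc_codim by simp
  then show ?thesis by (rule linear_basis_expand)
qed

lemma flux_C0:
  assumes "continuous_on D v"
  shows "flux D v \<in> C0_forms (DIM('a) - 1) D"
proof -
  have "continuous_on D (\<lambda>x. flux D v x \<xi>)" for \<xi>
  proof -
    have "continuous_on D (\<lambda>x. \<omega> (v x # \<xi>))"
    proof (cases "length \<xi> = DIM('a) - 1")
      case True
      have "continuous_on D (\<lambda>x. \<Sum>b\<in>Basis. (v x \<bullet> b) * \<omega> (b # \<xi>))"
        by (intro continuous_intros assms)
      then show ?thesis
        by (rule continuous_on_eq) (rule \<omega>_sum[OF True, symmetric])
    next
      case False
      then have "\<omega> (w # \<xi>) = 0" for w using Suc_codim by (intro alt_len[OF \<omega>]) auto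
      then show ?thesis by simp
    qed
    then show ?thesis by (rule continuous_on_eq) (simp add: flux_def)
  qed
  moreover have "flux D v x \<in> alt_forms (DIM('a) - 1)" for x
    using alt_contract[of \<omega> "DIM('a) - 1"] \<omega> Suc_codim subspace_0[OF subspace_alt_forms]
    by (auto simp: flux_def)
  ultimately show ?thesis by (auto simp: C0_forms_def flux_def)
qed

lemma dens_C0:
  assumes "continuous_on D f"
  shows "dens D f \<in> C0_forms DIM('a) D"
proof -
  have "continuous_on D (\<lambda>x. dens D f x \<xi>)" for \<xi>
    by (rule continuous_on_eq[of _ "\<lambda>x. f x * \<omega> \<xi>"])
       (auto simp: dens_def scaleR_fun_def intro!: continuous_intros assms)
  moreover have "dens D f x \<in> alt_forms DIM('a)" for x
    using subspace_scale[OF subspace_alt_forms \<omega>] subspace_0[OF subspace_alt_forms]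
    by (auto simp: dens_def)
  ultimately show ?thesis by (auto simp: C0_forms_def dens_def)
qed

lemma C0_imp_dens:
  assumes "w \<in> C0_forms DIM('a) D"
  shows "\<exists>f. continuous_on D f \<and> w = dens D f"
proof -
  obtain \<xi> where \<xi>: "\<omega> \<xi> \<noteq> 0" using ex_nz by blast
  let ?f = "\<lambda>x. w x \<xi> / \<omega> \<xi>"
  have eq: "w x = ?f x *\<^sub>R \<omega>" for x
  proof -
    obtain c where "w x = c *\<^sub>R \<omega>" using assms top_form_multiple[of "w x"] by (auto simp: C0_forms_def)
    then show ?thesis using \<xi> by (simp add: scaleR_fun_def)
  qed
  have "continuous_on D ?f"
    using assms \<xi> by (auto simp: C0_forms_def intro!: continuous_intros)
  moreover have "w = dens D ?f"
  proof
    fix x show "w x = dens D ?f x"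
    proof (cases "x \<in> D")
      case True then show ?thesis unfolding dens_def by (simp only: if_True) (rule eq)
    next
      case False then show ?thesis using assms unfolding dens_def C0_forms_def by simp
    qed
  qed
  ultimately show ?thesis by blast
qed

lemma C0_imp_flux:
  assumes "u \<in> C0_forms (DIM('a) - 1) D"
  shows "\<exists>v. continuous_on D v \<and> u = flux D v"
proof -
  obtain \<xi> where \<xi>: "\<omega> \<xi> \<noteq> 0" using ex_nz by blast
  let ?k = "DIM('a) - 1"
  let ?c = "\<lambda>x b. wedge ?k ((\<bullet>) b) (u x) \<xi> / \<omega> \<xi>"
  let ?v = "\<lambda>x. \<Sum>b\<in>Basis. ?c x b *\<^sub>R b"
  have ux: "u x \<in> alt_forms ?k" for x using assms by (auto simp: C0_forms_def)
  have eq: "u x = (\<lambda>\<xi>. \<omega> (?v x # \<xi>))" for x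
  proof (rule flux_proxy[OF ux])
    fix b :: 'a
    have "wedge ?k ((\<bullet>) b) (u x) \<in> alt_forms DIM('a)"
      using wedge_alt[OF bounded_linear.linear[OF bounded_linear_inner_right] ux] Suc_codim by simp
    then obtain c where "wedge ?k ((\<bullet>) b) (u x) = c *\<^sub>R \<omega>" using top_form_multiple by blast
    then show "wedge ?k ((\<bullet>) b) (u x) = ?c x b *\<^sub>R \<omega>" using \<xi> by (simp add: scaleR_fun_def)
  qed
  have "continuous_on D ?v"
  proof (intro continuous_intros)
    fix b :: 'a
    have "continuous_on D (\<lambda>x. u x \<eta>)" for \<eta> using assms by (auto simp: C0_forms_def)
    then show "continuous_on D (\<lambda>x. wedge ?k ((\<bullet>) b) (u x) \<xi>)"
      unfolding wedge_def by (cases "length \<xi> = ?k + 1") (auto intro!: continuous_intros simp del: sum.lessThan_Suc)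
  qed (use \<xi> in auto)
  moreover have "u = flux D ?v"
  proof
    fix x show "u x = flux D ?v x"
    proof (cases "x \<in> D")
      case True then show ?thesis unfolding flux_def by (simp only: if_True) (rule eq)
    next
      case False then show ?thesis using assms unfolding flux_def C0_forms_def by simp
    qed
  qed
  ultimately show ?thesis by blast
qed

lemma flux_eq_iff: "flux D v = flux D w \<longleftrightarrow> (\<forall>x\<in>D. v x = w x)"
proof
  assume eq: "flux D v = flux D w"
  show "\<forall>x\<in>D. v x = w x"
  proof
    fix x assume "x \<in> D"
    then show "v x = w x" using fun_cong[OF eq, of x] by (intro flux_inj) (simp add: flux_def)
  qed
qed (simp add: flux_def fun_eq_iff)

lemma dens_eq_iff: "dens D f = dens D g \<longleftrightarrow> (\<forall>x\<in>D. f x = g x)"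
proof
  assume eq: "dens D f = dens D g"
  show "\<forall>x\<in>D. f x = g x"
  proof
    fix x assume "x \<in> D"
    then show "f x = g x" using fun_cong[OF eq, of x] \<omega>_nz by (simp add: dens_def)
  qed
qed (simp add: dens_def fun_eq_iff)

end

section \<open>The exterior derivative as a weak divergence\<close>

definition weak_div :: "'a::euclidean_space set \<Rightarrow> ('a \<Rightarrow> 'a) \<Rightarrow> ('a \<Rightarrow> real) \<Rightarrow> bool" where
  "weak_div D v f \<longleftrightarrow> (\<forall>\<phi> \<phi>'. test_fun (interior D) \<phi> \<phi>' \<longrightarrow>
     (LINT x:D|lborel. \<phi> x * f x) = - (LINT x:D|lborel. \<phi>' x (v x)))"

lemma test_fun_linear: "test_fun U \<phi> \<phi>' \<Longrightarrow> linear (\<phi>' x)"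
  by (meson test_fun_def has_derivative_linear)

lemma test_fun_expand: "test_fun U \<phi> \<phi>' \<Longrightarrow> \<phi>' x v = (\<Sum>b\<in>Basis. (v \<bullet> b) * \<phi>' x b)"
  for v :: "'a::euclidean_space"
  by (rule linear_basis_expand[OF test_fun_linear])

lemma test_fun_cont: "test_fun U \<phi> \<phi>' \<Longrightarrow> continuous_on A \<phi>"
  unfolding test_fun_def
  by (meson continuous_at_imp_continuous_on has_derivative_continuous)

lemma test_fun_deriv_cont:
  assumes "test_fun U \<phi> \<phi>'" "continuous_on A v"
  shows "continuous_on A (\<lambda>x. \<phi>' x (v x))"
proof -
  have "continuous_on A (\<lambda>x. \<phi>' x b)" for b
    using assms(1) unfolding test_fun_def by (meson continuous_on_subset subset_UNIV)
  then have "continuous_on A (\<lambda>x. \<Sum>b\<in>Basis. (v x \<bullet> b) * \<phi>' x b)"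
    by (intro continuous_intros assms)
  then show ?thesis
    by (rule continuous_on_eq) (rule test_fun_expand[OF assms(1), symmetric])
qed

lemma set_integrable_cont:
  fixes f :: "'a::euclidean_space \<Rightarrow> real"
  shows "compact D \<Longrightarrow> continuous_on D f \<Longrightarrow> set_integrable lborel D f"
  unfolding set_integrable_def by (rule borel_integrable_compact)

lemma set_lint_sum:
  fixes f :: "'i \<Rightarrow> 'b \<Rightarrow> real"
  assumes "\<And>i. i \<in> I \<Longrightarrow> set_integrable M D (f i)"
  shows "(\<Sum>i\<in>I. c i * (LINT x:D|M. f i x)) = (LINT x:D|M. \<Sum>i\<in>I. c i * f i x)"
proof -
  have "(LINT x:D|M. \<Sum>i\<in>I. c i * f i x) = (LINT x|M. (\<Sum>i\<in>I. c i * (indicator D x *\<^sub>R f i x)))"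
    unfolding set_lebesgue_integral_def
    by (intro Bochner_Integration.integral_cong refl) (simp add: sum_distrib_left mult.left_commute)
  also have "\<dots> = (\<Sum>i\<in>I. LINT x|M. c i * (indicator D x *\<^sub>R f i x))"
    using assms unfolding set_integrable_def
    by (intro Bochner_Integration.integral_sum integrable_mult_right) auto
  also have "\<dots> = (\<Sum>i\<in>I. c i * (LINT x:D|M. f i x))"
    unfolding set_lebesgue_integral_def by (intro sum.cong refl integral_mult_right_zero)
  finally show ?thesis by simp
qed

context volume_form
begin

text \<open>Both sides of the defining identity of the exterior derivative are multiples of
  \<open>\<omega> \<xi>\<close>; by
  \<open>\<phi>' x \<and> \<iota>\<^sub>v \<omega> = \<phi>' x v \<omega>\<close>, the factors are
  the two sides of the identity for the divergence.\<close>

lemma has_ext_deriv_flux_iff: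
  assumes D: "compact D" and v: "continuous_on D v" and f: "continuous_on D f"
  shows "has_ext_deriv (DIM('a) - 1) D (flux D v) (dens D f) \<longleftrightarrow> weak_div D v f"
proof -
  let ?k = "DIM('a) - 1"
  have L: "(LINT x:D|lborel. \<phi> x * dens D f x \<xi>) = (LINT x:D|lborel. \<phi> x * f x) * \<omega> \<xi>" for \<phi> \<xi>
  proof -
    have "(LINT x:D|lborel. \<phi> x * dens D f x \<xi>) = (LINT x:D|lborel. (\<phi> x * f x) * \<omega> \<xi>)"
      unfolding set_lebesgue_integral_def
      by (intro Bochner_Integration.integral_cong) (auto simp: dens_def scaleR_fun_def indicator_def)
    then show ?thesis by simp
  qed
  have R: "(\<Sum>i<?k + 1. (- 1) ^ i *
             (LINT x:D|lborel. \<phi>' x (\<xi> ! i) * flux D v x (take i \<xi> @ drop (i + 1) \<xi>))) =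
           (LINT x:D|lborel. \<phi>' x (v x)) * \<omega> \<xi>"
    if t: "test_fun (interior D) \<phi> \<phi>'" and len: "length \<xi> = ?k + 1" for \<phi> \<phi>' \<xi>
  proof -
    have int: "set_integrable lborel D (\<lambda>x. \<phi>' x (\<xi> ! i) * flux D v x (take i \<xi> @ drop (i + 1) \<xi>))" for i
      using flux_C0[OF v] by (intro set_integrable_cont[OF D] continuous_on_mult test_fun_deriv_cont[OF t])
        (auto simp: C0_forms_def intro: continuous_intros)
    have "(\<Sum>i<?k + 1. (- 1) ^ i *
             (LINT x:D|lborel. \<phi>' x (\<xi> ! i) * flux D v x (take i \<xi> @ drop (i + 1) \<xi>))) =
          (LINT x:D|lborel. (\<Sum>i<?k + 1. (- 1) ^ i * (\<phi>' x (\<xi> ! i) * flux D v x (take i \<xi> @ drop (i + 1) \<xi>))))"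
      by (rule set_lint_sum) (rule int)
    also have "\<dots> = (LINT x:D|lborel. \<phi>' x (v x) * \<omega> \<xi>)"
      unfolding set_lebesgue_integral_def
    proof (intro Bochner_Integration.integral_cong refl)
      fix x
      have "x \<in> D \<Longrightarrow> (\<Sum>i<?k + 1. (- 1) ^ i * (\<phi>' x (\<xi> ! i) * flux D v x (take i \<xi> @ drop (i + 1) \<xi>))) =
          wedge ?k (\<phi>' x) (\<lambda>\<eta>. \<omega> (v x # \<eta>)) \<xi>"
        using len by (simp add: wedge_def flux_def)
      then show "indicat_real D x *\<^sub>R (\<Sum>i<?k + 1. (- 1) ^ i * (\<phi>' x (\<xi> ! i) * flux D v x (take i \<xi> @ drop (i + 1) \<xi>))) =
          indicat_real D x *\<^sub>R (\<phi>' x (v x) * \<omega> \<xi>)"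
        using wedge_flux[OF test_fun_linear[OF t], of x "v x"]
        by (cases "x \<in> D") (auto simp: scaleR_fun_def)
    qed
    also have "\<dots> = (LINT x:D|lborel. \<phi>' x (v x)) * \<omega> \<xi>" by simp
    finally show ?thesis .
  qed
  have "has_ext_deriv ?k D (flux D v) (dens D f) \<longleftrightarrow>
      (\<forall>\<phi> \<phi>' \<xi>. test_fun (interior D) \<phi> \<phi>' \<and> length \<xi> = ?k + 1 \<longrightarrow>
        (LINT x:D|lborel. \<phi> x * dens D f x \<xi>) = - (\<Sum>i<?k + 1. (- 1) ^ i *
             (LINT x:D|lborel. \<phi>' x (\<xi> ! i) * flux D v x (take i \<xi> @ drop (i + 1) \<xi>))))"
    unfolding has_ext_deriv_def using dens_C0[OF f] Suc_codim by simp
  also have "\<dots> \<longleftrightarrow> (\<forall>\<phi> \<phi>' \<xi>. test_fun (interior D) \<phi> \<phi>' \<and> length \<xi> = ?k + 1 \<longrightarrow>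
        (LINT x:D|lborel. \<phi> x * f x) * \<omega> \<xi> = - (LINT x:D|lborel. \<phi>' x (v x)) * \<omega> \<xi>)"
    (is "(\<forall>\<phi> \<phi>' \<xi>. ?P \<phi> \<phi>' \<xi> \<longrightarrow> ?Q \<phi> \<phi>' \<xi>) \<longleftrightarrow> (\<forall>\<phi> \<phi>' \<xi>. ?P \<phi> \<phi>' \<xi> \<longrightarrow> ?Q' \<phi> \<phi>' \<xi>)")
  proof -
    have "?Q \<phi> \<phi>' \<xi> \<longleftrightarrow> ?Q' \<phi> \<phi>' \<xi>" if "?P \<phi> \<phi>' \<xi>" for \<phi> \<phi>' \<xi>
      unfolding L R[OF conjunct1[OF that] conjunct2[OF that]] by simp
    then show ?thesis by blast
  qed
  also have "\<dots> \<longleftrightarrow> weak_div D v f"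
  proof
    obtain \<xi> where \<xi>: "\<omega> \<xi> \<noteq> 0 \<and> length \<xi> = DIM('a)" using ex_nz by blast
    assume *: "\<forall>\<phi> \<phi>' \<xi>. test_fun (interior D) \<phi> \<phi>' \<and> length \<xi> = ?k + 1 \<longrightarrow>
        (LINT x:D|lborel. \<phi> x * f x) * \<omega> \<xi> = - (LINT x:D|lborel. \<phi>' x (v x)) * \<omega> \<xi>"
    show "weak_div D v f"
      unfolding weak_div_def
    proof (intro allI impI)
      fix \<phi> \<phi>' assume t: "test_fun (interior D) \<phi> \<phi>'"
      have "(LINT x:D|lborel. \<phi> x * f x) * \<omega> \<xi> = - (LINT x:D|lborel. \<phi>' x (v x)) * \<omega> \<xi>"
        by (rule *[rule_format]) (use t \<xi> Suc_codim in simp)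
      then show "(LINT x:D|lborel. \<phi> x * f x) = - (LINT x:D|lborel. \<phi>' x (v x))"
        using \<xi> mult_right_cancel by blast
    qed
  qed (auto simp: weak_div_def)
  finally show ?thesis .
qed

text \<open>All \<open>(n + 1)\<close>-forms vanish, in particular \<open>\<phi>' x \<and> u x\<close>.\<close>

lemma has_ext_deriv_top:
  fixes u :: "'a form"
  assumes D: "compact D" and u: "u \<in> C0_forms DIM('a) D"
  shows "has_ext_deriv DIM('a) D u 0"
  unfolding has_ext_deriv_def
proof (intro conjI allI impI)
  show "0 \<in> C0_forms (DIM('a) + 1) D"
    using subspace_0[OF subspace_alt_forms] by (auto simp: C0_forms_def)
  fix \<phi> :: "'a \<Rightarrow> real" and \<phi>' and \<xi> :: "'a list"
  assume t: "test_fun (interior D) \<phi> \<phi>' \<and> length \<xi> = DIM('a) + 1"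
  let ?k = "DIM('a)"
  have "set_integrable lborel D (\<lambda>x. \<phi>' x (\<xi> ! i) * u x (take i \<xi> @ drop (i + 1) \<xi>))" for i
    using u by (intro set_integrable_cont[OF D] continuous_on_mult test_fun_deriv_cont[OF conjunct1[OF t]])
      (auto simp: C0_forms_def intro: continuous_intros)
  then have "(\<Sum>i<?k + 1. (- 1) ^ i *
             (LINT x:D|lborel. \<phi>' x (\<xi> ! i) * u x (take i \<xi> @ drop (i + 1) \<xi>))) =
          (LINT x:D|lborel. (\<Sum>i<?k + 1. (- 1) ^ i * (\<phi>' x (\<xi> ! i) * u x (take i \<xi> @ drop (i + 1) \<xi>))))"
    by (intro set_lint_sum)
  also have "\<dots> = 0"
  proof -
    have "(\<Sum>i<?k + 1. (- 1) ^ i * (\<phi>' x (\<xi> ! i) * u x (take i \<xi> @ drop (i + 1) \<xi>))) = 0" for x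
    proof -
      have "u x \<in> alt_forms ?k" using u by (auto simp: C0_forms_def)
      then have "wedge ?k (\<phi>' x) (u x) = 0"
        by (intro alt_forms_above_dim[OF wedge_alt[OF test_fun_linear[OF conjunct1[OF t]]]]) auto
      then show ?thesis using t by (simp add: wedge_def fun_eq_iff del: sum.lessThan_Suc split: if_splits)
    qed
    then show ?thesis unfolding set_lebesgue_integral_def by (simp only: scaleR_zero_right) simp
  qed
  finally show "(LINT x:D|lborel. \<phi> x * 0 x \<xi>) = - (\<Sum>i<?k + 1. (- 1) ^ i *
             (LINT x:D|lborel. \<phi>' x (\<xi> ! i) * u x (take i \<xi> @ drop (i + 1) \<xi>)))"
    by simp
qed

lemma C0_above_top: "w \<in> C0_forms (DIM('a) + 1) D \<longleftrightarrow> w = (0 :: 'a form)"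
proof
  assume "w \<in> C0_forms (DIM('a) + 1) D"
  then have "w x \<in> alt_forms (DIM('a) + 1)" for x by (auto simp: C0_forms_def)
  then have "w x = 0" for x by (rule alt_forms_above_dim) simp
  then show "w = 0" by (simp add: fun_eq_iff)
qed (use subspace_0[OF subspace_alt_forms] in \<open>auto simp: C0_forms_def\<close>)

lemma ext_deriv_top:
  fixes u :: "'a form"
  assumes D: "compact D" and u: "u \<in> C0_forms DIM('a) D"
  shows "ext_deriv DIM('a) D u = 0" "u \<in> C0d_forms DIM('a) D"
proof -
  show "u \<in> C0d_forms DIM('a) D" using has_ext_deriv_top[OF assms] u by (auto simp: C0d_forms_def)
  show "ext_deriv DIM('a) D u = 0"
    unfolding ext_deriv_def
  proof (rule the_equality)
    show "has_ext_deriv DIM('a) D u 0" by (rule has_ext_deriv_top[OF assms])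
  qed (use C0_above_top in \<open>auto simp: has_ext_deriv_def\<close>)
qed

end

section \<open>Locally Lipschitz functions and integration by parts\<close>

text \<open>Lipschitz continuity on every ball; in contrast to global Lipschitz continuity, it is inherited by products.\<close>

definition loclip :: "('a::real_normed_vector \<Rightarrow> real) \<Rightarrow> bool" where
  "loclip f \<longleftrightarrow> (\<forall>R. \<exists>L\<ge>0. \<forall>x y. norm x \<le> R \<longrightarrow> norm y \<le> R \<longrightarrow> \<bar>f x - f y\<bar> \<le> L * norm (x - y))"

lemma loclipE:
  assumes "loclip f"
  obtains L where "L \<ge> 0" "\<And>x y. norm x \<le> R \<Longrightarrow> norm y \<le> R \<Longrightarrow> \<bar>f x - f y\<bar> \<le> L * norm (x - y)"
proof -
  have "\<exists>L\<ge>0. \<forall>x y. norm x \<le> R \<longrightarrow> norm y \<le> R \<longrightarrow> \<bar>f x - f y\<bar> \<le> L * norm (x - y)"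
    using assms unfolding loclip_def by (rule spec)
  then obtain L where L: "L \<ge> 0"
    "\<forall>x y. norm x \<le> R \<longrightarrow> norm y \<le> R \<longrightarrow> \<bar>f x - f y\<bar> \<le> L * norm (x - y)" by (elim exE conjE)
  show ?thesis by (rule that[OF L(1)]) (rule L(2)[rule_format])
qed

lemma loclip_const: "loclip (\<lambda>x. c)"
  by (auto simp: loclip_def)

lemma loclip_linear:
  fixes f :: "'a::euclidean_space \<Rightarrow> real"
  assumes "linear f" shows "loclip f"
proof -
  obtain B where B: "B > 0" "\<And>x. norm (f x) \<le> B * norm x"
    using linear_bounded_pos[OF assms] by blast
  have "\<bar>f x - f y\<bar> \<le> B * norm (x - y)" for x y
    using B(2)[of "x - y"] by (simp add: linear_diff[OF assms])
  then show ?thesis using less_imp_le[OF B(1)] unfolding loclip_def by blast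
qed

lemma loclip_add:
  assumes "loclip f" "loclip g" shows "loclip (\<lambda>x. f x + g x)"
  unfolding loclip_def
proof
  fix R
  obtain L where L: "L \<ge> 0" "\<And>x y. norm x \<le> R \<Longrightarrow> norm y \<le> R \<Longrightarrow> \<bar>f x - f y\<bar> \<le> L * norm (x - y)"
    using loclipE[OF assms(1)] by blast
  obtain M where M: "M \<ge> 0" "\<And>x y. norm x \<le> R \<Longrightarrow> norm y \<le> R \<Longrightarrow> \<bar>g x - g y\<bar> \<le> M * norm (x - y)"
    using loclipE[OF assms(2)] by blast
  have "\<bar>f x + g x - (f y + g y)\<bar> \<le> (L + M) * norm (x - y)" if "norm x \<le> R" "norm y \<le> R" for x y
    using L(2)[OF that] M(2)[OF that] unfolding distrib_right by linarith
  then show "\<exists>L\<ge>0. \<forall>x y. norm x \<le> R \<longrightarrow> norm y \<le> R \<longrightarrow> \<bar>f x + g x - (f y + g y)\<bar> \<le> L * norm (x - y)"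
    using L M by (intro exI[of _ "L + M"]) auto
qed

lemma loclip_bounded:
  assumes "loclip f" obtains B where "B \<ge> 0" "\<And>x. norm x \<le> R \<Longrightarrow> \<bar>f x\<bar> \<le> B"
proof -
  obtain L where L: "L \<ge> 0" "\<And>x y. norm x \<le> max R 0 \<Longrightarrow> norm y \<le> max R 0 \<Longrightarrow> \<bar>f x - f y\<bar> \<le> L * norm (x - y)"
    using loclipE[OF assms] by blast
  have "\<bar>f x\<bar> \<le> \<bar>f 0\<bar> + L * max R 0" if "norm x \<le> R" for x
  proof -
    have "\<bar>f x - f 0\<bar> \<le> L * norm x" using L(2)[of x 0] that by simp
    also have "\<dots> \<le> L * max R 0" using L(1) that by (intro mult_left_mono) auto
    finally show ?thesis by linarith
  qed
  then show ?thesis using L(1) by (intro that[of "\<bar>f 0\<bar> + L * max R 0"]) auto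
qed

lemma loclip_mult:
  assumes "loclip f" "loclip g" shows "loclip (\<lambda>x. f x * g x)"
  unfolding loclip_def
proof
  fix R
  obtain L where L: "L \<ge> 0" "\<And>x y. norm x \<le> R \<Longrightarrow> norm y \<le> R \<Longrightarrow> \<bar>f x - f y\<bar> \<le> L * norm (x - y)"
    using loclipE[OF assms(1)] by blast
  obtain M where M: "M \<ge> 0" "\<And>x y. norm x \<le> R \<Longrightarrow> norm y \<le> R \<Longrightarrow> \<bar>g x - g y\<bar> \<le> M * norm (x - y)"
    using loclipE[OF assms(2)] by blast
  obtain A where A: "A \<ge> 0" "\<And>x. norm x \<le> R \<Longrightarrow> \<bar>f x\<bar> \<le> A" using loclip_bounded[OF assms(1)] by blast
  obtain B where B: "B \<ge> 0" "\<And>x. norm x \<le> R \<Longrightarrow> \<bar>g x\<bar> \<le> B" using loclip_bounded[OF assms(2)] by blast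
  have "\<bar>f x * g x - f y * g y\<bar> \<le> (A * M + L * B) * norm (x - y)" if "norm x \<le> R" "norm y \<le> R" for x y
  proof -
    have "\<bar>f x * g x - f y * g y\<bar> = \<bar>f x * (g x - g y) + (f x - f y) * g y\<bar>" by (simp add: algebra_simps)
    also have "\<dots> \<le> \<bar>f x\<bar> * \<bar>g x - g y\<bar> + \<bar>f x - f y\<bar> * \<bar>g y\<bar>" unfolding abs_mult[symmetric] by (rule abs_triangle_ineq)
    also have "\<dots> \<le> A * (M * norm (x - y)) + (L * norm (x - y)) * B"
      by (intro add_mono mult_mono L M A B that) (use L M A B in auto)
    finally show ?thesis by (simp add: algebra_simps)
  qed
  then show "\<exists>L\<ge>0. \<forall>x y. norm x \<le> R \<longrightarrow> norm y \<le> R \<longrightarrow> \<bar>f x * g x - f y * g y\<bar> \<le> L * norm (x - y)"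
    using L M A B by (intro exI[of _ "A * M + L * B"]) auto
qed

lemma loclip_Min:
  assumes "finite I" "I \<noteq> {}" "\<And>i. i \<in> I \<Longrightarrow> loclip (f i)"
  shows "loclip (\<lambda>x. Min ((\<lambda>i. f i x) ` I))"
  unfolding loclip_def
proof
  fix R
  have "\<exists>L. L \<ge> 0 \<and> (\<forall>x y. norm x \<le> R \<longrightarrow> norm y \<le> R \<longrightarrow> \<bar>f i x - f i y\<bar> \<le> L * norm (x - y))" if "i \<in> I" for i
    using assms(3)[OF that] unfolding loclip_def by auto
  then obtain L where L: "\<And>i. i \<in> I \<Longrightarrow> L i \<ge> 0"
      "\<And>i x y. i \<in> I \<Longrightarrow> norm x \<le> R \<Longrightarrow> norm y \<le> R \<Longrightarrow> \<bar>f i x - f i y\<bar> \<le> L i * norm (x - y)"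
    by metis
  let ?m = "\<lambda>x. Min ((\<lambda>i. f i x) ` I)"
  have L0: "sum L I \<ge> 0" using L(1) by (rule sum_nonneg)
  have le: "?m x - ?m y \<le> sum L I * norm (x - y)" if "norm x \<le> R" "norm y \<le> R" for x y
  proof -
    have "?m y \<in> (\<lambda>i. f i y) ` I" using assms by (intro Min_in) auto
    then obtain i where i: "i \<in> I" "?m y = f i y" by auto
    have "?m x \<le> f i x" using i assms by (intro Min_le) auto
    moreover have "f i x - f i y \<le> L i * norm (x - y)" using L(2)[OF i(1) that] by linarith
    moreover have "L i * norm (x - y) \<le> sum L I * norm (x - y)"
      using assms L(1) i by (intro mult_right_mono member_le_sum) auto
    ultimately show ?thesis using i(2) by linarith
  qed
  have "\<bar>?m x - ?m y\<bar> \<le> sum L I * norm (x - y)" if "norm x \<le> R" "norm y \<le> R" for x y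
    using le[OF that] le[OF that(2,1)] by (simp add: norm_minus_commute abs_le_iff)
  then show "\<exists>L\<ge>0. \<forall>x y. norm x \<le> R \<longrightarrow> norm y \<le> R \<longrightarrow> \<bar>?m x - ?m y\<bar> \<le> L * norm (x - y)"
    using L0 by blast
qed

lemma loclip_pos_part:
  assumes "loclip f" shows "loclip (\<lambda>x. max 0 (f x))"
  unfolding loclip_def
proof
  fix R
  obtain L where L: "L \<ge> 0" "\<And>x y. norm x \<le> R \<Longrightarrow> norm y \<le> R \<Longrightarrow> \<bar>f x - f y\<bar> \<le> L * norm (x - y)"
    using loclipE[OF assms] by blast
  have "\<bar>max 0 a - max 0 b\<bar> \<le> \<bar>a - b\<bar>" for a b :: real by auto
  then have "\<bar>max 0 (f x) - max 0 (f y)\<bar> \<le> L * norm (x - y)" if "norm x \<le> R" "norm y \<le> R" for x y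
    using L(2)[OF that] order_trans by blast
  then show "\<exists>L\<ge>0. \<forall>x y. norm x \<le> R \<longrightarrow> norm y \<le> R \<longrightarrow> \<bar>max 0 (f x) - max 0 (f y)\<bar> \<le> L * norm (x - y)"
    using L(1) by blast
qed

lemma loclip_continuous:
  fixes f :: "'a::euclidean_space \<Rightarrow> real"
  assumes "loclip f" shows "continuous_on A f"
proof -
  have "isCont f x" for x
  proof -
    obtain L where L: "L \<ge> 0" "\<And>y z. norm y \<le> norm x + 1 \<Longrightarrow> norm z \<le> norm x + 1 \<Longrightarrow> \<bar>f y - f z\<bar> \<le> L * norm (y - z)"
      using loclipE[OF assms] by blast
    have "L-lipschitz_on (ball x 1) f"
    proof (rule lipschitz_onI[OF _ L(1)])
      fix y z assume "y \<in> ball x 1" "z \<in> ball x 1"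
      then have "norm y \<le> norm x + 1" "norm z \<le> norm x + 1"
        using norm_triangle_sub[of y x] norm_triangle_sub[of z x]
        by (auto simp: dist_norm norm_minus_commute)
      then show "dist (f y) (f z) \<le> L * dist y z" using L(2) by (simp add: dist_norm)
    qed
    then have "continuous_on (ball x 1) f" by (rule lipschitz_on_continuous_on)
    then show "isCont f x" by (simp add: continuous_on_eq_continuous_at)
  qed
  then show ?thesis by (simp add: continuous_at_imp_continuous_on)
qed

lemma integral_translate:
  fixes h :: "'a::euclidean_space \<Rightarrow> real"
  assumes "h \<in> borel_measurable borel"
  shows "(\<integral>x. h (c + x) \<partial>lborel) = integral\<^sup>L lborel h"
  by (subst (2) lborel_distr_plus[of c, symmetric]) (rule integral_distr[symmetric], use assms in auto)

lemma integrable_translate: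
  fixes h :: "'a::euclidean_space \<Rightarrow> real"
  assumes "integrable lborel h"
  shows "integrable lborel (\<lambda>x. h (c + x))"
proof -
  have "integrable (distr lborel borel ((+) c)) h" using assms by (simp add: lborel_distr_plus)
  then show ?thesis by (rule integrable_distr[rotated]) simp
qed

text \<open>The divergence theorem without boundary. Translation invariance makes the integral of
  every difference quotient vanish, and local Lipschitz continuity dominates the quotients.\<close>

lemma integral_directional_derivative_zero:
  fixes h :: "'a::euclidean_space \<Rightarrow> real"
  assumes lip: "loclip h" and supp: "\<And>x. norm x > R \<Longrightarrow> h x = 0"
    and der: "AE x in lborel. (h has_derivative h' x) (at x)"
    and meas: "(\<lambda>x. h' x v) \<in> borel_measurable borel"
  shows "integrable lborel (\<lambda>x. h' x v)" "(\<integral>x. h' x v \<partial>lborel) = 0"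
proof -
  let ?s = "\<lambda>m x. real (Suc m) * (h ((1 / real (Suc m)) *\<^sub>R v + x) - h x)"
  \<comment> \<open>The translates by v / m with m at least 1 are supported in the ball of radius R + norm v.\<close>
  let ?S = "R + norm v"
  obtain L where L: "L \<ge> 0" "\<And>x y. norm x \<le> ?S + norm v \<Longrightarrow> norm y \<le> ?S + norm v \<Longrightarrow> \<bar>h x - h y\<bar> \<le> L * norm (x - y)"
    using loclipE[OF lip] by blast
  let ?w = "\<lambda>x. indicator (cball 0 ?S) x *\<^sub>R (L * norm v)"
  have cont: "continuous_on A h" for A by (rule loclip_continuous[OF lip])
  have hm [measurable]: "h \<in> borel_measurable borel" by (rule borel_measurable_continuous_onI[OF cont])
  have hint: "integrable lborel h"
  proof -
    have "integrable lborel (\<lambda>x. indicator (cball 0 R) x *\<^sub>R h x)"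
      by (rule borel_integrable_compact[OF compact_cball cont])
    also have "(\<lambda>x. indicator (cball 0 R) x *\<^sub>R h x) = h"
      using supp by (auto simp: fun_eq_iff indicator_def)
    finally show ?thesis .
  qed
  have bound: "norm (?s m x) \<le> ?w x" for m x
  proof -
    have small: "norm ((1 / real (Suc m)) *\<^sub>R v) \<le> norm v"
      using mult_right_mono[of "1 / real (Suc m)" 1 "norm v"] by (simp add: divide_simps)
    show ?thesis
    proof (cases "norm x \<le> ?S")
      case True
      have "norm ((1 / real (Suc m)) *\<^sub>R v + x) \<le> ?S + norm v"
        using True small norm_triangle_ineq[of "(1 / real (Suc m)) *\<^sub>R v" x] by linarith
      then have "\<bar>h ((1 / real (Suc m)) *\<^sub>R v + x) - h x\<bar> \<le> L * norm ((1 / real (Suc m)) *\<^sub>R v)"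
        using L(2)[of "(1 / real (Suc m)) *\<^sub>R v + x" x] True norm_ge_zero[of v] by (simp del: norm_scaleR)
      then have "real (Suc m) * \<bar>h ((1 / real (Suc m)) *\<^sub>R v + x) - h x\<bar> \<le>
          real (Suc m) * (L * norm ((1 / real (Suc m)) *\<^sub>R v))"
        by (rule mult_left_mono) simp
      also have "\<dots> = L * norm v" by simp
      finally show ?thesis using True by (simp add: abs_mult)
    next
      case False
      have "norm x \<le> norm ((1 / real (Suc m)) *\<^sub>R v + x) + norm ((1 / real (Suc m)) *\<^sub>R v)"
        using norm_triangle_ineq4[of "(1 / real (Suc m)) *\<^sub>R v + x" "(1 / real (Suc m)) *\<^sub>R v"] by simp
      then have "norm ((1 / real (Suc m)) *\<^sub>R v + x) > R" using False small by linarith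
      moreover have "norm x > R" using False norm_ge_zero[of v] by linarith
      ultimately show ?thesis using supp False by simp
    qed
  qed
  have lim: "AE x in lborel. (\<lambda>m. ?s m x) \<longlonglongrightarrow> h' x v"
    using der
  proof eventually_elim
    case (elim x)
    have lin: "linear (h' x)" by (rule has_derivative_linear[OF elim])
    have a: "((\<lambda>t. t *\<^sub>R v + x) has_derivative (\<lambda>t. t *\<^sub>R v)) (at (0::real))"
      by (auto intro!: derivative_eq_intros)
    have "((\<lambda>t. h (t *\<^sub>R v + x)) has_derivative (\<lambda>t. h' x (t *\<^sub>R v))) (at (0::real))"
      using has_derivative_compose[OF a, of h "h' x"] elim by simp
    then have "((\<lambda>t. h (t *\<^sub>R v + x)) has_real_derivative h' x v) (at 0)"
      unfolding has_field_derivative_def by (simp add: linear_scale[OF lin] mult_commute_abs)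
    then have D: "((\<lambda>t. (h (t *\<^sub>R v + x) - h x) / t) \<longlongrightarrow> h' x v) (at 0)"
      by (simp add: DERIV_def)
    have "filterlim (\<lambda>m. 1 / real (Suc m)) (at 0) sequentially"
      by (rule filterlim_atI) (use LIMSEQ_inverse_real_of_nat in \<open>auto simp: inverse_eq_divide\<close>)
    from filterlim_compose[OF D this] show ?case by (simp add: mult.commute)
  qed
  have sm: "?s m \<in> borel_measurable lborel" for m by measurable
  have wint: "integrable lborel ?w"
    by (rule borel_integrable_compact) auto
  show "integrable lborel (\<lambda>x. h' x v)"
    by (rule integrable_dominated_convergence[where s="?s" and w="?w"])
       (use meas sm wint lim bound in auto)
  have conv: "(\<lambda>m. integral\<^sup>L lborel (?s m)) \<longlonglongrightarrow> (\<integral>x. h' x v \<partial>lborel)"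
    by (rule integral_dominated_convergence[where w="?w"])
       (use meas sm wint lim bound in auto)
  have "integral\<^sup>L lborel (?s m) = 0" for m
  proof -
    have "integral\<^sup>L lborel (?s m) = real (Suc m) *
        ((\<integral>x. h ((1 / real (Suc m)) *\<^sub>R v + x) \<partial>lborel) - integral\<^sup>L lborel h)"
      using integrable_translate[OF hint] hint by simp
    then show ?thesis using integral_translate[OF hm] by simp
  qed
  then show "(\<integral>x. h' x v \<partial>lborel) = 0"
    using conv by (simp add: LIMSEQ_const_iff)
qed

text \<open>A derivative that exists almost everywhere need not be the distributional one (the Cantor function is a
  counterexample); with local Lipschitz continuity it is. The derivative of a piecewise affine function is
  covered, whatever values are assigned to it on the faces of the pieces.\<close>

definition wderiv :: "('a::euclidean_space \<Rightarrow> real) \<Rightarrow> ('a \<Rightarrow> 'a \<Rightarrow> real) \<Rightarrow> bool" where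
  "wderiv f f' \<longleftrightarrow> loclip f \<and> (AE x in lborel. (f has_derivative f' x) (at x)) \<and>
     (\<forall>v. (\<lambda>x. f' x v) \<in> borel_measurable borel)"

lemma wderiv_continuous: "wderiv f f' \<Longrightarrow> continuous_on A f"
  by (auto simp: wderiv_def loclip_continuous)

lemma wderiv_add:
  assumes "wderiv f f'" "wderiv g g'"
  shows "wderiv (\<lambda>x. f x + g x) (\<lambda>x v. f' x v + g' x v)"
proof -
  have "AE x in lborel. ((\<lambda>x. f x + g x) has_derivative (\<lambda>v. f' x v + g' x v)) (at x)"
    using assms[THEN wderiv_def[THEN iffD1], THEN conjunct2, THEN conjunct1]
    by eventually_elim (auto intro: has_derivative_add)
  then show ?thesis using assms by (auto simp: wderiv_def loclip_add intro: borel_measurable_add)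
qed

lemma wderiv_mult:
  assumes "wderiv f f'" "wderiv g g'"
  shows "wderiv (\<lambda>x. f x * g x) (\<lambda>x v. f x * g' x v + f' x v * g x)"
proof -
  have "AE x in lborel. ((\<lambda>x. f x * g x) has_derivative (\<lambda>v. f x * g' x v + f' x v * g x)) (at x)"
    using assms[THEN wderiv_def[THEN iffD1], THEN conjunct2, THEN conjunct1]
    by eventually_elim (auto intro: has_derivative_mult)
  moreover have "f \<in> borel_measurable borel" "g \<in> borel_measurable borel"
    using assms by (auto intro: borel_measurable_continuous_onI wderiv_continuous)
  ultimately show ?thesis using assms
    by (auto simp: wderiv_def loclip_mult intro!: borel_measurable_add borel_measurable_times)
qed

lemma wderiv_const: "wderiv (\<lambda>x. c) (\<lambda>x v. 0)"
  by (auto simp: wderiv_def loclip_const)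

lemma wderiv_linear: "linear f \<Longrightarrow> wderiv f (\<lambda>x. f)" for f :: "'a::euclidean_space \<Rightarrow> real"
  by (auto simp: wderiv_def loclip_linear linear_imp_has_derivative)

lemma test_fun_zero:
  assumes "test_fun U \<phi> \<phi>'"
  shows "\<exists>K. compact K \<and> K \<subseteq> U \<and> (\<forall>x. x \<notin> K \<longrightarrow> \<phi> x = 0) \<and> (\<forall>x v. x \<notin> K \<longrightarrow> \<phi>' x v = 0)"
proof -
  obtain K where K: "compact K" "K \<subseteq> U" "\<And>x. x \<notin> K \<Longrightarrow> \<phi> x = 0"
    and d: "\<And>x. (\<phi> has_derivative \<phi>' x) (at x)"
    using assms unfolding test_fun_def by blast
  have "\<phi>' x v = 0" if "x \<notin> K" for x v
  proof -
    have "((\<lambda>x. 0) has_derivative \<phi>' x) (at x)"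
      using d[of x] by (rule has_derivative_transform_within_open[of _ _ _ _ "- K"])
        (use that K compact_imp_closed in auto)
    then have "\<phi>' x = (\<lambda>v. 0)" using has_derivative_unique[OF _ has_derivative_const] by blast
    then show ?thesis by simp
  qed
  then show ?thesis using K by blast
qed

lemma test_fun_loclip:
  assumes t: "test_fun U \<phi> \<phi>'"
  shows "loclip \<phi>"
  unfolding loclip_def
proof
  fix R
  let ?B = "\<lambda>x. \<Sum>b\<in>Basis. \<bar>\<phi>' x b\<bar>"
  have d: "(\<phi> has_derivative \<phi>' x) (at x)" for x using t by (auto simp: test_fun_def)
  have "continuous_on (cball 0 R) ?B"
    by (intro continuous_intros test_fun_deriv_cont[OF t])
  then have "bounded (?B ` cball 0 R)" by (intro compact_imp_bounded compact_continuous_image) auto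
  then obtain M where M: "M > 0" "\<And>x. x \<in> cball 0 R \<Longrightarrow> \<bar>?B x\<bar> \<le> M"
    unfolding bounded_pos by auto
  have "\<bar>\<phi> x - \<phi> y\<bar> \<le> M * norm (x - y)" if "norm x \<le> R" "norm y \<le> R" for x y
  proof -
    have "norm (\<phi> x - \<phi> y) \<le> M * norm (x - y)"
    proof (rule differentiable_bound[of "cball 0 R"])
      fix z :: 'a assume z: "z \<in> cball 0 R"
      show "onorm (\<phi>' z) \<le> M"
      proof (rule onorm_le)
        fix v
        have "\<bar>\<phi>' z v\<bar> \<le> (\<Sum>b\<in>Basis. \<bar>(v \<bullet> b) * \<phi>' z b\<bar>)"
          by (subst test_fun_expand[OF t]) (rule sum_abs)
        also have "\<dots> \<le> (\<Sum>b\<in>Basis. norm v * \<bar>\<phi>' z b\<bar>)"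
          by (intro sum_mono) (auto simp: abs_mult intro!: mult_right_mono Basis_le_norm)
        also have "\<dots> = ?B z * norm v" by (simp add: sum_distrib_left mult.commute)
        also have "\<dots> \<le> M * norm v" using M(2)[OF z] by (intro mult_right_mono) auto
        finally show "norm (\<phi>' z v) \<le> M * norm v" by simp
      qed
    qed (use d that in \<open>auto intro: has_derivative_at_withinI\<close>)
    then show ?thesis by simp
  qed
  then show "\<exists>L\<ge>0. \<forall>x y. norm x \<le> R \<longrightarrow> norm y \<le> R \<longrightarrow> \<bar>\<phi> x - \<phi> y\<bar> \<le> L * norm (x - y)"
    using M(1) by (intro exI[of _ M]) auto
qed

lemma test_fun_wderiv:
  assumes t: "test_fun U \<phi> \<phi>'" shows "wderiv \<phi> \<phi>'"
proof -
  have "(\<lambda>x. \<phi>' x v) \<in> borel_measurable borel" for v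
    by (rule borel_measurable_continuous_onI) (rule test_fun_deriv_cont[OF t continuous_on_const])
  moreover have "AE x in lborel. (\<phi> has_derivative \<phi>' x) (at x)"
    using t by (simp add: test_fun_def)
  ultimately show ?thesis using test_fun_loclip[OF t] by (simp add: wderiv_def)
qed

lemma integrable_compact_support:
  fixes f :: "'a::euclidean_space \<Rightarrow> real"
  assumes "compact K" "continuous_on UNIV f" "\<And>x. x \<notin> K \<Longrightarrow> f x = 0"
  shows "integrable lborel f"
proof -
  have "integrable lborel (\<lambda>x. indicator K x *\<^sub>R f x)"
    by (rule borel_integrable_compact[OF assms(1) continuous_on_subset[OF assms(2) subset_UNIV]])
  also have "(\<lambda>x. indicator K x *\<^sub>R f x) = f" using assms(3) by (auto simp: fun_eq_iff indicator_def)
  finally show ?thesis .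
qed

text \<open>The integral of the derivative of the compactly supported product \<open>\<phi> f\<close> is zero.\<close>

lemma integration_by_parts:
  assumes t: "test_fun U \<phi> \<phi>'" and f: "wderiv f f'"
  shows "integrable lborel (\<lambda>x. \<phi> x * f' x v)" "integrable lborel (\<lambda>x. \<phi>' x v * f x)"
    "(\<integral>x. \<phi> x * f' x v \<partial>lborel) = - (\<integral>x. \<phi>' x v * f x \<partial>lborel)"
proof -
  obtain K where K: "compact K" "K \<subseteq> U" "\<forall>x. x \<notin> K \<longrightarrow> \<phi> x = 0" "\<forall>x v. x \<notin> K \<longrightarrow> \<phi>' x v = 0"
    using test_fun_zero[OF t] by (elim exE conjE)
  obtain R where R: "\<And>x. x \<in> K \<Longrightarrow> norm x \<le> R"
    using compact_imp_bounded[OF K(1)] unfolding bounded_iff by blast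
  have w: "wderiv (\<lambda>x. \<phi> x * f x) (\<lambda>x v. \<phi> x * f' x v + \<phi>' x v * f x)"
    by (rule wderiv_mult[OF test_fun_wderiv[OF t] f])
  have supp: "\<phi> x * f x = 0" if "norm x > R" for x
  proof -
    have "x \<notin> K" using R[of x] that by linarith
    then show ?thesis by (simp add: K(3))
  qed
  show b: "integrable lborel (\<lambda>x. \<phi>' x v * f x)"
  proof (rule integrable_compact_support[OF K(1)])
    show "continuous_on UNIV (\<lambda>x. \<phi>' x v * f x)"
      by (rule continuous_on_mult[OF test_fun_deriv_cont[OF t continuous_on_const] wderiv_continuous[OF f]])
  qed (simp add: K(4))
  have wd: "loclip (\<lambda>x. \<phi> x * f x)"
     "AE x in lborel. ((\<lambda>x. \<phi> x * f x) has_derivative (\<lambda>v. \<phi> x * f' x v + \<phi>' x v * f x)) (at x)"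
     "(\<lambda>x. \<phi> x * f' x v + \<phi>' x v * f x) \<in> borel_measurable borel"
    using w by (simp_all only: wderiv_def)
  note z = integral_directional_derivative_zero[where R=R and v=v and
      h'="\<lambda>x v. \<phi> x * f' x v + \<phi>' x v * f x", OF wd(1) supp wd(2,3)]
  have "integrable lborel (\<lambda>x. (\<phi> x * f' x v + \<phi>' x v * f x) - \<phi>' x v * f x)"
    using z(1) b by (intro Bochner_Integration.integrable_diff) auto
  then show a: "integrable lborel (\<lambda>x. \<phi> x * f' x v)" by simp
  show "(\<integral>x. \<phi> x * f' x v \<partial>lborel) = - (\<integral>x. \<phi>' x v * f x \<partial>lborel)"
    using z(2) Bochner_Integration.integral_add[OF a b] by simp
qed

lemma weak_div_integral:
  assumes J: "finite J" and f: "\<And>j. j \<in> J \<Longrightarrow> wderiv (f j) (f' j)"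
    and v: "\<And>x. x \<in> D \<Longrightarrow> v x = (\<Sum>j\<in>J. f j x *\<^sub>R a j)"
    and t: "test_fun (interior D) \<phi> \<phi>'"
  shows "integrable lborel (\<lambda>x. \<phi> x * (\<Sum>j\<in>J. f' j x (a j)))"
    "(LINT x:D|lborel. \<phi>' x (v x)) = - (\<integral>x. \<phi> x * (\<Sum>j\<in>J. f' j x (a j)) \<partial>lborel)"
proof -
  obtain K where "compact K" and K: "K \<subseteq> interior D" and "\<forall>x. x \<notin> K \<longrightarrow> \<phi> x = 0"
    and K0: "\<forall>x v. x \<notin> K \<longrightarrow> \<phi>' x v = 0"
    using test_fun_zero[OF t] by (elim exE conjE)
  note ibp = integration_by_parts[OF t f]
  have lin: "linear (\<phi>' x)" for x by (rule test_fun_linear[OF t])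
  show "integrable lborel (\<lambda>x. \<phi> x * (\<Sum>j\<in>J. f' j x (a j)))"
    using ibp(1) by (simp add: sum_distrib_left)
  have "(LINT x:D|lborel. \<phi>' x (v x)) = (LINT x|lborel. (\<Sum>j\<in>J. \<phi>' x (a j) * f j x))"
    unfolding set_lebesgue_integral_def
  proof (intro Bochner_Integration.integral_cong refl)
    fix x
    show "indicat_real D x *\<^sub>R \<phi>' x (v x) = (\<Sum>j\<in>J. \<phi>' x (a j) * f j x)"
    proof (cases "x \<in> D")
      case True
      then show ?thesis
        by (simp add: v linear_sum[OF lin] linear_scale[OF lin] mult.commute)
    next
      case False
      then have "x \<notin> K" using K interior_subset by blast
      then show ?thesis using False K0 by simp
    qed
  qed
  also have "\<dots> = (\<Sum>j\<in>J. \<integral>x. \<phi>' x (a j) * f j x \<partial>lborel)"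
    by (rule Bochner_Integration.integral_sum) (rule ibp(2))
  also have "\<dots> = (\<Sum>j\<in>J. - (\<integral>x. \<phi> x * f' j x (a j) \<partial>lborel))"
    by (intro sum.cong refl) (simp add: ibp(3))
  also have "\<dots> = - (\<Sum>j\<in>J. \<integral>x. \<phi> x * f' j x (a j) \<partial>lborel)" by (simp add: sum_negf)
  also have "(\<Sum>j\<in>J. \<integral>x. \<phi> x * f' j x (a j) \<partial>lborel) = (\<integral>x. \<phi> x * (\<Sum>j\<in>J. f' j x (a j)) \<partial>lborel)"
    using ibp(1) by (simp add: sum_distrib_left integral_sum)
  finally show "(LINT x:D|lborel. \<phi>' x (v x)) = - (\<integral>x. \<phi> x * (\<Sum>j\<in>J. f' j x (a j)) \<partial>lborel)" .
qed

text \<open>A field that is given by finitely many scalar functions and constant vectors has its weak divergence computed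
  pointwise almost everywhere.\<close>

lemma weak_divI:
  assumes D: "compact D" and J: "finite J" and f: "\<And>j. j \<in> J \<Longrightarrow> wderiv (f j) (f' j)"
    and v: "\<And>x. x \<in> D \<Longrightarrow> v x = (\<Sum>j\<in>J. f j x *\<^sub>R a j)"
    and g: "continuous_on D g"
    and eq: "AE x in lborel. x \<in> interior D \<longrightarrow> (\<Sum>j\<in>J. f' j x (a j)) = g x"
  shows "weak_div D v g"
  unfolding weak_div_def
proof (intro allI impI)
  fix \<phi> \<phi>' assume t: "test_fun (interior D) \<phi> \<phi>'"
  obtain K where "compact K" and K: "K \<subseteq> interior D" "\<forall>x. x \<notin> K \<longrightarrow> \<phi> x = 0"
    and "\<forall>x v. x \<notin> K \<longrightarrow> \<phi>' x v = 0"
    using test_fun_zero[OF t] by (elim exE conjE)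
  have "(LINT x:D|lborel. \<phi> x * g x) = (\<integral>x. \<phi> x * (\<Sum>j\<in>J. f' j x (a j)) \<partial>lborel)"
    unfolding set_lebesgue_integral_def
  proof (rule integral_cong_AE)
    have "set_integrable lborel D (\<lambda>x. \<phi> x * g x)"
      by (intro set_integrable_cont[OF D] continuous_on_mult g test_fun_cont[OF t])
    then show "(\<lambda>x. indicat_real D x *\<^sub>R (\<phi> x * g x)) \<in> borel_measurable lborel"
      unfolding set_integrable_def by (rule borel_measurable_integrable)
    show "(\<lambda>x. \<phi> x * (\<Sum>j\<in>J. f' j x (a j))) \<in> borel_measurable lborel"
      by (rule borel_measurable_integrable) (rule weak_div_integral(1)[OF J f v t])
    show "AE x in lborel. indicat_real D x *\<^sub>R (\<phi> x * g x) = \<phi> x * (\<Sum>j\<in>J. f' j x (a j))"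
      using eq
    proof eventually_elim
      case (elim x)
      then show ?case using K interior_subset[of D] by (cases "x \<in> K") (auto simp: indicator_def)
    qed
  qed
  then show "(LINT x:D|lborel. \<phi> x * g x) = - (LINT x:D|lborel. \<phi>' x (v x))"
    using weak_div_integral(2)[OF J f v t] by simp
qed

lemma weak_div_add:
  assumes D: "compact D" and c: "continuous_on D v" "continuous_on D w" "continuous_on D f" "continuous_on D g"
    and "weak_div D v f" "weak_div D w g"
  shows "weak_div D (\<lambda>x. v x + r *\<^sub>R w x) (\<lambda>x. f x + r * g x)"
  unfolding weak_div_def
proof (intro allI impI)
  fix \<phi> \<phi>' assume t: "test_fun (interior D) \<phi> \<phi>'"
  have lin: "linear (\<phi>' x)" for x by (rule test_fun_linear[OF t])
  have "set_integrable lborel D (\<lambda>x. \<phi> x * f x)" "set_integrable lborel D (\<lambda>x. \<phi> x * g x)"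
    "set_integrable lborel D (\<lambda>x. \<phi>' x (v x))" "set_integrable lborel D (\<lambda>x. \<phi>' x (w x))"
    by (intro set_integrable_cont[OF D] continuous_on_mult test_fun_deriv_cont[OF t] test_fun_cont[OF t] c)+
  moreover have "(LINT x:D|lborel. \<phi> x * f x) = - (LINT x:D|lborel. \<phi>' x (v x))"
     "(LINT x:D|lborel. \<phi> x * g x) = - (LINT x:D|lborel. \<phi>' x (w x))"
    using assms t unfolding weak_div_def by auto
  ultimately show "(LINT x:D|lborel. \<phi> x * (f x + r * g x)) = - (LINT x:D|lborel. \<phi>' x (v x + r *\<^sub>R w x))"
    by (simp add: linear_add[OF lin] linear_scale[OF lin] distrib_left mult.left_commute set_integral_add)
qed

section \<open>Bump functions and uniqueness of the weak divergence\<close>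

lemma has_real_derivative_pos_part_square:
  "((\<lambda>s::real. (max 0 s)\<^sup>2) has_real_derivative 2 * max 0 s) (at s)"
proof -
  consider "s > 0" | "s < 0" | "s = 0" by linarith
  then show ?thesis
  proof cases
    case 1
    have "((\<lambda>s::real. s\<^sup>2) has_real_derivative 2 * max 0 s) (at s)"
      using 1 by (auto intro!: derivative_eq_intros)
    then show ?thesis
      by (rule has_field_derivative_transform_within_open[of _ _ _ "{0<..}"]) (use 1 in auto)
  next
    case 2
    have "((\<lambda>s::real. 0) has_real_derivative 2 * max 0 s) (at s)" using 2 by simp
    then show ?thesis
      by (rule has_field_derivative_transform_within_open[of _ _ _ "{..<0}"]) (use 2 in auto)
  next
    case 3
    have "((\<lambda>h::real. (max 0 h)\<^sup>2 / h) \<longlongrightarrow> 0) (at 0)"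
    proof (rule Lim_null_comparison)
      show "\<forall>\<^sub>F h in at (0::real). norm ((max 0 h)\<^sup>2 / h) \<le> \<bar>h\<bar>"
        by (intro always_eventually allI) (auto simp: max_def power2_eq_square)
      show "((\<lambda>h::real. \<bar>h\<bar>) \<longlongrightarrow> 0) (at 0)" by (rule tendsto_rabs_zero) simp
    qed
    then show ?thesis using 3 by (simp add: DERIV_def)
  qed
qed

text \<open>The function \<open>(max 0 (r\<^sup>2 - \<bar>x - p\<bar>\<^sup>2))\<^sup>2\<close> is continuously
  differentiable, which is all that is asked of a test function.\<close>

lemma ex_bump:
  assumes "open U" "p \<in> U"
  obtains \<phi> \<phi>' r where "test_fun U \<phi> \<phi>'" "\<And>x. \<phi> x \<ge> 0" "r > 0" "\<And>x. x \<in> ball p r \<Longrightarrow> \<phi> x > 0"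
proof -
  obtain r where r: "r > 0" "cball p r \<subseteq> U" using assms open_contains_cball by blast
  let ?q = "\<lambda>x. r\<^sup>2 - (x - p) \<bullet> (x - p)"
  let ?\<phi> = "\<lambda>x. (max 0 (?q x))\<^sup>2"
  let ?\<phi>' = "\<lambda>x v. (- 2 * ((x - p) \<bullet> v)) * (2 * max 0 (?q x))"
  have q: "?q x > 0 \<longleftrightarrow> x \<in> ball p r" "?q x \<ge> 0 \<longleftrightarrow> x \<in> cball p r" for x
    using r(1) power_mono_iff[of r "norm (x - p)" 2] power_mono_iff[of "norm (x - p)" r 2]
    by (simp_all add: dist_norm norm_minus_commute[of p x] dot_square_norm not_le[symmetric])
  have "(?\<phi> has_derivative ?\<phi>' x) (at x)" for x
  proof -
    have "(?q has_derivative (\<lambda>v. - 2 * ((x - p) \<bullet> v))) (at x)"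
      by (auto intro!: derivative_eq_intros simp: inner_commute)
    from DERIV_compose_FDERIV[OF has_real_derivative_pos_part_square this] show ?thesis .
  qed
  moreover have "continuous_on UNIV (\<lambda>x. ?\<phi>' x v)" for v by (intro continuous_intros)
  moreover have "?\<phi> x = 0" if "x \<notin> cball p r" for x
    using q(2)[of x] that by simp
  ultimately have "test_fun U ?\<phi> ?\<phi>'"
    unfolding test_fun_def using r(2) by (intro conjI allI exI[of _ "cball p r"]) auto
  moreover have "?\<phi> x > 0" if "x \<in> ball p r" for x using q(1)[of x] that by simp
  ultimately show ?thesis using that[of ?\<phi> ?\<phi>' r] r(1) by auto
qed

lemma integral_pos:
  fixes h :: "'a::euclidean_space \<Rightarrow> real"
  assumes "integrable lborel h" "\<And>x. h x \<ge> 0" "r > 0" "\<And>x. x \<in> ball p r \<Longrightarrow> h x > 0"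
  shows "integral\<^sup>L lborel h > 0"
proof -
  have "integral\<^sup>L lborel h \<noteq> 0"
  proof
    assume "integral\<^sup>L lborel h = 0"
    then have "AE x in lborel. h x = 0"
      using integral_nonneg_eq_0_iff_AE[OF assms(1)] assms(2) by auto
    then have "AE x in lborel. x \<notin> ball p r"
      by eventually_elim (use assms(4) in force)
    then have "emeasure lborel (ball p r) = 0"
      by (subst (asm) AE_iff_measurable[of "ball p r"]) auto
    moreover have "unit_ball_vol (real DIM('a)) * r ^ DIM('a) > 0"
      using assms(3) by (intro mult_pos_pos) auto
    ultimately show False using assms(3) emeasure_ball[of r p] by (simp add: ennreal_eq_0_iff)
  qed
  moreover have "integral\<^sup>L lborel h \<ge> 0" using assms(2) by simp
  ultimately show ?thesis by simp
qed

text \<open>The fundamental lemma of the calculus of variations: otherwise \<open>g\<close> has a constant sign near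
  \<open>p\<close>, and a bump function that is supported there gives a nonzero integral.\<close>

lemma weakly_zero:
  fixes g :: "'a::euclidean_space \<Rightarrow> real"
  assumes D: "compact D" and g: "continuous_on D g"
    and z: "\<And>\<phi> \<phi>'. test_fun (interior D) \<phi> \<phi>' \<Longrightarrow> (LINT x:D|lborel. \<phi> x * g x) = 0"
    and p: "p \<in> interior D"
  shows "g p = 0"
proof (rule ccontr)
  assume nz: "g p \<noteq> 0"
  define s where "s = sgn (g p)"
  have sp: "s * g p > 0" using nz by (simp add: s_def sgn_if)
  have "continuous_on (interior D) (\<lambda>x. s * g x)"
    using g by (intro continuous_intros) (rule continuous_on_subset[OF _ interior_subset])
  then have op: "open (interior D \<inter> (\<lambda>x. s * g x) -` {0<..})"
    by (rule continuous_open_preimage) auto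
  let ?U = "interior D \<inter> (\<lambda>x. s * g x) -` {0<..}"
  obtain \<phi> \<phi>' r where \<phi>: "test_fun ?U \<phi> \<phi>'" "\<And>x. \<phi> x \<ge> 0" "r > 0" "\<And>x. x \<in> ball p r \<Longrightarrow> \<phi> x > 0"
    using ex_bump[OF op, of p] p sp by auto
  obtain K where "compact K" and K: "K \<subseteq> ?U" "\<forall>x. x \<notin> K \<longrightarrow> \<phi> x = 0"
    and "\<forall>x v. x \<notin> K \<longrightarrow> \<phi>' x v = 0"
    using test_fun_zero[OF \<phi>(1)] by (elim exE conjE)
  have t: "test_fun (interior D) \<phi> \<phi>'" using \<phi>(1) unfolding test_fun_def by blast
  let ?h = "\<lambda>x. indicator D x *\<^sub>R (\<phi> x * (s * g x))"
  have hint: "integrable lborel ?h"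
    by (rule borel_integrable_compact[OF D]) (intro continuous_intros g test_fun_cont[OF t])
  have "integral\<^sup>L lborel ?h > 0"
  proof (rule integral_pos[OF hint _ \<phi>(3)])
    fix x
    show "?h x \<ge> 0"
      using K \<phi>(2)[of x] by (cases "x \<in> K") (auto intro!: mult_nonneg_nonneg simp: subset_iff less_imp_le)
    assume "x \<in> ball p r"
    then have "\<phi> x > 0" by (rule \<phi>(4))
    moreover from this have "x \<in> ?U" using K by force
    ultimately show "?h x > 0" using interior_subset[of D] by auto
  qed
  moreover have "integral\<^sup>L lborel ?h = s * (LINT x:D|lborel. \<phi> x * g x)"
  proof -
    have "integral\<^sup>L lborel ?h = (\<integral>x. s * (indicator D x *\<^sub>R (\<phi> x * g x)) \<partial>lborel)"
      by (intro Bochner_Integration.integral_cong refl) simp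
    then show ?thesis unfolding set_lebesgue_integral_def by simp
  qed
  ultimately show False using z[OF t] by simp
qed

lemma weak_div_unique:
  assumes D: "compact D" "convex D" "interior D \<noteq> {}"
    and c: "continuous_on D f" "continuous_on D g"
    and w: "weak_div D v f" "weak_div D v g" and x: "x \<in> D"
  shows "f x = g x"
proof -
  have inner: "f y - g y = 0" if "y \<in> interior D" for y
  proof (rule weakly_zero[OF D(1) _ _ that])
    show "continuous_on D (\<lambda>x. f x - g x)" by (intro continuous_intros c)
    fix \<phi> \<phi>' assume t: "test_fun (interior D) \<phi> \<phi>'"
    have "set_integrable lborel D (\<lambda>x. \<phi> x * f x)" "set_integrable lborel D (\<lambda>x. \<phi> x * g x)"
      by (intro set_integrable_cont[OF D(1)] continuous_on_mult test_fun_cont[OF t] c)+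
    then show "(LINT x:D|lborel. \<phi> x * (f x - g x)) = 0"
      using w t by (simp add: weak_div_def right_diff_distrib set_integral_diff)
  qed
  have cl: "closure (interior D) = D"
    using convex_closure_interior[OF D(2,3)] compact_imp_closed[OF D(1)] by simp
  have "(\<lambda>x. f x - g x) x = 0"
    by (rule continuous_constant_on_closure[of "interior D" "\<lambda>x. f x - g x" 0])
       (use inner cl x in \<open>auto intro!: continuous_intros c\<close>)
  then show ?thesis by simp
qed

section \<open>Barycentric coordinates\<close>

lemma AE_linear_ne:
  fixes g :: "'a::euclidean_space \<Rightarrow> real"
  assumes g: "linear g" and nz: "g d \<noteq> 0"
  shows "AE x in lborel. g x \<noteq> c"
proof -
  define a where "a = (\<Sum>b\<in>Basis. g b *\<^sub>R b)"
  have ga: "g x = a \<bullet> x" for x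
  proof -
    have "g x = (\<Sum>b\<in>Basis. (x \<bullet> b) * g b)" by (rule linear_basis_expand[OF g])
    also have "\<dots> = a \<bullet> x"
      unfolding a_def inner_sum_left inner_scaleR_left by (intro sum.cong refl) (simp add: inner_commute)
    finally show ?thesis .
  qed
  have "a \<noteq> 0" using nz ga[of d] by auto
  then have "negligible {x. a \<bullet> x = c}" by (intro negligible_hyperplane) simp
  moreover have "closed {x. a \<bullet> x = c}" by (rule closed_hyperplane)
  ultimately have "{x. a \<bullet> x = c} \<in> null_sets lborel"
    by (metis borel_closed negligible_iff_null_sets null_sets_completion_iff sets_lborel)
  then have "AE x in lborel. x \<notin> {x. a \<bullet> x = c}" by (rule AE_not_in)
  then show ?thesis by (simp add: ga)
qed

locale simplex =
  fixes S :: "'a::euclidean_space set"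
  assumes indep: "\<not> affine_dependent S" and card_S: "card S = Suc DIM('a)"
begin

lemma finite_S [simp]: "finite S"
  using card_S card_ge_0_finite by force

text \<open>Barycentric coordinates on the whole space, not only on the simplex. The value at
  \<open>V \<notin> S\<close> is arbitrary.\<close>

definition lam :: "'a \<Rightarrow> 'a \<Rightarrow> real" where
  "lam V x = (SOME c. sum c S = 1 \<and> (\<Sum>v\<in>S. c v *\<^sub>R v) = x) V"

lemma sum_lam: "(\<Sum>V\<in>S. lam V x) = 1" and lam_point: "(\<Sum>V\<in>S. lam V x *\<^sub>R V) = x"
proof -
  have "x \<in> affine hull S" using affine_independent_span_eq[OF indep card_S] by simp
  then have "\<exists>c. sum c S = 1 \<and> (\<Sum>v\<in>S. c v *\<^sub>R v) = x"
    by (simp add: affine_hull_finite)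
  from someI_ex[OF this] show "(\<Sum>V\<in>S. lam V x) = 1" "(\<Sum>V\<in>S. lam V x *\<^sub>R V) = x"
    by (simp_all add: lam_def)
qed

lemma coeff_unique:
  assumes "sum c S = sum e S" "(\<Sum>v\<in>S. c v *\<^sub>R v) = (\<Sum>v\<in>S. e v *\<^sub>R v)" "V \<in> S"
  shows "c V = e V"
proof (rule ccontr)
  assume "c V \<noteq> e V"
  then have "affine_dependent S"
    unfolding affine_dependent_explicit_finite[OF finite_S]
    using assms by (intro exI[of _ "\<lambda>v. c v - e v"])
      (auto simp: sum_subtractf scaleR_left_diff_distrib)
  then show False using indep by simp
qed

lemma lam_unique:
  assumes "sum c S = 1" "(\<Sum>v\<in>S. c v *\<^sub>R v) = x" "V \<in> S"
  shows "lam V x = c V"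
  by (rule coeff_unique) (use assms sum_lam lam_point in auto)

text \<open>The differential of the affine function \<open>lam V\<close>, the same at every point.\<close>

definition grad :: "'a \<Rightarrow> 'a \<Rightarrow> real" where
  "grad V d = lam V d - lam V 0"

lemma lam_add:
  assumes "V \<in> S" shows "lam V (x + d) = lam V x + grad V d"
  unfolding grad_def
  by (rule lam_unique[of "\<lambda>V. lam V x + (lam V d - lam V 0)" _ V, OF _ _ assms])
     (simp_all add: sum.distrib sum_subtractf sum_lam scaleR_left_distrib scaleR_left_diff_distrib lam_point)

lemma lam_eq: "V \<in> S \<Longrightarrow> lam V x = lam V 0 + grad V x"
  by (simp add: grad_def)

lemma linear_grad:
  assumes "V \<in> S" shows "linear (grad V)"
proof (rule linearI)
  fix x y show "grad V (x + y) = grad V x + grad V y"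
    using lam_add[OF assms, of x y] by (simp add: grad_def)
next
  fix r x
  have "lam V (r *\<^sub>R x) = r * lam V x + (1 - r) * lam V 0"
  proof (rule lam_unique[of "\<lambda>V. r * lam V x + (1 - r) * lam V 0" _ V, OF _ _ assms])
    show "(\<Sum>V\<in>S. r * lam V x + (1 - r) * lam V 0) = 1"
      unfolding sum.distrib sum_distrib_left[symmetric] sum_lam by simp
    have "(\<Sum>V\<in>S. (r * lam V x + (1 - r) * lam V 0) *\<^sub>R V) =
        (\<Sum>V\<in>S. r *\<^sub>R (lam V x *\<^sub>R V) + (1 - r) *\<^sub>R (lam V 0 *\<^sub>R V))"
      by (simp add: scaleR_left_distrib)
    also have "\<dots> = r *\<^sub>R x + (1 - r) *\<^sub>R 0"
      unfolding sum.distrib scaleR_sum_right[symmetric] lam_point ..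
    finally show "(\<Sum>V\<in>S. (r * lam V x + (1 - r) * lam V 0) *\<^sub>R V) = r *\<^sub>R x" by simp
  qed
  then show "grad V (r *\<^sub>R x) = r *\<^sub>R grad V x" by (simp add: grad_def algebra_simps)
qed

lemma grad_diff: "V \<in> S \<Longrightarrow> grad V (x - y) = lam V x - lam V y"
  using linear_diff[OF linear_grad, of V x y] by (simp add: grad_def)

lemma sum_grad: "(\<Sum>V\<in>S. grad V d) = 0" and grad_vec: "(\<Sum>V\<in>S. grad V d *\<^sub>R V) = d"
  by (simp_all add: grad_def sum_subtractf sum_lam scaleR_left_diff_distrib lam_point)

lemma grad_all_zero: "(\<And>V. V \<in> S \<Longrightarrow> grad V d = 0) \<Longrightarrow> d = 0"
  using grad_vec[of d] by simp

lemma lam_vertex: "U \<in> S \<Longrightarrow> V \<in> S \<Longrightarrow> lam V U = (if U = V then 1 else 0)"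
  by (rule lam_unique[of "\<lambda>V. if U = V then 1 else 0"]) (auto simp: if_distrib[of "\<lambda>c. c *\<^sub>R _"] cong: if_cong)

lemma lam_affine_comb:
  assumes "V \<in> S" "u + v = 1"
  shows "lam V (u *\<^sub>R x + v *\<^sub>R y) = u * lam V x + v * lam V y"
proof -
  have "lam V (u *\<^sub>R x + v *\<^sub>R y) = lam V 0 + u * grad V x + v * grad V y"
    unfolding lam_eq[OF assms(1), of "u *\<^sub>R x + v *\<^sub>R y"]
    by (simp add: linear_add[OF linear_grad[OF assms(1)]] linear_scale[OF linear_grad[OF assms(1)]])
  also have "\<dots> = (u + v) * lam V 0 + u * grad V x + v * grad V y" using assms by simp
  finally show ?thesis by (simp add: grad_def algebra_simps)
qed

abbreviation D :: "'a set" where "D \<equiv> convex hull S"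

lemma mem_D: "x \<in> D \<longleftrightarrow> (\<forall>V\<in>S. 0 \<le> lam V x)"
proof
  assume "x \<in> D"
  then obtain u where "\<forall>x\<in>S. 0 \<le> u x" "sum u S = 1" "(\<Sum>x\<in>S. u x *\<^sub>R x) = x"
    unfolding convex_hull_finite[OF finite_S] by auto
  then show "\<forall>V\<in>S. 0 \<le> lam V x" using lam_unique[of u x] by simp
next
  assume "\<forall>V\<in>S. 0 \<le> lam V x"
  then show "x \<in> D" unfolding convex_hull_finite[OF finite_S]
    using sum_lam[of x] lam_point[of x] by (intro CollectI exI[of _ "\<lambda>V. lam V x"]) auto
qed

lemma mem_interior_D: "x \<in> interior D \<longleftrightarrow> (\<forall>V\<in>S. 0 < lam V x)"
proof -
  have eq: "interior D = {y. \<exists>u. (\<forall>x\<in>S. 0 < u x \<and> u x < 1) \<and> sum u S = 1 \<and> (\<Sum>x\<in>S. u x *\<^sub>R x) = y}"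
    using interior_convex_hull_explicit[OF indep] card_S by simp
  show ?thesis
  proof
    assume "x \<in> interior D"
    then obtain u where "\<forall>x\<in>S. 0 < u x \<and> u x < 1" "sum u S = 1" "(\<Sum>x\<in>S. u x *\<^sub>R x) = x"
      unfolding eq by blast
    then show "\<forall>V\<in>S. 0 < lam V x" using lam_unique[of u x] by simp
  next
    assume pos: "\<forall>V\<in>S. 0 < lam V x"
    have "lam V x < 1" if V: "V \<in> S" for V
    proof -
      have "card (S - {V}) > 0" using card_S V by simp
      then have "S - {V} \<noteq> {}" by (metis card.empty less_irrefl)
      then have "0 < (\<Sum>U\<in>S - {V}. lam U x)" using pos by (intro sum_pos) auto
      then show ?thesis using sum_lam[of x] V by (simp add: sum.remove[of S V])
    qed
    with pos show "x \<in> interior D" unfolding eq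
      using sum_lam[of x] lam_point[of x] by (intro CollectI exI[of _ "\<lambda>V. lam V x"]) auto
  qed
qed

lemma lam_rel_interior:
  assumes "x \<in> rel_interior (convex hull T)" "T \<subseteq> S" "V \<in> S"
  shows "V \<in> T \<Longrightarrow> lam V x > 0" "V \<notin> T \<Longrightarrow> lam V x = 0"
proof -
  have indT: "\<not> affine_dependent T" using affine_independent_subset[OF indep assms(2)] .
  obtain u where u: "\<forall>x\<in>T. 0 < u x" "sum u T = 1" "(\<Sum>x\<in>T. u x *\<^sub>R x) = x"
    using assms(1) unfolding rel_interior_convex_hull_explicit[OF indT] by auto
  let ?c = "\<lambda>V. if V \<in> T then u V else 0"
  have "sum ?c S = 1" "(\<Sum>V\<in>S. ?c V *\<^sub>R V) = x"
    using u assms(2) by (simp_all add: if_distrib[of "\<lambda>c. c *\<^sub>R _"] sum.If_cases Int_absorb1 cong: if_cong)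
  then have "lam V x = ?c V" using assms(3) by (rule lam_unique)
  then show "V \<in> T \<Longrightarrow> lam V x > 0" "V \<notin> T \<Longrightarrow> lam V x = 0" using u by auto
qed

lemma compact_D: "compact D"
  by (simp add: finite_imp_compact compact_convex_hull)

lemma vertex_in_D: "V \<in> S \<Longrightarrow> V \<in> D"
  by (rule hull_inc)

lemma interior_D_ne: "interior D \<noteq> {}"
proof -
  let ?x = "\<Sum>V\<in>S. (1 / real (card S)) *\<^sub>R V"
  have "card S > 0" using card_S by simp
  then have "lam V ?x = 1 / real (card S)" if "V \<in> S" for V
    by (intro lam_unique[of "\<lambda>V. 1 / real (card S)", OF _ _ that]) auto
  then have "?x \<in> interior D" using \<open>card S > 0\<close> by (simp add: mem_interior_D)
  then show ?thesis by blast
qed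

lemma wderiv_lam:
  assumes "V \<in> S" shows "wderiv (lam V) (\<lambda>x. grad V)"
proof -
  have "wderiv (\<lambda>x. lam V 0 + grad V x) (\<lambda>x v. 0 + grad V v)"
    by (rule wderiv_add[OF wderiv_const wderiv_linear[OF linear_grad[OF assms]]])
  moreover have "(\<lambda>x. lam V 0 + grad V x) = lam V" by (simp add: grad_def fun_eq_iff)
  ultimately show ?thesis by simp
qed

lemma loclip_lam: "V \<in> S \<Longrightarrow> loclip (lam V)"
  using wderiv_lam by (auto simp: wderiv_def)

lemma continuous_lam: "V \<in> S \<Longrightarrow> continuous_on A (lam V)"
  by (rule loclip_continuous[OF loclip_lam])

end

section \<open>The hat functions of the split simplex\<close>

locale split_simplex = simplex S for S :: "'a::euclidean_space set" +
  fixes W :: "'a set \<Rightarrow> 'a"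
  assumes inpoints: "inpoints S W" and dim2: "DIM('a) \<ge> 2"
begin

abbreviation WF :: "'a \<Rightarrow> 'a" where "WF V \<equiv> W (S - {V})"

text \<open>Barycentric coordinates of the inpoints of the simplex and of its facets. Relative interiority of the inpoints
  makes them positive at the vertices of the respective face.\<close>

definition beta :: "'a \<Rightarrow> real" where "beta V = lam V (W S)"
definition tau :: "'a \<Rightarrow> 'a \<Rightarrow> real" where "tau V U = lam U (WF V)"

lemma S_ne: "S \<noteq> {}"
  using card_S by auto

lemma card_facet: "V \<in> S \<Longrightarrow> card (S - {V}) = DIM('a)"
  using card_S by simp

lemma facet_ne: "V \<in> S \<Longrightarrow> S - {V} \<noteq> {}"
  using card_facet[of V] dim2 by (metis card.empty not_numeral_le_zero)

lemma card_ridge: "V \<in> S \<Longrightarrow> U \<in> S \<Longrightarrow> U \<noteq> V \<Longrightarrow> card (S - {V, U}) = DIM('a) - 1"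
  using card_S by (simp add: card_Diff_subset)

lemma ridge_ne: "V \<in> S \<Longrightarrow> U \<in> S \<Longrightarrow> U \<noteq> V \<Longrightarrow> S - {V, U} \<noteq> {}"
  using card_ridge[of V U] dim2 by (metis One_nat_def card.empty diff_is_0_eq not_less_eq_eq numeral_2_eq_2)

lemma beta_pos: "V \<in> S \<Longrightarrow> beta V > 0"
  unfolding beta_def using inpoints S_ne
  by (intro lam_rel_interior(1)[of _ S]) (auto simp: inpoints_def faces_def)

lemma WF_rel: "V \<in> S \<Longrightarrow> WF V \<in> rel_interior (convex hull (S - {V}))"
  using inpoints facet_ne[of V] by (auto simp: inpoints_def faces_def)

lemma tau_pos: "V \<in> S \<Longrightarrow> U \<in> S \<Longrightarrow> U \<noteq> V \<Longrightarrow> tau V U > 0"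
  unfolding tau_def using WF_rel by (intro lam_rel_interior(1)[of _ "S - {V}"]) auto

lemma tau_self: "V \<in> S \<Longrightarrow> tau V V = 0"
  unfolding tau_def using WF_rel by (intro lam_rel_interior(2)[of _ "S - {V}"]) auto

lemma sum_beta: "sum beta S = 1"
  by (simp add: beta_def sum_lam)

lemma sum_tau: "(\<Sum>U\<in>S. tau V U) = 1"
  by (simp add: tau_def sum_lam)

lemma sum_tau_facet: "V \<in> S \<Longrightarrow> (\<Sum>U\<in>S - {V}. tau V U) = 1"
  using sum_tau[of V] tau_self[of V] by (simp add: sum.remove[of S V])

lemma WS_point: "(\<Sum>Z\<in>S. beta Z *\<^sub>R Z) = W S"
  by (simp add: beta_def lam_point)

lemma WF_point: "(\<Sum>Z\<in>S. tau V Z *\<^sub>R Z) = WF V"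
  by (simp add: tau_def lam_point)

lemma WS_in_D: "W S \<in> D"
  unfolding mem_D using beta_pos by (auto simp: beta_def less_imp_le)

lemma WF_in_D: "V \<in> S \<Longrightarrow> WF V \<in> D"
  unfolding mem_D using tau_pos tau_self by (metis less_eq_real_def tau_def)

text \<open>The affine function that is \<open>1\<close> at the inpoint of the facet opposite to \<open>V\<close> and
  \<open>0\<close> at \<open>W S\<close> and at all vertices except \<open>V\<close> and \<open>U\<close>. On
  the cell spanned by these points it is the hat function of the facet.\<close>

definition facet_coord :: "'a \<Rightarrow> 'a \<Rightarrow> 'a \<Rightarrow> real" where
  "facet_coord V U x = (lam U x - beta U / beta V * lam V x) / tau V U"

text \<open>The hat functions of the interior vertex \<open>W S\<close> and of the vertex \<open>WF V\<close> of the
  fine split, written as lattice expressions in affine functions. In this form they are defined on the whole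
  space, local Lipschitz continuity is immediate, and the split does not have to be known to be a
  triangulation: the piece that contains a point is the one for which the minima are attained.\<close>

definition hatS :: "'a \<Rightarrow> real" where
  "hatS x = Min ((\<lambda>V. lam V x / beta V) ` S)"

definition hatF :: "'a \<Rightarrow> 'a \<Rightarrow> real" where
  "hatF V x = max 0 (Min ((\<lambda>U. facet_coord V U x) ` (S - {V})))"

text \<open>Within the simplex, this is the cone with apex \<open>W S\<close> over the facet opposite to \<open>V\<close>
  (\<open>in_cone_hull\<close> and, for the converse, \<open>sector_in_cell\<close>).\<close>

definition in_cone :: "'a \<Rightarrow> 'a \<Rightarrow> bool" where
  "in_cone V x \<longleftrightarrow> V \<in> S \<and> (\<forall>Z\<in>S. lam V x / beta V \<le> lam Z x / beta Z)"

text \<open>Within the simplex, this is the cell with the vertices \<open>W S\<close>, \<open>WF V\<close> and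
  \<open>S - {V, U}\<close> (\<open>sector_hull\<close>, \<open>sector_in_cell\<close>): the cone over the
  facet opposite to \<open>V\<close>, split from the inpoint of this facet.\<close>

definition sector :: "'a \<Rightarrow> 'a \<Rightarrow> 'a \<Rightarrow> bool" where
  "sector V U x \<longleftrightarrow> in_cone V x \<and> U \<in> S \<and> U \<noteq> V \<and> (\<forall>Z\<in>S - {V}. facet_coord V U x \<le> facet_coord V Z x)"

lemma facet_coord_eq: "V \<in> S \<Longrightarrow> U \<in> S \<Longrightarrow> facet_coord V U x = beta U / tau V U * (lam U x / beta U - lam V x / beta V)"
  using beta_pos[of U] by (simp add: facet_coord_def right_diff_distrib diff_divide_distrib)

lemma ex_in_cone: "\<exists>V. in_cone V x"
proof -
  have "Min ((\<lambda>V. lam V x / beta V) ` S) \<in> (\<lambda>V. lam V x / beta V) ` S"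
    using S_ne by (intro Min_in) auto
  then obtain V where V: "V \<in> S" "Min ((\<lambda>V. lam V x / beta V) ` S) = lam V x / beta V" by auto
  have "lam V x / beta V \<le> lam Z x / beta Z" if "Z \<in> S" for Z
    unfolding V(2)[symmetric] using that by (intro Min_le) auto
  then show ?thesis using V(1) by (auto simp: in_cone_def)
qed

lemma ex_sector: "\<exists>V U. sector V U x"
proof -
  obtain V where V: "in_cone V x" using ex_in_cone by blast
  then have VS: "V \<in> S" by (simp add: in_cone_def)
  have "Min ((\<lambda>U. facet_coord V U x) ` (S - {V})) \<in> (\<lambda>U. facet_coord V U x) ` (S - {V})"
    using facet_ne[OF VS] by (intro Min_in) auto
  then obtain U where U: "U \<in> S - {V}" "Min ((\<lambda>U. facet_coord V U x) ` (S - {V})) = facet_coord V U x" by auto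
  have "facet_coord V U x \<le> facet_coord V Z x" if "Z \<in> S - {V}" for Z
    unfolding U(2)[symmetric] using that by (intro Min_le) auto
  then show ?thesis using V U(1) by (auto simp: sector_def)
qed

lemma sectorD:
  assumes "sector V U x"
  shows "in_cone V x" "V \<in> S" "U \<in> S" "U \<noteq> V" "\<And>Z. Z \<in> S \<Longrightarrow> Z \<noteq> V \<Longrightarrow> facet_coord V U x \<le> facet_coord V Z x"
  using assms by (auto simp: sector_def in_cone_def)

lemma in_coneD:
  assumes "in_cone V x" shows "V \<in> S" "\<And>Z. Z \<in> S \<Longrightarrow> lam V x / beta V \<le> lam Z x / beta Z"
  using assms by (auto simp: in_cone_def)

lemma in_cone_hatS: "in_cone V x \<Longrightarrow> hatS x = lam V x / beta V"
  unfolding hatS_def by (rule Min_eqI) (auto simp: in_cone_def)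

lemma in_cone_facet_coord_nonneg:
  assumes "in_cone V x" "Z \<in> S" "Z \<noteq> V" shows "facet_coord V Z x \<ge> 0"
  using assms in_coneD[OF assms(1)] beta_pos[of Z] tau_pos[of V Z] unfolding facet_coord_eq[OF in_coneD(1)[OF assms(1)] assms(2)]
  by (intro mult_nonneg_nonneg) (auto simp: less_imp_le)

lemma sector_hatF:
  assumes "sector V U x" shows "hatF V x = facet_coord V U x"
proof -
  note s = sectorD[OF assms]
  have "Min ((\<lambda>U. facet_coord V U x) ` (S - {V})) = facet_coord V U x"
    by (rule Min_eqI) (use s in auto)
  then show ?thesis using in_cone_facet_coord_nonneg[OF s(1,3,4)] by (simp add: hatF_def)
qed

lemma hatF_other:
  assumes "in_cone V x" "V' \<in> S" "V' \<noteq> V" shows "hatF V' x = 0"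
proof -
  note c = in_coneD[OF assms(1)]
  have "Min ((\<lambda>U. facet_coord V' U x) ` (S - {V'})) \<le> facet_coord V' V x"
    using c(1) assms(3) by (intro Min_le) auto
  also have "\<dots> = beta V / tau V' V * (lam V x / beta V - lam V' x / beta V')"
    by (rule facet_coord_eq[OF assms(2) c(1)])
  also have "\<dots> \<le> 0"
    using c(2)[OF assms(2)] beta_pos[OF c(1)] tau_pos[OF assms(2) c(1)] assms(3)
    by (intro mult_nonneg_nonpos) (auto simp: less_imp_le)
  finally show ?thesis by (simp add: hatF_def)
qed

text \<open>On the sector \<open>(V, U)\<close>, these are the coordinates at the vertices \<open>Z\<close> of \<open>S\<close> in the representation of
  \<open>x\<close> as a convex combination of the vertices of the cell; the coordinates at \<open>WF V\<close> and \<open>W S\<close> are the values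
  of the hat functions.\<close>

definition coef :: "'a \<Rightarrow> 'a \<Rightarrow> 'a \<Rightarrow> real" where
  "coef V Z x = lam Z x - tau V Z * hatF V x - beta Z * hatS x"

lemma sum_coef: "(\<Sum>Z\<in>S. coef V Z x) = 1 - hatF V x - hatS x"
  by (simp add: coef_def sum_subtractf sum_lam sum_tau sum_beta flip: sum_distrib_right)

lemma coef_point: "(\<Sum>Z\<in>S. coef V Z x *\<^sub>R Z) + hatF V x *\<^sub>R WF V + hatS x *\<^sub>R W S = x"
proof -
  have "(\<Sum>Z\<in>S. coef V Z x *\<^sub>R Z) = (\<Sum>Z\<in>S. lam Z x *\<^sub>R Z) - hatF V x *\<^sub>R (\<Sum>Z\<in>S. tau V Z *\<^sub>R Z)
      - hatS x *\<^sub>R (\<Sum>Z\<in>S. beta Z *\<^sub>R Z)"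
    by (simp add: coef_def scaleR_left_diff_distrib sum_subtractf scaleR_sum_right mult.commute)
  then show ?thesis by (simp add: lam_point WS_point WF_point)
qed

lemma coef_sector:
  assumes "sector V U x"
  shows "coef V V x = 0" "coef V U x = 0" "Z \<in> S \<Longrightarrow> coef V Z x \<ge> 0"
proof -
  note s = sectorD[OF assms]
  note h = in_cone_hatS[OF s(1)] sector_hatF[OF assms]
  show z: "coef V V x = 0"
    using beta_pos[OF s(2)] tau_self[OF s(2)] by (simp add: coef_def h)
  show "coef V U x = 0"
    using beta_pos[OF s(2)] tau_pos[OF s(2,3,4)] by (simp add: coef_def h facet_coord_def)
  assume Z: "Z \<in> S"
  show "coef V Z x \<ge> 0"
  proof (cases "Z = V")
    case False
    have t: "tau V Z > 0" using tau_pos[OF s(2) Z False] .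
    have "tau V Z * facet_coord V U x \<le> tau V Z * facet_coord V Z x"
      using s(5)[OF Z False] t by (intro mult_left_mono) auto
    also have "\<dots> = lam Z x - beta Z / beta V * lam V x" using t by (simp add: facet_coord_def)
    finally show ?thesis by (simp add: coef_def h)
  qed (simp add: z)
qed

lemma hatF_nonneg: "hatF V x \<ge> 0"
  by (simp add: hatF_def)

lemma hatS_nonneg: "x \<in> D \<Longrightarrow> hatS x \<ge> 0"
  using ex_in_cone[of x] in_cone_hatS beta_pos in_coneD(1) by (metis mem_D divide_nonneg_pos)

definition cell :: "'a \<Rightarrow> 'a \<Rightarrow> 'a set" where
  "cell V U = insert (W S) (insert (WF V) (S - {V, U}))"

text \<open>The coefficients \<open>coef\<close>, \<open>hatF\<close> and \<open>hatS\<close> are nonnegative, sum to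
  \<open>1\<close>, and vanish at \<open>V\<close> and \<open>U\<close>.\<close>

lemma sector_in_cell:
  assumes "sector V U x" "x \<in> D"
  shows "x \<in> convex hull (cell V U)"
proof -
  note s = sectorD[OF assms(1)] and c = coef_sector[OF assms(1)]
  \<comment> \<open>The sum is indexed by a disjoint union of labels, so that it need not be known that the
    inpoints differ from the vertices and from each other.\<close>
  let ?I = "insert (Inr True) (insert (Inr False) (Inl ` (S - {V, U})))"
  let ?c = "case_sum (\<lambda>Z. coef V Z x) (\<lambda>b. if b then hatS x else hatF V x)"
  let ?p = "case_sum (\<lambda>Z. Z) (\<lambda>b. if b then W S else WF V)"
  have sub: "(\<Sum>Z\<in>S - {V, U}. coef V Z x) = (\<Sum>Z\<in>S. coef V Z x)"
    "(\<Sum>Z\<in>S - {V, U}. coef V Z x *\<^sub>R Z) = (\<Sum>Z\<in>S. coef V Z x *\<^sub>R Z)"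
    by (rule sum.mono_neutral_left; use c in auto)+
  have "(\<Sum>i\<in>?I. ?c i *\<^sub>R ?p i) \<in> convex hull (cell V U)"
  proof (rule convex_sum)
    have "sum ?c ?I = hatS x + (hatF V x + (\<Sum>Z\<in>S - {V, U}. coef V Z x))"
      by (simp add: sum.reindex inj_on_def image_iff)
    then show "sum ?c ?I = 1" by (simp add: sub sum_coef)
    fix i assume "i \<in> ?I"
    then show "?c i \<ge> 0" using c(3) hatF_nonneg hatS_nonneg[OF assms(2)] by auto
    show "?p i \<in> convex hull (cell V U)" using \<open>i \<in> ?I\<close> by (intro hull_inc) (auto simp: cell_def)
  qed (auto)
  also have "(\<Sum>i\<in>?I. ?c i *\<^sub>R ?p i) = hatS x *\<^sub>R W S + (hatF V x *\<^sub>R WF V + (\<Sum>Z\<in>S - {V, U}. coef V Z x *\<^sub>R Z))"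
    by (simp add: sum.reindex inj_on_def image_iff)
  also have "\<dots> = x" unfolding sub using coef_point[of V x] by (simp add: algebra_simps)
  finally show ?thesis .
qed

lemma convex_in_cone: "V \<in> S \<Longrightarrow> convex {x. in_cone V x}"
proof (rule convexI)
  fix x y and u v :: real
  assume *: "V \<in> S" "x \<in> {x. in_cone V x}" "y \<in> {x. in_cone V x}" "0 \<le> u" "0 \<le> v" "u + v = 1"
  have "lam V (u *\<^sub>R x + v *\<^sub>R y) / beta V \<le> lam Z (u *\<^sub>R x + v *\<^sub>R y) / beta Z" if Z: "Z \<in> S" for Z
  proof -
    have "u * (lam V x / beta V) + v * (lam V y / beta V) \<le> u * (lam Z x / beta Z) + v * (lam Z y / beta Z)"
      using * Z by (intro add_mono mult_left_mono) (auto simp: in_cone_def)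
    then show ?thesis using lam_affine_comb[OF *(1,6)] lam_affine_comb[OF Z *(6)] by (simp add: add_divide_distrib)
  qed
  then show "u *\<^sub>R x + v *\<^sub>R y \<in> {x. in_cone V x}" using *(1) by (simp add: in_cone_def)
qed

lemma facet_coord_comb:
  assumes "V \<in> S" "U \<in> S" "u + v = 1"
  shows "facet_coord V U (u *\<^sub>R x + v *\<^sub>R y) = u * facet_coord V U x + v * facet_coord V U y"
  unfolding facet_coord_def lam_affine_comb[OF assms(1,3)] lam_affine_comb[OF assms(2,3)]
  by (simp add: divide_simps) (simp add: algebra_simps)

lemma convex_sector:
  assumes "V \<in> S" "U \<in> S" shows "convex {x. sector V U x}"
proof (rule convexI)
  fix x y and u v :: real
  assume *: "x \<in> {x. sector V U x}" "y \<in> {x. sector V U x}" "0 \<le> u" "0 \<le> v" "u + v = 1"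
  have "u *\<^sub>R x + v *\<^sub>R y \<in> {x. in_cone V x}"
    using * by (intro convexD[OF convex_in_cone[OF assms(1)]]) (auto simp: sector_def)
  moreover have "facet_coord V U (u *\<^sub>R x + v *\<^sub>R y) \<le> facet_coord V Z (u *\<^sub>R x + v *\<^sub>R y)" if Z: "Z \<in> S - {V}" for Z
  proof -
    have "u * facet_coord V U x + v * facet_coord V U y \<le> u * facet_coord V Z x + v * facet_coord V Z y"
      using * Z by (intro add_mono mult_left_mono) (auto simp: sector_def)
    then show ?thesis using Z assms by (simp add: facet_coord_comb[OF _ _ *(5)])
  qed
  ultimately show "u *\<^sub>R x + v *\<^sub>R y \<in> {x. sector V U x}" using * by (simp add: sector_def)
qed

lemma in_cone_WS:
  assumes "V \<in> S" shows "in_cone V (W S)"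
proof -
  have eq: "lam Z (W S) / beta Z = 1" if "Z \<in> S" for Z
    using beta_pos[OF that] by (simp add: beta_def[symmetric])
  have "lam V (W S) / beta V \<le> lam Z (W S) / beta Z" if "Z \<in> S" for Z
    unfolding eq[OF assms] eq[OF that] by (rule order_refl)
  then show ?thesis using assms unfolding in_cone_def by blast
qed

lemma in_cone_facet:
  assumes "V \<in> S" "x \<in> D" "lam V x = 0" shows "in_cone V x"
  using assms beta_pos by (auto simp: in_cone_def mem_D intro!: divide_nonneg_pos)

lemma in_cone_hull:
  assumes "V \<in> S" "x \<in> convex hull (insert (W S) (S - {V}))" shows "in_cone V x"
proof -
  have "convex hull (insert (W S) (S - {V})) \<subseteq> {x. in_cone V x}"
  proof (rule hull_minimal)
    have "in_cone V Z" if "Z \<in> S - {V}" for Z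
      by (rule in_cone_facet) (use that assms(1) in \<open>auto simp: vertex_in_D lam_vertex\<close>)
    then show "insert (W S) (S - {V}) \<subseteq> {x. in_cone V x}"
      using in_cone_WS[OF assms(1)] by auto
    show "convex {x. in_cone V x}" by (rule convex_in_cone[OF assms(1)])
  qed
  then show ?thesis using assms(2) by auto
qed

text \<open>A sector is convex, so it suffices to look at the vertices of the cell.\<close>

lemma sector_hull:
  assumes "V \<in> S" "U \<in> S" "U \<noteq> V" "x \<in> convex hull (cell V U)" shows "sector V U x"
proof -
  have vs: "sector V U Z" if "Z \<in> S - {V, U}" for Z
  proof -
    have "in_cone V Z" using that assms(1) by (intro in_cone_facet) (auto simp: vertex_in_D lam_vertex)
    moreover have "facet_coord V U Z = 0" using that assms by (simp add: facet_coord_def lam_vertex)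
    ultimately show ?thesis using in_cone_facet_coord_nonneg[of V Z] assms by (auto simp: sector_def)
  qed
  have "facet_coord V Z (W S) = 0" if "Z \<in> S" for Z
    using that assms(1) beta_pos[of V] by (simp add: facet_coord_def beta_def[symmetric])
  then have ws: "sector V U (W S)" using assms in_cone_WS by (auto simp: sector_def)
  have "facet_coord V Z (WF V) = 1" if "Z \<in> S - {V}" for Z
    using that assms(1) tau_pos[of V Z] tau_self by (simp add: facet_coord_def tau_def[symmetric])
  then have wf: "sector V U (WF V)" using assms WF_in_D in_cone_facet[of V "WF V"] tau_self[of V]
    by (auto simp: sector_def tau_def[symmetric])
  have "convex hull (cell V U) \<subseteq> {x. sector V U x}"
  proof (rule hull_minimal)
    show "cell V U \<subseteq> {x. sector V U x}" using vs ws wf by (auto simp: cell_def)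
    show "convex {x. sector V U x}" by (rule convex_sector[OF assms(1,2)])
  qed
  then show ?thesis using assms(4) by auto
qed

lemma cell_subset_D: "V \<in> S \<Longrightarrow> convex hull (cell V U) \<subseteq> D"
  by (rule hull_minimal) (auto simp: cell_def WS_in_D WF_in_D vertex_in_D convex_convex_hull)

lemma WF_in_facet: "V \<in> S \<Longrightarrow> WF V \<in> convex hull (S - {V})"
  using WF_rel rel_interior_subset by blast

lemma cell_subset_cone:
  assumes "V \<in> S" shows "convex hull (cell V U) \<subseteq> convex hull (insert (W S) (S - {V}))"
proof (rule hull_minimal)
  have "convex hull (S - {V}) \<subseteq> convex hull (insert (W S) (S - {V}))" by (rule hull_mono) auto
  then have "WF V \<in> convex hull (insert (W S) (S - {V}))"
    using WF_in_facet[OF assms] by blast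
  then show "cell V U \<subseteq> convex hull (insert (W S) (S - {V}))"
    unfolding cell_def by (auto intro: hull_inc)
qed (rule convex_convex_hull)

lemma cone_subset_D: "convex hull (insert (W S) (S - {V})) \<subseteq> D"
  by (rule hull_minimal) (auto simp: WS_in_D vertex_in_D convex_convex_hull)

lemma hatS_facet: "V \<in> S \<Longrightarrow> x \<in> D \<Longrightarrow> lam V x = 0 \<Longrightarrow> hatS x = 0"
  using in_cone_hatS[OF in_cone_facet] by simp

lemma hatF_facet_other: "V \<in> S \<Longrightarrow> x \<in> D \<Longrightarrow> lam V x = 0 \<Longrightarrow> Z \<in> S \<Longrightarrow> Z \<noteq> V \<Longrightarrow> hatF Z x = 0"
  using hatF_other[OF in_cone_facet] by simp

lemma hatF_facet_pos:
  assumes "V \<in> S" "lam V x = 0" "\<And>U. U \<in> S \<Longrightarrow> U \<noteq> V \<Longrightarrow> lam U x > 0"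
  shows "hatF V x > 0"
proof -
  have "0 < Min ((\<lambda>U. facet_coord V U x) ` (S - {V}))"
    using facet_ne[OF assms(1)] assms tau_pos[OF assms(1)] by (subst Min_gr_iff) (auto simp: facet_coord_def)
  then show ?thesis by (simp add: hatF_def)
qed

lemma hatS_pos: "x \<in> interior D \<Longrightarrow> hatS x > 0"
  using ex_in_cone[of x] in_cone_hatS beta_pos in_coneD(1) by (metis mem_interior_D divide_pos_pos)

lemma hatS_vertex:
  assumes "Z \<in> S" shows "hatS Z = 0"
proof -
  obtain V where "V \<in> S" "V \<noteq> Z" using facet_ne[OF assms] by auto
  then show ?thesis using assms by (intro hatS_facet[of V]) (auto simp: vertex_in_D lam_vertex)
qed

text \<open>Because \<open>n \<ge> 2\<close>, the vertex \<open>Z\<close> lies on a facet other than the one opposite to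
  \<open>V\<close>, and \<open>hatF V\<close> vanishes there.\<close>

lemma hatF_vertex:
  assumes "Z \<in> S" "V \<in> S" shows "hatF V Z = 0"
proof -
  obtain U where U: "U \<in> S" "U \<noteq> V" "U \<noteq> Z"
  proof (cases "Z = V")
    case True then show ?thesis using facet_ne[OF assms(2)] that by auto
  next
    case False then show ?thesis using ridge_ne[OF assms(2,1)] that by auto
  qed
  then show ?thesis using assms by (intro hatF_facet_other[of U]) (auto simp: vertex_in_D lam_vertex)
qed

section \<open>Differentiability of the hat functions almost everywhere\<close>

lemma loclip_lam_scaled: "V \<in> S \<Longrightarrow> loclip (\<lambda>x. c * lam V x)"
  by (rule loclip_mult[OF loclip_const loclip_lam])

lemma loclip_hatS: "loclip hatS"
  unfolding hatS_def[abs_def]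
proof (rule loclip_Min[OF finite_S S_ne])
  fix V assume "V \<in> S"
  then show "loclip (\<lambda>x. lam V x / beta V)"
    using loclip_lam_scaled[of V "1 / beta V"] by simp
qed

lemma facet_coord_expand: "facet_coord V U x = (1 / tau V U) * lam U x + (- beta U / beta V / tau V U) * lam V x"
  by (simp add: facet_coord_def diff_divide_distrib)

lemma loclip_hatF:
  assumes "V \<in> S" shows "loclip (hatF V)"
  unfolding hatF_def[abs_def]
proof (rule loclip_pos_part, rule loclip_Min)
  fix U assume "U \<in> S - {V}"
  then show "loclip (facet_coord V U)"
    unfolding facet_coord_expand[abs_def] using assms by (intro loclip_add loclip_lam_scaled) auto
qed (use facet_ne[OF assms] in auto)

text \<open>The interior of a sector, where all minima in the definition of the hat functions are attained only once. The
  open sectors are disjoint and cover almost everything.\<close>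

definition open_sector :: "'a \<times> 'a \<Rightarrow> 'a set" where
  "open_sector p = {x. (\<forall>Z\<in>S - {fst p}. lam (fst p) x / beta (fst p) < lam Z x / beta Z) \<and>
     (\<forall>Z\<in>S - {fst p, snd p}. facet_coord (fst p) (snd p) x < facet_coord (fst p) Z x)}"

definition pairs :: "('a \<times> 'a) set" where
  "pairs = {p \<in> S \<times> S. fst p \<noteq> snd p}"

lemma finite_pairs [simp]: "finite pairs"
  unfolding pairs_def by (rule finite_subset[of _ "S \<times> S"]) auto

lemma open_sector_sector: "p \<in> pairs \<Longrightarrow> x \<in> open_sector p \<Longrightarrow> sector (fst p) (snd p) x"
  by (auto simp: pairs_def open_sector_def sector_def in_cone_def less_imp_le)
     (metis Diff_iff empty_iff insert_iff less_eq_real_def)+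

lemma open_sector_disjoint:
  assumes "p \<in> pairs" "p' \<in> pairs" "x \<in> open_sector p" "x \<in> open_sector p'" shows "p = p'"
proof -
  obtain V U V' U' where p: "p = (V, U)" "p' = (V', U')" by (metis prod.collapse)
  have "V = V'"
  proof (rule ccontr)
    assume "V \<noteq> V'"
    then have "lam V x / beta V < lam V' x / beta V'" "lam V' x / beta V' < lam V x / beta V"
      using assms p by (auto simp: open_sector_def pairs_def)
    then show False by simp
  qed
  moreover have "U = U'"
  proof (rule ccontr)
    assume "U \<noteq> U'"
    then have "facet_coord V U x < facet_coord V U' x" "facet_coord V U' x < facet_coord V U x"
      using assms p \<open>V = V'\<close> by (auto simp: open_sector_def pairs_def)
    then show False by simp
  qed
  ultimately show ?thesis using p by simp
qed

lemma continuous_facet_coord: "V \<in> S \<Longrightarrow> U \<in> S \<Longrightarrow> continuous_on A (facet_coord V U)"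
  unfolding facet_coord_expand[abs_def] by (intro continuous_intros continuous_lam)

lemma open_open_sector:
  assumes "p \<in> pairs" shows "open (open_sector p)"
proof -
  have "open_sector p = (\<Inter>Z\<in>S - {fst p}. {x. lam (fst p) x / beta (fst p) < lam Z x / beta Z}) \<inter>
     (\<Inter>Z\<in>S - {fst p, snd p}. {x. facet_coord (fst p) (snd p) x < facet_coord (fst p) Z x})"
    by (auto simp: open_sector_def)
  moreover have "open \<dots>"
    using assms beta_pos by (intro open_Int open_INT ballI open_Collect_less continuous_intros continuous_lam continuous_facet_coord)
      (force simp: pairs_def)+
  ultimately show ?thesis by simp
qed

text \<open>A point outside all open sectors lies on one of finitely many hyperplanes, on which two of the competing
  affine functions agree.\<close>

lemma AE_open_sector: "AE x in lborel. \<exists>p\<in>pairs. x \<in> open_sector p"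
proof -
  have 1: "AE x in lborel. lam V x / beta V \<noteq> lam Z x / beta Z" if "V \<in> S" "Z \<in> S" "V \<noteq> Z" for V Z
  proof -
    let ?g = "\<lambda>d. (1 / beta V) * grad V d - (1 / beta Z) * grad Z d"
    have lin: "linear ?g"
      using linear_compose_sub[OF linear_compose_scale_right[OF linear_grad[OF that(1)]]
          linear_compose_scale_right[OF linear_grad[OF that(2)]], of "1 / beta V" "1 / beta Z"] by simp
    \<comment> \<open>The difference of the two functions increases in the direction V - Z, so it is not constant.\<close>
    have "?g (V - Z) = 1 / beta V + 1 / beta Z"
      using that by (simp add: grad_diff lam_vertex)
    also have "\<dots> \<noteq> 0" using beta_pos[OF that(1)] beta_pos[OF that(2)] by (smt (verit) divide_pos_pos)
    finally have "AE x in lborel. ?g x \<noteq> lam Z 0 / beta Z - lam V 0 / beta V"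
      by (rule AE_linear_ne[OF lin])
    then show ?thesis
    proof eventually_elim
      case (elim x)
      then show ?case by (simp add: grad_def diff_divide_distrib)
    qed
  qed
  have 2: "AE x in lborel. facet_coord V U x \<noteq> facet_coord V Z x" if "V \<in> S" "U \<in> S" "Z \<in> S" "U \<noteq> V" "Z \<noteq> V" "U \<noteq> Z" for V U Z
  proof -
    have taus: "tau V U > 0" "tau V Z > 0" using that by (auto intro: tau_pos)
    let ?k = "- beta U / beta V / tau V U + beta Z / beta V / tau V Z"
    let ?g = "\<lambda>d. ((1 / tau V U) * grad U d - (1 / tau V Z) * grad Z d) + ?k * grad V d"
    have lin: "linear ?g"
      using linear_compose_add[OF linear_compose_sub[OF linear_compose_scale_right[OF linear_grad[OF that(2)]]
          linear_compose_scale_right[OF linear_grad[OF that(3)]]] linear_compose_scale_right[OF linear_grad[OF that(1)]],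
          of "1 / tau V U" "1 / tau V Z" ?k] by simp
    have "?g (U - Z) = 1 / tau V U + 1 / tau V Z"
      using that by (simp add: grad_diff lam_vertex)
    also have "\<dots> \<noteq> 0" using taus by (smt (verit) divide_pos_pos)
    finally have "AE x in lborel. ?g x \<noteq> facet_coord V Z 0 - facet_coord V U 0"
      by (rule AE_linear_ne[OF lin])
    then show ?thesis
    proof eventually_elim
      case (elim x)
      have "facet_coord V U x - facet_coord V U 0 - (facet_coord V Z x - facet_coord V Z 0) = ?g x"
        unfolding facet_coord_expand grad_def by (simp add: algebra_simps diff_divide_distrib)
      then show ?case using elim by auto
    qed
  qed
  have "AE x in lborel. \<forall>V\<in>S. \<forall>Z\<in>S - {V}. lam V x / beta V \<noteq> lam Z x / beta Z"
    using 1 by (auto simp: AE_ball_countable countable_finite)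
  moreover have "AE x in lborel. \<forall>V\<in>S. \<forall>U\<in>S - {V}. \<forall>Z\<in>S - {V, U}. facet_coord V U x \<noteq> facet_coord V Z x"
    using 2 by (auto simp: AE_ball_countable countable_finite)
  ultimately show ?thesis
  proof eventually_elim
    case (elim x)
    obtain V U where "sector V U x" using ex_sector by blast
    note s = this sectorD[OF this]
    have "x \<in> open_sector (V, U)"
      unfolding open_sector_def mem_Collect_eq fst_conv snd_conv
    proof (intro conjI ballI)
      fix Z assume "Z \<in> S - {V}"
      then show "lam V x / beta V < lam Z x / beta Z"
        using in_coneD(2)[OF s(2), of Z] elim(1) s(3) by (simp add: order_less_le)
    next
      fix Z assume "Z \<in> S - {V, U}"
      then show "facet_coord V U x < facet_coord V Z x"
        using s(6)[of Z] elim(2) s(3,4,5) by (simp add: order_less_le)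
    qed
    then show ?case using s by (intro bexI[of _ "(V, U)"]) (auto simp: pairs_def)
  qed
qed

lemma open_sector_sum:
  assumes "p \<in> pairs" "x \<in> open_sector p"
  shows "(\<Sum>q\<in>pairs. indicator (open_sector q) x * h q) = (h p :: real)"
proof -
  have "indicator (open_sector q) x * h q = 0" if "q \<in> pairs - {p}" for q
    using open_sector_disjoint[of q p x] that assms by (auto simp: indicator_def)
  then have "(\<Sum>q\<in>pairs - {p}. indicator (open_sector q) x * h q) = 0"
    by (rule sum.neutral[OF ballI])
  then show ?thesis using assms by (simp add: sum.remove[OF finite_pairs assms(1)])
qed

lemma wderiv_piecewise:
  assumes lip: "loclip f"
    and g: "\<And>p. p \<in> pairs \<Longrightarrow> linear (g p)"
    and f: "\<And>p x. p \<in> pairs \<Longrightarrow> x \<in> open_sector p \<Longrightarrow> f x = c p + g p x"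
  shows "wderiv f (\<lambda>x d. \<Sum>p\<in>pairs. indicator (open_sector p) x * g p d)"
  unfolding wderiv_def
proof (intro conjI allI lip)
  show "(\<lambda>x. \<Sum>p\<in>pairs. indicator (open_sector p) x * g p v) \<in> borel_measurable borel" for v
    using open_open_sector by (intro borel_measurable_sum borel_measurable_times borel_measurable_indicator) auto
  show "AE x in lborel. (f has_derivative (\<lambda>d. \<Sum>p\<in>pairs. indicator (open_sector p) x * g p d)) (at x)"
    using AE_open_sector
  proof eventually_elim
    case (elim x)
    then obtain p where p: "p \<in> pairs" "x \<in> open_sector p" by blast
    have "(\<Sum>q\<in>pairs. indicator (open_sector q) x * g q d) = g p d" for d
      by (rule open_sector_sum[OF p])
    moreover have "((\<lambda>x. c p + g p x) has_derivative g p) (at x)"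
      using has_derivative_add[OF has_derivative_const linear_imp_has_derivative[OF g[OF p(1)]]] by simp
    then have "(f has_derivative g p) (at x)"
      by (rule has_derivative_transform_within_open[OF _ open_open_sector[OF p(1)] p(2)])
         (simp add: f[OF p(1)])
    ultimately show ?case by simp
  qed
qed

definition facet_coord_grad :: "'a \<Rightarrow> 'a \<Rightarrow> 'a \<Rightarrow> real" where
  "facet_coord_grad V U d = (grad U d - beta U / beta V * grad V d) / tau V U"

text \<open>The derivatives on the open sectors, and zero on the null set outside.\<close>

definition hatS' :: "'a \<Rightarrow> 'a \<Rightarrow> real" where
  "hatS' x d = (\<Sum>p\<in>pairs. indicator (open_sector p) x * ((1 / beta (fst p)) * grad (fst p) d))"

definition hatF' :: "'a \<Rightarrow> 'a \<Rightarrow> 'a \<Rightarrow> real" where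
  "hatF' V x d = (\<Sum>p\<in>pairs. indicator (open_sector p) x * (if fst p = V then facet_coord_grad V (snd p) d else 0))"

lemma linear_facet_coord_grad:
  assumes "V \<in> S" "U \<in> S" shows "linear (facet_coord_grad V U)"
proof -
  have "linear (\<lambda>d. (1 / tau V U) * grad U d - (beta U / beta V / tau V U) * grad V d)"
    using linear_compose_sub[OF linear_compose_scale_right[OF linear_grad[OF assms(2)]]
          linear_compose_scale_right[OF linear_grad[OF assms(1)]], of "1 / tau V U" "beta U / beta V / tau V U"] by simp
  then show ?thesis by (simp add: facet_coord_grad_def[abs_def] diff_divide_distrib)
qed

lemma wderiv_hatS: "wderiv hatS hatS'"
  unfolding hatS'_def[abs_def]
proof (rule wderiv_piecewise[OF loclip_hatS, where c="\<lambda>p. lam (fst p) 0 / beta (fst p)"])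
  fix p assume p: "p \<in> pairs"
  then have V: "fst p \<in> S" by (auto simp: pairs_def)
  show "linear (\<lambda>d. (1 / beta (fst p)) * grad (fst p) d)"
    using linear_compose_scale_right[OF linear_grad[OF V], of "1 / beta (fst p)"] by simp
  fix x assume "x \<in> open_sector p"
  then have "hatS x = lam (fst p) x / beta (fst p)"
    using in_cone_hatS[OF sectorD(1)[OF open_sector_sector[OF p]]] by simp
  then show "hatS x = lam (fst p) 0 / beta (fst p) + (1 / beta (fst p)) * grad (fst p) x"
    using lam_eq[OF V, of x] by (simp add: add_divide_distrib)
qed

lemma wderiv_hatF:
  assumes "V \<in> S" shows "wderiv (hatF V) (hatF' V)"
  unfolding hatF'_def[abs_def]
proof (rule wderiv_piecewise[OF loclip_hatF[OF assms], where c="\<lambda>p. if fst p = V then facet_coord V (snd p) 0 else 0"])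
  fix p assume p: "p \<in> pairs"
  then have VU: "fst p \<in> S" "snd p \<in> S" by (auto simp: pairs_def)
  show "linear (\<lambda>d. if fst p = V then facet_coord_grad V (snd p) d else 0)"
    using linear_facet_coord_grad[OF assms VU(2)] by (cases "fst p = V") (auto simp: linear_zero)
  fix x assume "x \<in> open_sector p"
  then have s: "sector (fst p) (snd p) x" by (rule open_sector_sector[OF p])
  have "facet_coord V (snd p) x = facet_coord V (snd p) 0 + facet_coord_grad V (snd p) x"
    unfolding facet_coord_expand facet_coord_grad_def grad_def by (simp add: algebra_simps diff_divide_distrib add_divide_distrib)
  then show "hatF V x = (if fst p = V then facet_coord V (snd p) 0 else 0) + (if fst p = V then facet_coord_grad V (snd p) x else 0)"
    using sector_hatF[OF s] hatF_other[OF sectorD(1)[OF s] assms] by auto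
qed

end

section \<open>Integration in coordinates\<close>

abbreviation coordM :: "nat \<Rightarrow> (nat \<Rightarrow> real) measure" where
  "coordM k \<equiv> PiM {..<k} (\<lambda>_. lborel)"

interpretation coord: product_sigma_finite "\<lambda>_::nat. lborel :: real measure"
  by standard

lemma sigma_finite_coordM: "sigma_finite_measure (coordM k)"
  by (rule coord.sigma_finite) simp

text \<open>The domain of integration of \<open>face_integral\<close>. No condition is placed on the coordinates with
  index at least \<open>k\<close>; this makes the set usable with \<open>coordM j\<close> for every
  \<open>j \<ge> k\<close>.\<close>

definition std_simplex :: "nat \<Rightarrow> (nat \<Rightarrow> real) set" where
  "std_simplex k = {t. (\<forall>i<k. 0 \<le> t i) \<and> (\<Sum>i<k. t i) \<le> 1}"

definition open_std_simplex :: "nat \<Rightarrow> (nat \<Rightarrow> real) set" where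
  "open_std_simplex k = {t. (\<forall>i<k. 0 < t i) \<and> (\<Sum>i<k. t i) < 1}"

definition chart :: "nat \<Rightarrow> 'a::real_vector list \<Rightarrow> (nat \<Rightarrow> real) \<Rightarrow> 'a" where
  "chart k vs t = vs ! 0 + (\<Sum>i<k. t i *\<^sub>R (vs ! (i + 1) - vs ! 0))"

definition edges :: "nat \<Rightarrow> 'a::real_vector list \<Rightarrow> 'a list" where
  "edges k vs = map (\<lambda>i. vs ! (i + 1) - vs ! 0) [0..<k]"

lemma face_integral_eq: "face_integral k u vs = (LINT t:std_simplex k|coordM k. u (chart k vs t) (edges k vs))"
  by (simp add: face_integral_def std_simplex_def chart_def edges_def)

lemma indicator_std_simplex_measurable [measurable]: "(\<lambda>t. indicator (std_simplex k) t :: real) \<in> borel_measurable (coordM k)"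
proof -
  have "(\<lambda>t. indicator (std_simplex k) t :: real) = (\<lambda>t. if (\<forall>i\<in>{..<k}. 0 \<le> t i) \<and> (\<Sum>i<k. t i) \<le> 1 then 1 else 0)"
    by (auto simp: std_simplex_def indicator_def fun_eq_iff)
  also have "\<dots> \<in> borel_measurable (coordM k)" by measurable
  finally show ?thesis .
qed

lemma chart_measurable [measurable]:
  fixes vs :: "'a::euclidean_space list"
  shows "chart k vs \<in> borel_measurable (coordM k)"
  unfolding chart_def[abs_def] by measurable

lemma coordM_box:
  assumes "\<And>i. i < k \<Longrightarrow> A i \<in> sets borel"
  shows "emeasure (coordM k) (Pi\<^sub>E {..<k} A) = (\<Prod>i<k. emeasure lborel (A i))"
  by (rule coord.emeasure_PiM) (use assms in auto)

lemma coordM_translate: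
  "distr (coordM k) (coordM k) (\<lambda>t. \<lambda>i\<in>{..<k}. s i + t i) = coordM k"
proof (rule coord.PiM_eqI)
  fix A :: "nat \<Rightarrow> real set" assume A: "\<And>i. i \<in> {..<k} \<Longrightarrow> A i \<in> sets lborel"
  have m: "(\<lambda>t. \<lambda>i\<in>{..<k}. s i + t i) \<in> measurable (coordM k) (coordM k)" by measurable
  have "emeasure (distr (coordM k) (coordM k) (\<lambda>t. \<lambda>i\<in>{..<k}. s i + t i)) (Pi\<^sub>E {..<k} A) =
      emeasure (coordM k) ((\<lambda>t. \<lambda>i\<in>{..<k}. s i + t i) -` Pi\<^sub>E {..<k} A \<inter> space (coordM k))"
    using A by (intro emeasure_distr[OF m] sets_PiM_I_finite) auto
  also have "(\<lambda>t. \<lambda>i\<in>{..<k}. s i + t i) -` Pi\<^sub>E {..<k} A \<inter> space (coordM k) = Pi\<^sub>E {..<k} (\<lambda>i. (+) (s i) -` A i)"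
    by (auto simp: space_PiM PiE_iff)
  also have "emeasure (coordM k) \<dots> = (\<Prod>i<k. emeasure lborel ((+) (s i) -` A i))"
    using A by (intro coordM_box) (auto intro!: measurable_sets_borel[of "(+) _" borel])
  also have "\<dots> = (\<Prod>i<k. emeasure lborel (A i))"
  proof (intro prod.cong refl)
    fix i assume "i \<in> {..<k}"
    then have "emeasure (distr lborel borel ((+) (s i))) (A i) = emeasure lborel ((+) (s i) -` A i)"
      using A by (subst emeasure_distr) auto
    then show "emeasure lborel ((+) (s i) -` A i) = emeasure lborel (A i)" by (simp add: lborel_distr_plus)
  qed
  finally show "emeasure (distr (coordM k) (coordM k) (\<lambda>t. \<lambda>i\<in>{..<k}. s i + t i)) (Pi\<^sub>E {..<k} A) =
     (\<Prod>i\<in>{..<k}. emeasure lborel (A i))" .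
qed auto

lemma nn_integral_coordM_translate:
  fixes e :: "nat \<Rightarrow> 'a::euclidean_space" and h :: "'a \<Rightarrow> ennreal"
  assumes h [measurable]: "h \<in> borel_measurable borel"
  shows "(\<integral>\<^sup>+t. h ((\<Sum>i<k. s i *\<^sub>R e i) + (\<Sum>i<k. t i *\<^sub>R e i)) \<partial>coordM k) = (\<integral>\<^sup>+t. h (\<Sum>i<k. t i *\<^sub>R e i) \<partial>coordM k)"
proof -
  have m: "(\<lambda>t. \<lambda>i\<in>{..<k}. s i + t i) \<in> measurable (coordM k) (coordM k)" by measurable
  have hm: "(\<lambda>t. h (\<Sum>i<k. t i *\<^sub>R e i)) \<in> borel_measurable (coordM k)" by measurable
  have "(\<integral>\<^sup>+t. h (\<Sum>i<k. t i *\<^sub>R e i) \<partial>coordM k) =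
     (\<integral>\<^sup>+t. h (\<Sum>i<k. t i *\<^sub>R e i) \<partial>distr (coordM k) (coordM k) (\<lambda>t. \<lambda>i\<in>{..<k}. s i + t i))"
    by (simp add: coordM_translate)
  also have "\<dots> = (\<integral>\<^sup>+t. h (\<Sum>i<k. (\<lambda>i\<in>{..<k}. s i + t i) i *\<^sub>R e i) \<partial>coordM k)"
    using nn_integral_distr[OF m, of "\<lambda>t. h (\<Sum>i<k. t i *\<^sub>R e i)"] hm by simp
  also have "\<dots> = (\<integral>\<^sup>+t. h ((\<Sum>i<k. s i *\<^sub>R e i) + (\<Sum>i<k. t i *\<^sub>R e i)) \<partial>coordM k)"
    by (simp add: scaleR_left_distrib sum.distrib)
  finally show ?thesis by simp
qed

lemma nn_integral_lborel_translate:
  fixes h :: "'a::euclidean_space \<Rightarrow> ennreal"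
  assumes [measurable]: "h \<in> borel_measurable borel"
  shows "(\<integral>\<^sup>+x. h (c + x) \<partial>lborel) = (\<integral>\<^sup>+x. h x \<partial>lborel)"
  by (subst (2) lborel_distr_plus[of c, symmetric]) (rule nn_integral_distr[symmetric]; simp)

text \<open>The usual proof that a translation invariant measure is unique: integrate \<open>f (y + L t) g y\<close> over both
  variables, where \<open>L\<close> is the linear parametrisation. Invariance in \<open>t\<close> gives the left hand side; the substitution
  \<open>y \<mapsto> y - L t\<close> and then invariance in \<open>t\<close> again give the right hand side. So changes of variables need no determinant formula.\<close>

lemma coordM_haar:
  fixes e :: "nat \<Rightarrow> 'a::euclidean_space" and f g :: "'a \<Rightarrow> ennreal"
  assumes surj: "\<And>a. \<exists>s. (\<Sum>i<k. s i *\<^sub>R e i) = a"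
    and f [measurable]: "f \<in> borel_measurable borel" and g [measurable]: "g \<in> borel_measurable borel"
  shows "(\<integral>\<^sup>+t. f (\<Sum>i<k. t i *\<^sub>R e i) \<partial>coordM k) * (\<integral>\<^sup>+y. g y \<partial>lborel) =
    (\<integral>\<^sup>+y. f y \<partial>lborel) * (\<integral>\<^sup>+t. g (- (\<Sum>i<k. t i *\<^sub>R e i)) \<partial>coordM k)"
proof -
  interpret P: sigma_finite_measure "coordM k" by (rule sigma_finite_coordM)
  \<comment> \<open>Both measures are sigma-finite, so the order of integration can be exchanged.\<close>
  interpret PL: pair_sigma_finite "coordM k" lborel ..
  define L where "L t = (\<Sum>i<k. t i *\<^sub>R e i)" for t :: "nat \<Rightarrow> real"
  have L [measurable]: "L \<in> borel_measurable (coordM k)"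
    unfolding L_def[abs_def] by measurable
  have tr: "(\<integral>\<^sup>+t. h (a + L t) \<partial>coordM k) = (\<integral>\<^sup>+t. h (L t) \<partial>coordM k)" if [measurable]: "h \<in> borel_measurable borel" for h :: "'a \<Rightarrow> ennreal" and a
  proof -
    obtain s where "(\<Sum>i<k. s i *\<^sub>R e i) = a" using surj by blast
    then show ?thesis using nn_integral_coordM_translate[OF that, where e=e and s=s and k=k] by (simp add: L_def)
  qed
  have "(\<integral>\<^sup>+t. f (L t) \<partial>coordM k) * (\<integral>\<^sup>+y. g y \<partial>lborel) = (\<integral>\<^sup>+y. (\<integral>\<^sup>+t. f (L t) \<partial>coordM k) * g y \<partial>lborel)"
    by (rule nn_integral_cmult[symmetric]) simp
  also have "\<dots> = (\<integral>\<^sup>+y. (\<integral>\<^sup>+t. f (y + L t) * g y \<partial>coordM k) \<partial>lborel)"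
    by (intro nn_integral_cong) (simp add: tr nn_integral_multc)
  also have "\<dots> = (\<integral>\<^sup>+t. (\<integral>\<^sup>+y. f (y + L t) * g y \<partial>lborel) \<partial>coordM k)"
    by (rule PL.Fubini') measurable
  also have "\<dots> = (\<integral>\<^sup>+t. (\<integral>\<^sup>+y. f y * g (- L t + y) \<partial>lborel) \<partial>coordM k)"
  proof (rule nn_integral_cong)
    fix t
    show "(\<integral>\<^sup>+y. f (y + L t) * g y \<partial>lborel) = (\<integral>\<^sup>+y. f y * g (- L t + y) \<partial>lborel)"
      using nn_integral_lborel_translate[of "\<lambda>y. f y * g (- L t + y)" "L t"] by (simp add: add.commute)
  qed
  also have "\<dots> = (\<integral>\<^sup>+y. (\<integral>\<^sup>+t. f y * g (- L t + y) \<partial>coordM k) \<partial>lborel)"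
    by (rule PL.Fubini'[symmetric]) measurable
  also have "\<dots> = (\<integral>\<^sup>+y. f y * (\<integral>\<^sup>+t. g (- L t) \<partial>coordM k) \<partial>lborel)"
  proof (rule nn_integral_cong)
    fix y
    have "(\<integral>\<^sup>+t. g (- L t + y) \<partial>coordM k) = (\<integral>\<^sup>+t. g (- L t) \<partial>coordM k)"
      using tr[of "\<lambda>x. g (- x)" "- y"] by (simp add: add.commute)
    then show "(\<integral>\<^sup>+t. f y * g (- L t + y) \<partial>coordM k) = f y * (\<integral>\<^sup>+t. g (- L t) \<partial>coordM k)"
      by (subst nn_integral_cmult) simp_all
  qed
  also have "\<dots> = (\<integral>\<^sup>+y. f y \<partial>lborel) * (\<integral>\<^sup>+t. g (- L t) \<partial>coordM k)"
    by (rule nn_integral_multc) simp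
  finally show ?thesis by (simp add: L_def)
qed

text \<open>A box of positive measure inside the open standard simplex; any such box would do.\<close>

lemma std_simplex_box_subset: "k > 0 \<Longrightarrow> Pi\<^sub>E {..<k} (\<lambda>_. {1 / (4 * real k)..1 / (2 * real k)}) \<subseteq> open_std_simplex k"
proof
  fix t assume k: "k > 0" and t: "t \<in> Pi\<^sub>E {..<k} (\<lambda>_. {1 / (4 * real k)..1 / (2 * real k)})"
  have "(\<Sum>i<k. t i) \<le> (\<Sum>i<k. 1 / (2 * real k))"
    using t by (intro sum_mono) (auto simp: PiE_iff)
  also have "\<dots> < 1" using k by simp
  finally have "(\<Sum>i<k. t i) < 1" .
  moreover have "0 < t i" if "i < k" for i
  proof -
    have "1 / (4 * real k) \<le> t i" using t that by (auto simp: PiE_iff)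
    moreover have "1 / (4 * real k) > 0" using k by simp
    ultimately show ?thesis by linarith
  qed
  ultimately show "t \<in> open_std_simplex k" by (simp add: open_std_simplex_def)
qed

lemma std_simplex_box_pos:
  assumes k: "k > 0"
  shows "emeasure (coordM k) (Pi\<^sub>E {..<k} (\<lambda>_. {1 / (4 * real k)..1 / (2 * real k)})) > 0"
proof -
  define a where "a = 1 / (4 * real k)"
  define b where "b = 1 / (2 * real k)"
  have "a < b" using k by (simp add: a_def b_def field_simps)
  then have "emeasure lborel {a..b} \<noteq> 0" by simp
  then have "emeasure (coordM k) (Pi\<^sub>E {..<k} (\<lambda>_. {a..b})) \<noteq> 0"
    by (subst coordM_box) simp_all
  then show ?thesis unfolding zero_less_iff_neq_zero a_def b_def .
qed

lemma std_simplex_bounds: "t \<in> std_simplex k \<Longrightarrow> i < k \<Longrightarrow> 0 \<le> t i \<and> t i \<le> 1"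
proof -
  assume t: "t \<in> std_simplex k" "i < k"
  then have "t i \<le> (\<Sum>i<k. t i)" by (intro member_le_sum) (auto simp: std_simplex_def)
  then show ?thesis using t by (auto simp: std_simplex_def)
qed

lemma open_std_simplex_subset: "open_std_simplex k \<subseteq> std_simplex k"
  by (auto simp: open_std_simplex_def std_simplex_def less_imp_le)

lemma std_simplex_space_sets: "std_simplex k \<inter> space (coordM k) \<in> sets (coordM k)"
proof -
  have "{t \<in> space (coordM k). (\<forall>i\<in>{..<k}. 0 \<le> t i) \<and> (\<Sum>i<k. t i) \<le> 1} \<in> sets (coordM k)" by measurable
  also have "{t \<in> space (coordM k). (\<forall>i\<in>{..<k}. 0 \<le> t i) \<and> (\<Sum>i<k. t i) \<le> 1} = std_simplex k \<inter> space (coordM k)"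
    by (auto simp: std_simplex_def)
  finally show ?thesis .
qed

lemma std_simplex_finite: "emeasure (coordM k) (std_simplex k \<inter> space (coordM k)) < \<infinity>"
proof -
  have "emeasure (coordM k) (std_simplex k \<inter> space (coordM k)) \<le> emeasure (coordM k) (Pi\<^sub>E {..<k} (\<lambda>_. {0..1}))"
  proof (rule emeasure_mono)
    show "std_simplex k \<inter> space (coordM k) \<subseteq> Pi\<^sub>E {..<k} (\<lambda>_. {0..1})"
    proof
      fix t assume t: "t \<in> std_simplex k \<inter> space (coordM k)"
      then have "\<forall>i<k. 0 \<le> t i \<and> t i \<le> 1" using std_simplex_bounds by blast
      then show "t \<in> Pi\<^sub>E {..<k} (\<lambda>_. {0..1})" using t by (simp add: space_PiM PiE_iff)
    qed
  qed (rule sets_PiM_I_finite; simp)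
  also have "\<dots> = 1" by (subst coordM_box) simp_all
  finally show ?thesis by (rule le_less_trans) simp
qed

lemma std_simplex_pos: "k > 0 \<Longrightarrow> emeasure (coordM k) (std_simplex k \<inter> space (coordM k)) > 0"
proof -
  assume k: "k > 0"
  have "emeasure (coordM k) (Pi\<^sub>E {..<k} (\<lambda>_. {1 / (4 * real k)..1 / (2 * real k)})) \<le>
      emeasure (coordM k) (std_simplex k \<inter> space (coordM k))"
    using std_simplex_box_subset[OF k] open_std_simplex_subset
    by (intro emeasure_mono std_simplex_space_sets) (auto simp: space_PiM PiE_iff)
  then show ?thesis using std_simplex_box_pos[OF k] by (rule less_le_trans[rotated])
qed

lemma std_simplex_integral_pos:
  assumes k: "k > 0" and int: "set_integrable (coordM k) (std_simplex k) g"
    and nn: "\<And>t. t \<in> std_simplex k \<Longrightarrow> g t \<ge> (0::real)" and pos: "\<And>t. t \<in> open_std_simplex k \<Longrightarrow> g t > 0"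
  shows "(LINT t:std_simplex k|coordM k. g t) > 0"
proof -
  let ?h = "\<lambda>t. indicator (std_simplex k) t *\<^sub>R g t" and ?B = "Pi\<^sub>E {..<k} (\<lambda>_. {1 / (4 * real k)..1 / (2 * real k)})"
  have h: "integrable (coordM k) ?h" using int by (simp add: set_integrable_def)
  have h0: "?h t \<ge> 0" for t using nn[of t] by (auto simp: indicator_def)
  have "integral\<^sup>L (coordM k) ?h \<noteq> 0"
  proof
    assume "integral\<^sup>L (coordM k) ?h = 0"
    then have "AE t in coordM k. ?h t = 0"
      using integral_nonneg_eq_0_iff_AE[OF h] h0 by auto
    then have "AE t in coordM k. t \<notin> ?B"
    proof eventually_elim
      case (elim t)
      show ?case
      proof
        assume "t \<in> ?B"
        then have t: "t \<in> open_std_simplex k" using std_simplex_box_subset[OF k] by blast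
        then show False using pos[OF t] open_std_simplex_subset elim by (auto simp: indicator_def)
      qed
    qed
    then have "emeasure (coordM k) ?B = 0"
      by (subst (asm) AE_iff_measurable[of ?B]) (auto simp: space_PiM intro!: sets_PiM_I_finite)
    then show False using std_simplex_box_pos[OF k] by simp
  qed
  moreover have "integral\<^sup>L (coordM k) ?h \<ge> 0" by (rule Bochner_Integration.integral_nonneg) (rule h0)
  ultimately show ?thesis by (simp add: set_lebesgue_integral_def)
qed

text \<open>By Fubini's theorem: for fixed values of the other coordinates, at most one value of the last one is excluded.\<close>

lemma AE_sum_ne:
  assumes "0 < j" "j \<le> k" shows "AE t in coordM k. (\<Sum>i<j. t i) \<noteq> (c::real)"
proof -
  obtain q where q: "j = Suc q" using assms gr0_implies_Suc by blast
  let ?I = "{..<k} - {q}"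
  have ins: "{..<k} = insert q ?I" using assms q by auto
  let ?A = "{t \<in> space (coordM k). (\<Sum>i<j. t i) = c}"
  have "(\<lambda>t. \<Sum>i<j. t i) \<in> borel_measurable (coordM k)"
    using assms by (intro borel_measurable_sum measurable_component_singleton[where M="\<lambda>_. lborel", simplified]) auto
  then have A: "?A \<in> sets (coordM k)" by measurable
  have "emeasure (coordM k) ?A = (\<integral>\<^sup>+t. indicator ?A t \<partial>coordM k)" using A by simp
  also have "\<dots> = (\<integral>\<^sup>+x. (\<integral>\<^sup>+y. indicator ?A (x(q := y)) \<partial>lborel) \<partial>PiM ?I (\<lambda>_. lborel :: real measure))"
  proof -
    have m: "indicator ?A \<in> borel_measurable (PiM (insert q ?I) (\<lambda>_. lborel :: real measure))"
      unfolding ins[symmetric] using A by simp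
    show ?thesis using coord.product_nn_integral_insert[OF _ _ m] unfolding ins[symmetric] by simp
  qed
  also have "\<dots> = (\<integral>\<^sup>+x. 0 \<partial>PiM ?I (\<lambda>_. lborel :: real measure))"
  proof (rule nn_integral_cong)
    fix x
    have "(\<integral>\<^sup>+y. indicator ?A (x(q := y)) \<partial>lborel) \<le> (\<integral>\<^sup>+y. indicator {c - (\<Sum>i<q. x i)} y \<partial>lborel)"
      by (rule nn_integral_mono) (auto simp: q indicator_def)
    also have "\<dots> = 0" by simp
    finally show "(\<integral>\<^sup>+y. indicator ?A (x(q := y)) \<partial>lborel) = 0" by simp
  qed
  finally have "emeasure (coordM k) ?A = 0" by simp
  then show ?thesis by (subst AE_iff_measurable[OF A]) auto
qed

lemma AE_coord_ne:
  assumes "i < k" shows "AE t in coordM k. t i \<noteq> (c::real)"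
proof -
  let ?A = "Pi\<^sub>E {..<k} (\<lambda>j. if j = i then {c} else UNIV)"
  have "emeasure (coordM k) ?A = (\<Prod>j<k. emeasure lborel (if j = i then {c} else UNIV))"
    by (rule coordM_box) auto
  also have "\<dots> = 0" using assms by (intro prod_zero) auto
  finally have z: "emeasure (coordM k) ?A = 0" .
  have A: "?A \<in> sets (coordM k)" by (rule sets_PiM_I_finite) auto
  have "AE t in coordM k. t \<notin> ?A" using A z by (intro AE_not_in) auto
  then show ?thesis
  proof (rule AE_mp, intro AE_I2 impI)
    fix t assume "t \<in> space (coordM k)" "t \<notin> ?A"
    then show "t i \<noteq> c" by (auto simp: space_PiM PiE_iff split: if_splits)
  qed
qed

lemma AE_std_simplex:
  assumes "0 < j" "j \<le> k" shows "AE t in coordM k. t \<in> std_simplex j \<longrightarrow> t \<in> open_std_simplex j"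
proof -
  have "AE t in coordM k. \<forall>i\<in>{..<j}. t i \<noteq> 0"
    using assms AE_coord_ne by (subst AE_ball_countable) auto
  then show ?thesis using AE_sum_ne[OF assms, of 1]
  proof eventually_elim
    case (elim t)
    then show ?case by (auto simp: std_simplex_def open_std_simplex_def order_less_le)
  qed
qed

context simplex
begin

lemma grad_sum: "V \<in> S \<Longrightarrow> grad V (\<Sum>i\<in>I. c i *\<^sub>R p i) = (\<Sum>i\<in>I. c i * grad V (p i))"
  by (simp add: linear_sum[OF linear_grad] linear_scale[OF linear_grad])

text \<open>The chart of a face has barycentric coordinates as its parameters.\<close>

lemma lam_chart:
  assumes V: "V \<in> S" and fs: "length fs = Suc k" "distinct fs" "set fs \<subseteq> S"
  shows "i < k \<Longrightarrow> lam (fs ! Suc i) (chart k fs t) = t i"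
    "lam (fs ! 0) (chart k fs t) = 1 - (\<Sum>i<k. t i)"
    "V \<notin> set fs \<Longrightarrow> lam V (chart k fs t) = 0"
proof -
  have mem: "fs ! i \<in> S" if "i < Suc k" for i using that fs by (metis nth_mem subsetD)
  have gen: "lam U (chart k fs t) = lam U (fs ! 0) + (\<Sum>i<k. t i * (lam U (fs ! Suc i) - lam U (fs ! 0)))"
    if "U \<in> S" for U
    unfolding chart_def lam_add[OF that] grad_sum[OF that] by (simp add: grad_diff[OF that])
  have d: "lam (fs ! i) (fs ! j) = (if j = i then 1 else 0)" if "i < Suc k" "j < Suc k" for i j
    using that mem fs by (simp add: lam_vertex nth_eq_iff_index_eq)
  show "lam (fs ! Suc i) (chart k fs t) = t i" if "i < k"
    using that by (simp add: gen mem d if_distrib[of "\<lambda>c. _ * c"] cong: if_cong)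
  show "lam (fs ! 0) (chart k fs t) = 1 - (\<Sum>i<k. t i)"
    by (simp add: gen mem d sum_negf)
  assume nV: "V \<notin> set fs"
  then have "lam V (fs ! i) = 0" if "i < Suc k" for i
    using that V mem[OF that] fs by (auto simp: lam_vertex)
  then show "lam V (chart k fs t) = 0" by (simp add: gen[OF V])
qed

lemma set_nth_Suc: "length fs = Suc k \<Longrightarrow> set fs = insert (fs ! 0) ((\<lambda>i. fs ! Suc i) ` {..<k})"
proof (cases fs)
  case (Cons a xs)
  assume "length fs = Suc k"
  moreover have "set xs = (!) xs ` {..<length xs}" by (auto simp: set_conv_nth)
  ultimately show ?thesis using Cons by simp
qed simp

lemma chart_std_simplex_iff:
  assumes fs: "length fs = Suc k" "distinct fs" "set fs \<subseteq> S"
  shows "(\<forall>U\<in>set fs. 0 \<le> lam U (chart k fs t)) \<longleftrightarrow> t \<in> std_simplex k"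
    "(\<forall>U\<in>set fs. 0 < lam U (chart k fs t)) \<longleftrightarrow> t \<in> open_std_simplex k"
proof -
  have "fs ! 0 \<in> S" using fs by (cases fs) auto
  note l = lam_chart(1,2)[OF this fs, where t=t]
  show "(\<forall>U\<in>set fs. 0 \<le> lam U (chart k fs t)) \<longleftrightarrow> t \<in> std_simplex k"
    "(\<forall>U\<in>set fs. 0 < lam U (chart k fs t)) \<longleftrightarrow> t \<in> open_std_simplex k"
    unfolding set_nth_Suc[OF fs(1)] std_simplex_def open_std_simplex_def using l by auto
qed

lemma chart_in_D:
  assumes fs: "length fs = Suc k" "distinct fs" "set fs \<subseteq> S" and t: "t \<in> std_simplex k"
  shows "chart k fs t \<in> D"
  unfolding mem_D
proof
  fix V assume V: "V \<in> S"
  show "0 \<le> lam V (chart k fs t)"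
    using chart_std_simplex_iff(1)[OF fs, of t] t lam_chart(3)[OF V fs, of t] by (cases "V \<in> set fs") auto
qed

lemma edges_span:
  assumes vs: "length vs = Suc DIM('a)" "distinct vs" "set vs = S"
  shows "\<exists>s. (\<Sum>i<DIM('a). s i *\<^sub>R (vs ! (i + 1) - vs ! 0)) = a"
proof -
  let ?n = "DIM('a)"
  have reidx: "(\<Sum>V\<in>S. h V) = h (vs ! 0) + (\<Sum>i<?n. h (vs ! Suc i))" for h :: "'a \<Rightarrow> 'b::comm_monoid_add"
  proof -
    have "(\<Sum>V\<in>S. h V) = (\<Sum>i<Suc ?n. h (vs ! i))"
      using sum.reindex_bij_betw[OF bij_betw_nth[OF vs(2), of "{..<Suc ?n}" S], of h] vs by simp
    then show ?thesis by (simp only: sum.lessThan_Suc_shift)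
  qed
  have "(\<Sum>i<?n. grad (vs ! Suc i) a *\<^sub>R (vs ! (i + 1) - vs ! 0)) =
      (\<Sum>i<?n. grad (vs ! Suc i) a *\<^sub>R vs ! Suc i) - (\<Sum>i<?n. grad (vs ! Suc i) a) *\<^sub>R vs ! 0"
    by (simp add: scaleR_right_diff_distrib sum_subtractf scaleR_sum_left)
  also have "(\<Sum>i<?n. grad (vs ! Suc i) a) = - grad (vs ! 0) a"
    using sum_grad[of a] reidx[of "\<lambda>V. grad V a"] by simp
  also have "(\<Sum>i<?n. grad (vs ! Suc i) a *\<^sub>R vs ! Suc i) = a - grad (vs ! 0) a *\<^sub>R vs ! 0"
    using grad_vec[of a] reidx[of "\<lambda>V. grad V a *\<^sub>R V"] by (simp add: algebra_simps)
  finally show ?thesis by (intro exI[of _ "\<lambda>i. grad (vs ! Suc i) a"]) simp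
qed

text \<open>The image of the coordinate measure is translation invariant, hence a multiple \<open>c\<close> of Lebesgue
  measure. The factor is determined by comparing the measures of the simplex.\<close>

lemma change_of_variables:
  assumes vs: "length vs = Suc DIM('a)" "distinct vs" "set vs = S"
  shows "\<exists>c>0. \<forall>h :: 'a \<Rightarrow> real. h \<in> borel_measurable borel \<longrightarrow>
    (integrable lborel h \<longrightarrow> integrable (coordM DIM('a)) (\<lambda>t. h (chart DIM('a) vs t))) \<and>
    (LINT t|coordM DIM('a). h (chart DIM('a) vs t)) = c * integral\<^sup>L lborel h"
proof -
  let ?n = "DIM('a)" and ?P = "coordM DIM('a)"
  let ?L = "\<lambda>t. \<Sum>i<?n. t i *\<^sub>R (vs ! (i + 1) - vs ! 0)"
  have chart: "chart ?n vs t = vs ! 0 + ?L t" for t by (simp add: chart_def)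
  \<comment> \<open>With the indicator of D as the second function, coordM_haar relates the integrals of an
    arbitrary f; taking f to be the indicator of D as well shows that C is the measure of the
    standard simplex.\<close>
  define C where "C = (\<integral>\<^sup>+t. indicator D (- ?L t) \<partial>?P)"
  define l where "l = emeasure lborel D"
  have Db [measurable]: "D \<in> sets borel" using compact_imp_closed[OF compact_D] by (rule borel_closed)
  have haar: "(\<integral>\<^sup>+t. f (chart ?n vs t) \<partial>?P) * l = (\<integral>\<^sup>+x. f x \<partial>lborel) * C"
    if [measurable]: "f \<in> borel_measurable borel" for f :: "'a \<Rightarrow> ennreal"
    using coordM_haar[OF edges_span[OF vs], of "\<lambda>x. f (vs ! 0 + x)" "indicator D"]
    unfolding chart l_def C_def by (simp add: nn_integral_lborel_translate)
  have "interior D \<noteq> {}" by (rule interior_D_ne)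
  then obtain p r where pr: "r > 0" "ball p r \<subseteq> D" by (meson all_not_in_conv mem_interior)
  have "emeasure lborel (ball p r) \<noteq> 0"
  proof -
    have "unit_ball_vol (real ?n) * r ^ ?n > 0" using pr(1) by (intro mult_pos_pos) auto
    then show ?thesis unfolding emeasure_ball[OF less_imp_le[OF pr(1)]] ennreal_eq_0_iff by linarith
  qed
  then have l0: "l \<noteq> 0" unfolding l_def using emeasure_mono[OF pr(2), of lborel] Db
    by (metis le_zero_eq sets_lborel)
  have linf: "l < \<infinity>" unfolding l_def using compact_D by (intro emeasure_bounded_finite compact_imp_bounded)
  let ?p = "emeasure ?P (std_simplex ?n \<inter> space ?P)"
  have "(\<integral>\<^sup>+t. indicator D (chart ?n vs t) \<partial>?P) = (\<integral>\<^sup>+t. indicator (std_simplex ?n \<inter> space ?P) t \<partial>?P)"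
  proof (rule nn_integral_cong)
    fix t assume t: "t \<in> space ?P"
    have "chart ?n vs t \<in> D \<longleftrightarrow> t \<in> std_simplex ?n"
      using chart_std_simplex_iff(1)[OF vs(1,2), of t] vs(3) by (simp add: mem_D)
    then show "indicator D (chart ?n vs t) = (indicator (std_simplex ?n \<inter> space ?P) t :: ennreal)"
      using t by (simp add: indicator_def)
  qed
  then have "?p * l = l * C" using haar[of "indicator D"] std_simplex_space_sets[of ?n] by (simp add: l_def)
  then have Cp: "C = ?p" using l0 linf by (auto simp: mult.commute[of ?p] ennreal_mult_cancel_left)
  have C0: "C \<noteq> 0" using std_simplex_pos[of ?n] Cp DIM_positive by auto
  have Cinf: "C < \<infinity>" using std_simplex_finite[of ?n] Cp by simp
  define c where "c = enn2real C / enn2real l"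
  have c: "c > 0" using C0 l0 Cinf linf by (simp add: c_def enn2real_positive_iff zero_less_iff_neq_zero)
  have Cc: "C = ennreal c * l"
  proof -
    have "C = ennreal (enn2real C)" "l = ennreal (enn2real l)" using Cinf linf by simp_all
    moreover have "enn2real C = c * enn2real l" using l0 linf by (simp add: c_def enn2real_eq_0_iff)
    ultimately show ?thesis using c by (metis ennreal_mult' less_imp_le)
  qed
  have eq: "distr ?P borel (chart ?n vs) = density lborel (\<lambda>x. ennreal c)"
  proof (rule measure_eqI)
    fix A assume "A \<in> sets (distr ?P borel (chart ?n vs))"
    then have A [measurable]: "A \<in> sets borel" by simp
    have "emeasure (distr ?P borel (chart ?n vs)) A = (\<integral>\<^sup>+t. indicator A (chart ?n vs t) \<partial>?P)"
      by (subst emeasure_distr) (auto simp: nn_integral_indicator[symmetric] indicator_def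
          simp del: nn_integral_indicator intro!: nn_integral_cong)
    moreover have "(\<integral>\<^sup>+t. indicator A (chart ?n vs t) \<partial>?P) * l = (ennreal c * emeasure lborel A) * l"
      using haar[of "indicator A"] by (simp add: Cc mult_ac)
    then have "(\<integral>\<^sup>+t. indicator A (chart ?n vs t) \<partial>?P) = ennreal c * emeasure lborel A"
      using l0 linf by (auto simp: mult.commute[of _ l] ennreal_mult_cancel_left)
    moreover have "emeasure (density lborel (\<lambda>x. ennreal c)) A = ennreal c * emeasure lborel A"
      by (subst emeasure_density) (auto simp: nn_integral_cmult)
    ultimately show "emeasure (distr ?P borel (chart ?n vs)) A = emeasure (density lborel (\<lambda>x. ennreal c)) A" by simp
  qed simp
  show ?thesis
  proof (intro exI[of _ c] conjI allI impI c)
    fix h :: "'a \<Rightarrow> real" assume h [measurable]: "h \<in> borel_measurable borel"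
    show "integrable ?P (\<lambda>t. h (chart ?n vs t))" if "integrable lborel h"
    proof -
      have "integrable (distr ?P borel (chart ?n vs)) h"
        unfolding eq using that c by (subst integrable_density) auto
      then show ?thesis by (rule integrable_distr[rotated]) simp
    qed
    have "(LINT t|?P. h (chart ?n vs t)) = integral\<^sup>L (distr ?P borel (chart ?n vs)) h"
      by (rule integral_distr[symmetric]) simp_all
    also have "\<dots> = (LINT x|lborel. c *\<^sub>R h x)"
      unfolding eq using c by (intro integral_density) auto
    finally show "(LINT t|?P. h (chart ?n vs t)) = c * integral\<^sup>L lborel h" by simp
  qed
qed

end

section \<open>The boundary layer of a simplex\<close>

text \<open>A continuously differentiable function that increases from \<open>0\<close> on \<open>s \<le> 1\<close> to
  the limit \<open>1\<close>. It is rational for \<open>s \<ge> 1\<close>, so that its derivative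
  \<open>ramp'\<close> is explicit.\<close>

definition ramp :: "real \<Rightarrow> real" where
  "ramp s = (max 0 (s - 1))\<^sup>2 / (1 + (max 0 (s - 1))\<^sup>2)"

definition ramp' :: "real \<Rightarrow> real" where
  "ramp' s = 2 * max 0 (s - 1) / (1 + (max 0 (s - 1))\<^sup>2)\<^sup>2"

lemma one_plus_sq: "1 + (x::real)\<^sup>2 > 0"
  by (smt (verit) zero_le_power2)

lemma ramp_deriv: "(ramp has_real_derivative ramp' s) (at s)"
proof -
  have p: "((\<lambda>s. (max 0 (s - 1))\<^sup>2) has_real_derivative 2 * max 0 (s - 1)) (at s)"
  proof -
    have "((\<lambda>s. s - 1) has_real_derivative 1) (at s)" by (auto intro!: derivative_eq_intros)
    from DERIV_chain2[where f="\<lambda>s. (max 0 s)\<^sup>2" and g="\<lambda>s. s - 1",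
        OF has_real_derivative_pos_part_square this] show ?thesis by simp
  qed
  have nz: "1 + (max 0 (s - 1))\<^sup>2 \<noteq> 0" using one_plus_sq[of "max 0 (s - 1)"] by linarith
  have "((\<lambda>s. 1 + (max 0 (s - 1))\<^sup>2) has_real_derivative 2 * max 0 (s - 1)) (at s)"
    using DERIV_add[OF DERIV_const p] by simp
  from DERIV_divide[OF p this nz] show ?thesis
    unfolding ramp_def[abs_def] ramp'_def by (simp add: algebra_simps power2_eq_square)
qed

lemma ramp_bounds: "0 \<le> ramp s" "ramp s \<le> 1"
  using one_plus_sq[of "max 0 (s - 1)"] by (auto simp: ramp_def divide_le_eq)

lemma ramp_zero: "s \<le> 1 \<Longrightarrow> ramp s = 0" and ramp'_zero: "s \<le> 1 \<Longrightarrow> ramp' s = 0"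
  by (simp_all add: ramp_def ramp'_def)

lemma ramp'_nonneg: "ramp' s \<ge> 0"
  by (simp add: ramp'_def)

lemma continuous_ramp: "continuous_on A ramp"
  by (meson ramp_deriv DERIV_isCont continuous_at_imp_continuous_on)

lemma continuous_ramp': "continuous_on A ramp'"
proof -
  have "(1 + (max 0 (s - 1))\<^sup>2)\<^sup>2 \<noteq> 0" for s :: real using one_plus_sq[of "max 0 (s - 1)"] by simp
  then show ?thesis unfolding ramp'_def[abs_def] by (intro continuous_intros) auto
qed

lemma ramp_at_top: "(ramp \<longlongrightarrow> 1) at_top"
proof -
  have "filterlim (\<lambda>s::real. 1 + (s - 1)\<^sup>2) at_top at_top"
    by real_asymp
  then have "((\<lambda>s::real. 1 - inverse (1 + (s - 1)\<^sup>2)) \<longlongrightarrow> 1 - 0) at_top"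
    by (intro tendsto_diff tendsto_const tendsto_inverse_0_at_top)
  moreover have "\<forall>\<^sub>F s::real in at_top. 1 - inverse (1 + (s - 1)\<^sup>2) = ramp s"
    using eventually_ge_at_top[of 1]
  proof eventually_elim
    case (elim s)
    then show ?case using one_plus_sq[of "s - 1"] by (simp add: ramp_def max_def field_simps)
  qed
  ultimately show ?thesis using Lim_transform_eventually by fastforce
qed

lemma integrable_ramp': "integrable lborel ramp'"
proof (rule integrableI_nonneg)
  show "ramp' \<in> borel_measurable lborel"
    using borel_measurable_continuous_onI[OF continuous_ramp'] by simp
  have "(\<integral>\<^sup>+x. ennreal (ramp' x) \<partial>lborel) = (\<integral>\<^sup>+x. ennreal (ramp' x) * indicator {1..} x \<partial>lborel)"
    by (intro nn_integral_cong) (auto simp: indicator_def ramp'_zero)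
  also have "\<dots> = 1 - ramp 1"
    using borel_measurable_continuous_onI[OF continuous_ramp'] ramp_deriv ramp'_nonneg ramp_at_top
    by (intro nn_integral_FTC_atLeast) auto
  finally show "(\<integral>\<^sup>+x. ennreal (ramp' x) \<partial>lborel) < \<infinity>" by (simp add: less_top[symmetric])
qed (use ramp'_nonneg in auto)

lemma coordM_scale_last:
  assumes F: "integrable (coordM (Suc k)) F" "integrable (coordM (Suc k)) (\<lambda>t. F (t(k := r * t k)))" and r: "r > 0"
  shows "(LINT t|coordM (Suc k). F t) = r * (LINT t|coordM (Suc k). F (t(k := r * t k)) :: real)"
proof -
  have ins: "{..<Suc k} = insert k {..<k}" by auto
  have "(LINT t|coordM (Suc k). F t) = (LINT x|coordM k. LINT y|lborel. F (x(k := y)))"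
    using F(1) unfolding ins by (intro coord.product_integral_insert) auto
  also have "\<dots> = (LINT x|coordM k. r * (LINT y|lborel. F (x(k := r * y))))"
    using r by (intro Bochner_Integration.integral_cong refl)
      (subst lborel_integral_real_affine[where t=0 and c=r], auto)
  also have "\<dots> = r * (LINT x|coordM k. LINT y|lborel. F (x(k := r * y)))" by simp
  also have "(LINT x|coordM k. LINT y|lborel. F (x(k := r * y))) = (LINT t|coordM (Suc k). F (t(k := r * t k)))"
    using F(2) unfolding ins by (subst coord.product_integral_insert) auto
  finally show ?thesis .
qed

lemma std_simplex_upd: "x(k := y) \<in> std_simplex k \<longleftrightarrow> x \<in> std_simplex k"
  by (simp add: std_simplex_def)

lemma indicator_std_simplex_measurable_le:
  assumes "j \<le> k"
  shows "(\<lambda>t. indicator (std_simplex j) t :: real) \<in> borel_measurable (coordM k)"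
proof -
  have c: "(\<lambda>t. t i) \<in> borel_measurable (coordM k)" if "i < j" for i
    using that assms measurable_component_singleton[of i "{..<k}" "\<lambda>_. lborel :: real measure"] by simp
  have s: "(\<lambda>t. \<Sum>i<j. t i) \<in> borel_measurable (coordM k)"
    using c by (intro borel_measurable_sum) auto
  have "{t \<in> space (coordM k). \<forall>i\<in>{..<j}. 0 \<le> t i} \<in> sets (coordM k)"
    using c by (intro sets.sets_Collect_finite_All borel_measurable_le) auto
  moreover have "{t \<in> space (coordM k). (\<Sum>i<j. t i) \<le> 1} \<in> sets (coordM k)"
    using s by (intro borel_measurable_le) auto
  ultimately have "{t \<in> space (coordM k). \<forall>i\<in>{..<j}. 0 \<le> t i} \<inter> {t \<in> space (coordM k). (\<Sum>i<j. t i) \<le> 1} \<in> sets (coordM k)"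
    by (rule sets.Int)
  then have "(\<lambda>t. indicator ({t \<in> space (coordM k). \<forall>i\<in>{..<j}. 0 \<le> t i} \<inter> {t \<in> space (coordM k). (\<Sum>i<j. t i) \<le> 1}) t :: real)
     \<in> borel_measurable (coordM k)" by (rule borel_measurable_indicator)
  then show ?thesis
    by (rule measurable_cong[THEN iffD1, rotated]) (auto simp: indicator_def std_simplex_def)
qed

text \<open>The dominating function for the boundary layer near a facet, in coordinates of which the first
  \<open>k\<close> run along the facet and the last one, rescaled, measures the distance from it.\<close>

lemma integrable_layer_bound:
  "integrable (coordM (Suc k)) (\<lambda>t. indicator (std_simplex k) t * ramp' (t k))"
proof (rule integrableI_nonneg)
  have ins: "{..<Suc k} = insert k {..<k}" by auto
  have cm [measurable]: "ramp' \<in> borel_measurable borel"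
    using borel_measurable_continuous_onI[OF continuous_ramp'] by simp
  have "(\<lambda>t. t k) \<in> borel_measurable (coordM (Suc k))"
    using measurable_component_singleton[of k "{..<Suc k}" "\<lambda>_. lborel :: real measure"] by simp
  then have "(\<lambda>t. ramp' (t k)) \<in> borel_measurable (coordM (Suc k))" by measurable
  then show m: "(\<lambda>t. indicator (std_simplex k) t * ramp' (t k)) \<in> borel_measurable (coordM (Suc k))"
    using indicator_std_simplex_measurable_le[of k "Suc k"] by (intro borel_measurable_times) auto
  have "(\<integral>\<^sup>+t. ennreal (indicator (std_simplex k) t * ramp' (t k)) \<partial>coordM (Suc k)) =
      (\<integral>\<^sup>+x. \<integral>\<^sup>+y. ennreal (indicator (std_simplex k) (x(k := y)) * ramp' ((x(k := y)) k)) \<partial>lborel \<partial>coordM k)"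
    using m unfolding ins by (intro coord.product_nn_integral_insert) auto
  also have "\<dots> = (\<integral>\<^sup>+x. ennreal (indicator (std_simplex k) x) * (\<integral>\<^sup>+y. ennreal (ramp' y) \<partial>lborel) \<partial>coordM k)"
  proof (rule nn_integral_cong)
    fix x
    show "(\<integral>\<^sup>+y. ennreal (indicator (std_simplex k) (x(k := y)) * ramp' ((x(k := y)) k)) \<partial>lborel) =
      ennreal (indicator (std_simplex k) x) * (\<integral>\<^sup>+y. ennreal (ramp' y) \<partial>lborel)"
      by (subst nn_integral_cmult[symmetric]) (auto simp: indicator_def std_simplex_upd ramp'_nonneg ennreal_mult')
  qed
  also have "\<dots> = (\<integral>\<^sup>+x. ennreal (indicator (std_simplex k) x) \<partial>coordM k) * (\<integral>\<^sup>+y. ennreal (ramp' y) \<partial>lborel)"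
    by (rule nn_integral_multc) simp
  also have "(\<integral>\<^sup>+x. ennreal (indicator (std_simplex k) x) \<partial>coordM k) = (\<integral>\<^sup>+x. indicator (std_simplex k \<inter> space (coordM k)) x \<partial>coordM k)"
    by (intro nn_integral_cong) (auto simp: indicator_def)
  also have "\<dots> = emeasure (coordM k) (std_simplex k \<inter> space (coordM k))"
    using std_simplex_space_sets by simp
  finally show "(\<integral>\<^sup>+t. ennreal (indicator (std_simplex k) t * ramp' (t k)) \<partial>coordM (Suc k)) < \<infinity>"
    using std_simplex_finite[of k] integrable_ramp' ramp'_nonneg
    by (simp add: nn_integral_eq_integral ennreal_mult_less_top)
qed (auto simp: ramp'_nonneg)

context simplex
begin

text \<open>The differential of \<open>cutoff r\<close> is \<open>\<Sum>\<^sub>V layer r V \<cdot> grad V\<close>;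
  the term for \<open>V\<close> is concentrated, for large \<open>r\<close>, near the facet opposite to
  \<open>V\<close>.\<close>

definition layer :: "real \<Rightarrow> 'a \<Rightarrow> 'a \<Rightarrow> real" where
  "layer r V x = r * ramp' (r * lam V x) * (\<Prod>U\<in>S - {V}. ramp (r * lam U x))"

definition cutoff :: "real \<Rightarrow> 'a \<Rightarrow> real" where
  "cutoff r x = (\<Prod>V\<in>S. ramp (r * lam V x))"

lemma continuous_layer: "V \<in> S \<Longrightarrow> continuous_on A (layer r V)"
  unfolding layer_def[abs_def]
  by (intro continuous_intros continuous_on_compose2[OF continuous_ramp'[of UNIV]]
      continuous_on_compose2[OF continuous_ramp[of UNIV]] continuous_lam) auto

lemma cutoff_test_fun:
  assumes r: "r > 0"
  shows "test_fun (interior D) (cutoff r) (\<lambda>x d. \<Sum>V\<in>S. layer r V x * grad V d)"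
  unfolding test_fun_def
proof (intro conjI allI)
  fix x
  have "((\<lambda>x. ramp (r * lam V x)) has_derivative (\<lambda>d. r * grad V d * ramp' (r * lam V x))) (at x)" if V: "V \<in> S" for V
  proof -
    have "((\<lambda>x. r * lam V 0 + r * grad V x) has_derivative (\<lambda>d. 0 + r * grad V d)) (at x)"
      by (intro has_derivative_add has_derivative_const has_derivative_mult_right
          linear_imp_has_derivative linear_grad[OF V])
    moreover have "(\<lambda>x. r * lam V 0 + r * grad V x) = (\<lambda>x. r * lam V x)"
      by (simp add: grad_def algebra_simps)
    ultimately have "((\<lambda>x. r * lam V x) has_derivative (\<lambda>d. r * grad V d)) (at x)" by simp
    from DERIV_compose_FDERIV[OF ramp_deriv this] show ?thesis .
  qed
  then have "((\<lambda>x. \<Prod>V\<in>S. ramp (r * lam V x)) has_derivative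
      (\<lambda>d. \<Sum>V\<in>S. (r * grad V d * ramp' (r * lam V x)) * (\<Prod>U\<in>S - {V}. ramp (r * lam U x)))) (at x)"
    by (rule has_derivative_prod)
  then show "(cutoff r has_derivative (\<lambda>d. \<Sum>V\<in>S. layer r V x * grad V d)) (at x)"
    by (simp add: cutoff_def[abs_def] layer_def mult_ac)
next
  fix v show "continuous_on UNIV (\<lambda>x. \<Sum>V\<in>S. layer r V x * grad V v)"
    by (intro continuous_intros continuous_layer)
next
  \<comment> \<open>The ramp vanishes up to 1, so the cutoff vanishes unless all coordinates are at least 1 / r.\<close>
  let ?K = "{x. \<forall>V\<in>S. 1 / r \<le> lam V x}"
  have sub: "?K \<subseteq> interior D"
  proof
    fix x assume x: "x \<in> ?K"
    have "1 / r > 0" using r by simp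
    moreover have "1 / r \<le> lam V x" if "V \<in> S" for V using x that by blast
    ultimately have "0 < lam V x" if "V \<in> S" for V using that by (meson less_le_trans)
    then show "x \<in> interior D" unfolding mem_interior_D by blast
  qed
  have "?K = (\<Inter>V\<in>S. {x. 1 / r \<le> lam V x})" by auto
  also have "closed \<dots>"
    by (intro closed_INT ballI closed_Collect_le continuous_intros continuous_lam)
  finally have "compact (D \<inter> ?K)" by (rule compact_Int_closed[OF compact_D])
  moreover have "D \<inter> ?K = ?K" using sub interior_subset by blast
  ultimately have "compact ?K" by simp
  moreover have "cutoff r x = 0" if nK: "x \<notin> ?K" for x
  proof -
    obtain V where V: "V \<in> S" "\<not> 1 / r \<le> lam V x" using nK by blast
    then have "r * lam V x < 1" using r by (simp add: field_simps not_le)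
    then have "ramp (r * lam V x) = 0" by (intro ramp_zero) simp
    then show ?thesis unfolding cutoff_def using V(1) by (intro prod_zero) auto
  qed
  ultimately show "\<exists>K. compact K \<and> K \<subseteq> interior D \<and> (\<forall>x. x \<notin> K \<longrightarrow> cutoff r x = 0)"
    using sub by blast
qed

lemma cutoff_limit:
  assumes f: "continuous_on D f"
  shows "(\<lambda>m. LINT x:D|lborel. cutoff (real (Suc m)) x * f x) \<longlonglongrightarrow> (LINT x:D|lborel. f x)"
proof -
  have f_int: "integrable lborel (\<lambda>x. indicator D x *\<^sub>R f x)"
    by (rule borel_integrable_compact[OF compact_D f])
  have cm: "cutoff (real (Suc m)) \<in> borel_measurable borel" for m
    by (rule borel_measurable_continuous_onI) (rule test_fun_cont[OF cutoff_test_fun], simp)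
  have fro: "AE x in lborel. x \<in> D \<longrightarrow> x \<in> interior D"
  proof -
    have "negligible (frontier D)" by (rule negligible_convex_frontier) simp
    then have "frontier D \<in> null_sets lborel"
      by (metis borel_closed frontier_closed negligible_iff_null_sets null_sets_completion_iff sets_lborel)
    then have "AE x in lborel. x \<notin> frontier D" by (rule AE_not_in)
    then show ?thesis by eventually_elim (use closure_subset in \<open>auto simp: frontier_def\<close>)
  qed
  show ?thesis unfolding set_lebesgue_integral_def
  proof (rule integral_dominated_convergence[where w="\<lambda>x. norm (indicator D x *\<^sub>R f x)"])
    show fm: "(\<lambda>x. indicat_real D x *\<^sub>R f x) \<in> borel_measurable lborel" using f_int by simp
    show "integrable lborel (\<lambda>x. norm (indicator D x *\<^sub>R f x))" using f_int by (rule integrable_norm)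
    show "(\<lambda>x. indicat_real D x *\<^sub>R (cutoff (real (Suc m)) x * f x)) \<in> borel_measurable lborel" for m
    proof -
      have "(\<lambda>x. cutoff (real (Suc m)) x * (indicat_real D x *\<^sub>R f x)) \<in> borel_measurable lborel"
        using cm[of m] fm by (intro borel_measurable_times) simp_all
      then show ?thesis by (simp add: mult.left_commute)
    qed
    show "AE x in lborel. norm (indicat_real D x *\<^sub>R (cutoff (real (Suc m)) x * f x)) \<le> norm (indicator D x *\<^sub>R f x)" for m
    proof (rule AE_I2)
      fix x
      have "0 \<le> cutoff (real (Suc m)) x" "cutoff (real (Suc m)) x \<le> 1"
        unfolding cutoff_def by (intro prod_nonneg prod_le_1 conjI ballI ramp_bounds)+
      then show "norm (indicat_real D x *\<^sub>R (cutoff (real (Suc m)) x * f x)) \<le> norm (indicator D x *\<^sub>R f x)"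
        by (auto simp: indicator_def abs_mult intro!: mult_left_le_one_le)
    qed
    show "AE x in lborel. (\<lambda>m. indicat_real D x *\<^sub>R (cutoff (real (Suc m)) x * f x)) \<longlonglongrightarrow> indicat_real D x *\<^sub>R f x"
      using fro
    proof eventually_elim
      case (elim x)
      show ?case
      proof (cases "x \<in> D")
        case True
        with elim have pos: "lam V x > 0" if "V \<in> S" for V using that by (simp add: mem_interior_D)
        have "(\<lambda>m. ramp (real (Suc m) * lam V x)) \<longlonglongrightarrow> 1" if "V \<in> S" for V
        proof (rule filterlim_compose[OF ramp_at_top])
          show "filterlim (\<lambda>m. real (Suc m) * lam V x) at_top sequentially"
            using pos[OF that] by (intro filterlim_at_top_mult_tendsto_pos[OF tendsto_const _ filterlim_compose[OF filterlim_real_sequentially filterlim_Suc], THEN filterlim_cong[THEN iffD1, rotated -1]]) (auto simp: mult.commute)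
        qed
        then have "(\<lambda>m. cutoff (real (Suc m)) x) \<longlonglongrightarrow> (\<Prod>V\<in>S. 1)"
          unfolding cutoff_def by (intro tendsto_prod)
        then have "(\<lambda>m. cutoff (real (Suc m)) x * f x) \<longlonglongrightarrow> 1 * f x"
          by (intro tendsto_mult tendsto_const) simp
        then show ?thesis using True by simp
      qed simp
    qed
  qed
qed

end

context simplex
begin

text \<open>In the chart of the simplex that has \<open>V\<close> as its last vertex, rescaling the last coordinate by
  \<open>1 / r\<close> absorbs the factor \<open>r\<close> of the layer. The integrand then converges to
  \<open>ramp' (t k) g\<close> on the facet, and the integral of \<open>ramp'\<close> factors out. The
  constant does not depend on \<open>g\<close>.\<close>

lemma layer_limit:
  assumes V: "V \<in> S" and k: "DIM('a) = Suc k" "k > 0"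
    and fs: "length fs = Suc k" "distinct fs" "set fs = S - {V}"
  shows "\<exists>s. \<forall>g. continuous_on D g \<longrightarrow>
    (\<lambda>m. LINT x:D|lborel. layer (real (Suc m)) V x * g x) \<longlonglongrightarrow> s * (LINT t:std_simplex k|coordM k. g (chart k fs t))"
proof -
  define vs where "vs = fs @ [V]"
  have vs: "length vs = Suc DIM('a)" "distinct vs" "set vs = S"
    using fs V k by (auto simp: vs_def)
  let ?p = "fs ! 0"
  have p: "?p \<in> S" "?p \<noteq> V" using fs nth_mem[of 0 fs] by auto
  have fsS: "set fs \<subseteq> S" using fs by auto
  have chart_vs: "chart (Suc k) vs t = chart k fs t + t k *\<^sub>R (V - ?p)" for t
    using fs(1) by (simp add: chart_def vs_def nth_append)
  have chart_upd: "chart k fs (t(k := y)) = chart k fs t" for t y by (simp add: chart_def)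
  obtain c where c: "c > 0" and cv: "\<And>h :: 'a \<Rightarrow> real. h \<in> borel_measurable borel \<Longrightarrow>
    (integrable lborel h \<longrightarrow> integrable (coordM (Suc k)) (\<lambda>t. h (chart (Suc k) vs t))) \<and>
    (LINT t|coordM (Suc k). h (chart (Suc k) vs t)) = c * integral\<^sup>L lborel h"
    using change_of_variables[OF vs] unfolding k(1) by blast
  define C where "C = integral\<^sup>L lborel ramp'"
  \<comment> \<open>The point of the simplex at the rescaled last coordinate: its distance from the facet,
    measured by lam V, is t k / r.\<close>
  define z where "z r t = chart k fs t + (t k / r) *\<^sub>R (V - ?p)" for r :: real and t
  have lamz: "lam U (z r t) = lam U (chart k fs t) - t k / r * lam U ?p" if "U \<in> S - {V}" for U r t
  proof -
    have "lam U V = 0" using that V by (auto simp: lam_vertex)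
    then show ?thesis using that unfolding z_def
      by (simp add: lam_add linear_scale[OF linear_grad] grad_diff)
  qed
  have lamVz: "lam V (z r t) = t k / r" for r t
  proof -
    have "lam V (chart k fs t) = 0" using lam_chart(3)[OF V fs(1,2) fsS] fs(3) by simp
    moreover have "lam V ?p = 0" using p V by (simp add: lam_vertex)
    ultimately show ?thesis using V unfolding z_def
      by (simp add: lam_add linear_scale[OF linear_grad] grad_diff lam_vertex)
  qed
  have lamp: "0 \<le> lam U ?p" if "U \<in> S" for U using that p by (simp add: lam_vertex)
  have zD: "t \<in> std_simplex k" if "z r t \<in> D" "t k \<ge> 0" "r > 0" for r t
  proof -
    have "0 \<le> lam U (chart k fs t)" if U: "U \<in> S - {V}" for U
    proof -
      have "0 \<le> lam U (z r t)" using \<open>z r t \<in> D\<close> U by (simp add: mem_D)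
      moreover have "0 \<le> t k / r * lam U ?p" using \<open>t k \<ge> 0\<close> \<open>r > 0\<close> lamp U by simp
      ultimately show ?thesis using lamz[OF U, of r t] by linarith
    qed
    then show ?thesis using chart_std_simplex_iff(1)[OF fs(1,2) fsS, of t] fs(3) by simp
  qed
  have "(\<lambda>m. LINT x:D|lborel. layer (real (Suc m)) V x * g x) \<longlonglongrightarrow> (C / c) * (LINT t:std_simplex k|coordM k. g (chart k fs t))"
    if g: "continuous_on D g" for g
  proof -
    have "bounded (g ` D)" by (intro compact_imp_bounded compact_continuous_image[OF g compact_D])
    then obtain M where M: "M > 0" "\<And>x. x \<in> D \<Longrightarrow> \<bar>g x\<bar> \<le> M" unfolding bounded_pos by auto
    \<comment> \<open>The integrand after the change of variables and the rescaling.\<close>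
    define G where "G m t = indicator D (z (real (Suc m)) t) *
      (ramp' (t k) * (\<Prod>U\<in>S - {V}. ramp (real (Suc m) * lam U (z (real (Suc m)) t))) * g (z (real (Suc m)) t))" for m t
    define H where "H m x = indicator D x *\<^sub>R (layer (real (Suc m)) V x * g x)" for m x
    have Hi: "integrable lborel (H m)" for m
      unfolding H_def by (intro borel_integrable_compact compact_D continuous_on_mult continuous_layer V g)
    have Hm: "H m \<in> borel_measurable borel" for m using Hi[of m] by simp
    have upd: "H m (chart (Suc k) vs (t(k := (1 / real (Suc m)) * t k))) = real (Suc m) * G m t" for m t
    proof -
      have "chart (Suc k) vs (t(k := (1 / real (Suc m)) * t k)) = z (real (Suc m)) t"
        unfolding chart_vs chart_upd z_def by simp
      moreover have "real (Suc m) * lam V (z (real (Suc m)) t) = t k" by (simp add: lamVz del: of_nat_Suc)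
      ultimately show ?thesis by (simp add: H_def G_def layer_def del: of_nat_Suc)
    qed
    have zm: "(\<lambda>t. z r t) \<in> borel_measurable (coordM (Suc k))" for r
    proof -
      have "(\<lambda>t. t i) \<in> borel_measurable (coordM (Suc k))" if "i < Suc k" for i
        using that measurable_component_singleton[of i "{..<Suc k}" "\<lambda>_. lborel :: real measure"] by simp
      then show ?thesis unfolding z_def[abs_def] chart_def
        by (intro borel_measurable_add borel_measurable_const borel_measurable_sum borel_measurable_scaleR
            borel_measurable_divide) auto
    qed
    have Gm: "G m \<in> borel_measurable (coordM (Suc k))" for m
    proof -
      have e: "G m = (\<lambda>t. (1 / real (Suc m)) * H m (z (real (Suc m)) t))"
        using upd[of m] unfolding chart_vs chart_upd z_def by (simp add: fun_eq_iff del: of_nat_Suc)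
      show ?thesis unfolding e using measurable_compose[OF zm Hm[of m]] by (intro borel_measurable_times) auto
    qed
    let ?w = "\<lambda>t. M * (indicator (std_simplex k) t * ramp' (t k))"
    have wi: "integrable (coordM (Suc k)) ?w" by (intro integrable_mult_right integrable_layer_bound)
    have Gw: "norm (G m t) \<le> ?w t" for m t
    proof (cases "z (real (Suc m)) t \<in> D \<and> t k > 1")
      case True
      then have t: "t \<in> std_simplex k" by (intro zD[of "real (Suc m)"]) auto
      let ?\<Pi> = "\<Prod>U\<in>S - {V}. ramp (real (Suc m) * lam U (z (real (Suc m)) t))"
      have P: "0 \<le> ?\<Pi>" "?\<Pi> \<le> 1"
        by (intro prod_nonneg prod_le_1 conjI ballI ramp_bounds)+
      have "norm (G m t) = ramp' (t k) * ?\<Pi> * \<bar>g (z (real (Suc m)) t)\<bar>"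
        using True P(1) ramp'_nonneg[of "t k"] by (simp add: G_def abs_mult del: of_nat_Suc)
      also have "\<dots> \<le> ramp' (t k) * 1 * M"
        using True P M ramp'_nonneg[of "t k"] by (intro mult_mono mult_nonneg_nonneg) auto
      finally show ?thesis using t by (simp add: mult.commute)
    next
      case False
      then have "G m t = 0" by (auto simp: G_def ramp'_zero)
      then show ?thesis using M(1) ramp'_nonneg by simp
    qed
    have Gi: "integrable (coordM (Suc k)) (G m)" for m
      by (rule Bochner_Integration.integrable_bound[OF wi Gm AE_I2])
        (unfold real_norm_def, rule order_trans[OF Gw[unfolded real_norm_def] abs_ge_self])
    have layer_G: "(LINT x:D|lborel. layer (real (Suc m)) V x * g x) = (1 / c) * (LINT t|coordM (Suc k). G m t)" for m
    proof -
      have "c * (LINT x:D|lborel. layer (real (Suc m)) V x * g x) = (LINT t|coordM (Suc k). H m (chart (Suc k) vs t))"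
        using cv[OF Hm[of m]] by (simp add: H_def[abs_def] set_lebesgue_integral_def)
      also have "\<dots> = (1 / real (Suc m)) * (LINT t|coordM (Suc k). H m (chart (Suc k) vs (t(k := (1 / real (Suc m)) * t k))))"
      proof (rule coordM_scale_last)
        show "integrable (coordM (Suc k)) (\<lambda>t. H m (chart (Suc k) vs t))" using cv[OF Hm[of m]] Hi by blast
        show "integrable (coordM (Suc k)) (\<lambda>t. H m (chart (Suc k) vs (t(k := (1 / real (Suc m)) * t k))))"
          unfolding upd by (intro integrable_mult_right Gi)
      qed simp
      also have "\<dots> = (LINT t|coordM (Suc k). G m t)" unfolding upd by (simp del: of_nat_Suc)
      finally show ?thesis using c by (simp add: field_simps)
    qed
    let ?G = "\<lambda>t. indicator (std_simplex k) t * (ramp' (t k) * g (chart k fs t))"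
    have lim: "AE t in coordM (Suc k). (\<lambda>m. G m t) \<longlonglongrightarrow> ?G t"
      using AE_std_simplex[OF k(2), of "Suc k", OF le_SucI[OF order_refl]]
    proof eventually_elim
      case (elim t)
      \<comment> \<open>The null set where t lies in the boundary of the standard simplex is excluded: there the
        other ramps need not tend to 1.\<close>
      consider "t k \<le> 1" | "t k > 1" "t \<notin> std_simplex k" | "t k > 1" "t \<in> open_std_simplex k" using elim not_le by blast
      then show ?case
      proof cases
        case 1 then show ?thesis by (simp add: G_def ramp'_zero)
      next
        case 2
        have "z (real (Suc m)) t \<notin> D" for m using zD[of "real (Suc m)" t] 2 by auto
        then have "G m t = 0" for m by (simp add: G_def del: of_nat_Suc)
        then show ?thesis using 2 by simp
      next
        case 3
        let ?y = "chart k fs t"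
        have tstd: "t \<in> std_simplex k" using 3 open_std_simplex_subset by blast
        have yD: "?y \<in> D" by (rule chart_in_D[OF fs(1,2) fsS tstd])
        have ypos: "lam U ?y > 0" if "U \<in> S - {V}" for U
          using chart_std_simplex_iff(2)[OF fs(1,2) fsS, of t] 3 fs(3) that by auto
        have a0: "(\<lambda>m. t k / real (Suc m)) \<longlonglongrightarrow> 0"
          using tendsto_mult[OF tendsto_const LIMSEQ_inverse_real_of_nat, of "t k"] by (simp add: divide_inverse)
        have zy: "(\<lambda>m. z (real (Suc m)) t) \<longlonglongrightarrow> ?y"
          unfolding z_def using tendsto_add[OF tendsto_const[of ?y] tendsto_scaleR[OF a0 tendsto_const[of "V - ?p"]]]
          by (simp only: scaleR_zero_left add_0_right)
        have lz: "(\<lambda>m. lam U (z (real (Suc m)) t)) \<longlonglongrightarrow> lam U ?y" if "U \<in> S" for U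
          using continuous_on_tendsto_compose[OF continuous_lam[OF that, of UNIV] zy] by simp
        have evD: "\<forall>\<^sub>F m in sequentially. z (real (Suc m)) t \<in> D"
        proof -
          have "\<forall>\<^sub>F m in sequentially. \<forall>U\<in>S. 0 \<le> lam U (z (real (Suc m)) t)"
          proof (rule eventually_ball_finite[OF finite_S], rule ballI)
            fix U assume U: "U \<in> S"
            show "\<forall>\<^sub>F m in sequentially. 0 \<le> lam U (z (real (Suc m)) t)"
            proof (cases "U = V")
              case True then show ?thesis using 3 by (simp add: lamVz)
            next
              case False
              then have "\<forall>\<^sub>F m in sequentially. 0 < lam U (z (real (Suc m)) t)"
                using ypos U by (intro order_tendstoD(1)[OF lz]) auto
              then show ?thesis by (rule eventually_mono) simp
            qed
          qed
          then show ?thesis by (simp add: mem_D)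
        qed
        have gz: "(\<lambda>m. g (z (real (Suc m)) t)) \<longlonglongrightarrow> g ?y"
          by (rule continuous_on_tendsto_compose[OF g zy yD evD])
        have "(\<lambda>m. ramp (real (Suc m) * lam U (z (real (Suc m)) t))) \<longlonglongrightarrow> 1" if U: "U \<in> S - {V}" for U
        proof (rule filterlim_compose[OF ramp_at_top])
          have "filterlim (\<lambda>m. real (Suc m)) at_top sequentially"
            by (rule filterlim_compose[OF filterlim_real_sequentially filterlim_Suc])
          then have "filterlim (\<lambda>m. lam U (z (real (Suc m)) t) * real (Suc m)) at_top sequentially"
            using lz[of U] ypos[OF U] U by (intro filterlim_tendsto_pos_mult_at_top) auto
          then show "filterlim (\<lambda>m. real (Suc m) * lam U (z (real (Suc m)) t)) at_top sequentially"
            by (simp only: mult.commute)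
        qed
        then have "(\<lambda>m. \<Prod>U\<in>S - {V}. ramp (real (Suc m) * lam U (z (real (Suc m)) t))) \<longlonglongrightarrow> (\<Prod>U\<in>S - {V}. 1)"
          by (intro tendsto_prod)
        then have "(\<lambda>m. ramp' (t k) * (\<Prod>U\<in>S - {V}. ramp (real (Suc m) * lam U (z (real (Suc m)) t))) * g (z (real (Suc m)) t))
           \<longlonglongrightarrow> ramp' (t k) * (\<Prod>U\<in>S - {V}. 1) * g ?y"
          by (intro tendsto_mult tendsto_const gz)
        then have "(\<lambda>m. G m t) \<longlonglongrightarrow> ramp' (t k) * (\<Prod>U\<in>S - {V}. 1) * g ?y"
          by (rule Lim_transform_eventually) (use evD in eventually_elim, simp add: G_def)
        then show ?thesis using tstd by simp
      qed
    qed
    have gcm: "(\<lambda>t. indicator D (chart k fs t) *\<^sub>R g (chart k fs t)) \<in> borel_measurable (coordM j)" if "j \<ge> k" for j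
    proof -
      have "chart k fs \<in> borel_measurable (coordM j)"
      proof -
        have "(\<lambda>t. t i) \<in> borel_measurable (coordM j)" if "i < k" for i
          using that \<open>j \<ge> k\<close> measurable_component_singleton[of i "{..<j}" "\<lambda>_. lborel :: real measure"] by simp
        then show ?thesis unfolding chart_def[abs_def]
          by (intro borel_measurable_add borel_measurable_const borel_measurable_sum borel_measurable_scaleR) auto
      qed
      moreover have "(\<lambda>x. indicator D x *\<^sub>R g x) \<in> borel_measurable borel"
        by (rule borel_measurable_continuous_on_indicator[OF borel_closed[OF compact_imp_closed[OF compact_D]] g])
      ultimately show ?thesis by (rule measurable_compose)
    qed
    have gstd: "indicator (std_simplex k) t * (a * g (chart k fs t)) = indicator (std_simplex k) t * (a * (indicator D (chart k fs t) *\<^sub>R g (chart k fs t)))" for t and a :: real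
      using chart_in_D[OF fs(1,2) fsS, of t] by (auto simp: indicator_def)
    have Gmeas: "?G \<in> borel_measurable (coordM (Suc k))"
    proof -
      have "(\<lambda>t. ramp' (t k)) \<in> borel_measurable (coordM (Suc k))"
        using measurable_compose[OF measurable_component_singleton[of k "{..<Suc k}" "\<lambda>_. lborel :: real measure"],
          of ramp' borel] borel_measurable_continuous_onI[OF continuous_ramp'] by simp
      then show ?thesis unfolding gstd
        using gcm[of "Suc k"] indicator_std_simplex_measurable_le[of k "Suc k"] by (intro borel_measurable_times) auto
    qed
    have dom: "(\<lambda>m. LINT t|coordM (Suc k). G m t) \<longlonglongrightarrow> (LINT t|coordM (Suc k). ?G t)"
      by (rule integral_dominated_convergence[OF Gmeas Gm wi lim AE_I2[OF Gw]])
    have Gint: "integrable (coordM (Suc k)) ?G"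
      by (rule integrable_dominated_convergence[OF Gmeas Gm wi lim AE_I2[OF Gw]])
    have "(LINT t|coordM (Suc k). ?G t) = C * (LINT t:std_simplex k|coordM k. g (chart k fs t))"
    proof -
      have ins: "{..<Suc k} = insert k {..<k}" by auto
      have "(LINT t|coordM (Suc k). ?G t) = (LINT x|coordM k. LINT y|lborel. ?G (x(k := y)))"
        using Gint unfolding ins by (intro coord.product_integral_insert) auto
      also have "\<dots> = (LINT x|coordM k. C * (indicator (std_simplex k) x * g (chart k fs x)))"
        by (intro Bochner_Integration.integral_cong refl)
           (simp add: C_def chart_upd indicator_def std_simplex_upd)
      finally show ?thesis by (simp add: set_lebesgue_integral_def)
    qed
    then have "(\<lambda>m. (1 / c) * (LINT t|coordM (Suc k). G m t)) \<longlonglongrightarrow> (1 / c) * (C * (LINT t:std_simplex k|coordM k. g (chart k fs t)))"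
      using dom by (intro tendsto_mult tendsto_const) simp
    then show ?thesis unfolding layer_G by simp
  qed
  then show ?thesis by blast
qed

section \<open>Stokes' theorem for continuous fields with continuous divergence\<close>

text \<open>Apply the definition of the weak divergence to the test functions \<open>cutoff m\<close> and let
  \<open>m\<close> tend to infinity: the left side tends to the integral of the divergence, and each summand
  of the right side to a multiple of the flux through a facet. It is essential for the application to
  interpolators that the field is only assumed to be continuous, and that the constants depend on the simplex
  alone.\<close>

lemma stokes:
  assumes k: "DIM('a) = Suc k" "k > 0"
    and ori: "\<And>V. V \<in> S \<Longrightarrow> length (fs V) = Suc k \<and> distinct (fs V) \<and> set (fs V) = S - {V}"
  shows "\<exists>\<sigma>. \<forall>v f. continuous_on D v \<longrightarrow> continuous_on D f \<longrightarrow> weak_div D v f \<longrightarrow>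
    (LINT x:D|lborel. f x) = (\<Sum>V\<in>S. \<sigma> V * (LINT t:std_simplex k|coordM k. grad V (v (chart k (fs V) t))))"
proof -
  have "\<forall>V\<in>S. \<exists>s. \<forall>g. continuous_on D g \<longrightarrow>
    (\<lambda>m. LINT x:D|lborel. layer (real (Suc m)) V x * g x) \<longlonglongrightarrow> s * (LINT t:std_simplex k|coordM k. g (chart k (fs V) t))"
  proof
    fix V assume V: "V \<in> S"
    show "\<exists>s. \<forall>g. continuous_on D g \<longrightarrow>
      (\<lambda>m. LINT x:D|lborel. layer (real (Suc m)) V x * g x) \<longlonglongrightarrow> s * (LINT t:std_simplex k|coordM k. g (chart k (fs V) t))"
      by (rule layer_limit[OF V k]) (use ori[OF V] in auto)
  qed
  from bchoice[OF this] obtain s where "\<forall>V\<in>S. \<forall>g. continuous_on D g \<longrightarrow>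
    (\<lambda>m. LINT x:D|lborel. layer (real (Suc m)) V x * g x) \<longlonglongrightarrow> s V * (LINT t:std_simplex k|coordM k. g (chart k (fs V) t))"
    by (elim exE)
  note s = this[rule_format]
  have "(LINT x:D|lborel. f x) = (\<Sum>V\<in>S. (- s V) * (LINT t:std_simplex k|coordM k. grad V (v (chart k (fs V) t))))"
    if v: "continuous_on D v" and f: "continuous_on D f" and w: "weak_div D v f" for v f
  proof -
    have gv: "continuous_on D (\<lambda>x. grad V (v x))" if "V \<in> S" for V
      using linear_continuous_on_compose[OF v linear_grad[OF that]] .
    have eq: "(LINT x:D|lborel. cutoff (real (Suc m)) x * f x) =
        - (\<Sum>V\<in>S. LINT x:D|lborel. layer (real (Suc m)) V x * grad V (v x))" for m
    proof -
      have t: "test_fun (interior D) (cutoff (real (Suc m))) (\<lambda>x d. \<Sum>V\<in>S. layer (real (Suc m)) V x * grad V d)"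
        by (rule cutoff_test_fun) simp
      have "set_integrable lborel D (\<lambda>x. layer (real (Suc m)) V x * grad V (v x))" if "V \<in> S" for V
        by (intro set_integrable_cont compact_D continuous_on_mult continuous_layer gv that)
      then have "(\<Sum>V\<in>S. 1 * (LINT x:D|lborel. layer (real (Suc m)) V x * grad V (v x))) =
          (LINT x:D|lborel. \<Sum>V\<in>S. 1 * (layer (real (Suc m)) V x * grad V (v x)))"
        by (rule set_lint_sum)
      then show ?thesis using w t unfolding weak_div_def by simp
    qed
    have "(\<lambda>m. LINT x:D|lborel. cutoff (real (Suc m)) x * f x) \<longlonglongrightarrow>
      - (\<Sum>V\<in>S. s V * (LINT t:std_simplex k|coordM k. grad V (v (chart k (fs V) t))))"
      unfolding eq by (intro tendsto_minus tendsto_sum s gv)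
    from LIMSEQ_unique[OF cutoff_limit[OF f] this] show ?thesis by (simp add: sum_negf)
  qed
  then show ?thesis by (intro exI[of _ "\<lambda>V. - s V"] allI impI)
qed

end

section \<open>The cells of the two refinements\<close>

lemma refinement_iff:
  "\<sigma> \<in> refinement m W T \<longleftrightarrow> (\<exists>C T'. \<sigma> \<in> faces (W ` C \<union> T') \<and> T' \<in> faces T \<and> card T' \<le> m + 1 \<and>
     C \<subseteq> faces T \<and> chain\<^sub>\<subseteq> C \<and> (\<forall>F \<in> C. T' \<subset> F \<and> card F \<ge> m + 2))"
  (is "_ \<longleftrightarrow> (\<exists>C T'. ?P C T')")
proof
  assume "\<sigma> \<in> refinement m W T"
  then obtain X C T' where "\<sigma> \<in> X" "X = faces (W ` C \<union> T')" "T' \<in> faces T" "card T' \<le> m + 1"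
     "C \<subseteq> faces T" "chain\<^sub>\<subseteq> C" "\<forall>F \<in> C. T' \<subset> F \<and> card F \<ge> m + 2"
    unfolding refinement_def by (elim UnionE CollectE exE conjE)
  then show "\<exists>C T'. ?P C T'" by (intro exI[of _ C] exI[of _ T']) simp
next
  assume "\<exists>C T'. ?P C T'"
  then obtain C T' where CT: "?P C T'" by (elim exE)
  show "\<sigma> \<in> refinement m W T"
    unfolding refinement_def
    by (rule UnionI[of "faces (W ` C \<union> T')"], intro CollectI exI[of _ C] exI[of _ T']) (use CT in simp_all)
qed

context split_simplex
begin

text \<open>The cells of \<open>R\<^bsub>n-1\<^esub>(S)\<close>, of dimension \<open>n\<close>; those of
  \<open>R\<^bsub>n-2\<^esub>(S)\<close> are the simplices \<open>cell V U\<close>.\<close>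

definition cone :: "'a \<Rightarrow> 'a set" where
  "cone V = insert (W S) (S - {V})"

text \<open>The faces that are split are the simplex itself and, in the fine split, its facets.\<close>

lemma big_face:
  assumes "F \<in> faces S" "card F \<ge> DIM('a)"
  shows "F = S \<or> (\<exists>V\<in>S. F = S - {V})"
proof -
  have F: "F \<subseteq> S" using assms(1) by (simp add: faces_def)
  have "card (S - F) \<le> Suc 0"
    using card_Diff_subset[of F S] F assms(2) card_S finite_subset[OF F] by simp
  then have eq: "\<forall>a\<in>S - F. \<forall>b\<in>S - F. a = b"
    by (subst (asm) card_le_Suc0_iff_eq) auto
  show ?thesis
  proof (cases "S - F = {}")
    case True then show ?thesis using F by auto
  next
    case False
    then obtain V where "V \<in> S - F" by auto
    then have "F = S - {V}" using eq F by blast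
    then show ?thesis using \<open>V \<in> S - F\<close> by blast
  qed
qed

lemma fine_cell_in:
  assumes "V \<in> S" "U \<in> S" "U \<noteq> V"
  shows "cell V U \<in> refinement (DIM('a) - 1 - 1) W S"
proof -
  let ?C = "{S - {V}, S}" and ?T = "S - {V, U}"
  have "cell V U \<in> faces (W ` ?C \<union> ?T)"
    by (auto simp: faces_def cell_def)
  moreover have "?T \<in> faces S" using ridge_ne[OF assms] by (auto simp: faces_def)
  moreover have "card ?T \<le> DIM('a) - 1 - 1 + 1" using card_ridge[OF assms] dim2 by simp
  moreover have "?C \<subseteq> faces S" using facet_ne[OF assms(1)] S_ne by (auto simp: faces_def)
  moreover have "chain\<^sub>\<subseteq> ?C" by (auto simp: chain_subset_def)
  moreover have "\<forall>F\<in>?C. ?T \<subset> F \<and> card F \<ge> DIM('a) - 1 - 1 + 2"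
    using assms card_facet[OF assms(1)] card_S dim2 by auto
  ultimately show ?thesis unfolding refinement_iff by (intro exI conjI)
qed

text \<open>A chain of refined faces contains at most one facet. If it contains the facet opposite to \<open>V\<close>,
  the face below it also omits another vertex \<open>U\<close>; if it contains none, the face below it omits
  two vertices by dimension.\<close>

lemma fine_cell_cover:
  assumes "\<sigma> \<in> refinement (DIM('a) - 1 - 1) W S"
  shows "\<exists>V U. V \<in> S \<and> U \<in> S \<and> U \<noteq> V \<and> \<sigma> \<subseteq> cell V U"
proof -
  obtain C T where CT: "\<sigma> \<in> faces (W ` C \<union> T)" "T \<in> faces S" "card T \<le> DIM('a) - 1 - 1 + 1"
    "C \<subseteq> faces S" "chain\<^sub>\<subseteq> C" "\<forall>F\<in>C. T \<subset> F \<and> card F \<ge> DIM('a) - 1 - 1 + 2"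
    using assms unfolding refinement_iff by (elim exE conjE)
  have \<sigma>: "\<sigma> \<subseteq> W ` C \<union> T" using CT(1) by (simp add: faces_def)
  have TS: "T \<subseteq> S" using CT(2) by (simp add: faces_def)
  have C: "F = S \<or> (\<exists>V\<in>S. F = S - {V})" if "F \<in> C" for F
    using that CT(4,6) dim2 by (intro big_face) auto
  show ?thesis
  proof (cases "\<exists>V\<in>S. S - {V} \<in> C")
    case True
    then obtain V where V: "V \<in> S" "S - {V} \<in> C" by blast
    have FC: "F = S \<or> F = S - {V}" if "F \<in> C" for F
    proof -
      have "F \<subseteq> S - {V} \<or> S - {V} \<subseteq> F" using CT(5) that V(2) by (auto simp: chain_subset_def)
      then have sub: "V \<notin> F \<or> S - {V} \<subseteq> F" by blast
      from C[OF that] show ?thesis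
      proof
        assume "\<exists>V'\<in>S. F = S - {V'}"
        then obtain V' where V': "V' \<in> S" "F = S - {V'}" by blast
        then have "V' = V" using sub V(1) by auto
        then show ?thesis using V' by simp
      qed simp
    qed
    have WC: "W ` C \<subseteq> {W S, WF V}"
    proof
      fix y assume "y \<in> W ` C"
      then obtain F where F: "F \<in> C" "y = W F" by blast
      show "y \<in> {W S, WF V}" using FC[OF F(1)] F(2) by auto
    qed
    have TV: "T \<subset> S - {V}" using bspec[OF CT(6) V(2)] by simp
    then obtain U where "U \<in> S - {V}" "U \<notin> T" using psubset_imp_ex_mem[OF TV] by auto
    then show ?thesis using \<sigma> WC TV V(1)
      by (intro exI[of _ V] exI[of _ U]) (auto simp: cell_def)
  next
    case False
    then have FS: "F = S" if "F \<in> C" for F using C[OF that] that by auto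
    have WC: "W ` C \<subseteq> {W S}"
    proof
      fix y assume "y \<in> W ` C"
      then obtain F where F: "F \<in> C" "y = W F" by blast
      show "y \<in> {W S}" using FS[OF F(1)] F(2) by simp
    qed
    have "\<not> card (S - T) \<le> Suc 0"
      using card_Diff_subset[of T S] TS CT(3) card_S finite_subset[OF TS] dim2 by simp
    then have "\<not> (\<forall>a\<in>S - T. \<forall>b\<in>S - T. a = b)"
      using card_le_Suc0_iff_eq[of "S - T"] by simp
    then obtain V U where "V \<in> S - T" "U \<in> S - T" "V \<noteq> U" by blast
    then show ?thesis using \<sigma> WC TS
      by (intro exI[of _ V] exI[of _ U]) (auto simp: cell_def)
  qed
qed

lemma coarse_cell_in:
  assumes "V \<in> S"
  shows "cone V \<in> refinement (DIM('a) - 1) W S"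
proof -
  let ?T = "S - {V}"
  have "cone V \<in> faces (W ` {S} \<union> ?T)"
    by (auto simp: faces_def cone_def)
  moreover have "?T \<in> faces S" using facet_ne[OF assms] by (auto simp: faces_def)
  moreover have "card ?T \<le> DIM('a) - 1 + 1" using card_facet[OF assms] dim2 by simp
  moreover have "{S} \<subseteq> faces S" using S_ne by (auto simp: faces_def)
  moreover have "chain\<^sub>\<subseteq> {S}" by (auto simp: chain_subset_def)
  moreover have "\<forall>F\<in>{S}. ?T \<subset> F \<and> card F \<ge> DIM('a) - 1 + 2"
    using assms card_S dim2 by auto
  ultimately show ?thesis unfolding refinement_iff by (intro exI conjI)
qed

lemma coarse_cell_cover:
  assumes "\<sigma> \<in> refinement (DIM('a) - 1) W S"
  shows "\<exists>V. V \<in> S \<and> \<sigma> \<subseteq> cone V"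
proof -
  obtain C T where CT: "\<sigma> \<in> faces (W ` C \<union> T)" "T \<in> faces S" "card T \<le> DIM('a) - 1 + 1"
    "C \<subseteq> faces S" "chain\<^sub>\<subseteq> C" "\<forall>F\<in>C. T \<subset> F \<and> card F \<ge> DIM('a) - 1 + 2"
    using assms unfolding refinement_iff by (elim exE conjE)
  have \<sigma>: "\<sigma> \<subseteq> W ` C \<union> T" using CT(1) by (simp add: faces_def)
  have TS: "T \<subseteq> S" using CT(2) by (simp add: faces_def)
  have FS: "F = S" if "F \<in> C" for F
  proof (rule card_subset_eq[OF finite_S])
    show FS: "F \<subseteq> S" using that CT(4) by (auto simp: faces_def)
    show "card F = card S"
      using CT(6) that card_S dim2 card_mono[OF finite_S FS] by force
  qed
  have WC: "W ` C \<subseteq> {W S}"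
  proof
    fix y assume "y \<in> W ` C"
    then obtain F where F: "F \<in> C" "y = W F" by blast
    show "y \<in> {W S}" using FS[OF F(1)] F(2) by simp
  qed
  have "T \<noteq> S" using CT(3) card_S dim2 by auto
  then obtain V where "V \<in> S" "V \<notin> T" using TS by blast
  then show ?thesis using \<sigma> WC TS by (intro exI[of _ V]) (auto simp: cone_def)
qed

lemma fine_union: "(\<Union>\<sigma>\<in>refinement (DIM('a) - 1 - 1) W S. convex hull \<sigma>) = D"
proof
  show "(\<Union>\<sigma>\<in>refinement (DIM('a) - 1 - 1) W S. convex hull \<sigma>) \<subseteq> D"
  proof (rule UN_least)
    fix \<sigma> assume "\<sigma> \<in> refinement (DIM('a) - 1 - 1) W S"
    then obtain V U where "V \<in> S" "\<sigma> \<subseteq> cell V U" using fine_cell_cover by blast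
    then show "convex hull \<sigma> \<subseteq> D" using cell_subset_D[of V U] hull_mono[of \<sigma> "cell V U" convex] by blast
  qed
  show "D \<subseteq> (\<Union>\<sigma>\<in>refinement (DIM('a) - 1 - 1) W S. convex hull \<sigma>)"
  proof
    fix x assume x: "x \<in> D"
    obtain V U where s: "sector V U x" using ex_sector by blast
    then show "x \<in> (\<Union>\<sigma>\<in>refinement (DIM('a) - 1 - 1) W S. convex hull \<sigma>)"
      using fine_cell_in[OF sectorD(2-4)[OF s]] sector_in_cell[OF s x] by blast
  qed
qed

lemma coarse_union: "(\<Union>\<sigma>\<in>refinement (DIM('a) - 1) W S. convex hull \<sigma>) = D"
proof
  show "(\<Union>\<sigma>\<in>refinement (DIM('a) - 1) W S. convex hull \<sigma>) \<subseteq> D"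
  proof (rule UN_least)
    fix \<sigma> assume "\<sigma> \<in> refinement (DIM('a) - 1) W S"
    then obtain V where "V \<in> S" "\<sigma> \<subseteq> cone V" using coarse_cell_cover by blast
    then show "convex hull \<sigma> \<subseteq> D" using cone_subset_D[of V] hull_mono[of \<sigma> "cone V" convex]
      unfolding cone_def by blast
  qed
  show "D \<subseteq> (\<Union>\<sigma>\<in>refinement (DIM('a) - 1) W S. convex hull \<sigma>)"
  proof
    fix x assume x: "x \<in> D"
    obtain V U where s: "sector V U x" using ex_sector by blast
    then have "x \<in> convex hull (cone V)"
      using sector_in_cell[OF s x] cell_subset_cone[OF sectorD(2)[OF s]] unfolding cone_def by blast
    then show "x \<in> (\<Union>\<sigma>\<in>refinement (DIM('a) - 1) W S. convex hull \<sigma>)"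
      using coarse_cell_in[OF sectorD(2)[OF s]] by blast
  qed
qed

section \<open>Piecewise affine fields\<close>

text \<open>The general piecewise affine function on the fine split, with the vertex values \<open>a\<close> and the
  deviations \<open>A V\<close> and \<open>B\<close> at the inpoints from the affine interpolant of
  \<open>a\<close>. The functions on the coarse split are those with \<open>A = 0\<close>.\<close>

definition pl :: "('a \<Rightarrow> 'b::real_vector) \<Rightarrow> ('a \<Rightarrow> 'b) \<Rightarrow> 'b \<Rightarrow> 'a \<Rightarrow> 'b" where
  "pl a A B x = (\<Sum>Z\<in>S. lam Z x *\<^sub>R a Z) + (\<Sum>V\<in>S. hatF V x *\<^sub>R A V) + hatS x *\<^sub>R B"

lemma linear_pl: "linear L \<Longrightarrow> L (pl a A B x) = pl (\<lambda>Z. L (a Z)) (\<lambda>V. L (A V)) (L B) x"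
  by (simp add: pl_def linear_add linear_sum linear_scale)

lemma pl_add: "pl (\<lambda>Z. a Z + r *\<^sub>R a' Z) (\<lambda>V. A V + r *\<^sub>R A' V) (B + r *\<^sub>R B') x = pl a A B x + r *\<^sub>R pl a' A' B' x"
  by (simp add: pl_def sum.distrib scaleR_right_distrib scaleR_sum_right mult.commute algebra_simps)

lemma pl_sector:
  assumes "sector V U x"
  shows "pl a A B x = (\<Sum>Z\<in>S. lam Z x *\<^sub>R a Z) + facet_coord V U x *\<^sub>R A V + (lam V x / beta V) *\<^sub>R B"
proof -
  note s = sectorD[OF assms]
  have "(\<Sum>Z\<in>S - {V}. hatF Z x *\<^sub>R A Z) = 0"
    by (rule sum.neutral) (use hatF_other[OF s(1)] in auto)
  then have "(\<Sum>Z\<in>S. hatF Z x *\<^sub>R A Z) = hatF V x *\<^sub>R A V"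
    using s(2) by (simp add: sum.remove[of S V])
  then show ?thesis by (simp add: pl_def in_cone_hatS[OF s(1)] sector_hatF[OF assms])
qed

lemma pl_vertex: "Z \<in> S \<Longrightarrow> pl a A B Z = a Z"
  by (simp add: pl_def lam_vertex hatF_vertex hatS_vertex if_distrib[of "\<lambda>c. c *\<^sub>R _"] cong: if_cong)

lemma pl_facet:
  assumes "V \<in> S" "x \<in> D" "lam V x = 0"
  shows "pl a A B x = (\<Sum>Z\<in>S. lam Z x *\<^sub>R a Z) + hatF V x *\<^sub>R A V"
proof -
  have "(\<Sum>Z\<in>S - {V}. hatF Z x *\<^sub>R A Z) = 0"
    by (rule sum.neutral) (use hatF_facet_other[OF assms] in auto)
  then have "(\<Sum>Z\<in>S. hatF Z x *\<^sub>R A Z) = hatF V x *\<^sub>R A V"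
    using assms(1) by (simp add: sum.remove[of S V])
  then show ?thesis by (simp add: pl_def hatS_facet[OF assms])
qed

lemma continuous_hatS: "continuous_on A hatS"
  by (rule loclip_continuous[OF loclip_hatS])

lemma continuous_hatF: "V \<in> S \<Longrightarrow> continuous_on A (hatF V)"
  by (rule loclip_continuous[OF loclip_hatF])

lemma continuous_pl:
  fixes a :: "'a \<Rightarrow> 'b::real_normed_vector"
  shows "continuous_on X (pl a A B)"
  unfolding pl_def[abs_def] by (intro continuous_intros continuous_lam continuous_hatS continuous_hatF)

lemma facet_coord_affine: "facet_coord V U x = facet_coord V U 0 + facet_coord_grad V U x"
  unfolding facet_coord_expand facet_coord_grad_def grad_def by (simp add: algebra_simps diff_divide_distrib add_divide_distrib)

lemma pl_affine_on_cell:
  fixes a :: "'a \<Rightarrow> real"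
  assumes "V \<in> S" "U \<in> S" "U \<noteq> V"
  shows "\<exists>g c. linear g \<and> (\<forall>x\<in>convex hull (cell V U). pl a A B x = g x + c)"
proof -
  let ?g = "\<lambda>x. (\<Sum>Z\<in>S. a Z * grad Z x) + A V * facet_coord_grad V U x + (B / beta V) * grad V x"
  have lin: "linear (\<lambda>x. c * h x)" if "linear h" for h :: "'a \<Rightarrow> real" and c
    using linear_compose_scale_right[OF that, of c] by simp
  have "linear ?g"
    by (intro linear_compose_add linear_compose_sum ballI lin linear_grad linear_facet_coord_grad assms)
  moreover have "pl a A B x = ?g x + ((\<Sum>Z\<in>S. a Z * lam Z 0) + A V * facet_coord V U 0 + (B / beta V) * lam V 0)"
    if x: "x \<in> convex hull (cell V U)" for x
  proof -
    have "sector V U x" by (rule sector_hull[OF assms x])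
    then have "pl a A B x = (\<Sum>Z\<in>S. lam Z x *\<^sub>R a Z) + facet_coord V U x *\<^sub>R A V + (lam V x / beta V) *\<^sub>R B"
      by (rule pl_sector)
    also have "facet_coord V U x = facet_coord V U 0 + facet_coord_grad V U x" by (rule facet_coord_affine)
    also have "(\<Sum>Z\<in>S. lam Z x *\<^sub>R a Z) = (\<Sum>Z\<in>S. a Z * grad Z x) + (\<Sum>Z\<in>S. a Z * lam Z 0)"
      by (simp add: grad_def algebra_simps flip: sum.distrib)
    finally show ?thesis by (simp add: grad_def algebra_simps diff_divide_distrib)
  qed
  ultimately show ?thesis by blast
qed

lemma pl_affine_on_cone:
  fixes a :: "'a \<Rightarrow> real"
  assumes "V \<in> S"
  shows "\<exists>g c. linear g \<and> (\<forall>x\<in>convex hull (cone V). pl a (\<lambda>_. 0) B x = g x + c)"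
proof -
  let ?g = "\<lambda>x. (\<Sum>Z\<in>S. a Z * grad Z x) + (B / beta V) * grad V x"
  have lin: "linear (\<lambda>x. c * h x)" if "linear h" for h :: "'a \<Rightarrow> real" and c
    using linear_compose_scale_right[OF that, of c] by simp
  have "linear ?g"
    by (intro linear_compose_add linear_compose_sum ballI lin linear_grad assms)
  moreover have "pl a (\<lambda>_. 0) B x = ?g x + ((\<Sum>Z\<in>S. a Z * lam Z 0) + (B / beta V) * lam V 0)"
    if x: "x \<in> convex hull (cone V)" for x
  proof -
    have "in_cone V x" using in_cone_hull[OF assms] x by (simp add: cone_def)
    then have "pl a (\<lambda>_. 0) B x = (\<Sum>Z\<in>S. lam Z x *\<^sub>R a Z) + (lam V x / beta V) *\<^sub>R B"
      by (simp add: pl_def in_cone_hatS)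
    also have "(\<Sum>Z\<in>S. lam Z x *\<^sub>R a Z) = (\<Sum>Z\<in>S. a Z * grad Z x) + (\<Sum>Z\<in>S. a Z * lam Z 0)"
      by (simp add: grad_def algebra_simps flip: sum.distrib)
    finally show ?thesis by (simp add: grad_def algebra_simps diff_divide_distrib)
  qed
  ultimately show ?thesis by blast
qed

text \<open>On the cell that contains \<open>x\<close>, both sides are affine, and \<open>x\<close> is the combination of the vertices of the cell
  with the coefficients \<open>coef\<close>, \<open>hatF\<close> and \<open>hatS\<close>.\<close>

lemma pl_representation:
  fixes f :: "'a \<Rightarrow> real"
  assumes aff: "\<And>V U. V \<in> S \<Longrightarrow> U \<in> S \<Longrightarrow> U \<noteq> V \<Longrightarrow>
      \<exists>g c. linear g \<and> (\<forall>x\<in>convex hull (cell V U). f x = g x + c)"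
    and x: "x \<in> D"
  shows "f x = pl f (\<lambda>V. f (WF V) - (\<Sum>Z\<in>S. tau V Z * f Z)) (f (W S) - (\<Sum>Z\<in>S. beta Z * f Z)) x"
proof -
  obtain V U where s: "sector V U x" using ex_sector by blast
  note sd = sectorD[OF s] and c0 = coef_sector[OF s]
  obtain g c where g: "linear g" and f: "\<And>y. y \<in> convex hull (cell V U) \<Longrightarrow> f y = g y + c"
    using aff[OF sd(2,3,4)] by blast
  have cf: "coef V Z x * f Z = coef V Z x * (g Z + c)" if "Z \<in> S" for Z
  proof (cases "Z = V \<or> Z = U")
    case True then show ?thesis using c0 by auto
  next
    case False
    then have "f Z = g Z + c" using that by (intro f hull_inc) (auto simp: cell_def)
    then show ?thesis by simp
  qed
  have "(\<Sum>Z\<in>S. coef V Z x * f Z) = (\<Sum>Z\<in>S. coef V Z x * (g Z + c))"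
    by (rule sum.cong[OF refl cf])
  also have "\<dots> = (\<Sum>Z\<in>S. coef V Z x * g Z) + c * (\<Sum>Z\<in>S. coef V Z x)"
    by (simp add: algebra_simps sum.distrib sum_distrib_left)
  finally have "(\<Sum>Z\<in>S. coef V Z x * f Z) = (\<Sum>Z\<in>S. coef V Z x * g Z) + c * (\<Sum>Z\<in>S. coef V Z x)" .
  moreover have "f (WF V) = g (WF V) + c" "f (W S) = g (W S) + c"
    by (rule f, rule hull_inc, simp add: cell_def)+
  moreover have "g x = (\<Sum>Z\<in>S. coef V Z x * g Z) + hatF V x * g (WF V) + hatS x * g (W S)"
    by (subst coef_point[of V x, symmetric]) (simp add: linear_add[OF g] linear_sum[OF g] linear_scale[OF g])
  moreover have "f x = g x + c" by (rule f[OF sector_in_cell[OF s x]])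
  ultimately have fx: "f x = (\<Sum>Z\<in>S. coef V Z x * f Z) + hatF V x * f (WF V) + hatS x * f (W S)"
    using sum_coef[of V x] by (simp add: algebra_simps)
  have "(\<Sum>Z\<in>S. coef V Z x * f Z) = (\<Sum>Z\<in>S. lam Z x * f Z) - hatF V x * (\<Sum>Z\<in>S. tau V Z * f Z) - hatS x * (\<Sum>Z\<in>S. beta Z * f Z)"
    by (simp add: coef_def algebra_simps sum_subtractf sum.distrib sum_distrib_left)
  then show ?thesis
    unfolding pl_sector[OF s] using fx sector_hatF[OF s] in_cone_hatS[OF sd(1)] by (simp add: algebra_simps)
qed

text \<open>A function that is affine on the cone over a facet has no deviation at the inpoint of this facet.\<close>

lemma pl_representation_coarse:
  fixes f :: "'a \<Rightarrow> real"
  assumes aff: "\<And>V. V \<in> S \<Longrightarrow> \<exists>g c. linear g \<and> (\<forall>x\<in>convex hull (cone V). f x = g x + c)"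
    and x: "x \<in> D"
  shows "f x = pl f (\<lambda>_. 0) (f (W S) - (\<Sum>Z\<in>S. beta Z * f Z)) x"
proof -
  have z: "f (WF V) - (\<Sum>Z\<in>S. tau V Z * f Z) = 0" if V: "V \<in> S" for V
  proof -
    obtain g c where g: "linear g" and f: "\<And>y. y \<in> convex hull (cone V) \<Longrightarrow> f y = g y + c"
      using aff[OF V] by blast
    \<comment> \<open>The degenerate cell V V, the cone with the inpoint of the facet added, serves to place
      the inpoint in the hull of the cone.\<close>
    have "WF V \<in> convex hull (cell V V)" by (rule hull_inc) (simp add: cell_def)
    then have "f (WF V) = g (WF V) + c" using cell_subset_cone[OF V, of V] by (intro f) (auto simp: cone_def)
    also have "g (WF V) = (\<Sum>Z\<in>S. tau V Z * g Z)"
      unfolding WF_point[symmetric] by (simp add: linear_sum[OF g] linear_scale[OF g])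
    also have "\<dots> + c = (\<Sum>Z\<in>S. tau V Z * (g Z + c))"
      by (simp add: distrib_left sum.distrib sum_tau flip: sum_distrib_right)
    also have "\<dots> = (\<Sum>Z\<in>S. tau V Z * f Z)"
    proof (rule sum.cong[OF refl])
      fix Z assume Z: "Z \<in> S"
      show "tau V Z * (g Z + c) = tau V Z * f Z"
      proof (cases "Z = V")
        case True then show ?thesis using tau_self[OF V] by simp
      next
        case False
        then have "f Z = g Z + c" using Z by (intro f hull_inc) (auto simp: cone_def)
        then show ?thesis by simp
      qed
    qed
    finally show ?thesis by simp
  qed
  have "\<exists>g c. linear g \<and> (\<forall>x\<in>convex hull (cell V U). f x = g x + c)" if V: "V \<in> S" "U \<in> S" "U \<noteq> V" for V U
  proof -
    obtain g c where "linear g" "\<forall>y\<in>convex hull (cone V). f y = g y + c" using aff[OF V(1)] by blast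
    then show ?thesis using cell_subset_cone[OF V(1), of U] unfolding cone_def by blast
  qed
  from pl_representation[OF this x] show ?thesis by (simp add: pl_def z)
qed

text \<open>The constant divergence of \<open>pl a A B\<close> on the sector \<open>p = (V, U)\<close>: there the
  hat functions have the differentials \<open>facet_coord_grad V U\<close> for \<open>WF V\<close>,
  \<open>grad V / beta V\<close> for \<open>W S\<close>, and zero for the other inpoints.\<close>

definition sector_div :: "('a \<Rightarrow> 'a) \<Rightarrow> ('a \<Rightarrow> 'a) \<Rightarrow> 'a \<Rightarrow> 'a \<times> 'a \<Rightarrow> real" where
  "sector_div a A B p = (\<Sum>Z\<in>S. grad Z (a Z)) + facet_coord_grad (fst p) (snd p) (A (fst p)) + grad (fst p) B / beta (fst p)"

text \<open>The index set of the three groups of hat functions, which turns \<open>pl a A B\<close> into a single sum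
  as required by \<open>weak_divI\<close>.\<close>

definition plJ :: "('a + 'a + unit) set" where "plJ = S <+> S <+> {()}"

abbreviation "plf \<equiv> case_sum lam (case_sum hatF (\<lambda>_. hatS))"
abbreviation "plf' \<equiv> case_sum (\<lambda>Z x. grad Z) (case_sum hatF' (\<lambda>_. hatS'))"

lemma plJ_sum: "(\<Sum>j\<in>plJ. h j) = (\<Sum>Z\<in>S. h (Inl Z)) + ((\<Sum>V\<in>S. h (Inr (Inl V))) + h (Inr (Inr ())))"
  unfolding plJ_def by (simp add: sum.Plus)

lemma finite_plJ: "finite plJ" unfolding plJ_def by simp

lemma plf_wderiv: "j \<in> plJ \<Longrightarrow> wderiv (plf j) (plf' j)"
  unfolding plJ_def using wderiv_lam wderiv_hatF wderiv_hatS by (auto elim!: PlusE)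

lemma pl_plJ: "pl a A B x = (\<Sum>j\<in>plJ. plf j x *\<^sub>R case_sum a (case_sum A (\<lambda>_. B)) j)"
  unfolding plJ_sum by (simp add: pl_def)

lemma plf'_open_sector:
  assumes p: "p \<in> pairs" "x \<in> open_sector p"
  shows "(\<Sum>j\<in>plJ. plf' j x (case_sum a (case_sum A (\<lambda>_. B)) j)) = sector_div a A B p"
proof -
  have hF: "hatF' V x d = (if fst p = V then facet_coord_grad V (snd p) d else 0)" for V d
    unfolding hatF'_def by (rule open_sector_sum[OF p])
  have hS: "hatS' x d = (1 / beta (fst p)) * grad (fst p) d" for d
    unfolding hatS'_def by (rule open_sector_sum[OF p])
  have "fst p \<in> S" using p by (auto simp: pairs_def)
  then show ?thesis unfolding plJ_sum by (simp add: hF hS sector_div_def)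
qed

lemma weak_div_pl:
  assumes "\<And>p. p \<in> pairs \<Longrightarrow> sector_div a A B p = r"
  shows "weak_div D (pl a A B) (\<lambda>x. r)"
proof (rule weak_divI[OF compact_D finite_plJ plf_wderiv pl_plJ])
  show "AE x in lborel. x \<in> interior D \<longrightarrow> (\<Sum>j\<in>plJ. plf' j x (case_sum a (case_sum A (\<lambda>_. B)) j)) = r"
    using AE_open_sector by eventually_elim (use plf'_open_sector assms in auto)
qed auto

text \<open>The witness is the barycentre of the cell.\<close>

lemma open_sector_interior_ne:
  assumes "p \<in> pairs"
  shows "open_sector p \<inter> interior D \<noteq> {}"
proof -
  obtain V U where p: "p = (V, U)" "V \<in> S" "U \<in> S" "U \<noteq> V" using assms by (auto simp: pairs_def)
  let ?N = "real DIM('a) + 1"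
  \<comment> \<open>The cell has n + 1 vertices: W S with coordinates beta, WF V with coordinates tau V,
    and the points of S other than V and U, with coordinates e.\<close>
  define e where "e Z = (if Z \<in> {V, U} then 0 else 1 :: real)" for Z
  define k where "k Z = (e Z + tau V Z + beta Z) / ?N" for Z
  have "sum e S = (\<Sum>Z\<in>S - {V, U}. 1)"
    by (rule sum.mono_neutral_cong_right) (auto simp: e_def)
  then have "sum e S = real (card (S - {V, U}))" by simp
  then have "sum e S = real DIM('a) - 1" using card_ridge[OF p(2-4)] dim2 by simp
  then have "sum k S = 1"
    unfolding k_def using dim2 by (simp add: sum_divide_distrib[symmetric] sum.distrib sum_tau sum_beta)
  define x where "x = (\<Sum>Z\<in>S. k Z *\<^sub>R Z)"
  have lam: "lam Z x = (e Z + tau V Z + beta Z) / ?N" if "Z \<in> S" for Z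
    using lam_unique[OF \<open>sum k S = 1\<close> _ that, of x] by (simp add: x_def k_def)
  have eV: "e V = 0" "e U = 0" by (auto simp: e_def)
  have e0: "e Z \<ge> 0" for Z by (simp add: e_def)
  have tau0: "tau V Z \<ge> 0" if "Z \<in> S" for Z
    using that tau_pos[OF p(2) that] tau_self[OF p(2)] by (cases "Z = V") auto
  have N: "?N > 0" by simp
  have lb: "lam Z x / beta Z = (e Z + tau V Z) / (?N * beta Z) + 1 / ?N" if "Z \<in> S" for Z
    using that beta_pos[OF that] by (simp add: lam add_divide_distrib)
  have "lam V x / beta V = 1 / ?N" using lb[OF p(2)] eV tau_self[OF p(2)] by simp
  moreover have "(e Z + tau V Z) / (?N * beta Z) > 0" if "Z \<in> S" "Z \<noteq> V" for Z
    using e0[of Z] tau_pos[OF p(2) that] beta_pos[OF that(1)] N by (intro divide_pos_pos mult_pos_pos) linarith+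
  ultimately have 1: "lam V x / beta V < lam Z x / beta Z" if "Z \<in> S - {V}" for Z
    using that lb by simp
  have q: "facet_coord V Z x = 1 / ?N + e Z / (?N * tau V Z)" if "Z \<in> S" "Z \<noteq> V" for Z
  proof -
    have "lam Z x - beta Z / beta V * lam V x = (e Z + tau V Z) / ?N"
      using that p(2) beta_pos[OF p(2)] eV tau_self[OF p(2)] by (simp add: lam add_divide_distrib)
    then show ?thesis unfolding facet_coord_def using tau_pos[OF p(2) that] by (simp add: add_divide_distrib)
  qed
  have 2: "facet_coord V U x < facet_coord V Z x" if "Z \<in> S - {V, U}" for Z
  proof -
    have "e Z = 1" using that by (simp add: e_def)
    moreover have "tau V Z > 0" using that by (intro tau_pos p) auto
    ultimately have "e Z / (?N * tau V Z) > 0" using N by (intro divide_pos_pos mult_pos_pos) auto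
    then show ?thesis using q[of Z] q[OF p(3,4)] eV that by simp
  qed
  have "0 < lam Z x" if "Z \<in> S" for Z
    using e0[of Z] tau0[OF that] beta_pos[OF that] N unfolding lam[OF that]
    by (intro divide_pos_pos) linarith+
  then have "x \<in> interior D" by (simp add: mem_interior_D)
  moreover have "x \<in> open_sector p" using 1 2 p by (simp add: open_sector_def)
  ultimately show ?thesis by blast
qed

text \<open>Test with a bump function that is supported in the sector \<open>p\<close>, where the divergence is constant.\<close>

lemma weak_div_pl_zero:
  assumes w: "weak_div D (pl a A B) (\<lambda>x. 0)" and p: "p \<in> pairs"
  shows "sector_div a A B p = 0"
proof -
  obtain y where y: "y \<in> open_sector p \<inter> interior D" using open_sector_interior_ne[OF p] by blast
  obtain \<phi> \<phi>' r where \<phi>: "test_fun (open_sector p \<inter> interior D) \<phi> \<phi>'" "\<And>x. \<phi> x \<ge> 0" "r > 0" "\<And>x. x \<in> ball y r \<Longrightarrow> \<phi> x > 0"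
    using ex_bump[OF _ y] open_open_sector[OF p] by blast
  have t: "test_fun (interior D) \<phi> \<phi>'" using \<phi>(1) unfolding test_fun_def by blast
  obtain K where K: "compact K" "K \<subseteq> open_sector p \<inter> interior D" "\<forall>x. x \<notin> K \<longrightarrow> \<phi> x = 0"
    using test_fun_zero[OF \<phi>(1)] by (elim exE conjE)
  have "(\<integral>x. \<phi> x * (\<Sum>j\<in>plJ. plf' j x (case_sum a (case_sum A (\<lambda>_. B)) j)) \<partial>lborel) = 0"
    using weak_div_integral(2)[OF finite_plJ plf_wderiv pl_plJ t] w t unfolding weak_div_def by fastforce
  moreover have "(\<integral>x. \<phi> x * (\<Sum>j\<in>plJ. plf' j x (case_sum a (case_sum A (\<lambda>_. B)) j)) \<partial>lborel) =
      (\<integral>x. \<phi> x * sector_div a A B p \<partial>lborel)"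
  proof (intro Bochner_Integration.integral_cong refl)
    fix x
    show "\<phi> x * (\<Sum>j\<in>plJ. plf' j x (case_sum a (case_sum A (\<lambda>_. B)) j)) = \<phi> x * sector_div a A B p"
      using K plf'_open_sector[OF p, of x a A B] by (cases "x \<in> K") auto
  qed
  ultimately have "integral\<^sup>L lborel \<phi> * sector_div a A B p = 0" by simp
  moreover have "integrable lborel \<phi>"
    by (rule integrable_compact_support[OF K(1) test_fun_cont[OF t]]) (use K in auto)
  then have "integral\<^sup>L lborel \<phi> > 0" by (rule integral_pos[OF _ \<phi>(2-4)])
  ultimately show ?thesis by simp
qed

end

section \<open>The element spaces in terms of vector fields\<close>

lemma wderiv_cmult: "wderiv f f' \<Longrightarrow> wderiv (\<lambda>x. r * f x) (\<lambda>x d. r * f' x d)"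
  using wderiv_mult[OF wderiv_const, of f f' r] by simp

text \<open>The integral of the Poincare operator along a ray, on which the coefficient is affine.\<close>

lemma moment_integral:
  assumes "n > 0"
  shows "integral {0..1} (\<lambda>t::real. t ^ (n - 1) * ((a + t * b) * w)) = (a / real n + b / (real n + 1)) * w"
proof -
  obtain m where m: "n = Suc m" using assms gr0_implies_Suc by blast
  let ?F = "\<lambda>t. (a * (t ^ Suc m / real (Suc m)) + b * (t ^ Suc (Suc m) / real (Suc (Suc m)))) * w"
  have "(?F has_real_derivative t ^ m * ((a + t * b) * w)) (at t within {0..1})" for t
    by (rule derivative_eq_intros refl | simp add: field_simps del: of_nat_Suc)+
  then have "((\<lambda>t. t ^ m * ((a + t * b) * w)) has_integral (?F 1 - ?F 0)) {0..1}"
    by (intro fundamental_theorem_of_calculus)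
       (auto simp: has_real_derivative_iff_has_vector_derivative)
  then show ?thesis using m by (simp add: integral_unique algebra_simps)
qed

locale element = split_simplex S W + volume_form \<omega>
  for S :: "'a::euclidean_space set" and W :: "'a set \<Rightarrow> 'a" and \<omega> :: "'a list \<Rightarrow> real" +
  fixes ori :: "'a set \<Rightarrow> 'a list"
  assumes ori: "orientation S ori"
begin

lemma ext_deriv_flux:
  assumes v: "continuous_on D v" and f: "continuous_on D f" and w: "weak_div D v f"
  shows "ext_deriv (DIM('a) - 1) D (flux D v) = dens D f" "flux D v \<in> C0d_forms (DIM('a) - 1) D"
proof -
  have h: "has_ext_deriv (DIM('a) - 1) D (flux D v) (dens D f)"
    using has_ext_deriv_flux_iff[OF compact_D v f] w by simp
  then show "flux D v \<in> C0d_forms (DIM('a) - 1) D" using flux_C0[OF v] by (auto simp: C0d_forms_def)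
  show "ext_deriv (DIM('a) - 1) D (flux D v) = dens D f"
    unfolding ext_deriv_def
  proof (rule the_equality)
    show "has_ext_deriv (DIM('a) - 1) D (flux D v) (dens D f)" by (rule h)
    fix y assume y: "has_ext_deriv (DIM('a) - 1) D (flux D v) y"
    then have "y \<in> C0_forms DIM('a) D" using Suc_codim by (simp add: has_ext_deriv_def)
    then obtain g where g: "continuous_on D g" "y = dens D g" using C0_imp_dens by blast
    then have "weak_div D v g" using y has_ext_deriv_flux_iff[OF compact_D v g(1)] by simp
    then have "\<forall>x\<in>D. g x = f x"
      using weak_div_unique[OF compact_D convex_convex_hull interior_D_ne g(1) f _ w] by blast
    then show "y = dens D f" unfolding g(2) dens_eq_iff .
  qed
qed

lemma C0d_flux:
  assumes "u \<in> C0d_forms (DIM('a) - 1) D"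
  shows "\<exists>v f. continuous_on D v \<and> continuous_on D f \<and> weak_div D v f \<and> u = flux D v \<and>
    ext_deriv (DIM('a) - 1) D u = dens D f"
proof -
  obtain y where u: "u \<in> C0_forms (DIM('a) - 1) D" and y: "has_ext_deriv (DIM('a) - 1) D u y"
    using assms by (auto simp: C0d_forms_def)
  obtain v where v: "continuous_on D v" "u = flux D v" using C0_imp_flux[OF u] by blast
  have "y \<in> C0_forms DIM('a) D" using y Suc_codim by (simp add: has_ext_deriv_def)
  then obtain f where f: "continuous_on D f" "y = dens D f" using C0_imp_dens by blast
  have "weak_div D v f" using y has_ext_deriv_flux_iff[OF compact_D v(1) f(1)] v f by simp
  then show ?thesis using v f ext_deriv_flux(1)[OF v(1) f(1)] by blast
qed

lemma pl_cong:
  "(\<And>Z. Z \<in> S \<Longrightarrow> a Z = a' Z) \<Longrightarrow> (\<And>V. V \<in> S \<Longrightarrow> A V = A' V) \<Longrightarrow> B = B' \<Longrightarrow> pl a A B x = pl a' A' B' x"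
  by (simp add: pl_def)

lemma linear_contract:
  assumes "length \<xi> = DIM('a) - 1"
  shows "linear (\<lambda>v. \<omega> (v # \<xi>))"
  using alt_lin[OF \<omega>, of "[]" \<xi>] assms Suc_codim by simp

lemma contract_len: "length \<xi> \<noteq> DIM('a) - 1 \<Longrightarrow> \<omega> (v # \<xi>) = 0"
  using Suc_codim by (intro alt_len[OF \<omega>]) auto

text \<open>The coefficients of the form are linear images of the proxy, and these separate vectors; so the representation
  of real piecewise affine functions carries over to the proxy.\<close>

lemma C0P1_imp_flux:
  assumes "u \<in> C0P1_forms (DIM('a) - 1) (refinement (DIM('a) - 1 - 1) W S)"
  shows "\<exists>a A B. u = flux D (pl a A B)"
proof -
  have "u \<in> C0_forms (DIM('a) - 1) D" using assms unfolding C0P1_forms_def fine_union by blast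
  then obtain v where v: "u = flux D v" using C0_imp_flux by blast
  have aff: "\<exists>g c. linear g \<and> (\<forall>x\<in>convex hull (cell V U). \<omega> (v x # \<xi>) = g x + c)"
    if VU: "V \<in> S" "U \<in> S" "U \<noteq> V" for V U \<xi>
  proof -
    have "cell V U \<in> refinement (DIM('a) - 1 - 1) W S" by (rule fine_cell_in[OF VU])
    then obtain g c where "linear g" "\<forall>x\<in>convex hull (cell V U). u x \<xi> = g x + c"
      using assms unfolding C0P1_forms_def by blast
    moreover have "u x \<xi> = \<omega> (v x # \<xi>)" if "x \<in> convex hull (cell V U)" for x
      using that cell_subset_D[OF VU(1)] by (auto simp: v flux_def)
    ultimately show ?thesis by auto
  qed
  let ?A = "\<lambda>V. v (WF V) - (\<Sum>Z\<in>S. tau V Z *\<^sub>R v Z)" and ?B = "v (W S) - (\<Sum>Z\<in>S. beta Z *\<^sub>R v Z)"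
  have "v x = pl v ?A ?B x" if x: "x \<in> D" for x
  proof (rule flux_inj, rule ext)
    fix \<xi> :: "'a list"
    show "\<omega> (v x # \<xi>) = \<omega> (pl v ?A ?B x # \<xi>)"
    proof (cases "length \<xi> = DIM('a) - 1")
      case True
      note lin = linear_contract[OF True]
      have "\<omega> (v x # \<xi>) = pl (\<lambda>x. \<omega> (v x # \<xi>)) (\<lambda>V. \<omega> (v (WF V) # \<xi>) - (\<Sum>Z\<in>S. tau V Z * \<omega> (v Z # \<xi>)))
          (\<omega> (v (W S) # \<xi>) - (\<Sum>Z\<in>S. beta Z * \<omega> (v Z # \<xi>))) x"
        by (rule pl_representation[OF aff x])
      also have "\<dots> = \<omega> (pl v ?A ?B x # \<xi>)"
        by (simp add: linear_pl[OF lin] linear_diff[OF lin] linear_sum[OF lin] linear_scale[OF lin])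
      finally show ?thesis .
    qed (simp add: contract_len)
  qed
  then have "u = flux D (pl v ?A ?B)" unfolding v flux_eq_iff by blast
  then show ?thesis by (intro exI)
qed

lemma flux_pl_C0P1:
  "flux D (pl a A B) \<in> C0P1_forms (DIM('a) - 1) (refinement (DIM('a) - 1 - 1) W S)"
  unfolding C0P1_forms_def fine_union
proof (intro CollectI conjI ballI allI)
  show "flux D (pl a A B) \<in> C0_forms (DIM('a) - 1) D" by (rule flux_C0[OF continuous_pl])
  fix \<sigma> \<xi> assume "\<sigma> \<in> refinement (DIM('a) - 1 - 1) W S"
  then obtain V U where VU: "V \<in> S" "U \<in> S" "U \<noteq> V" "\<sigma> \<subseteq> cell V U" using fine_cell_cover by blast
  have sub: "convex hull \<sigma> \<subseteq> convex hull (cell V U)" by (rule hull_mono[OF VU(4)])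
  have D: "x \<in> D" if "x \<in> convex hull \<sigma>" for x using that sub cell_subset_D[OF VU(1)] by blast
  show "\<exists>g c. linear g \<and> (\<forall>x\<in>convex hull \<sigma>. flux D (pl a A B) x \<xi> = g x + c)"
  proof (cases "length \<xi> = DIM('a) - 1")
    case True
    obtain g c where "linear g" "\<forall>x\<in>convex hull (cell V U).
        pl (\<lambda>Z. \<omega> (a Z # \<xi>)) (\<lambda>V. \<omega> (A V # \<xi>)) (\<omega> (B # \<xi>)) x = g x + c"
      using pl_affine_on_cell[OF VU(1-3)] by blast
    then show ?thesis using sub D
      by (intro exI[of _ g] exI[of _ c]) (auto simp: flux_def linear_pl[OF linear_contract[OF True]])
  next
    case False
    then show ?thesis using D
      by (intro exI[of _ "\<lambda>_. 0"] exI[of _ 0]) (auto simp: flux_def contract_len linear_zero)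
  qed
qed

lemma C0P1_imp_dens:
  assumes "u \<in> C0P1_forms DIM('a) (refinement (DIM('a) - 1) W S)"
  shows "\<exists>c \<beta>. u = dens D (pl c (\<lambda>_. 0) \<beta>)"
proof -
  have "u \<in> C0_forms DIM('a) D" using assms unfolding C0P1_forms_def coarse_union by blast
  then obtain f where f: "u = dens D f" using C0_imp_dens by blast
  obtain \<xi> where \<xi>: "\<omega> \<xi> \<noteq> 0" using ex_nz by blast
  have aff: "\<exists>g c. linear g \<and> (\<forall>x\<in>convex hull (cone V). f x = g x + c)" if V: "V \<in> S" for V
  proof -
    have "cone V \<in> refinement (DIM('a) - 1) W S" by (rule coarse_cell_in[OF V])
    then obtain g c where g: "linear g" "\<forall>x\<in>convex hull (cone V). u x \<xi> = g x + c"
      using assms unfolding C0P1_forms_def by blast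
    have fx: "f x = (1 / \<omega> \<xi>) * g x + c / \<omega> \<xi>" if "x \<in> convex hull (cone V)" for x
    proof -
      have "x \<in> D" using that cone_subset_D[of V] by (auto simp: cone_def)
      moreover have "u x \<xi> = g x + c" using g(2) that by blast
      ultimately have "f x * \<omega> \<xi> = g x + c" by (simp add: f dens_def scaleR_fun_def)
      then show ?thesis using \<xi> by (simp add: field_simps)
    qed
    have "linear (\<lambda>x. (1 / \<omega> \<xi>) * g x)"
      using linear_compose_scale_right[OF g(1), of "1 / \<omega> \<xi>"] by simp
    then show ?thesis using fx by (intro exI conjI ballI)
  qed
  have "u = dens D (pl f (\<lambda>_. 0) (f (W S) - (\<Sum>Z\<in>S. beta Z * f Z)))"
    unfolding f dens_eq_iff using pl_representation_coarse[OF aff] by blast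
  then show ?thesis by (intro exI)
qed

lemma dens_pl_C0P1:
  "dens D (pl c (\<lambda>_. 0) \<beta>) \<in> C0P1_forms DIM('a) (refinement (DIM('a) - 1) W S)"
  unfolding C0P1_forms_def coarse_union
proof (intro CollectI conjI ballI allI)
  show "dens D (pl c (\<lambda>_. 0) \<beta>) \<in> C0_forms DIM('a) D" by (rule dens_C0[OF continuous_pl])
  fix \<sigma> \<xi> assume "\<sigma> \<in> refinement (DIM('a) - 1) W S"
  then obtain V where V: "V \<in> S" "\<sigma> \<subseteq> cone V" using coarse_cell_cover by blast
  have sub: "convex hull \<sigma> \<subseteq> convex hull (cone V)" by (rule hull_mono[OF V(2)])
  obtain g c0 where g: "linear g" "\<forall>x\<in>convex hull (cone V). pl c (\<lambda>_. 0) \<beta> x = g x + c0"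
    using pl_affine_on_cone[OF V(1)] by blast
  have "dens D (pl c (\<lambda>_. 0) \<beta>) x \<xi> = \<omega> \<xi> * g x + \<omega> \<xi> * c0" if "x \<in> convex hull \<sigma>" for x
  proof -
    have x: "x \<in> convex hull (cone V)" using that sub by blast
    then have "x \<in> D" using cone_subset_D[of V] by (auto simp: cone_def)
    then show ?thesis using g(2) x by (simp add: dens_def scaleR_fun_def algebra_simps)
  qed
  moreover have "linear (\<lambda>x. \<omega> \<xi> * g x)"
    using linear_compose_scale_right[OF g(1), of "\<omega> \<xi>"] by simp
  ultimately show "\<exists>g c'. linear g \<and> (\<forall>x\<in>convex hull \<sigma>. dens D (pl c (\<lambda>_. 0) \<beta>) x \<xi> = g x + c')"
    by (intro exI conjI ballI)
qed

lemma dens_zero: "dens D (\<lambda>_. 0) = 0"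
  by (auto simp: dens_def fun_eq_iff scaleR_fun_def)

text \<open>A jump of the field across a face would contribute to its divergence, but the fields are continuous; so only
  the constants on the sectors matter.\<close>

lemma K_space_flux_iff: "u \<in> K_space (DIM('a) - 1) W S \<longleftrightarrow>
  (\<exists>a A B. u = flux D (pl a A B) \<and> (\<forall>p\<in>pairs. sector_div a A B p = 0))"
proof -
  have "has_ext_deriv (DIM('a) - 1) D (flux D (pl a A B)) 0 \<longleftrightarrow> (\<forall>p\<in>pairs. sector_div a A B p = 0)" for a A B
    using has_ext_deriv_flux_iff[OF compact_D continuous_pl continuous_on_const, of a A B 0]
      weak_div_pl[of a A B 0] weak_div_pl_zero[of a A B] unfolding dens_zero by blast
  then show ?thesis unfolding K_space_def using C0P1_imp_flux flux_pl_C0P1 by blast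
qed

lemma K_space_dens_iff: "u \<in> K_space DIM('a) W S \<longleftrightarrow> (\<exists>c \<beta>. u = dens D (pl c (\<lambda>_. 0) \<beta>))"
proof -
  have "has_ext_deriv DIM('a) D (dens D (pl c (\<lambda>_. 0) \<beta>)) 0" for c \<beta>
    by (rule has_ext_deriv_top[OF compact_D dens_C0[OF continuous_pl]])
  then show ?thesis unfolding K_space_def using C0P1_imp_dens dens_pl_C0P1 by blast
qed

lemma K_space_above_top: "K_space (DIM('a) + 1) W S = {0}"
proof
  show "K_space (DIM('a) + 1) W S \<subseteq> {0}"
    unfolding K_space_def C0P1_forms_def using C0_above_top by blast
  have "(0 :: 'a form) \<in> C0_forms j X" for j X
    using subspace_0[OF subspace_alt_forms] by (auto simp: C0_forms_def)
  moreover from this have "has_ext_deriv (DIM('a) + 1) D 0 0"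
    by (auto simp: has_ext_deriv_def)
  moreover have "\<exists>g c. linear g \<and> (\<forall>x\<in>X. (0 :: 'a form) x \<xi> = g x + c)" for X and \<xi> :: "'a list"
    by (intro exI[of _ "\<lambda>_. 0"] exI[of _ 0]) (simp add: linear_zero)
  ultimately show "{0} \<subseteq> K_space (DIM('a) + 1) W S"
    unfolding K_space_def C0P1_forms_def by blast
qed

text \<open>There is no contribution from \<open>K\<^bsup>n+1\<^esup>\<close>, which is zero.\<close>

lemma A_space_dens_iff: "u \<in> A_space DIM('a) W S \<longleftrightarrow> (\<exists>c \<beta>. u = dens D (pl c (\<lambda>_. 0) \<beta>))"
proof -
  have "poincare (DIM('a) + 1) D (W S) 0 = 0"
    by (simp add: poincare_def fun_eq_iff)
  then have "A_space DIM('a) W S = K_space DIM('a) W S"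
    unfolding A_space_def K_space_above_top by simp
  then show ?thesis using K_space_dens_iff by simp
qed

text \<open>The vector proxy of the Poincare operator applied to \<open>f \<omega>\<close>, where \<open>f = pl c 0 \<beta>\<close>. On every ray from \<open>W S\<close> the
  function \<open>f\<close> is affine, so that the integral over the ray combines its two end values with the weights
  \<open>1 / n\<close> and \<open>1 / (n + 1)\<close>.\<close>

definition radial_field :: "('a \<Rightarrow> real) \<Rightarrow> real \<Rightarrow> 'a \<Rightarrow> 'a" where
  "radial_field c \<beta> x = (pl c (\<lambda>_. 0) \<beta> (W S) / real DIM('a) +
     (pl c (\<lambda>_. 0) \<beta> x - pl c (\<lambda>_. 0) \<beta> (W S)) / (real DIM('a) + 1)) *\<^sub>R (x - W S)"

lemma continuous_radial_field: "continuous_on X (radial_field c \<beta>)"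
  unfolding radial_field_def[abs_def] by (intro continuous_intros continuous_pl) auto

lemma pl_in_cone:
  "in_cone V x \<Longrightarrow> pl c (\<lambda>_. 0) \<beta> x = (\<Sum>Z\<in>S. lam Z x * c Z) + lam V x / beta V * \<beta>" for \<beta> :: real
  by (simp add: pl_def in_cone_hatS)

text \<open>A ray from \<open>W S\<close> stays in one cone, on which the function is affine.\<close>

lemma pl_ray:
  fixes \<beta> :: real
  assumes "0 \<le> t" "t \<le> 1"
  shows "pl c (\<lambda>_. 0) \<beta> (W S + t *\<^sub>R (x - W S)) = pl c (\<lambda>_. 0) \<beta> (W S) + t * (pl c (\<lambda>_. 0) \<beta> x - pl c (\<lambda>_. 0) \<beta> (W S))"
proof -
  obtain V where V: "in_cone V x" using ex_in_cone by blast
  have VS: "V \<in> S" using in_coneD(1)[OF V] .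
  have e: "W S + t *\<^sub>R (x - W S) = (1 - t) *\<^sub>R W S + t *\<^sub>R x" by (simp add: algebra_simps)
  have "in_cone V ((1 - t) *\<^sub>R W S + t *\<^sub>R x)"
    using convexD[OF convex_in_cone[OF VS], of "W S" x "1 - t" t] V in_cone_WS[OF VS] assms by simp
  note p = pl_in_cone[OF this] pl_in_cone[OF V] pl_in_cone[OF in_cone_WS[OF VS]]
  have l: "lam Z ((1 - t) *\<^sub>R W S + t *\<^sub>R x) = (1 - t) * lam Z (W S) + t * lam Z x" if "Z \<in> S" for Z
    by (rule lam_affine_comb[OF that]) simp
  have "(\<Sum>Z\<in>S. lam Z ((1 - t) *\<^sub>R W S + t *\<^sub>R x) * c Z) = (1 - t) * (\<Sum>Z\<in>S. lam Z (W S) * c Z) + t * (\<Sum>Z\<in>S. lam Z x * c Z)"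
  proof -
    have "(\<Sum>Z\<in>S. lam Z ((1 - t) *\<^sub>R W S + t *\<^sub>R x) * c Z) = (\<Sum>Z\<in>S. ((1 - t) * lam Z (W S) + t * lam Z x) * c Z)"
      by (rule sum.cong[OF refl]) (simp only: l)
    then show ?thesis by (simp add: sum.distrib sum_subtractf sum_distrib_left algebra_simps)
  qed
  then show ?thesis unfolding e p l[OF VS] by (simp add: algebra_simps add_divide_distrib diff_divide_distrib)
qed

lemma poincare_dens:
  "poincare DIM('a) D (W S) (dens D (pl c (\<lambda>_. 0) \<beta>)) = flux D (radial_field c \<beta>)"
proof (intro ext)
  fix x and \<xi> :: "'a list"
  let ?f = "pl c (\<lambda>_. 0) \<beta>"
  show "poincare DIM('a) D (W S) (dens D ?f) x \<xi> = flux D (radial_field c \<beta>) x \<xi>"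
  proof (cases "x \<in> D")
    case True
    have "integral {0..1} (\<lambda>t. t ^ (DIM('a) - 1) * dens D ?f (W S + t *\<^sub>R (x - W S)) ((x - W S) # \<xi>)) =
        integral {0..1} (\<lambda>t. t ^ (DIM('a) - 1) * ((?f (W S) + t * (?f x - ?f (W S))) * \<omega> ((x - W S) # \<xi>)))"
    proof (rule Henstock_Kurzweil_Integration.integral_cong)
      fix t :: real assume t: "t \<in> {0..1}"
      have "(1 - t) *\<^sub>R W S + t *\<^sub>R x \<in> D" using t True WS_in_D by (intro convexD[OF convex_convex_hull]) auto
      then have "W S + t *\<^sub>R (x - W S) \<in> D" by (simp add: algebra_simps)
      then show "t ^ (DIM('a) - 1) * dens D ?f (W S + t *\<^sub>R (x - W S)) ((x - W S) # \<xi>) =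
          t ^ (DIM('a) - 1) * ((?f (W S) + t * (?f x - ?f (W S))) * \<omega> ((x - W S) # \<xi>))"
        using t by (simp add: dens_def scaleR_fun_def pl_ray)
    qed
    also have "\<dots> = (?f (W S) / real DIM('a) + (?f x - ?f (W S)) / (real DIM('a) + 1)) * \<omega> ((x - W S) # \<xi>)"
      by (rule moment_integral) simp
    also have "\<dots> = \<omega> (radial_field c \<beta> x # \<xi>)"
      by (cases "length \<xi> = DIM('a) - 1")
         (simp_all add: radial_field_def linear_scale[OF linear_contract] contract_len)
    finally show ?thesis using True by (simp add: poincare_def flux_def)
  qed (simp add: poincare_def flux_def)
qed

text \<open>This is the homotopy formula \<open>d p u = u\<close> for the \<open>n\<close>-form
  \<open>u = f \<omega>\<close>. On a cone, \<open>f\<close> is affine with a differential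
  \<open>K\<close>, and \<open>K (x - W S) = f x - f (W S)\<close>; hence the field
  \<open>h (x) (x - W S)\<close> has the divergence
  \<open>n h (x) + K (x - W S) / (n + 1) = f x\<close>.\<close>

lemma weak_div_radial_field: "weak_div D (radial_field c \<beta>) (pl c (\<lambda>_. 0) \<beta>)"
proof -
  define f where "f = pl c (\<lambda>_. 0) \<beta>"
  define g where "g d = (\<Sum>Z\<in>S. c Z * grad Z d)" for d
  define c0 where "c0 = (\<Sum>Z\<in>S. c Z * lam Z 0)"
  define n where "n = real DIM('a)"
  have n: "n > 0" by (simp add: n_def)
  have lin: "linear (\<lambda>x. r * h x)" if "linear h" for h :: "'a \<Rightarrow> real" and r
    using linear_compose_scale_right[OF that, of r] by simp
  have ling: "linear g" unfolding g_def[abs_def] by (intro linear_compose_sum ballI lin linear_grad)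
  have feq: "f = (\<lambda>x. (c0 + g x) + \<beta> * hatS x)"
    unfolding f_def pl_def c0_def g_def by (simp add: grad_def fun_eq_iff algebra_simps sum_subtractf)
  have wf: "wderiv f (\<lambda>x d. (0 + g d) + \<beta> * hatS' x d)"
    unfolding feq by (intro wderiv_add wderiv_const wderiv_linear ling wderiv_cmult wderiv_hatS)
  let ?k = "f (W S) / n - f (W S) / (n + 1)"
  define h where "h x = ?k + 1 / (n + 1) * f x" for x
  define h' where "h' x d = 0 + 1 / (n + 1) * ((0 + g d) + \<beta> * hatS' x d)" for x d
  have wh: "wderiv h h'"
    unfolding h_def[abs_def] h'_def[abs_def] by (intro wderiv_add wderiv_const wderiv_cmult wf)
  have wx: "wderiv (\<lambda>x. - (W S \<bullet> b) + x \<bullet> b) (\<lambda>x d. 0 + d \<bullet> b)" for b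
    by (intro wderiv_add wderiv_const wderiv_linear) (simp add: bounded_linear.linear bounded_linear_inner_left)
  have radial: "radial_field c \<beta> x = h x *\<^sub>R (x - W S)" for x
    unfolding radial_field_def h_def f_def[symmetric] n_def[symmetric] by (simp add: diff_divide_distrib)
  have "weak_div D (radial_field c \<beta>) f"
  proof (rule weak_divI[OF compact_D finite_Basis wderiv_mult[OF wh wx]])
    fix x
    have "x - W S = (\<Sum>b\<in>Basis. ((x - W S) \<bullet> b) *\<^sub>R b)" by (simp only: euclidean_representation)
    then have "radial_field c \<beta> x = h x *\<^sub>R (\<Sum>b\<in>Basis. ((x - W S) \<bullet> b) *\<^sub>R b)" unfolding radial by (rule arg_cong)
    also have "\<dots> = (\<Sum>b\<in>Basis. (h x * (- (W S \<bullet> b) + x \<bullet> b)) *\<^sub>R b)"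
      by (simp add: scaleR_sum_right inner_diff_left algebra_simps)
    finally show "radial_field c \<beta> x = (\<Sum>b\<in>Basis. (h x * (- (W S \<bullet> b) + x \<bullet> b)) *\<^sub>R b)" .
  next
    show "continuous_on D f" unfolding f_def by (rule continuous_pl)
    show "AE x in lborel. x \<in> interior D \<longrightarrow> (\<Sum>b\<in>Basis. h x * (0 + b \<bullet> b) + h' x b * (- (W S \<bullet> b) + x \<bullet> b)) = f x"
      using AE_open_sector
    proof eventually_elim
      case (elim x)
      then obtain p where p: "p \<in> pairs" "x \<in> open_sector p" by blast
      define V where "V = fst p"
      have V: "V \<in> S" "in_cone V x" using p sectorD(1)[OF open_sector_sector[OF p]] by (auto simp: V_def pairs_def)
      have hS: "hatS' x d = (1 / beta V) * grad V d" for d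
        unfolding hatS'_def V_def by (rule open_sector_sum[OF p])
      define K where "K d = g d + \<beta> / beta V * grad V d" for d
      have linK: "linear K" unfolding K_def[abs_def] by (intro linear_compose_add ling lin linear_grad V)
      have hK: "h' x d = K d / (n + 1)" for d by (simp add: h'_def K_def hS)
      have "(\<Sum>b\<in>Basis. h x * (0 + b \<bullet> b) + h' x b * (- (W S \<bullet> b) + x \<bullet> b)) =
          n * h x + (\<Sum>b\<in>Basis. ((x - W S) \<bullet> b) * K b) / (n + 1)"
        by (simp add: sum.distrib n_def hK inner_diff_left sum_divide_distrib mult.commute)
      also have "(\<Sum>b\<in>Basis. ((x - W S) \<bullet> b) * K b) = K (x - W S)"
        by (rule linear_basis_expand[OF linK, symmetric])
      also have "K (x - W S) = f x - f (W S)"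
        using beta_pos[OF V(1)] unfolding K_def feq in_cone_hatS[OF V(2)] in_cone_hatS[OF in_cone_WS[OF V(1)]]
        by (simp add: grad_diff[OF V(1)] linear_diff[OF ling] right_diff_distrib beta_def[symmetric])
      also have "n * h x + (f x - f (W S)) / (n + 1) = f x"
      proof -
        define q where "q = 1 / (n + 1)"
        have q: "n * q = 1 - q" using n by (simp add: q_def field_simps)
        have "n * h x + (f x - f (W S)) / (n + 1) = f (W S) - f (W S) * (n * q) + (n * q) * f x + (f x - f (W S)) * q"
          using n by (simp add: h_def q_def right_diff_distrib distrib_left)
        then show ?thesis unfolding q by (simp add: algebra_simps)
      qed
      finally show ?case by (simp only:) simp
    qed
  qed
  then show ?thesis by (simp add: f_def)
qed

lemma flux_add: "flux D v + flux D w = flux D (\<lambda>x. v x + w x)"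
proof (intro ext)
  fix x and \<xi> :: "'a list"
  show "(flux D v + flux D w) x \<xi> = flux D (\<lambda>x. v x + w x) x \<xi>"
    by (cases "length \<xi> = DIM('a) - 1") (simp_all add: flux_def linear_add[OF linear_contract] contract_len)
qed

lemma flux_scale: "r *\<^sub>R flux D v = flux D (\<lambda>x. r *\<^sub>R v x)"
proof (intro ext)
  fix x and \<xi> :: "'a list"
  show "(r *\<^sub>R flux D v) x \<xi> = flux D (\<lambda>x. r *\<^sub>R v x) x \<xi>"
    by (cases "length \<xi> = DIM('a) - 1") (simp_all add: flux_def scaleR_fun_def linear_scale[OF linear_contract] contract_len)
qed

lemma A_space_flux_iff: "u \<in> A_space (DIM('a) - 1) W S \<longleftrightarrow>
  (\<exists>a A B c \<beta>. u = flux D (\<lambda>x. pl a A B x + radial_field c \<beta> x) \<and> (\<forall>p\<in>pairs. sector_div a A B p = 0))"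
proof -
  have "DIM('a) - 1 + 1 = DIM('a)" using Suc_codim by simp
  then have "u \<in> A_space (DIM('a) - 1) W S \<longleftrightarrow> (\<exists>v b. u = v + poincare DIM('a) D (W S) b \<and>
      v \<in> K_space (DIM('a) - 1) W S \<and> b \<in> K_space DIM('a) W S)"
    unfolding A_space_def by simp
  also have "\<dots> \<longleftrightarrow> (\<exists>a A B c \<beta>. u = flux D (pl a A B) + flux D (radial_field c \<beta>) \<and> (\<forall>p\<in>pairs. sector_div a A B p = 0))"
    unfolding K_space_flux_iff K_space_dens_iff poincare_dens[symmetric] by blast
  finally show ?thesis by (simp add: flux_add)
qed

end

section \<open>Dimensions from unisolvent functionals\<close>

text \<open>The elements dual to the functionals form a basis. Unisolvence is used here without knowing beforehand that
  the space is finite-dimensional. It applies to the spaces of alternating forms as well as to the element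
  spaces.\<close>

lemma dim_eq_card_functionals:
  fixes L :: "'i \<Rightarrow> 'v::real_vector \<Rightarrow> real"
  assumes A: "subspace A" and I: "finite I"
    and lin: "\<And>i u w r. i \<in> I \<Longrightarrow> u \<in> A \<Longrightarrow> w \<in> A \<Longrightarrow> L i (u + r *\<^sub>R w) = L i u + r * L i w"
    and uni: "\<And>c. \<exists>!u. u \<in> A \<and> (\<forall>i\<in>I. L i u = c i)"
  shows "dim A = card I"
proof -
  define e where "e i = (THE u. u \<in> A \<and> (\<forall>j\<in>I. L j u = (if j = i then 1 else 0)))" for i
  have e: "e i \<in> A \<and> (\<forall>j\<in>I. L j (e i) = (if j = i then 1 else 0))" for i
    unfolding e_def by (rule theI'[OF uni])
  have L0: "L i 0 = 0" if "i \<in> I" for i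
    using lin[OF that subspace_0[OF A] subspace_0[OF A], of 1] by simp
  have comb: "(\<Sum>i\<in>F. c i *\<^sub>R e i) \<in> A \<and> (\<forall>j\<in>I. L j (\<Sum>i\<in>F. c i *\<^sub>R e i) = (\<Sum>i\<in>F. c i * L j (e i)))"
    if "finite F" for F c
    using that
  proof (induction F)
    case empty then show ?case using subspace_0[OF A] L0 by simp
  next
    case (insert i F)
    have m: "(\<Sum>i\<in>insert i F. c i *\<^sub>R e i) = (\<Sum>i\<in>F. c i *\<^sub>R e i) + c i *\<^sub>R e i"
      using insert by (simp add: add.commute)
    show ?case
    proof (intro conjI ballI)
      show "(\<Sum>i\<in>insert i F. c i *\<^sub>R e i) \<in> A"
        unfolding m using insert e by (intro subspace_add[OF A] subspace_scale[OF A]) auto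
      fix j assume j: "j \<in> I"
      have "L j ((\<Sum>i\<in>F. c i *\<^sub>R e i) + c i *\<^sub>R e i) = L j (\<Sum>i\<in>F. c i *\<^sub>R e i) + c i * L j (e i)"
        using insert e by (intro lin[OF j]) auto
      then show "L j (\<Sum>i\<in>insert i F. c i *\<^sub>R e i) = (\<Sum>i\<in>insert i F. c i * L j (e i))"
        unfolding m using insert j by simp
    qed
  qed
  have Lcomb: "L j (\<Sum>i\<in>I. c i *\<^sub>R e i) = c j" if "j \<in> I" for j c
  proof -
    have "L j (\<Sum>i\<in>I. c i *\<^sub>R e i) = (\<Sum>i\<in>I. c i * L j (e i))" using comb[OF I, of c] that by blast
    also have "\<dots> = (\<Sum>i\<in>I. if i = j then c i else 0)"
      by (rule sum.cong) (use e that in auto)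
    finally show ?thesis using that I by simp
  qed
  have inj: "inj_on e I"
  proof (rule inj_onI)
    fix i j assume ij: "i \<in> I" "j \<in> I" "e i = e j"
    have "L i (e i) = 1" "L i (e j) = (if i = j then 1 else 0)" using e[of i] e[of j] ij(1,2) by simp_all
    then show "i = j" unfolding ij(3) by (cases "i = j") simp_all
  qed
  have "independent (e ` I)"
  proof
    assume "dependent (e ` I)"
    then obtain u where u: "\<exists>v\<in>e ` I. u v \<noteq> 0" "(\<Sum>v\<in>e ` I. u v *\<^sub>R v) = 0"
      using I by (auto simp: real_vector.dependent_finite)
    then have "(\<Sum>i\<in>I. u (e i) *\<^sub>R e i) = 0" by (simp add: sum.reindex[OF inj])
    then have "u (e j) = 0" if "j \<in> I" for j
      using Lcomb[OF that, of "\<lambda>i. u (e i)"] L0[OF that] by simp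
    then show False using u(1) by auto
  qed
  moreover have "span (e ` I) = A"
  proof
    show "span (e ` I) \<subseteq> A" using e by (intro span_minimal A) auto
    show "A \<subseteq> span (e ` I)"
    proof
      fix u assume u: "u \<in> A"
      have "(\<Sum>i\<in>I. L i u *\<^sub>R e i) = u"
        using uni[of "\<lambda>i. L i u"] u comb[OF I, of "\<lambda>i. L i u"] Lcomb[of _ "\<lambda>i. L i u"] by blast
      moreover have "(\<Sum>i\<in>I. L i u *\<^sub>R e i) \<in> span (e ` I)"
        by (intro span_sum span_scale span_base) auto
      ultimately show "u \<in> span (e ` I)" by simp
    qed
  qed
  ultimately have "dim A = card (e ` I)"
    by (intro real_vector.dim_eq_card) (simp_all add: span_eq_iff[THEN iffD2, OF A])
  then show ?thesis by (simp add: card_image[OF inj])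
qed

lemma edges_Cons: "edges (length ws) (a # ws) = map (\<lambda>x. - a + x) ws"
  unfolding edges_def by (rule nth_equalityI) auto

context volume_form
begin

text \<open>Some list of vectors on which \<open>\<omega>\<close> does not vanish, to read off the scalar proxy of an
  \<open>n\<close>-form.\<close>

definition test_list :: "'a list" where "test_list = (SOME \<xi>. \<omega> \<xi> \<noteq> 0)"

lemma test_list: "\<omega> test_list \<noteq> 0"
  unfolding test_list_def using ex_nz by (metis (mono_tags, lifting) someI_ex)

lemma ex_proxy:
  assumes "a \<in> alt_forms (DIM('a) - 1)"
  shows "\<exists>v. a = (\<lambda>\<xi>. \<omega> (v # \<xi>))"
proof -
  have "wedge (DIM('a) - 1) ((\<bullet>) b) a \<in> alt_forms DIM('a)" for b
    using wedge_alt[OF bounded_linear.linear[OF bounded_linear_inner_right] assms] Suc_codim by simp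
  then have "\<forall>b. \<exists>c. wedge (DIM('a) - 1) ((\<bullet>) b) a = c *\<^sub>R \<omega>" using top_form_multiple by blast
  from choice[OF this] obtain c where "\<forall>b. wedge (DIM('a) - 1) ((\<bullet>) b) a = c b *\<^sub>R \<omega>" by blast
  then have "a = (\<lambda>\<xi>. \<omega> ((\<Sum>b\<in>Basis. c b *\<^sub>R b) # \<xi>))" by (intro flux_proxy[OF assms]) simp
  then show ?thesis by (intro exI)
qed

lemma contract_alt: "(\<lambda>\<xi>. \<omega> (v # \<xi>)) \<in> alt_forms (DIM('a) - 1)"
  using alt_contract[of \<omega> "DIM('a) - 1"] \<omega> Suc_codim by simp

definition proxy :: "('a list \<Rightarrow> real) \<Rightarrow> 'a" where
  "proxy a = (THE v. a = (\<lambda>\<xi>. \<omega> (v # \<xi>)))"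

lemma proxy_contract: "proxy (\<lambda>\<xi>. \<omega> (v # \<xi>)) = v"
  unfolding proxy_def by (rule the_equality) (auto dest: flux_inj)

lemma contract_proxy: "a \<in> alt_forms (DIM('a) - 1) \<Longrightarrow> (\<lambda>\<xi>. \<omega> (proxy a # \<xi>)) = a"
  using ex_proxy proxy_contract by metis

lemma contract_comb:
  "(\<lambda>\<xi>. \<omega> (v # \<xi>)) + r *\<^sub>R (\<lambda>\<xi>. \<omega> (w # \<xi>)) = (\<lambda>\<xi>. \<omega> ((v + r *\<^sub>R w) # \<xi>))"
proof
  fix \<xi> :: "'a list"
  show "((\<lambda>\<xi>. \<omega> (v # \<xi>)) + r *\<^sub>R (\<lambda>\<xi>. \<omega> (w # \<xi>))) \<xi> = \<omega> ((v + r *\<^sub>R w) # \<xi>)"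
  proof (cases "length \<xi> = DIM('a) - 1")
    case True
    have lin: "linear (\<lambda>v. \<omega> (v # \<xi>))" using alt_lin[OF \<omega>, of "[]" \<xi>] True Suc_codim by simp
    show ?thesis by (simp add: scaleR_fun_def linear_add[OF lin] linear_scale[OF lin])
  next
    case False
    then have "\<omega> (x # \<xi>) = 0" for x using Suc_codim by (intro alt_len[OF \<omega>]) auto
    then show ?thesis by (simp add: scaleR_fun_def)
  qed
qed

lemma dim_alt_forms_codim1: "dim (alt_forms (DIM('a) - 1) :: ('a list \<Rightarrow> real) set) = DIM('a)"
proof (rule dim_eq_card_functionals[OF subspace_alt_forms finite_Basis, where L="\<lambda>b a. proxy a \<bullet> b"])
  fix b :: 'a and u w :: "'a list \<Rightarrow> real" and r assume uw: "u \<in> alt_forms (DIM('a) - 1)" "w \<in> alt_forms (DIM('a) - 1)"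
  obtain x y where xy: "u = (\<lambda>\<xi>. \<omega> (x # \<xi>))" "w = (\<lambda>\<xi>. \<omega> (y # \<xi>))" using ex_proxy uw by blast
  show "proxy (u + r *\<^sub>R w) \<bullet> b = proxy u \<bullet> b + r * (proxy w \<bullet> b)"
    unfolding xy contract_comb proxy_contract by (simp add: inner_add_left)
next
  fix c :: "'a \<Rightarrow> real"
  show "\<exists>!u. u \<in> alt_forms (DIM('a) - 1) \<and> (\<forall>b\<in>Basis. proxy u \<bullet> b = c b)"
  proof (rule ex1I)
    let ?v = "\<Sum>b\<in>Basis. c b *\<^sub>R b"
    show "(\<lambda>\<xi>. \<omega> (?v # \<xi>)) \<in> alt_forms (DIM('a) - 1) \<and> (\<forall>b\<in>Basis. proxy (\<lambda>\<xi>. \<omega> (?v # \<xi>)) \<bullet> b = c b)"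
      unfolding proxy_contract using contract_alt by simp
    fix u assume u: "u \<in> alt_forms (DIM('a) - 1) \<and> (\<forall>b\<in>Basis. proxy u \<bullet> b = c b)"
    have "proxy u \<bullet> b = ?v \<bullet> b" if "b \<in> Basis" for b using u that by simp
    then have "proxy u = ?v" by (rule euclidean_eqI)
    then show "u = (\<lambda>\<xi>. \<omega> (?v # \<xi>))" using contract_proxy u by metis
  qed
qed

lemma dim_alt_forms_top: "dim (alt_forms DIM('a) :: ('a list \<Rightarrow> real) set) = 1"
proof -
  have "dim (alt_forms DIM('a) :: ('a list \<Rightarrow> real) set) = card {()}"
  proof (rule dim_eq_card_functionals[OF subspace_alt_forms, where L="\<lambda>_ a. a test_list"])
    fix c :: "unit \<Rightarrow> real"
    show "\<exists>!u. u \<in> alt_forms DIM('a) \<and> (\<forall>i\<in>{()}. u test_list = c i)"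
    proof (rule ex1I)
      show "(c () / \<omega> test_list) *\<^sub>R \<omega> \<in> alt_forms DIM('a) \<and> (\<forall>i\<in>{()}. ((c () / \<omega> test_list) *\<^sub>R \<omega>) test_list = c i)"
        using subspace_scale[OF subspace_alt_forms \<omega>, of "c () / \<omega> test_list"] test_list by (intro conjI) (simp_all add: scaleR_fun_def)
      fix u assume u: "u \<in> alt_forms DIM('a) \<and> (\<forall>i\<in>{()}. u test_list = c i)"
      then obtain d where "u = d *\<^sub>R \<omega>" using top_form_multiple by blast
      moreover from this have "d = c () / \<omega> test_list" using u test_list by (simp add: scaleR_fun_def field_simps)
      ultimately show "u = (c () / \<omega> test_list) *\<^sub>R \<omega>" by simp
    qed
  qed (auto simp: scaleR_fun_def)
  then show ?thesis by simp
qed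

lemma alt_forms_above: "alt_forms (DIM('a) + 1) = {0 :: 'a list \<Rightarrow> real}"
  using alt_forms_above_dim[where 'a='a] subspace_0[OF subspace_alt_forms] by auto

end

section \<open>Vertex values and fluxes of the fields\<close>

text \<open>A name for \<open>n - 1\<close>, the dimension of a facet, avoids truncated subtraction in the terms below.\<close>

locale element_dofs = element S W \<omega> ori
  for S :: "'a::euclidean_space set" and W :: "'a set \<Rightarrow> 'a" and \<omega> :: "'a list \<Rightarrow> real" and ori +
  fixes fdim :: nat
  assumes dim_eq: "DIM('a) = Suc fdim"
begin

abbreviation fs :: "'a \<Rightarrow> 'a list" where "fs V \<equiv> ori (S - {V})"

lemma codim: "DIM('a) = Suc fdim" "fdim > 0"
  using dim2 dim_eq by auto

lemma fdim_eq: "DIM('a) - 1 = fdim"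
  using dim_eq by simp

lemma fs: "V \<in> S \<Longrightarrow> length (fs V) = Suc fdim \<and> distinct (fs V) \<and> set (fs V) = S - {V}"
proof -
  assume V: "V \<in> S"
  have "S - {V} \<in> faces S" using facet_ne[OF V] by (auto simp: faces_def)
  then have "set (fs V) = S - {V}" "distinct (fs V)" using ori by (auto simp: orientation_def)
  moreover from this have "length (fs V) = card (S - {V})" by (metis distinct_card)
  ultimately show ?thesis using card_facet[OF V] codim by simp
qed

lemma ori_S: "length (ori S) = Suc DIM('a)" "distinct (ori S)" "set (ori S) = S"
proof -
  have "S \<in> faces S" using S_ne by (auto simp: faces_def)
  then show "set (ori S) = S" "distinct (ori S)" using ori by (auto simp: orientation_def)
  then show "length (ori S) = Suc DIM('a)" using card_S by (metis distinct_card)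
qed

lemma edges_nz:
  assumes "length vs = Suc DIM('a)" "distinct vs" "set vs = S"
  shows "\<omega> (edges DIM('a) vs) \<noteq> 0"
proof -
  obtain a ws where vs: "vs = a # ws" using assms(1) by (cases vs) auto
  have len: "length ws = DIM('a)" and a: "a \<notin> set ws" and S: "S = insert a (set ws)"
    using assms vs by auto
  have e: "edges DIM('a) vs = map (\<lambda>x. - a + x) ws" using edges_Cons[of ws a] len vs by simp
  show ?thesis unfolding e
  proof (rule volume_basis_nz)
    show "distinct (map (\<lambda>x. - a + x) ws)" using assms vs by (simp add: distinct_map inj_on_def)
    show "independent (set (map (\<lambda>x. - a + x) ws))"
      using affine_dependent_iff_dependent[OF a] indep S by simp
  qed (simp add: len)
qed

text \<open>The pullback of \<open>\<iota>\<^sub>v \<omega>\<close> to the facet opposite to \<open>V\<close> depends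
  only on the normal component \<open>grad V v\<close>; this is the proportionality factor in the chart of
  the facet (\<open>contract_edges\<close>).\<close>

definition facet_factor :: "'a \<Rightarrow> real" where
  "facet_factor V = \<omega> ((V - fs V ! 0) # edges fdim (fs V))"

lemma facet_factor_nz: "V \<in> S \<Longrightarrow> facet_factor V \<noteq> 0"
proof -
  assume V: "V \<in> S"
  obtain p ws where p: "fs V = p # ws" using fs[OF V] by (cases "fs V") auto
  have len: "length ws = fdim" using fs[OF V] p by simp
  have "edges DIM('a) (p # V # ws) = map (\<lambda>x. - p + x) (V # ws)"
    using edges_Cons[of "V # ws" p] len codim(1) by simp
  also have "\<dots> = (V - p) # edges fdim (fs V)"
    using edges_Cons[of ws p] len p by simp
  finally have "facet_factor V = \<omega> (edges DIM('a) (p # V # ws))" by (simp add: facet_factor_def p)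
  moreover have "p \<in> S" "p \<noteq> V" "set ws \<subseteq> S" using fs[OF V] p by auto
  then have "set (p # V # ws) = S" "distinct (p # V # ws)" using fs[OF V] p V by auto
  then have "\<omega> (edges DIM('a) (p # V # ws)) \<noteq> 0"
    using len codim by (intro edges_nz) auto
  ultimately show ?thesis by simp
qed

text \<open>Subtracting \<open>grad V w\<close> times an edge towards \<open>V\<close> leaves a vector \<open>w'\<close>
  that is tangential to the facet, hence a combination of its edges, and \<open>\<omega>\<close> vanishes on
  dependent vectors.\<close>

lemma contract_edges:
  assumes V: "V \<in> S"
  shows "\<omega> (w # edges fdim (fs V)) = grad V w * facet_factor V"
proof -
  let ?p = "fs V ! 0"
  let ?L = "\<lambda>w. \<omega> (w # edges fdim (fs V))"
  note f = fs[OF V]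
  have lin: "linear ?L" by (rule linear_contract) (simp add: edges_def dim_eq)
  have p: "?p \<in> S - {V}" using f nth_mem[of 0 "fs V"] by auto
  have LU: "?L (U - ?p) = 0" if U: "U \<in> S - {V}" for U
  proof -
    have "U \<in> insert ?p ((\<lambda>i. fs V ! Suc i) ` {..<fdim})" using set_nth_Suc[of "fs V" fdim] f U by simp
    then consider "U = ?p" | i where "i < fdim" "U = fs V ! Suc i" by auto
    then show ?thesis
    proof cases
      case 1 then show ?thesis using linear_0[OF lin] by simp
    next
      case 2
      then have "U - ?p \<in> set (edges fdim (fs V))" by (auto simp: edges_def)
      then show ?thesis by (intro alt_nondistinct[OF \<omega>]) simp
    qed
  qed
  define w' where "w' = w - grad V w *\<^sub>R (V - ?p)"
  have gV: "grad V w' = 0"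
  proof -
    have "grad V (V - ?p) = 1" using V p by (simp add: grad_diff lam_vertex)
    then show ?thesis
      unfolding w'_def linear_diff[OF linear_grad[OF V], of w "grad V w *\<^sub>R (V - ?p)"]
        linear_scale[OF linear_grad[OF V]] by simp
  qed
  have "(\<Sum>U\<in>S - {V}. grad U w') = 0" "(\<Sum>U\<in>S - {V}. grad U w' *\<^sub>R U) = w'"
    using sum_grad[of w'] grad_vec[of w'] V gV by (simp_all add: sum.remove[of S V])
  then have "w' = (\<Sum>U\<in>S - {V}. grad U w' *\<^sub>R (U - ?p))"
    by (simp add: scaleR_right_diff_distrib sum_subtractf flip: scaleR_sum_left)
  then have "?L w' = ?L (\<Sum>U\<in>S - {V}. grad U w' *\<^sub>R (U - ?p))" by (rule arg_cong)
  also have "\<dots> = 0" by (simp add: linear_sum[OF lin] linear_scale[OF lin] LU)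
  finally show ?thesis unfolding w'_def by (simp add: linear_diff[OF lin] linear_scale[OF lin] facet_factor_def)
qed

lemma fs_chart:
  assumes "V \<in> S" "t \<in> std_simplex fdim" shows "chart fdim (fs V) t \<in> D" "lam V (chart fdim (fs V) t) = 0"
proof -
  have f: "length (fs V) = Suc fdim" "distinct (fs V)" "set (fs V) \<subseteq> S" using fs[OF assms(1)] by auto
  show "chart fdim (fs V) t \<in> D" by (rule chart_in_D[OF f assms(2)])
  show "lam V (chart fdim (fs V) t) = 0" using fs[OF assms(1)] by (intro lam_chart(3)[OF assms(1) f]) auto
qed

definition facet_flux :: "'a \<Rightarrow> ('a \<Rightarrow> 'a) \<Rightarrow> real" where
  "facet_flux V v = (LINT t:std_simplex fdim|coordM fdim. grad V (v (chart fdim (fs V) t)))"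

lemma std_simplex_set_integral_cong:
  fixes g h :: "(nat \<Rightarrow> real) \<Rightarrow> real"
  assumes "\<And>t. t \<in> std_simplex k \<Longrightarrow> g t = h t"
  shows "(LINT t:std_simplex k|coordM k. g t) = (LINT t:std_simplex k|coordM k. h t)"
  unfolding set_lebesgue_integral_def
  by (intro Bochner_Integration.integral_cong refl) (use assms in \<open>auto simp: indicator_def\<close>)

lemma face_integral_flux:
  assumes V: "V \<in> S" shows "face_integral fdim (flux D v) (fs V) = facet_factor V * facet_flux V v"
proof -
  have "face_integral fdim (flux D v) (fs V) = (LINT t:std_simplex fdim|coordM fdim. grad V (v (chart fdim (fs V) t)) * facet_factor V)"
    unfolding face_integral_eq
    by (rule std_simplex_set_integral_cong) (simp add: flux_def fs_chart[OF V] contract_edges[OF V])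
  then show ?thesis by (simp add: facet_flux_def mult.commute)
qed

text \<open>The factor contains the Jacobian of the chart and the sign of the orientation.\<close>

lemma face_integral_dens: "\<exists>K. K \<noteq> 0 \<and> (\<forall>f. continuous_on D f \<longrightarrow>
  face_integral DIM('a) (dens D f) (ori S) = K * (LINT x:D|lborel. f x))"
proof -
  obtain c where c: "c > 0" and cv: "\<And>h :: 'a \<Rightarrow> real. h \<in> borel_measurable borel \<Longrightarrow>
    (LINT t|coordM DIM('a). h (chart DIM('a) (ori S) t)) = c * integral\<^sup>L lborel h"
    using change_of_variables[OF ori_S] by blast
  let ?w = "\<omega> (edges DIM('a) (ori S))"
  have "face_integral DIM('a) (dens D f) (ori S) = (c * ?w) * (LINT x:D|lborel. f x)"
    if f: "continuous_on D f" for f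
  proof -
    have iff: "chart DIM('a) (ori S) t \<in> D \<longleftrightarrow> t \<in> std_simplex DIM('a)" for t
      using chart_std_simplex_iff(1)[OF ori_S(1,2), of t] ori_S(3) by (simp add: mem_D)
    have m: "(\<lambda>x. indicator D x *\<^sub>R f x) \<in> borel_measurable borel"
      by (rule borel_measurable_continuous_on_indicator[OF borel_closed[OF compact_imp_closed[OF compact_D]] f])
    have "face_integral DIM('a) (dens D f) (ori S) =
        (LINT t|coordM DIM('a). (indicator D (chart DIM('a) (ori S) t) *\<^sub>R f (chart DIM('a) (ori S) t)) * ?w)"
      unfolding face_integral_eq set_lebesgue_integral_def
      by (intro Bochner_Integration.integral_cong refl)
         (auto simp: iff dens_def scaleR_fun_def indicator_def)
    also have "\<dots> = (LINT t|coordM DIM('a). indicator D (chart DIM('a) (ori S) t) *\<^sub>R f (chart DIM('a) (ori S) t)) * ?w"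
      by simp
    also have "\<dots> = (c * (LINT x:D|lborel. f x)) * ?w"
      using cv[OF m] by (simp add: set_lebesgue_integral_def)
    finally show ?thesis by simp
  qed
  then show ?thesis using c edges_nz[OF ori_S] by (intro exI[of _ "c * ?w"]) auto
qed

lemma std_simplex_integrable:
  assumes V: "V \<in> S" and g: "continuous_on D g"
  shows "set_integrable (coordM fdim) (std_simplex fdim) (\<lambda>t. g (chart fdim (fs V) t) :: real)"
proof -
  have "bounded (g ` D)" by (intro compact_imp_bounded compact_continuous_image[OF g compact_D])
  then obtain M where M: "\<And>x. x \<in> D \<Longrightarrow> \<bar>g x\<bar> \<le> M" unfolding bounded_iff by auto
  have "integrable (coordM fdim) (\<lambda>t. indicator (std_simplex fdim \<inter> space (coordM fdim)) t :: real)"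
    using std_simplex_finite[of fdim] std_simplex_space_sets[of fdim] by (intro integrable_real_indicator) auto
  then have w: "integrable (coordM fdim) (\<lambda>t. M * indicator (std_simplex fdim \<inter> space (coordM fdim)) t)"
    by (rule integrable_mult_right)
  have ae: "AE t in coordM fdim. norm (indicat_real (std_simplex fdim) t *\<^sub>R g (chart fdim (fs V) t)) \<le>
      norm (M * indicator (std_simplex fdim \<inter> space (coordM fdim)) t)"
  proof (rule AE_I2)
    fix t assume t: "t \<in> space (coordM fdim)"
    show "norm (indicat_real (std_simplex fdim) t *\<^sub>R g (chart fdim (fs V) t)) \<le>
      norm (M * indicator (std_simplex fdim \<inter> space (coordM fdim)) t)"
    proof (cases "t \<in> std_simplex fdim")
      case True
      then have "\<bar>g (chart fdim (fs V) t)\<bar> \<le> M" by (intro M fs_chart[OF V])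
      then show ?thesis using t True by simp
    qed simp
  qed
  have "(\<lambda>x. indicator D x *\<^sub>R g x) \<in> borel_measurable borel"
    by (rule borel_measurable_continuous_on_indicator[OF borel_closed[OF compact_imp_closed[OF compact_D]] g])
  then have "(\<lambda>t. indicator D (chart fdim (fs V) t) *\<^sub>R g (chart fdim (fs V) t)) \<in> borel_measurable (coordM fdim)"
    by (rule measurable_compose[OF chart_measurable])
  then have "(\<lambda>t. indicator (std_simplex fdim) t * (indicator D (chart fdim (fs V) t) *\<^sub>R g (chart fdim (fs V) t))) \<in> borel_measurable (coordM fdim)"
    by (intro borel_measurable_times indicator_std_simplex_measurable)
  also have "(\<lambda>t. indicator (std_simplex fdim) t * (indicator D (chart fdim (fs V) t) *\<^sub>R g (chart fdim (fs V) t))) =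
      (\<lambda>t. indicat_real (std_simplex fdim) t *\<^sub>R g (chart fdim (fs V) t))"
    using fs_chart(1)[OF V] by (auto simp: indicator_def fun_eq_iff)
  finally have m: "(\<lambda>t. indicat_real (std_simplex fdim) t *\<^sub>R g (chart fdim (fs V) t)) \<in> borel_measurable (coordM fdim)" .
  show ?thesis unfolding set_integrable_def by (rule Bochner_Integration.integrable_bound[OF w m ae])
qed

lemma continuous_grad: "V \<in> S \<Longrightarrow> continuous_on D v \<Longrightarrow> continuous_on D (\<lambda>x. grad V (v x))"
  by (rule linear_continuous_on_compose[OF _ linear_grad])

lemma facet_flux_add:
  assumes V: "V \<in> S" and v: "continuous_on D v" and w: "continuous_on D w"
  shows "facet_flux V (\<lambda>x. v x + r *\<^sub>R w x) = facet_flux V v + r * facet_flux V w"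
proof -
  note i = std_simplex_integrable[OF V continuous_grad[OF V v]] std_simplex_integrable[OF V continuous_grad[OF V w]]
  have "facet_flux V (\<lambda>x. v x + r *\<^sub>R w x) = (LINT t:std_simplex fdim|coordM fdim. grad V (v (chart fdim (fs V) t)) + r * grad V (w (chart fdim (fs V) t)))"
    unfolding facet_flux_def by (simp add: linear_add[OF linear_grad[OF V]] linear_scale[OF linear_grad[OF V]])
  also have "\<dots> = facet_flux V v + r * facet_flux V w"
    unfolding facet_flux_def using i by (subst set_integral_add) auto
  finally show ?thesis .
qed

lemma facet_flux_cong: "V \<in> S \<Longrightarrow> (\<And>x. x \<in> D \<Longrightarrow> lam V x = 0 \<Longrightarrow> v x = w x) \<Longrightarrow> facet_flux V v = facet_flux V w"
  unfolding facet_flux_def by (rule std_simplex_set_integral_cong) (simp add: fs_chart)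

definition hatF_mass :: "'a \<Rightarrow> real" where
  "hatF_mass V = (LINT t:std_simplex fdim|coordM fdim. hatF V (chart fdim (fs V) t))"

lemma hatF_mass_pos:
  assumes V: "V \<in> S" shows "hatF_mass V > 0"
  unfolding hatF_mass_def
proof (rule std_simplex_integral_pos[OF codim(2) std_simplex_integrable[OF V continuous_hatF[OF V]] hatF_nonneg])
  fix t assume t: "t \<in> open_std_simplex fdim"
  have f: "length (fs V) = Suc fdim" "distinct (fs V)" "set (fs V) \<subseteq> S" using fs[OF V] by auto
  have "lam V (chart fdim (fs V) t) = 0" using t open_std_simplex_subset by (intro fs_chart[OF V]) auto
  then show "hatF V (chart fdim (fs V) t) > 0"
    using chart_std_simplex_iff(2)[OF f, of t] t fs[OF V] by (intro hatF_facet_pos[OF V]) auto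
qed

text \<open>On the facet opposite to \<open>V\<close>, only the hat functions of its own inpoint and of the vertices are
  nonzero. So the normal component of \<open>A V\<close> changes the flux through this facet and no other.\<close>

lemma facet_flux_pl:
  assumes V: "V \<in> S"
  shows "facet_flux V (pl a A B) = facet_flux V (pl a (\<lambda>_. 0) 0) + grad V (A V) * hatF_mass V"
proof -
  have "facet_flux V (pl a A B) = facet_flux V (\<lambda>x. pl a (\<lambda>_. 0) 0 x + 1 *\<^sub>R (hatF V x *\<^sub>R A V))"
    by (rule facet_flux_cong[OF V]) (simp add: pl_facet[OF V])
  also have "\<dots> = facet_flux V (pl a (\<lambda>_. 0) 0) + 1 * facet_flux V (\<lambda>x. hatF V x *\<^sub>R A V)"
    by (intro facet_flux_add[OF V] continuous_pl continuous_intros continuous_hatF[OF V])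
  also have "facet_flux V (\<lambda>x. hatF V x *\<^sub>R A V) = grad V (A V) * hatF_mass V"
    unfolding facet_flux_def hatF_mass_def by (simp add: linear_scale[OF linear_grad[OF V]] mult.commute)
  finally show ?thesis by simp
qed

definition hatS_mass :: real where "hatS_mass = (LINT x:D|lborel. hatS x)"

lemma hatS_mass_pos: "hatS_mass > 0"
proof -
  obtain p r where pr: "r > 0" "ball p r \<subseteq> D" using interior_D_ne by (meson all_not_in_conv mem_interior)
  then have int: "ball p r \<subseteq> interior D" by (simp add: interior_maximal)
  show ?thesis unfolding hatS_mass_def set_lebesgue_integral_def
  proof (rule integral_pos[where p=p, OF borel_integrable_compact[OF compact_D continuous_hatS] _ pr(1)])
    show "indicat_real D x *\<^sub>R hatS x \<ge> 0" for x using hatS_nonneg[of x] by (simp add: indicator_def)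
    show "indicat_real D x *\<^sub>R hatS x > 0" if "x \<in> ball p r" for x
      using that int pr(2) hatS_pos[of x] by (auto simp: indicator_def)
  qed
qed

lemma integral_pl:
  fixes \<beta> :: real
  shows "(LINT x:D|lborel. pl c (\<lambda>_. 0) \<beta> x) = (LINT x:D|lborel. pl c (\<lambda>_. 0) 0 x) + \<beta> * hatS_mass"
proof -
  have "pl c (\<lambda>_. 0) \<beta> x = pl c (\<lambda>_. 0) 0 x + \<beta> * hatS x" for x by (simp add: pl_def)
  moreover have "set_integrable lborel D (pl c (\<lambda>_. 0 :: real) 0)" "set_integrable lborel D (\<lambda>x. \<beta> * hatS x)"
    by (intro set_integrable_cont compact_D continuous_pl continuous_intros continuous_hatS)+
  ultimately show ?thesis by (simp add: hatS_mass_def set_integral_add)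
qed

definition volume_D :: real where "volume_D = (LINT x:D|lborel. 1)"

lemma volume_D_pos: "volume_D > 0"
proof -
  obtain p r where pr: "r > 0" "ball p r \<subseteq> D" using interior_D_ne by (meson all_not_in_conv mem_interior)
  show ?thesis unfolding volume_D_def set_lebesgue_integral_def
    by (rule integral_pos[where p=p, OF borel_integrable_compact[OF compact_D continuous_on_const] _ pr(1)])
       (use pr(2) in auto)
qed

definition stokes_const :: "'a \<Rightarrow> real" where
  "stokes_const = (SOME \<sigma>. \<forall>v f. continuous_on D v \<longrightarrow> continuous_on D f \<longrightarrow> weak_div D v f \<longrightarrow>
    (LINT x:D|lborel. f x) = (\<Sum>V\<in>S. \<sigma> V * facet_flux V v))"

lemma stokes_facet_flux:
  assumes "continuous_on D v" "continuous_on D f" "weak_div D v f"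
  shows "(LINT x:D|lborel. f x) = (\<Sum>V\<in>S. stokes_const V * facet_flux V v)"
proof -
  have "\<exists>\<sigma>. \<forall>v f. continuous_on D v \<longrightarrow> continuous_on D f \<longrightarrow> weak_div D v f \<longrightarrow>
    (LINT x:D|lborel. f x) = (\<Sum>V\<in>S. \<sigma> V * facet_flux V v)"
    unfolding facet_flux_def by (rule stokes[OF codim fs])
  from someI_ex[OF this] show ?thesis using assms unfolding stokes_const_def by blast
qed

text \<open>The elements of \<open>A\<^bsup>n-1\<^esup>\<close> are these fields with vanishing
  \<open>sector_div a A B\<close>; their divergence is \<open>pl c 0 \<beta>\<close>.\<close>

definition shape_field :: "('a \<Rightarrow> 'a) \<Rightarrow> ('a \<Rightarrow> 'a) \<Rightarrow> 'a \<Rightarrow> ('a \<Rightarrow> real) \<Rightarrow> real \<Rightarrow> 'a \<Rightarrow> 'a" where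
  "shape_field a A B c \<beta> x = pl a A B x + radial_field c \<beta> x"

lemma continuous_shape_field: "continuous_on X (shape_field a A B c \<beta>)"
  unfolding shape_field_def[abs_def] by (intro continuous_on_add continuous_pl continuous_radial_field)

lemma weak_div_shape_field:
  assumes "\<And>p. p \<in> pairs \<Longrightarrow> sector_div a A B p = r"
  shows "weak_div D (shape_field a A B c \<beta>) (\<lambda>x. r + pl c (\<lambda>_. 0) \<beta> x)"
  using weak_div_add[OF compact_D continuous_pl continuous_radial_field continuous_on_const continuous_pl
      weak_div_pl[OF assms] weak_div_radial_field, of 1 c \<beta>] by (simp add: shape_field_def[abs_def])

lemma facet_flux_shape_field: "V \<in> S \<Longrightarrow> facet_flux V (shape_field a A B c \<beta>) = facet_flux V (pl a A B) + facet_flux V (radial_field c \<beta>)"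
  using facet_flux_add[OF _ continuous_pl continuous_radial_field, of V a A B 1 c \<beta>] by (simp add: shape_field_def[abs_def])

text \<open>The degree of freedom \<open>\<beta>\<close> of the divergence is fixed by Stokes' theorem, because the
  prescribed fluxes determine the integral of the divergence. Then \<open>a\<close> is fixed by the vertex
  values. It remains to correct the fluxes by fields that vanish at the vertices. The field
  \<open>hatF V (W S - WF V) / beta V + hatS (V - W S)\<close> does so for the facet opposite
  to \<open>V\<close>: it vanishes at the vertices and on the other facets, has a nonzero flux through this
  one, and its divergence is \<open>-1\<close> on all sectors. A combination of these with the weights
  \<open>\<nu>\<close> adjusts all fluxes, and the resulting \<open>sector_div\<close> is a constant
  \<open>R\<close>, the same on all sectors. Stokes' theorem forces \<open>R = 0\<close>, because the fluxes
  already account for the whole integral of \<open>pl b0 0 \<beta>\<close>.\<close>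

lemma exists_field:
  "\<exists>a A B \<beta>. (\<forall>p\<in>pairs. sector_div a A B p = 0) \<and> (\<forall>Z\<in>S. shape_field a A B b0 \<beta> Z = a0 Z) \<and>
     (\<forall>V\<in>S. facet_flux V (shape_field a A B b0 \<beta>) = c0 V)"
proof -
  define \<beta> where "\<beta> = ((\<Sum>V\<in>S. stokes_const V * c0 V) - (LINT x:D|lborel. pl b0 (\<lambda>_. 0) 0 x)) / hatS_mass"
  have int: "(LINT x:D|lborel. pl b0 (\<lambda>_. 0) \<beta> x) = (\<Sum>V\<in>S. stokes_const V * c0 V)"
    using hatS_mass_pos unfolding integral_pl[of b0 \<beta>] by (simp add: \<beta>_def)
  define a where "a Z = a0 Z - radial_field b0 \<beta> Z" for Z
  define \<nu> where "\<nu> V = (c0 V - facet_flux V (radial_field b0 \<beta>) - facet_flux V (pl a (\<lambda>_. 0) 0)) / hatF_mass V" for V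
  define A where "A V = (\<nu> V / beta V) *\<^sub>R (W S - WF V)" for V
  define B where "B = (\<Sum>V\<in>S. \<nu> V *\<^sub>R (V - W S))"
  define R where "R = (\<Sum>Z\<in>S. grad Z (a Z)) - (\<Sum>V\<in>S. \<nu> V)"
  have gA: "grad V (A V) = \<nu> V" if V: "V \<in> S" for V
    using beta_pos[OF V] tau_self[OF V] unfolding A_def
    by (simp add: linear_scale[OF linear_grad[OF V]] grad_diff[OF V] beta_def[symmetric] tau_def[symmetric])
  \<comment> \<open>The hat function of W S has the differential grad V / beta V on the cone over the facet
    opposite to V, so this is beta V times the contribution of B to the divergence there.\<close>
  have gB: "grad V B = \<nu> V - beta V * (\<Sum>U\<in>S. \<nu> U)" if V: "V \<in> S" for V
  proof -
    have "grad V B = (\<Sum>U\<in>S. \<nu> U * (lam V U - beta V))"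
      unfolding B_def by (simp add: grad_sum[OF V] grad_diff[OF V] beta_def)
    also have "\<dots> = (\<Sum>U\<in>S. (if U = V then \<nu> U else 0) - beta V * \<nu> U)"
      by (rule sum.cong[OF refl]) (simp add: lam_vertex V algebra_simps)
    finally show ?thesis using V by (simp add: sum_subtractf sum_distrib_left)
  qed
  have d: "sector_div a A B p = R" if p: "p \<in> pairs" for p
  proof -
    obtain V U where VU: "p = (V, U)" "V \<in> S" "U \<in> S" "U \<noteq> V" using p by (auto simp: pairs_def)
    have b: "beta V > 0" and t: "tau V U > 0" using beta_pos tau_pos VU by auto
    have gU: "grad U (A V) = \<nu> V / beta V * (beta U - tau V U)"
      unfolding A_def by (simp add: linear_scale[OF linear_grad[OF VU(3)]] grad_diff[OF VU(3)] beta_def tau_def)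
    have "facet_coord_grad V U (A V) = - \<nu> V / beta V"
      unfolding facet_coord_grad_def gU gA[OF VU(2)] using b t by (simp add: field_simps)
    moreover have "grad V B / beta V = \<nu> V / beta V - (\<Sum>U\<in>S. \<nu> U)"
      unfolding gB[OF VU(2)] using b by (simp add: diff_divide_distrib)
    ultimately show ?thesis by (simp add: sector_div_def VU(1) R_def)
  qed
  have flux_V: "facet_flux V (shape_field a A B b0 \<beta>) = c0 V" if V: "V \<in> S" for V
    using hatF_mass_pos[OF V] unfolding facet_flux_shape_field[OF V] facet_flux_pl[OF V, of a A B] gA[OF V] by (simp add: \<nu>_def)
  have "(LINT x:D|lborel. R + pl b0 (\<lambda>_. 0) \<beta> x) = (\<Sum>V\<in>S. stokes_const V * facet_flux V (shape_field a A B b0 \<beta>))"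
    by (rule stokes_facet_flux[OF continuous_shape_field _ weak_div_shape_field[OF d]]) (intro continuous_intros continuous_pl)
  also have "\<dots> = (LINT x:D|lborel. pl b0 (\<lambda>_. 0) \<beta> x)" unfolding int using flux_V by simp
  also have "(LINT x:D|lborel. R + pl b0 (\<lambda>_. 0) \<beta> x) = R * volume_D + (LINT x:D|lborel. pl b0 (\<lambda>_. 0) \<beta> x)"
  proof -
    have "set_integrable lborel D (\<lambda>x. R)" "set_integrable lborel D (pl b0 (\<lambda>_. 0) \<beta>)"
      by (intro set_integrable_cont compact_D continuous_pl continuous_intros)+
    then have "(LINT x:D|lborel. R + pl b0 (\<lambda>_. 0) \<beta> x) = (LINT x:D|lborel. R * 1) + (LINT x:D|lborel. pl b0 (\<lambda>_. 0) \<beta> x)"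
      by (simp add: set_integral_add)
    then show ?thesis unfolding volume_D_def by (simp only: set_integral_mult_right)
  qed
  finally have "R = 0" using volume_D_pos by simp
  moreover have "shape_field a A B b0 \<beta> Z = a0 Z" if "Z \<in> S" for Z
    using that by (simp add: shape_field_def pl_vertex a_def)
  ultimately show ?thesis using d flux_V by (intro exI[of _ a] exI[of _ A] exI[of _ B] exI[of _ \<beta>]) auto
qed

text \<open>Equal fluxes give equal integrals of the divergence, by Stokes' theorem; together with the vertex values this
  makes the divergences equal. The difference of the fields is then \<open>pl 0 A B\<close> with zero
  divergence on all sectors, where the fluxes give \<open>grad V (A V) = 0\<close>. For fixed
  \<open>V\<close>, the equation on the sector \<open>(V, U)\<close> becomes
  \<open>grad U (A V) = - tau V U \<cdot> grad V B / beta V\<close>. Summation over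
  \<open>U\<close> makes the left side zero, as the differentials of the barycentric coordinates sum to zero,
  and the factors \<open>tau V U\<close> sum to \<open>1\<close>; so \<open>grad V B = 0\<close> for all
  \<open>V\<close>. Hence \<open>B = 0\<close>, and then \<open>A V = 0\<close>.\<close>

lemma unique_field:
  assumes cl: "\<And>p. p \<in> pairs \<Longrightarrow> sector_div a A B p = 0" "\<And>p. p \<in> pairs \<Longrightarrow> sector_div a' A' B' p = 0"
    and val: "\<And>Z. Z \<in> S \<Longrightarrow> shape_field a A B c \<beta> Z = shape_field a' A' B' c' \<beta>' Z"
    and dval: "\<And>Z. Z \<in> S \<Longrightarrow> c Z = c' Z"
    and fval: "\<And>V. V \<in> S \<Longrightarrow> facet_flux V (shape_field a A B c \<beta>) = facet_flux V (shape_field a' A' B' c' \<beta>')"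
  shows "shape_field a A B c \<beta> x = shape_field a' A' B' c' \<beta>' x"
proof -
  have cc: "pl c (\<lambda>_. 0) r y = pl c' (\<lambda>_. 0) r y" for r y by (rule pl_cong) (use dval in auto)
  have s1: "(LINT x:D|lborel. 0 + pl c (\<lambda>_. 0) \<beta> x) = (\<Sum>V\<in>S. stokes_const V * facet_flux V (shape_field a A B c \<beta>))"
    by (rule stokes_facet_flux[OF continuous_shape_field _ weak_div_shape_field[OF cl(1)]]) (intro continuous_intros continuous_pl)
  have s2: "(LINT x:D|lborel. 0 + pl c' (\<lambda>_. 0) \<beta>' x) = (\<Sum>V\<in>S. stokes_const V * facet_flux V (shape_field a' A' B' c' \<beta>'))"
    by (rule stokes_facet_flux[OF continuous_shape_field _ weak_div_shape_field[OF cl(2)]]) (intro continuous_intros continuous_pl)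
  have "(LINT x:D|lborel. pl c (\<lambda>_. 0) \<beta> x) = (LINT x:D|lborel. pl c' (\<lambda>_. 0) \<beta>' x)"
    using s1 s2 fval by simp
  moreover have "(LINT x:D|lborel. pl c (\<lambda>_. 0) 0 x) = (LINT x:D|lborel. pl c' (\<lambda>_. 0) 0 x)"
    by (simp only: cc)
  ultimately have \<beta>: "\<beta> = \<beta>'" using hatS_mass_pos integral_pl[of c \<beta>] integral_pl[of c' \<beta>'] by simp
  have rr: "radial_field c \<beta> y = radial_field c' \<beta>' y" for y unfolding radial_field_def cc \<beta> ..
  have aa: "a Z = a' Z" if "Z \<in> S" for Z using val[OF that] that by (simp add: shape_field_def pl_vertex rr)
  have p0: "pl a (\<lambda>_. 0) 0 y = pl a' (\<lambda>_. 0) 0 y" for y by (rule pl_cong) (use aa in auto)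
  have fr: "facet_flux V (radial_field c \<beta>) = facet_flux V (radial_field c' \<beta>')" for V unfolding facet_flux_def rr ..
  have fp: "facet_flux V (pl a (\<lambda>_. 0) 0) = facet_flux V (pl a' (\<lambda>_. 0) 0)" for V unfolding facet_flux_def p0 ..
  have gA: "grad V (A V - A' V) = 0" if V: "V \<in> S" for V
    using fval[OF V] hatF_mass_pos[OF V] unfolding facet_flux_shape_field[OF V] facet_flux_pl[OF V, of a A B] facet_flux_pl[OF V, of a' A' B'] fr fp
    by (simp add: linear_diff[OF linear_grad[OF V]])
  have g: "grad U (A V - A' V) = - tau V U * (grad V (B - B') / beta V)" if VU: "V \<in> S" "U \<in> S" "U \<noteq> V" for V U
  proof -
    have p: "(V, U) \<in> pairs" using VU by (auto simp: pairs_def)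
    have "(\<Sum>Z\<in>S. grad Z (a Z)) = (\<Sum>Z\<in>S. grad Z (a' Z))" using aa by simp
    then have "facet_coord_grad V U (A V) - facet_coord_grad V U (A' V) + (grad V B / beta V - grad V B' / beta V) = 0"
      using cl(1)[OF p] cl(2)[OF p] by (simp add: sector_div_def)
    moreover have "facet_coord_grad V U (A V) - facet_coord_grad V U (A' V) = grad U (A V - A' V) / tau V U"
      using gA[OF VU(1)] unfolding linear_diff[OF linear_facet_coord_grad[OF VU(1,2)], symmetric] by (simp add: facet_coord_grad_def)
    moreover have "grad V B / beta V - grad V B' / beta V = grad V (B - B') / beta V"
      by (simp add: linear_diff[OF linear_grad[OF VU(1)]] diff_divide_distrib)
    ultimately show ?thesis using tau_pos[OF VU] by (simp add: field_simps)
  qed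
  have gB: "grad V (B - B') = 0" if V: "V \<in> S" for V
  proof -
    have "0 = (\<Sum>U\<in>S - {V}. grad U (A V - A' V))"
      using sum_grad[of "A V - A' V"] gA[OF V] V by (simp add: sum.remove[of S V])
    also have "\<dots> = (\<Sum>U\<in>S - {V}. - tau V U * (grad V (B - B') / beta V))"
      by (rule sum.cong[OF refl]) (use g V in auto)
    also have "\<dots> = - (\<Sum>U\<in>S - {V}. tau V U) * (grad V (B - B') / beta V)"
      by (simp only: sum_distrib_right sum_negf[symmetric])
    finally show ?thesis using sum_tau_facet[OF V] beta_pos[OF V] by simp
  qed
  then have "B - B' = 0" by (rule grad_all_zero)
  moreover have "A V - A' V = 0" if V: "V \<in> S" for V
  proof (rule grad_all_zero)
    fix U assume "U \<in> S"
    then show "grad U (A V - A' V) = 0" using g[OF V] gA[OF V] gB[OF V] by (cases "U = V") auto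
  qed
  ultimately have "pl a A B x = pl a' A' B' x" by (intro pl_cong) (use aa in auto)
  then show ?thesis by (simp add: shape_field_def rr)
qed

end

section \<open>Unisolvence in codimension one\<close>

context element_dofs
begin

lemma A_codim1_iff: "u \<in> A_space fdim W S \<longleftrightarrow>
  (\<exists>a A B c \<beta>. u = flux D (shape_field a A B c \<beta>) \<and> (\<forall>p\<in>pairs. sector_div a A B p = 0))"
  using A_space_flux_iff[of u] unfolding fdim_eq shape_field_def[abs_def] .

lemma weak_div_closed_shape_field:
  assumes "\<forall>p\<in>pairs. sector_div a A B p = 0"
  shows "weak_div D (shape_field a A B c \<beta>) (pl c (\<lambda>_. 0) \<beta>)"
  using weak_div_shape_field[of a A B 0 c \<beta>] assms by simp

text \<open>The degrees of freedom in terms of proxies, normalised such that on \<open>flux D v\<close> they are vertex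
  values of \<open>v\<close>, of its divergence, and facet fluxes.\<close>

definition vertex_vector :: "'a form \<Rightarrow> 'a \<Rightarrow> 'a" where "vertex_vector u Z = proxy (u Z)"
definition vertex_div :: "'a form \<Rightarrow> 'a \<Rightarrow> real" where "vertex_div u Z = ext_deriv fdim D u Z test_list / \<omega> test_list"
definition facet_dof :: "'a form \<Rightarrow> 'a \<Rightarrow> real" where "facet_dof u V = face_integral fdim u (fs V) / facet_factor V"

lemma flux_dofs:
  assumes v: "continuous_on D v" and f: "continuous_on D f" and w: "weak_div D v f"
  shows "Z \<in> D \<Longrightarrow> vertex_vector (flux D v) Z = v Z" "Z \<in> D \<Longrightarrow> vertex_div (flux D v) Z = f Z"
    "V \<in> S \<Longrightarrow> facet_dof (flux D v) V = facet_flux V v"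
proof -
  show "Z \<in> D \<Longrightarrow> vertex_vector (flux D v) Z = v Z" by (simp add: vertex_vector_def flux_def proxy_contract)
  show "Z \<in> D \<Longrightarrow> vertex_div (flux D v) Z = f Z"
    using ext_deriv_flux(1)[OF v f w] test_list unfolding fdim_eq by (simp add: vertex_div_def dens_def scaleR_fun_def)
  show "V \<in> S \<Longrightarrow> facet_dof (flux D v) V = facet_flux V v"
    using facet_factor_nz[of V] by (simp add: facet_dof_def face_integral_flux)
qed

lemma shape_field_dofs:
  assumes "\<forall>p\<in>pairs. sector_div a A B p = 0"
  shows "Z \<in> S \<Longrightarrow> vertex_vector (flux D (shape_field a A B c \<beta>)) Z = shape_field a A B c \<beta> Z"
    "Z \<in> S \<Longrightarrow> vertex_div (flux D (shape_field a A B c \<beta>)) Z = c Z"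
    "V \<in> S \<Longrightarrow> facet_dof (flux D (shape_field a A B c \<beta>)) V = facet_flux V (shape_field a A B c \<beta>)"
  using flux_dofs[OF continuous_shape_field continuous_pl weak_div_closed_shape_field[OF assms, of c \<beta>]] vertex_in_D pl_vertex
  by auto

text \<open>For the existence part, \<open>exists_field\<close> is used with \<open>c = b0\<close>: the vertex values of
  the divergence \<open>pl c 0 \<beta>\<close> are those of \<open>c\<close>.\<close>

lemma A_functionals:
  "\<exists>!u. u \<in> A_space fdim W S \<and> (\<forall>Z\<in>S. vertex_vector u Z = a0 Z) \<and> (\<forall>Z\<in>S. vertex_div u Z = b0 Z) \<and> (\<forall>V\<in>S. facet_dof u V = c0 V)"
proof -
  obtain a A B \<beta> where ex: "\<forall>p\<in>pairs. sector_div a A B p = 0" "\<forall>Z\<in>S. shape_field a A B b0 \<beta> Z = a0 Z"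
    "\<forall>V\<in>S. facet_flux V (shape_field a A B b0 \<beta>) = c0 V" using exists_field by blast
  show ?thesis
  proof (rule ex1I)
    show "flux D (shape_field a A B b0 \<beta>) \<in> A_space fdim W S \<and> (\<forall>Z\<in>S. vertex_vector (flux D (shape_field a A B b0 \<beta>)) Z = a0 Z) \<and>
      (\<forall>Z\<in>S. vertex_div (flux D (shape_field a A B b0 \<beta>)) Z = b0 Z) \<and> (\<forall>V\<in>S. facet_dof (flux D (shape_field a A B b0 \<beta>)) V = c0 V)"
    proof (intro conjI ballI)
      show "flux D (shape_field a A B b0 \<beta>) \<in> A_space fdim W S" unfolding A_codim1_iff using ex(1) by blast
    qed (use ex shape_field_dofs[OF ex(1)] in auto)
    fix u assume u: "u \<in> A_space fdim W S \<and> (\<forall>Z\<in>S. vertex_vector u Z = a0 Z) \<and> (\<forall>Z\<in>S. vertex_div u Z = b0 Z) \<and> (\<forall>V\<in>S. facet_dof u V = c0 V)"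
    then obtain a' A' B' c' \<beta>' where u': "u = flux D (shape_field a' A' B' c' \<beta>')" and cl: "\<forall>p\<in>pairs. sector_div a' A' B' p = 0"
      unfolding A_codim1_iff by blast
    have "shape_field a' A' B' c' \<beta>' x = shape_field a A B b0 \<beta> x" for x
    proof (rule unique_field)
      show "sector_div a' A' B' p = 0" if "p \<in> pairs" for p using cl that by blast
      show "sector_div a A B p = 0" if "p \<in> pairs" for p using ex(1) that by blast
      show "shape_field a' A' B' c' \<beta>' Z = shape_field a A B b0 \<beta> Z" if "Z \<in> S" for Z
        using shape_field_dofs(1)[OF cl that, of c' \<beta>'] u that ex(2) unfolding u' by auto
      show "c' Z = b0 Z" if "Z \<in> S" for Z
        using shape_field_dofs(2)[OF cl that, of c' \<beta>'] u that unfolding u' by auto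
      show "facet_flux V (shape_field a' A' B' c' \<beta>') = facet_flux V (shape_field a A B b0 \<beta>)" if "V \<in> S" for V
        using shape_field_dofs(3)[OF cl that, of c' \<beta>'] u that ex(3) unfolding u' by auto
    qed
    then show "u = flux D (shape_field a A B b0 \<beta>)" unfolding u' flux_eq_iff by blast
  qed
qed

lemma A_comb:
  assumes "u \<in> A_space fdim W S" "w \<in> A_space fdim W S"
  shows "u + r *\<^sub>R w \<in> A_space fdim W S"
    "Z \<in> S \<Longrightarrow> vertex_vector (u + r *\<^sub>R w) Z = vertex_vector u Z + r *\<^sub>R vertex_vector w Z"
    "Z \<in> S \<Longrightarrow> vertex_div (u + r *\<^sub>R w) Z = vertex_div u Z + r * vertex_div w Z"
    "V \<in> S \<Longrightarrow> facet_dof (u + r *\<^sub>R w) V = facet_dof u V + r * facet_dof w V"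
proof -
  obtain a A B c \<beta> where u: "u = flux D (shape_field a A B c \<beta>)" and cu: "\<forall>p\<in>pairs. sector_div a A B p = 0"
    using assms(1) unfolding A_codim1_iff by blast
  obtain a' A' B' c' \<beta>' where w: "w = flux D (shape_field a' A' B' c' \<beta>')" and cw: "\<forall>p\<in>pairs. sector_div a' A' B' p = 0"
    using assms(2) unfolding A_codim1_iff by blast
  let ?a = "\<lambda>Z. a Z + r *\<^sub>R a' Z" and ?A = "\<lambda>Z. A Z + r *\<^sub>R A' Z" and ?B = "B + r *\<^sub>R B'"
    and ?c = "\<lambda>Z. c Z + r *\<^sub>R c' Z" and ?\<beta> = "\<beta> + r *\<^sub>R \<beta>'"
  have p: "pl ?c (\<lambda>_. 0) ?\<beta> x = pl c (\<lambda>_. 0) \<beta> x + r * pl c' (\<lambda>_. 0) \<beta>' x" for x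
    using pl_add[of c r c' "\<lambda>_. 0" "\<lambda>_. 0" \<beta> \<beta>' x] by simp
  have "radial_field ?c ?\<beta> x = radial_field c \<beta> x + r *\<^sub>R radial_field c' \<beta>' x" for x
    unfolding radial_field_def p scaleR_scaleR scaleR_left_distrib[symmetric]
    by (rule arg_cong[of _ _ "\<lambda>s. s *\<^sub>R _"]) (simp add: add_divide_distrib diff_divide_distrib algebra_simps)
  then have comb: "shape_field ?a ?A ?B ?c ?\<beta> = (\<lambda>x. shape_field a A B c \<beta> x + r *\<^sub>R shape_field a' A' B' c' \<beta>' x)"
    by (simp add: shape_field_def fun_eq_iff pl_add scaleR_right_distrib)
  have uw: "u + r *\<^sub>R w = flux D (shape_field ?a ?A ?B ?c ?\<beta>)"
    unfolding u w flux_scale flux_add comb ..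
  have cl: "\<forall>q\<in>pairs. sector_div ?a ?A ?B q = 0"
  proof
    fix q assume q: "q \<in> pairs"
    obtain V U where VU: "q = (V, U)" "V \<in> S" "U \<in> S" using q by (auto simp: pairs_def)
    have "sector_div ?a ?A ?B q = sector_div a A B q + r * sector_div a' A' B' q"
    proof -
      have "(\<Sum>Z\<in>S. grad Z (?a Z)) = (\<Sum>Z\<in>S. grad Z (a Z)) + r * (\<Sum>Z\<in>S. grad Z (a' Z))"
        by (simp add: linear_add[OF linear_grad] linear_scale[OF linear_grad] sum.distrib sum_distrib_left)
      then show ?thesis
        unfolding sector_div_def VU(1) fst_conv snd_conv
        by (simp add: linear_add[OF linear_grad[OF VU(2)]] linear_scale[OF linear_grad[OF VU(2)]]
            linear_add[OF linear_facet_coord_grad[OF VU(2,3)]] linear_scale[OF linear_facet_coord_grad[OF VU(2,3)]] add_divide_distrib algebra_simps)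
    qed
    then show "sector_div ?a ?A ?B q = 0" using cu cw q by simp
  qed
  show "u + r *\<^sub>R w \<in> A_space fdim W S" unfolding A_codim1_iff uw using cl by blast
  show "vertex_vector (u + r *\<^sub>R w) Z = vertex_vector u Z + r *\<^sub>R vertex_vector w Z" if Z: "Z \<in> S"
  proof -
    have "vertex_vector (u + r *\<^sub>R w) Z = shape_field ?a ?A ?B ?c ?\<beta> Z" unfolding uw by (rule shape_field_dofs(1)[OF cl Z])
    also have "\<dots> = shape_field a A B c \<beta> Z + r *\<^sub>R shape_field a' A' B' c' \<beta>' Z" unfolding comb ..
    also have "\<dots> = vertex_vector u Z + r *\<^sub>R vertex_vector w Z" unfolding u w shape_field_dofs(1)[OF cu Z] shape_field_dofs(1)[OF cw Z] ..
    finally show ?thesis .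
  qed
  show "vertex_div (u + r *\<^sub>R w) Z = vertex_div u Z + r * vertex_div w Z" if Z: "Z \<in> S"
  proof -
    have "vertex_div (u + r *\<^sub>R w) Z = ?c Z" unfolding uw by (rule shape_field_dofs(2)[OF cl Z])
    also have "\<dots> = vertex_div u Z + r * vertex_div w Z" unfolding u w shape_field_dofs(2)[OF cu Z] shape_field_dofs(2)[OF cw Z] by simp
    finally show ?thesis .
  qed
  show "facet_dof (u + r *\<^sub>R w) V = facet_dof u V + r * facet_dof w V" if V: "V \<in> S"
  proof -
    have "facet_dof (u + r *\<^sub>R w) V = facet_flux V (shape_field ?a ?A ?B ?c ?\<beta>)" unfolding uw by (rule shape_field_dofs(3)[OF cl V])
    also have "\<dots> = facet_flux V (shape_field a A B c \<beta>) + r * facet_flux V (shape_field a' A' B' c' \<beta>')"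
      unfolding comb by (rule facet_flux_add[OF V continuous_shape_field continuous_shape_field])
    also have "\<dots> = facet_dof u V + r * facet_dof w V" unfolding u w shape_field_dofs(3)[OF cu V] shape_field_dofs(3)[OF cw V] ..
    finally show ?thesis .
  qed
qed

lemma ball_Plus: "(\<forall>i\<in>A <+> B. P i) \<longleftrightarrow> (\<forall>a\<in>A. P (Inl a)) \<and> (\<forall>b\<in>B. P (Inr b))"
  by auto

lemma subspaceI_comb:
  assumes "0 \<in> X" "\<And>u w r. u \<in> X \<Longrightarrow> w \<in> X \<Longrightarrow> u + r *\<^sub>R w \<in> X"
  shows "subspace X"
  unfolding subspace_def
proof (intro conjI ballI allI)
  fix x y assume "x \<in> X" "y \<in> X"
  then show "x + y \<in> X" using assms(2)[of x y 1] by simp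
next
  fix x c assume "x \<in> X"
  then show "c *\<^sub>R x \<in> X" using assms(2)[OF assms(1), of x c] by simp
qed (rule assms(1))

lemma subspace_A: "subspace (A_space fdim W S)"
proof (rule subspaceI_comb)
  have "flux D (shape_field (\<lambda>_. 0) (\<lambda>_. 0) 0 (\<lambda>_. 0) 0) = 0"
  proof -
    have "shape_field (\<lambda>_. 0) (\<lambda>_. 0) 0 (\<lambda>_. 0) 0 x = 0" for x
      by (simp add: shape_field_def radial_field_def pl_def)
    moreover have "\<omega> (0 # \<xi>) = 0" for \<xi>
      using linear_0[OF linear_contract[of \<xi>]] contract_len[of \<xi>] by blast
    ultimately show ?thesis by (simp add: flux_def fun_eq_iff)
  qed
  moreover have "\<forall>p\<in>pairs. sector_div (\<lambda>_. 0) (\<lambda>_. 0) 0 p = 0"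
    by (auto simp: sector_div_def pairs_def linear_0[OF linear_grad] linear_0[OF linear_facet_coord_grad])
  ultimately show "0 \<in> A_space fdim W S" unfolding A_codim1_iff by metis
qed (rule A_comb(1))

lemma dim_A: "dim (A_space fdim W S) = (DIM('a) + 1) * (DIM('a) + 2)"
proof -
  define L where "L = case_sum (\<lambda>(Z, b :: 'a) (u :: 'a form). vertex_vector u Z \<bullet> b) (case_sum (\<lambda>Z u. vertex_div u Z) (\<lambda>V u. facet_dof u V))"
  let ?I = "(S \<times> (Basis :: 'a set)) <+> (S <+> S)"
  have "dim (A_space fdim W S) = card ?I"
  proof (rule dim_eq_card_functionals[OF subspace_A, where L=L])
    show "finite ?I" by simp
    show "L i (u + r *\<^sub>R w) = L i u + r * L i w" if "i \<in> ?I" "u \<in> A_space fdim W S" "w \<in> A_space fdim W S" for i u w r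
      using that(1) A_comb(2)[OF that(2,3), where r=r] A_comb(3)[OF that(2,3), where r=r] A_comb(4)[OF that(2,3), where r=r]
      by (auto simp: L_def inner_add_left)
    fix c :: "('a \<times> 'a) + ('a + 'a) \<Rightarrow> real"
    have "(\<forall>i\<in>?I. L i u = c i) \<longleftrightarrow> (\<forall>Z\<in>S. vertex_vector u Z = (\<Sum>b\<in>Basis. c (Inl (Z, b)) *\<^sub>R b)) \<and>
        (\<forall>Z\<in>S. vertex_div u Z = c (Inr (Inl Z))) \<and> (\<forall>V\<in>S. facet_dof u V = c (Inr (Inr V)))" for u
    proof -
      have "vertex_vector u Z = (\<Sum>b\<in>Basis. c (Inl (Z, b)) *\<^sub>R b) \<longleftrightarrow> (\<forall>b\<in>Basis. vertex_vector u Z \<bullet> b = c (Inl (Z, b)))" for Z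
        by (subst euclidean_eq_iff) simp
      then show ?thesis unfolding ball_Plus by (auto simp: L_def)
    qed
    then show "\<exists>!u. u \<in> A_space fdim W S \<and> (\<forall>i\<in>?I. L i u = c i)"
      using A_functionals[of "\<lambda>Z. \<Sum>b\<in>Basis. c (Inl (Z, b)) *\<^sub>R b" "\<lambda>Z. c (Inr (Inl Z))" "\<lambda>V. c (Inr (Inr V))"] by simp
  qed
  also have "card ?I = (DIM('a) + 1) * (DIM('a) + 2)"
    using card_S by (simp add: card_Plus card_cartesian_product algebra_simps)
  finally show ?thesis .
qed

lemma kfaces_fdim: "kfaces fdim S = (\<lambda>V. S - {V}) ` S"
proof
  show "kfaces fdim S \<subseteq> (\<lambda>V. S - {V}) ` S"
  proof
    fix F assume F: "F \<in> kfaces fdim S"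
    then have "F \<in> faces S" "card F = DIM('a)" by (auto simp: kfaces_def dim_eq)
    then have "F = S \<or> (\<exists>V\<in>S. F = S - {V})" by (intro big_face) auto
    moreover have "F \<noteq> S" using \<open>card F = DIM('a)\<close> card_S by auto
    ultimately show "F \<in> (\<lambda>V. S - {V}) ` S" by blast
  qed
  show "(\<lambda>V. S - {V}) ` S \<subseteq> kfaces fdim S"
    using facet_ne card_facet dim_eq by (auto simp: kfaces_def faces_def)
qed

lemma kfaces_top: "kfaces DIM('a) S = {S}"
proof -
  have "F = S" if "F \<subseteq> S" "card F = Suc DIM('a)" for F
    using card_subset_eq[OF finite_S that(1)] that(2) card_S by simp
  then show ?thesis using card_S S_ne by (auto simp: kfaces_def faces_def)
qed

text \<open>Equations between forms are replaced by equations between proxies; this is possible because the prescribed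
  values are required to be alternating forms of the right degree.\<close>

lemma dofs_iff:
  assumes v: "continuous_on D v" and f: "continuous_on D f" and w: "weak_div D v f"
    and a: "\<forall>Z\<in>S. a Z \<in> alt_forms fdim" and b: "\<forall>Z\<in>S. b Z \<in> alt_forms (fdim + 1)"
  shows "has_dofs fdim S ori (flux D v) a b c \<longleftrightarrow>
    (\<forall>Z\<in>S. v Z = proxy (a Z)) \<and> (\<forall>Z\<in>S. f Z = b Z test_list / \<omega> test_list) \<and> (\<forall>V\<in>S. facet_flux V v = c (S - {V}) / facet_factor V)"
proof -
  have "flux D v Z = a Z \<longleftrightarrow> v Z = proxy (a Z)" if Z: "Z \<in> S" for Z
  proof -
    have "(\<lambda>\<xi>. \<omega> (proxy (a Z) # \<xi>)) = a Z" using a Z contract_proxy unfolding fdim_eq by blast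
    moreover have "flux D v Z = (\<lambda>\<xi>. \<omega> (v Z # \<xi>))" using vertex_in_D[OF Z] by (simp add: flux_def)
    ultimately show ?thesis using proxy_contract by metis
  qed
  moreover have "ext_deriv fdim D (flux D v) Z = b Z \<longleftrightarrow> f Z = b Z test_list / \<omega> test_list" if Z: "Z \<in> S" for Z
  proof -
    have "ext_deriv fdim D (flux D v) Z = f Z *\<^sub>R \<omega>"
      using ext_deriv_flux(1)[OF v f w] vertex_in_D[OF Z] unfolding fdim_eq by (simp add: dens_def)
    moreover obtain d where "b Z = d *\<^sub>R \<omega>" using b Z top_form_multiple[of "b Z"] by (auto simp: dim_eq)
    ultimately show ?thesis using test_list \<omega>_nz by (simp add: scaleR_fun_def) (auto simp: fun_eq_iff)
  qed
  moreover have "face_integral fdim (flux D v) (fs V) = c (S - {V}) \<longleftrightarrow> facet_flux V v = c (S - {V}) / facet_factor V" if V: "V \<in> S" for V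
    using facet_factor_nz[OF V] by (simp add: face_integral_flux[OF V] field_simps)
  ultimately show ?thesis unfolding has_dofs_def kfaces_fdim by auto
qed

lemma unisolvent_A: "unisolvent fdim S ori (A_space fdim W S)"
  unfolding unisolvent_def
proof (intro conjI allI impI)
  show "A_space fdim W S \<subseteq> C0d_forms fdim D"
    using ext_deriv_flux(2)[OF continuous_shape_field continuous_pl weak_div_closed_shape_field] unfolding fdim_eq A_codim1_iff subset_iff by blast
  fix a b :: "'a \<Rightarrow> 'a list \<Rightarrow> real" and c :: "'a set \<Rightarrow> real"
  assume ab: "(\<forall>V\<in>S. a V \<in> alt_forms fdim) \<and> (\<forall>V\<in>S. b V \<in> alt_forms (fdim + 1))"
  have iff: "has_dofs fdim S ori u a b c \<longleftrightarrow> (\<forall>Z\<in>S. vertex_vector u Z = proxy (a Z)) \<and> (\<forall>Z\<in>S. vertex_div u Z = b Z test_list / \<omega> test_list) \<and>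
      (\<forall>V\<in>S. facet_dof u V = c (S - {V}) / facet_factor V)" if "u \<in> A_space fdim W S" for u
  proof -
    obtain a' A B c' \<beta> where u: "u = flux D (shape_field a' A B c' \<beta>)" and cl: "\<forall>p\<in>pairs. sector_div a' A B p = 0"
      using \<open>u \<in> A_space fdim W S\<close> unfolding A_codim1_iff by blast
    show ?thesis unfolding u
      using dofs_iff[OF continuous_shape_field continuous_pl weak_div_closed_shape_field[OF cl, of c' \<beta>], of a b c] ab
      by (simp add: shape_field_dofs[OF cl] pl_vertex)
  qed
  show "\<exists>!u. u \<in> A_space fdim W S \<and> has_dofs fdim S ori u a b c"
    using A_functionals[of "\<lambda>Z. proxy (a Z)" "\<lambda>Z. b Z test_list / \<omega> test_list" "\<lambda>V. c (S - {V}) / facet_factor V"] iff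
    by (metis (no_types, lifting))
qed

section \<open>Unisolvence in top degree\<close>

definition chart_factor :: real where
  "chart_factor = (SOME K. K \<noteq> 0 \<and> (\<forall>f. continuous_on D f \<longrightarrow>
     face_integral DIM('a) (dens D f) (ori S) = K * (LINT x:D|lborel. f x)))"

lemma chart_factor: "chart_factor \<noteq> 0" "continuous_on D f \<Longrightarrow> face_integral DIM('a) (dens D f) (ori S) = chart_factor * (LINT x:D|lborel. f x)"
  using someI_ex[OF face_integral_dens] unfolding chart_factor_def by blast+

lemma dens_vertex: "Z \<in> S \<Longrightarrow> dens D (pl c (\<lambda>_. 0) \<beta>) Z = c Z *\<^sub>R \<omega>"
  using vertex_in_D by (simp add: dens_def pl_vertex)

lemma dens_pl_cong: "(\<And>Z. Z \<in> S \<Longrightarrow> c Z = c' Z) \<Longrightarrow> dens D (pl c (\<lambda>_. 0) \<beta>) = dens D (pl c' (\<lambda>_. 0) \<beta>)" for \<beta> :: real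
  unfolding dens_eq_iff by (intro ballI pl_cong) auto

text \<open>The vertex values fix \<open>c\<close>, and the integral then fixes \<open>\<beta>\<close>, because
  \<open>hatS\<close> has a positive integral.\<close>

lemma top_functionals:
  "\<exists>!u. u \<in> A_space DIM('a) W S \<and> (\<forall>Z\<in>S. u Z = c Z *\<^sub>R \<omega>) \<and> face_integral DIM('a) u (ori S) = s"
proof (rule ex1I)
  let ?\<beta> = "(s / chart_factor - (LINT x:D|lborel. pl c (\<lambda>_. 0) 0 x)) / hatS_mass"
  show "dens D (pl c (\<lambda>_. 0) ?\<beta>) \<in> A_space DIM('a) W S \<and> (\<forall>Z\<in>S. dens D (pl c (\<lambda>_. 0) ?\<beta>) Z = c Z *\<^sub>R \<omega>) \<and>
    face_integral DIM('a) (dens D (pl c (\<lambda>_. 0) ?\<beta>)) (ori S) = s"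
  proof (intro conjI ballI)
    show "dens D (pl c (\<lambda>_. 0) ?\<beta>) \<in> A_space DIM('a) W S" unfolding A_space_dens_iff by blast
    show "face_integral DIM('a) (dens D (pl c (\<lambda>_. 0) ?\<beta>)) (ori S) = s"
      unfolding chart_factor(2)[OF continuous_pl] integral_pl[of c ?\<beta>] using chart_factor(1) hatS_mass_pos by simp
  qed (rule dens_vertex)
  fix u assume u: "u \<in> A_space DIM('a) W S \<and> (\<forall>Z\<in>S. u Z = c Z *\<^sub>R \<omega>) \<and> face_integral DIM('a) u (ori S) = s"
  then obtain c' \<beta> where u': "u = dens D (pl c' (\<lambda>_. 0) \<beta>)" unfolding A_space_dens_iff by blast
  have "c' Z = c Z" if Z: "Z \<in> S" for Z
  proof -
    have "c' Z *\<^sub>R \<omega> = c Z *\<^sub>R \<omega>" using u Z dens_vertex[OF Z, of c' \<beta>] unfolding u' by metis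
    then show ?thesis using \<omega>_nz by auto
  qed
  then have u'': "u = dens D (pl c (\<lambda>_. 0) \<beta>)" unfolding u' by (rule dens_pl_cong)
  have "chart_factor * ((LINT x:D|lborel. pl c (\<lambda>_. 0) 0 x) + \<beta> * hatS_mass) = s"
    using u unfolding u'' chart_factor(2)[OF continuous_pl] integral_pl[of c \<beta>] by simp
  then have "\<beta> = ?\<beta>" using chart_factor(1) hatS_mass_pos by (simp add: field_simps)
  then show "u = dens D (pl c (\<lambda>_. 0) ?\<beta>)" unfolding u'' by simp
qed

lemma A_top_C0: "u \<in> A_space DIM('a) W S \<Longrightarrow> u \<in> C0_forms DIM('a) D"
  unfolding A_space_dens_iff using dens_C0[OF continuous_pl] by blast

lemma top_dofs_iff:
  assumes u: "u \<in> C0_forms DIM('a) D" and b: "\<forall>Z\<in>S. b Z \<in> alt_forms (DIM('a) + 1)"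
  shows "has_dofs DIM('a) S ori u a b c \<longleftrightarrow> (\<forall>Z\<in>S. u Z = a Z) \<and> face_integral DIM('a) u (ori S) = c S"
proof -
  have "ext_deriv DIM('a) D u Z = b Z" if "Z \<in> S" for Z
    using ext_deriv_top(1)[OF compact_D u] b that alt_forms_above by auto
  then show ?thesis unfolding has_dofs_def kfaces_top by auto
qed

lemma unisolvent_top: "unisolvent DIM('a) S ori (A_space DIM('a) W S)"
  unfolding unisolvent_def
proof (intro conjI allI impI)
  show "A_space DIM('a) W S \<subseteq> C0d_forms DIM('a) D"
    using ext_deriv_top(2)[OF compact_D] A_top_C0 by blast
  fix a b :: "'a \<Rightarrow> 'a list \<Rightarrow> real" and c :: "'a set \<Rightarrow> real"
  assume ab: "(\<forall>V\<in>S. a V \<in> alt_forms DIM('a)) \<and> (\<forall>V\<in>S. b V \<in> alt_forms (DIM('a) + 1))"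
  then have "\<forall>Z\<in>S. \<exists>d. a Z = d *\<^sub>R \<omega>" using top_form_multiple by blast
  from bchoice[OF this] obtain d where d: "\<forall>Z\<in>S. a Z = d Z *\<^sub>R \<omega>" by blast
  have "has_dofs DIM('a) S ori u a b c \<longleftrightarrow> (\<forall>Z\<in>S. u Z = d Z *\<^sub>R \<omega>) \<and> face_integral DIM('a) u (ori S) = c S"
    if "u \<in> A_space DIM('a) W S" for u
    using top_dofs_iff[OF A_top_C0[OF that]] ab d by auto
  then show "\<exists>!u. u \<in> A_space DIM('a) W S \<and> has_dofs DIM('a) S ori u a b c"
    using top_functionals[of d "c S"] by (metis (no_types, lifting))
qed

lemma dim_A_top: "dim (A_space DIM('a) W S) = DIM('a) + 2"
proof -
  define L where "L = case_sum (\<lambda>Z (u :: 'a form). u Z test_list / \<omega> test_list) (\<lambda>_ :: unit. \<lambda>u. face_integral DIM('a) u (ori S) / chart_factor)"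
  let ?I = "S <+> {()}"
  have comb: "dens D f + r *\<^sub>R dens D g = dens D (\<lambda>x. f x + r * g x)" for f g r
    by (auto simp: dens_def fun_eq_iff scaleR_fun_def algebra_simps)
  have "dim (A_space DIM('a) W S) = card ?I"
  proof (rule dim_eq_card_functionals[where L=L])
    show "subspace (A_space DIM('a) W S)"
    proof (rule subspaceI_comb)
      have "dens D (pl (\<lambda>_. 0) (\<lambda>_. 0) 0) = 0" by (auto simp: dens_def pl_def fun_eq_iff scaleR_fun_def)
      then show "0 \<in> A_space DIM('a) W S" unfolding A_space_dens_iff by metis
      fix u w r assume "u \<in> A_space DIM('a) W S" "w \<in> A_space DIM('a) W S"
      then obtain c \<beta> c' \<beta>' where uw: "u = dens D (pl c (\<lambda>_. 0) \<beta>)" "w = dens D (pl c' (\<lambda>_. 0) \<beta>')"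
        unfolding A_space_dens_iff by blast
      have "u + r *\<^sub>R w = dens D (pl (\<lambda>Z. c Z + r *\<^sub>R c' Z) (\<lambda>_. 0) (\<beta> + r *\<^sub>R \<beta>'))"
        unfolding uw comb dens_eq_iff using pl_add[of c r c' "\<lambda>_. 0" "\<lambda>_. 0" \<beta> \<beta>'] by simp
      then show "u + r *\<^sub>R w \<in> A_space DIM('a) W S" unfolding A_space_dens_iff by blast
    qed
    show "finite ?I" by simp
    show "L i (u + r *\<^sub>R w) = L i u + r * L i w"
      if i: "i \<in> ?I" and uw: "u \<in> A_space DIM('a) W S" "w \<in> A_space DIM('a) W S" for i u w r
    proof (cases i)
      case (Inl Z) then show ?thesis by (simp add: L_def scaleR_fun_def add_divide_distrib)
    next
      case (Inr x)
      obtain c \<beta> c' \<beta>' where uw': "u = dens D (pl c (\<lambda>_. 0) \<beta>)" "w = dens D (pl c' (\<lambda>_. 0) \<beta>')"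
        using uw unfolding A_space_dens_iff by blast
      let ?f = "pl c (\<lambda>_. 0) \<beta>" and ?g = "pl c' (\<lambda>_. 0) \<beta>'"
      have c: "continuous_on D (\<lambda>x. ?f x + r * ?g x)" by (intro continuous_intros continuous_pl)
      have "set_integrable lborel D ?f" "set_integrable lborel D (\<lambda>x. r * ?g x)"
        by (intro set_integrable_cont compact_D continuous_intros continuous_pl)+
      then have "(LINT x:D|lborel. ?f x + r * ?g x) = (LINT x:D|lborel. ?f x) + r * (LINT x:D|lborel. ?g x)"
        by (simp add: set_integral_add)
      then show ?thesis using chart_factor(1)
        unfolding L_def Inr uw' comb by (simp add: chart_factor(2)[OF c] chart_factor(2)[OF continuous_pl] distrib_left add_divide_distrib)
    qed
    fix c :: "'a + unit \<Rightarrow> real"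
    have "(\<forall>i\<in>?I. L i u = c i) \<longleftrightarrow> (\<forall>Z\<in>S. u Z = c (Inl Z) *\<^sub>R \<omega>) \<and> face_integral DIM('a) u (ori S) = chart_factor * c (Inr ())"
      if u: "u \<in> A_space DIM('a) W S" for u
    proof -
      obtain c' \<beta> where u': "u = dens D (pl c' (\<lambda>_. 0) \<beta>)" using u unfolding A_space_dens_iff by blast
      have "u Z test_list / \<omega> test_list = c (Inl Z) \<longleftrightarrow> u Z = c (Inl Z) *\<^sub>R \<omega>" if "Z \<in> S" for Z
        using test_list \<omega>_nz dens_vertex[OF that, of c' \<beta>] unfolding u' by (auto simp: scaleR_fun_def fun_eq_iff)
      moreover have "face_integral DIM('a) u (ori S) / chart_factor = c (Inr ()) \<longleftrightarrow> face_integral DIM('a) u (ori S) = chart_factor * c (Inr ())"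
        using chart_factor(1) by (simp add: field_simps)
      ultimately show ?thesis unfolding ball_Plus by (simp add: L_def)
    qed
    then show "\<exists>!u. u \<in> A_space DIM('a) W S \<and> (\<forall>i\<in>?I. L i u = c i)"
      using top_functionals[of "\<lambda>Z. c (Inl Z)" "chart_factor * c (Inr ())"] by (metis (no_types, lifting))
  qed
  also have "card ?I = DIM('a) + 2" using card_S by (simp add: card_Plus)
  finally show ?thesis .
qed

section \<open>Commuting interpolators\<close>

text \<open>Let \<open>q = I u\<close>. The form \<open>d q\<close> lies in \<open>A\<^sup>n\<close>, and it has the
  vertex values of \<open>d u\<close> because these are among the degrees of freedom of \<open>q\<close>.
  Stokes' theorem holds for \<open>q\<close> and for \<open>u\<close> with the same constants, and both have
  the same fluxes, so that also the integrals of \<open>d q\<close> and \<open>d u\<close> agree. By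
  unisolvence, \<open>d q\<close> is the interpolant of \<open>d u\<close>.\<close>

lemma interpolators_commute:
  assumes u: "u \<in> C0d_forms fdim D"
  shows "ext_deriv fdim D (interpolator fdim W S ori u) = interpolator DIM('a) W S ori (ext_deriv fdim D u)"
proof -
  obtain v f where v: "continuous_on D v" and f: "continuous_on D f" and w: "weak_div D v f"
    and uv: "u = flux D v" and du: "ext_deriv fdim D u = dens D f"
    using C0d_flux u unfolding fdim_eq by blast
  let ?b = "ext_deriv fdim D u" and ?c = "\<lambda>F. face_integral fdim u (ori F)"
  have ua: "\<forall>Z\<in>S. u Z \<in> alt_forms fdim" using u by (auto simp: C0d_forms_def C0_forms_def)
  have ub: "\<forall>Z\<in>S. ?b Z \<in> alt_forms (fdim + 1)"
    using dens_C0[OF f] unfolding du by (auto simp: C0_forms_def dim_eq)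
  define q where "q = interpolator fdim W S ori u"
  have "\<exists>!y. y \<in> A_space fdim W S \<and> has_dofs fdim S ori y u ?b ?c"
    using unisolvent_A ua ub unfolding unisolvent_def by blast
  from theI'[OF this] have q: "q \<in> A_space fdim W S" "has_dofs fdim S ori q u ?b ?c"
    unfolding q_def interpolator_def by blast+
  obtain a A B c \<beta> where qa: "q = flux D (shape_field a A B c \<beta>)" and cl: "\<forall>p\<in>pairs. sector_div a A B p = 0"
    using q(1) unfolding A_codim1_iff by blast
  let ?v = "shape_field a A B c \<beta>" and ?g = "pl c (\<lambda>_. 0) \<beta>"
  have w': "weak_div D ?v ?g" by (rule weak_div_closed_shape_field[OF cl])
  have dq: "ext_deriv fdim D q = dens D ?g"
    using ext_deriv_flux(1)[OF continuous_shape_field continuous_pl w'] unfolding qa fdim_eq .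
  have flux_eq: "facet_flux V ?v = facet_flux V v" if V: "V \<in> S" for V
  proof -
    have "face_integral fdim q (fs V) = face_integral fdim u (fs V)"
      using q(2) V unfolding has_dofs_def kfaces_fdim by blast
    then show ?thesis using facet_factor_nz[OF V] unfolding qa uv face_integral_flux[OF V] by simp
  qed
  have "(LINT x:D|lborel. ?g x) = (LINT x:D|lborel. f x)"
    using stokes_facet_flux[OF continuous_shape_field continuous_pl w'] stokes_facet_flux[OF v f w] flux_eq by simp
  then have fc: "face_integral DIM('a) (dens D ?g) (ori S) = face_integral DIM('a) (dens D f) (ori S)"
    by (simp add: chart_factor(2)[OF f] chart_factor(2)[OF continuous_pl])
  have val: "dens D ?g Z = dens D f Z" if "Z \<in> S" for Z
    using q(2) that unfolding has_dofs_def dq du by blast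
  have gA: "dens D ?g \<in> A_space DIM('a) W S" unfolding A_space_dens_iff by blast
  let ?b' = "ext_deriv DIM('a) D (dens D f)" and ?c' = "\<lambda>F. face_integral DIM('a) (dens D f) (ori F)"
  \<comment> \<open>In degree n the values of the exterior derivative impose no condition.\<close>
  have b'0: "?b' = 0" by (rule ext_deriv_top(1)[OF compact_D dens_C0[OF f]])
  have b': "\<forall>Z\<in>S. ?b' Z \<in> alt_forms (DIM('a) + 1)" unfolding b'0 using alt_forms_above by auto
  have a': "\<forall>Z\<in>S. dens D f Z \<in> alt_forms DIM('a)" using dens_C0[OF f] by (auto simp: C0_forms_def)
  have "has_dofs DIM('a) S ori (dens D ?g) (dens D f) ?b' ?c'"
    using top_dofs_iff[OF A_top_C0[OF gA] b'] val fc by blast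
  moreover have "\<exists>!y. y \<in> A_space DIM('a) W S \<and> has_dofs DIM('a) S ori y (dens D f) ?b' ?c'"
    using unisolvent_top a' b' unfolding unisolvent_def by blast
  ultimately have "interpolator DIM('a) W S ori (dens D f) = dens D ?g"
    unfolding interpolator_def using gA by (intro the1_equality) auto
  then show ?thesis unfolding du dq q_def[symmetric] by simp
qed

end

section \<open>Unisolvence, commutation and minimality\<close>

theorem proposition7p4:
  fixes S :: "'a::euclidean_space set"
    and W :: "'a set \<Rightarrow> 'a"
    and ori :: "'a set \<Rightarrow> 'a list"
    and n :: nat
  assumes "n = DIM('a)" and "n \<ge> 2"
    and "\<not> affine_dependent S" and "card S = n + 1"
    and "inpoints S W"
    and "orientation S ori"
  shows
    "(unisolvent (n - 1) S ori (A_space (n - 1) W S) \<and>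
      unisolvent n S ori (A_space n W S) \<and>
      dim (A_space (n - 1) W S) = (n + 1) * (n + 2) \<and>
      dim (A_space n W S) = n + 2) \<and>
     (\<forall>u \<in> C0d_forms (n - 1) (convex hull S).
        ext_deriv (n - 1) (convex hull S) (interpolator (n - 1) W S ori u) =
        interpolator n W S ori (ext_deriv (n - 1) (convex hull S) u)) \<and>
     (\<forall>k \<in> {n - 1, n}.
        dim (A_space k W S) =
        (n + 1) * (dim (alt_forms k :: ('a list \<Rightarrow> real) set) +
                   dim (alt_forms (k + 1) :: ('a list \<Rightarrow> real) set)) +
        ((n + 1) choose (k + 1)))"
proof -
  obtain \<omega> :: "'a list \<Rightarrow> real" where \<omega>: "\<omega> \<in> alt_forms DIM('a)" "\<omega> \<noteq> 0"
    using ex_top_form by blast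
  interpret element_dofs S W \<omega> ori "DIM('a) - 1"
    by unfold_locales (use assms \<omega> in auto)
  have n: "n = DIM('a)" by (rule assms(1))
  have "dim {0 :: 'a list \<Rightarrow> real} = card ({} :: ('a list \<Rightarrow> real) set)"
    by (rule real_vector.dim_eq_card) (auto simp: real_vector.independent_empty)
  then have dim0: "dim {0 :: 'a list \<Rightarrow> real} = 0" by simp
  have dims: "dim (alt_forms (n - 1) :: ('a list \<Rightarrow> real) set) = n"
    "dim (alt_forms n :: ('a list \<Rightarrow> real) set) = 1"
    "dim (alt_forms (n + 1) :: ('a list \<Rightarrow> real) set) = 0"
    unfolding n using dim_alt_forms_codim1 dim_alt_forms_top alt_forms_above dim0 by simp_all
  have dimA: "dim (A_space (n - 1) W S) = (n + 1) * (n + 2)" "dim (A_space n W S) = n + 2"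
    unfolding n using dim_A dim_A_top by simp_all
  have n1: "n - 1 + 1 = n" using assms(2) by simp
  have "dim (A_space k W S) = (n + 1) * (dim (alt_forms k :: ('a list \<Rightarrow> real) set) +
      dim (alt_forms (k + 1) :: ('a list \<Rightarrow> real) set)) + ((n + 1) choose (k + 1))" if "k \<in> {n - 1, n}" for k
  proof (cases "k = n")
    case True then show ?thesis using dims dimA by simp
  next
    case False
    then have k: "k = n - 1" using that by simp
    \<comment> \<open>The lower bound counts n + 1 values of the n components of a vector and of its divergence,
      and n + 1 facets.\<close>
    have "(n + 1) choose n = n + 1" by (simp add: binomial_Suc_n)
    then show ?thesis unfolding k n1 dims dimA by (simp add: algebra_simps)
  qed
  then show ?thesis
    using unisolvent_A unisolvent_top dimA interpolators_commute unfolding n by blast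
qed

end
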